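(* Every natural number $m$ can be represented in the form $$m = x^2+y^2+(2^a3^b z_1)^2+(2^c5^d z_2)^2,$$ where $x,y,a,b,c,d$ are non-negative integers and $z_1,z_2$ are integers each of which either vanishes or has at most $369$ prime factors.
   Context: "$z$ has at most $n$ prime factors" means that $z$ is, up to sign, an almost prime of order $n$, i.e. $|z|$ is a product of at most $n$ primes (counted with multiplicity; the empty product $1$ is allowed). *)

theory Defs
  imports "HOL-Computational_Algebra.Primes"
begin

definition at_most_prime_factors :: "nat \<Rightarrow> int \<Rightarrow> bool" where
  "at_most_prime_factors n z \<longleftrightarrow>
     (\<exists>P :: int multiset. (\<forall>p \<in># P. prime p) \<and> size P \<le> n \<and> \<bar>z\<bar> = prod_mset P)"

lemma at_most_prime_factors_iff:
  "at_most_prime_factors n z \<longleftrightarrow> z \<noteq> 0 \<and> size (prime_factorization z) \<le> n"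
proof
  assume "at_most_prime_factors n z"
  then obtain P where P: "\<And>p. p \<in># P \<Longrightarrow> prime p" "size P \<le> n" "\<bar>z\<bar> = prod_mset P"
    unfolding at_most_prime_factors_def by blast
  have "prime_factorization z = prime_factorization (normalize z)"
    by (rule prime_factorization_normalize [symmetric])
  also have "\<dots> = P"
    using P by (simp add: prime_factorization_prod_mset_primes)
  finally have "size (prime_factorization z) \<le> n" using P(2) by simp
  moreover have "prod_mset P \<noteq> 0" using P(1)[of 0] by auto
  hence "z \<noteq> 0" using P(3) by auto
  ultimately show "z \<noteq> 0 \<and> size (prime_factorization z) \<le> n" by simp
next
  assume "z \<noteq> 0 \<and> size (prime_factorization z) \<le> n"
  thus "at_most_prime_factors n z"
    unfolding at_most_prime_factors_def
    by (intro exI[of _ "prime_factorization z"]) (auto simp: prod_mset_prime_factorization)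
qed

end

(*
If 4 divides m, double a representation of m div 4. For m < 4^859 use Lagrange's theorem with one
coordinate prime to 3: without the primes 2 and 3, a number below 2^859 < 5^370 has at most 369
prime factors.

For large m let u, v run over a box of side about m^(31/64), with parities making
n = m - u^2 - v^2 = 1 mod 4, and weight (u, v) by the sum of chi4(q) over q | n, which is
nonnegative and positive only if n is a sum of two squares. A fourth moment bound for Kloosterman
sums gives the weighted distribution of u and v in residue classes. With Selberg type squared sieve
weights, the average of the number of odd prime factors of u and v below R is less than 169, so
some n of positive weight has at most 168 of them in u and in v. As u, v < R^200, at most 199 more
are at least R.
*)
theory Submission
  imports Defs "HOL-Analysis.Analysis" "HOL-Number_Theory.Number_Theory" "HOL-Computational_Algebra.Squarefree"
begin

section \<open>Gauss sums\<close>

text \<open>Expanding the weight means counting \<open>q dvd m - u^2 - v^2\<close> in the box for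
  \<open>q\<close> up to about \<open>X = sqrt m\<close>. Completing both coordinates gives a
  product of two Gauss sums, which depends on \<open>t\<close> only through an inverse of
  \<open>t\<close>; so plain Kloosterman sums appear. The fourth moment saves only a fourth root of
  the modulus, and the total error is about \<open>X^(7/4)\<close>, to be beaten by
  \<open>H^2\<close>. On the other side, divisors between \<open>Q\<close> and \<open>X\<close> are
  estimated trivially, which forces \<open>H\<close> below \<open>X\<close> by a power.
  \<open>H = X^(31/32)\<close> leaves room for both.

  The singular series is the same factor for every congruence condition, so the sieve sees only
  ratios of local factors, and the bound 5/12 for that series serves only to beat the errors.
  Parities giving \<open>n = 1\<close> modulo 4 exist exactly when 4 does not divide
  \<open>m\<close>; \<open>n = 1\<close> makes \<open>chi4\<close> symmetric under
  \<open>q -> n / q\<close>.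

  Numbers: the sieve level is \<open>R = X^(1/200)\<close>. The exponent 859 is the largest with
  \<open>2^859 < 5^370\<close>, and \<open>19^200 \<le> 2^859\<close> yields
  \<open>R \<ge> 19\<close>, enough for an average of 152. So 369 is dictated by small
  \<open>m\<close>; large \<open>m\<close> needs 367.\<close>

definition ee :: "nat \<Rightarrow> int \<Rightarrow> complex" where
  "ee c x = cis (2 * pi * real_of_int x / real c)"

lemma ee_0 [simp]: "ee c 0 = 1"
  by (simp add: ee_def)

lemma ee_add: "ee c (x + y) = ee c x * ee c y"
  by (simp add: ee_def cis_mult ring_distribs add_divide_distrib)

lemma ee_minus: "ee c (- x) = cnj (ee c x)"
  by (simp add: ee_def cis_cnj)

lemma norm_ee [simp]: "norm (ee c x) = 1"
  by (simp add: ee_def)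

lemma ee_self_mult [simp]: "ee c (int c * x) = 1"
proof (cases "c = 0")
  case False
  hence "ee c (int c * x) = cis (2 * pi * real_of_int x)"
    unfolding ee_def by (intro arg_cong[of _ _ cis]) simp
  thus ?thesis by (metis cis_multiple_2pi Ints_of_int)
qed (simp add: ee_def)

lemma ee_cong:
  assumes "[x = y] (mod int c)"
  shows "ee c x = ee c y"
proof -
  obtain k where "x = y + int c * k"
    using assms by (metis cong_iff_lin cong_sym mult.commute)
  thus ?thesis by (simp add: ee_add)
qed

lemma ee_scale: "k > 0 \<Longrightarrow> ee (c * k) (int k * x) = ee c x"
  by (simp add: ee_def field_simps)

lemma ee_scale': "k > 0 \<Longrightarrow> ee (k * c) (int k * x) = ee c x"
  by (simp add: ee_def field_simps)

lemma ee_mult_nat: "ee c (int n * x) = ee c x ^ n"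
  by (simp add: ee_def Complex.DeMoivre field_simps)

lemma ee_eq_1_iff:
  assumes "c > 0"
  shows "ee c x = 1 \<longleftrightarrow> int c dvd x"
proof
  assume "ee c x = 1"
  hence "cos (2 * pi * real_of_int x / real c) = 1"
    by (simp add: ee_def complex_eq_iff)
  then obtain n :: int where "2 * pi * real_of_int x / real c = real_of_int n * 2 * pi"
    by (auto simp: cos_one_2pi_int)
  hence "real_of_int x = real_of_int n * real c"
    using assms by (simp add: field_simps)
  hence "x = n * int c"
    by (metis of_int_eq_iff of_int_mult of_int_of_nat_eq)
  thus "int c dvd x" by simp
next
  assume "int c dvd x"
  thus "ee c x = 1" by (auto elim!: dvdE)
qed

lemma sum_ee:
  assumes "c > 0"
  shows "(\<Sum>t<c. ee c (int t * x)) = (if int c dvd x then of_nat c else 0)"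
proof (cases "int c dvd x")
  case True
  hence "ee c x = 1" using assms ee_eq_1_iff by blast
  thus ?thesis using True by (simp add: ee_mult_nat)
next
  case False
  hence 1: "ee c x \<noteq> 1" using assms ee_eq_1_iff by blast
  have "ee c x ^ c = 1" using ee_mult_nat[of c c x] by simp
  hence "(\<Sum>t<c. ee c x ^ t) = 0"
    using geometric_sum[OF 1, of c] by simp
  thus ?thesis using False by (simp add: ee_mult_nat)
qed

lemma bij_betw_residues_affine:
  assumes "coprime M (int c)" "c > 0"
  shows "bij_betw (\<lambda>x. nat ((a + M * int x) mod int c)) {..<c} {..<c}"
proof -
  let ?g = "\<lambda>x. nat ((a + M * int x) mod int c)"
  have "inj_on ?g {..<c}"
  proof (rule inj_onI)
    fix x y assume xy: "x \<in> {..<c}" "y \<in> {..<c}" "?g x = ?g y"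
    have "(a + M * int x) mod int c = (a + M * int y) mod int c"
      using xy(3) assms(2) by (simp add: nat_eq_iff2)
    hence "[a + M * int x = a + M * int y] (mod int c)"
      by (simp add: cong_def)
    hence "[M * int x = M * int y] (mod int c)"
      by (simp add: cong_add_lcancel)
    hence "[int x = int y] (mod int c)"
      using assms(1) cong_mult_lcancel by blast
    thus "x = y" using xy by (simp add: cong_def)
  qed
  moreover have "?g ` {..<c} \<subseteq> {..<c}"
    using assms(2) by (auto simp: nat_less_iff)
  ultimately show ?thesis
    by (simp add: bij_betw_def endo_inj_surj)
qed

lemma sum_residues_affine:
  fixes f :: "int \<Rightarrow> 'a :: comm_monoid_add"
  assumes "\<And>x y. [x = y] (mod int c) \<Longrightarrow> f x = f y" "coprime M (int c)" "c > 0"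
  shows "(\<Sum>x<c. f (a + M * int x)) = (\<Sum>x<c. f (int x))"
proof -
  have "(\<Sum>x<c. f (int x)) = (\<Sum>x<c. f (int (nat ((a + M * int x) mod int c))))"
    by (rule sum.reindex_bij_betw[OF bij_betw_residues_affine, symmetric]) fact+
  also have "\<dots> = (\<Sum>x<c. f (a + M * int x))"
    using assms(3) by (intro sum.cong refl assms(1)) (auto simp: cong_def)
  finally show ?thesis ..
qed

lemma sum_residues_shift:
  fixes f :: "int \<Rightarrow> 'a :: comm_monoid_add"
  assumes "\<And>x y. [x = y] (mod int c) \<Longrightarrow> f x = f y" "c > 0"
  shows "(\<Sum>x<c. f (a + int x)) = (\<Sum>x<c. f (int x))"
  using sum_residues_affine[of c f 1 a] assms by simp

lemma sum_residues_mult: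
  fixes f :: "int \<Rightarrow> 'a :: comm_monoid_add"
  assumes "\<And>x y. [x = y] (mod int c) \<Longrightarrow> f x = f y" "coprime M (int c)" "c > 0"
  shows "(\<Sum>x<c. f (M * int x)) = (\<Sum>x<c. f (int x))"
  using sum_residues_affine[of c f M 0] assms by simp

text \<open>The residues are parametrised by \<open>c2 * x + c1 * y\<close> instead of by
  idempotents: no inverses occur, and additive characters modulo \<open>c1 * c2\<close> split into
  characters modulo \<open>c1\<close> and \<open>c2\<close>.\<close>

lemma sum_residues_crt:
  fixes f :: "int \<Rightarrow> 'a :: comm_monoid_add"
  assumes "\<And>x y. [x = y] (mod int (c1 * c2)) \<Longrightarrow> f x = f y"
    and cop: "coprime c1 c2" and "c1 > 0" "c2 > 0"
  shows "(\<Sum>x<c1 * c2. f (int x)) = (\<Sum>x<c1. \<Sum>y<c2. f (int c2 * int x + int c1 * int y))"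
proof -
  let ?g = "\<lambda>(x, y). (c2 * x + c1 * y) mod (c1 * c2)"
  have inj: "inj_on ?g ({..<c1} \<times> {..<c2})"
  proof (rule inj_onI, clarify)
    fix x y x' y' assume *: "x < c1" "x' < c1" "y < c2" "y' < c2"
      "(c2 * x + c1 * y) mod (c1 * c2) = (c2 * x' + c1 * y') mod (c1 * c2)"
    hence eq: "[c2 * x + c1 * y = c2 * x' + c1 * y'] (mod (c1 * c2))" by (simp add: cong_def)
    have "[c2 * x + c1 * y = c2 * x' + c1 * y'] (mod c1)"
      using eq by (rule cong_modulus_mult_nat)
    hence "[c2 * x = c2 * x'] (mod c1)" by (simp add: cong_def)
    hence "[x = x'] (mod c1)" using cop by (meson cong_mult_lcancel_nat coprime_commute)
    moreover have "[c2 * x + c1 * y = c2 * x' + c1 * y'] (mod c2)"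
      using eq by (metis cong_modulus_mult_nat mult.commute)
    hence "[c1 * y = c1 * y'] (mod c2)" by (simp add: cong_def)
    hence "[y = y'] (mod c2)" using cop by (meson cong_mult_lcancel_nat coprime_commute)
    ultimately show "x = x' \<and> y = y'" using * by (simp add: cong_def)
  qed
  have "bij_betw ?g ({..<c1} \<times> {..<c2}) {..<c1 * c2}"
    unfolding bij_betw_def
  proof (intro conjI inj card_subset_eq)
    show "card (?g ` ({..<c1} \<times> {..<c2})) = card {..<c1 * c2}"
      by (simp add: card_image[OF inj] card_cartesian_product)
  qed (use assms in auto)
  hence "(\<Sum>x<c1 * c2. f (int x)) = (\<Sum>z\<in>{..<c1} \<times> {..<c2}. f (int (?g z)))"
    by (rule sum.reindex_bij_betw[symmetric])
  also have "\<dots> = (\<Sum>z\<in>{..<c1} \<times> {..<c2}. f (int c2 * int (fst z) + int c1 * int (snd z)))"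
    by (intro sum.cong refl assms(1)) (auto simp: cong_def zmod_int)
  finally show ?thesis by (simp add: sum.cartesian_product case_prod_beta)
qed

section \<open>The character modulo 4 and squares of quadratic Gauss sums\<close>

definition chi4 :: "nat \<Rightarrow> int" where
  "chi4 q = (if even q then 0 else if q mod 4 = 1 then 1 else - 1)"

lemma odd_mod4: "odd (q::nat) \<Longrightarrow> q mod 4 = 1 \<or> q mod 4 = 3"
  by presburger

abbreviation chi :: "nat \<Rightarrow> real" where "chi q \<equiv> real_of_int (chi4 q)"

lemma chi4_mult: "chi4 (a * b) = chi4 a * chi4 b"
proof (cases "even a \<or> even b")
  case False
  hence "a mod 4 = 1 \<or> a mod 4 = 3" "b mod 4 = 1 \<or> b mod 4 = 3"
    using odd_mod4 by auto
  moreover have "a * b mod 4 = (a mod 4) * (b mod 4) mod 4" by (simp add: mod_mult_eq)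
  ultimately show ?thesis using False by (auto simp: chi4_def)
qed (auto simp: chi4_def)

lemma chi4_1 [simp]: "chi4 1 = 1" "chi4 (Suc 0) = 1"
  by (simp_all add: chi4_def)

lemma chi4_odd_square: "odd q \<Longrightarrow> chi4 q * chi4 q = 1"
  by (simp add: chi4_def)

lemma abs_chi4_le: "\<bar>chi4 q\<bar> \<le> 1"
  by (simp add: chi4_def)

lemma abs_chi_le: "\<bar>chi q\<bar> \<le> 1"
  using abs_chi4_le[of q] by linarith

definition gs :: "nat \<Rightarrow> int \<Rightarrow> complex" where
  "gs c t = (\<Sum>x<c. ee c (t * (int x)\<^sup>2))"

text \<open>After the substitution of the Chinese remainder theorem the mixed term of the square is
  a multiple of \<open>c1 * c2\<close>, so the character factors.\<close>

lemma gs_mult: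
  assumes "coprime c1 c2" "c1 > 0" "c2 > 0"
  shows "gs (c1 * c2) t = gs c1 (t * int c2) * gs c2 (t * int c1)"
proof -
  have *: "ee (c1 * c2) (t * (int c2 * x + int c1 * y)\<^sup>2) =
      ee c1 (t * int c2 * x\<^sup>2) * ee c2 (t * int c1 * y\<^sup>2)" for x y :: int
  proof -
    have "t * (int c2 * x + int c1 * y)\<^sup>2 =
       int c2 * (t * int c2 * x\<^sup>2) + int c1 * (t * int c1 * y\<^sup>2) + int (c1 * c2) * (2 * t * x * y)"
      by (simp add: power2_eq_square algebra_simps)
    thus ?thesis using assms by (simp only: ee_add ee_self_mult ee_scale ee_scale') simp
  qed
  have "gs (c1 * c2) t = (\<Sum>x<c1. \<Sum>y<c2. ee (c1 * c2) (t * (int c2 * int x + int c1 * int y)\<^sup>2))"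
    unfolding gs_def
  proof (rule sum_residues_crt)
    fix x y :: int assume "[x = y] (mod int (c1 * c2))"
    thus "ee (c1 * c2) (t * x\<^sup>2) = ee (c1 * c2) (t * y\<^sup>2)"
      by (intro ee_cong cong_mult cong_pow) auto
  qed fact+
  also have "\<dots> = gs c1 (t * int c2) * gs c2 (t * int c1)"
    by (simp add: * gs_def sum_product)
  finally show ?thesis .
qed

text \<open>With \<open>x = a + p * d * b\<close> the exponent is linear in \<open>b\<close>, and
  the sum over \<open>b\<close> vanishes unless \<open>p dvd a\<close>. Writing \<open>a\<close> as
  \<open>p\<close> times a residue modulo \<open>d\<close> leaves the Gauss sum modulo
  \<open>d\<close>.\<close>

lemma gs_prime_square:
  assumes p: "prime p" "odd p" and t: "coprime t (int p)" and d: "d > 0"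
  shows "gs (p * p * d) t = of_nat p * gs d t"
proof -
  have p0: "p > 0" using p prime_gt_0_nat by blast
  define c where "c = p * p * d"
  have *: "ee c (t * (int a + int (p * d) * int b)\<^sup>2) =
      ee c (t * (int a)\<^sup>2) * ee p (int b * (2 * t * int a))" for a b
  proof -
    have "t * (int a + int (p * d) * int b)\<^sup>2 = t * (int a)\<^sup>2 +
       int (p * d) * (int b * (2 * t * int a)) + int c * (t * int d * (int b)\<^sup>2)"
      by (simp add: power2_eq_square algebra_simps c_def)
    moreover have "ee c (int (p * d) * z) = ee p z" for z
      using ee_scale[of "p * d" p z] p0 d by (simp add: c_def mult_ac)
    ultimately show ?thesis by (simp only: ee_add ee_self_mult) simp
  qed
  have dvd_iff: "int p dvd 2 * t * int a \<longleftrightarrow> p dvd a" for a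
  proof -
    have "coprime (int p) (2 * t)"
      using p t by (simp add: coprime_commute)
    thus ?thesis by (simp add: coprime_dvd_mult_right_iff)
  qed
  have "gs c t = (\<Sum>x<p * (p * d). ee c (t * (int x)\<^sup>2))"
    by (simp add: gs_def c_def mult.assoc)
  also have "\<dots> = (\<Sum>b<p. \<Sum>x = b * (p * d)..<b * (p * d) + p * d. ee c (t * (int x)\<^sup>2))"
    by (rule sum.nat_group[symmetric])
  also have "\<dots> = (\<Sum>b<p. \<Sum>a<p * d. ee c (t * (int a + int (p * d) * int b)\<^sup>2))"
  proof (rule sum.cong[OF refl])
    fix b
    have "(\<Sum>x = b * (p * d)..<b * (p * d) + p * d. ee c (t * (int x)\<^sup>2)) =
      (\<Sum>x = 0 + b * (p * d)..<p * d + b * (p * d). ee c (t * (int x)\<^sup>2))" by (simp add: add.commute)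
    also have "\<dots> = (\<Sum>a = 0..<p * d. ee c (t * (int (a + b * (p * d)))\<^sup>2))"
      by (rule sum.shift_bounds_nat_ivl)
    also have "\<dots> = (\<Sum>a<p * d. ee c (t * (int a + int (p * d) * int b)\<^sup>2))"
      by (simp add: lessThan_atLeast0 mult_ac)
    finally show "(\<Sum>x = b * (p * d)..<b * (p * d) + p * d. ee c (t * (int x)\<^sup>2)) =
      (\<Sum>a<p * d. ee c (t * (int a + int (p * d) * int b)\<^sup>2))" .
  qed
  also have "\<dots> = (\<Sum>b<p. \<Sum>a<p * d. ee c (t * (int a)\<^sup>2) * ee p (int b * (2 * t * int a)))"
    by (simp only: *)
  also have "\<dots> = (\<Sum>a<p * d. ee c (t * (int a)\<^sup>2) * (\<Sum>b<p. ee p (int b * (2 * t * int a))))"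
    by (subst sum.swap) (simp add: sum_distrib_left)
  also have "\<dots> = (\<Sum>a<p * d. if p dvd a then of_nat p * ee c (t * (int a)\<^sup>2) else 0)"
    by (intro sum.cong refl) (simp add: sum_ee[OF p0] dvd_iff)
  also have "\<dots> = (\<Sum>a\<in>{a\<in>{..<p * d}. p dvd a}. of_nat p * ee c (t * (int a)\<^sup>2))"
    by (subst sum.inter_filter) auto
  also have "{a\<in>{..<p * d}. p dvd a} = (\<lambda>a. p * a) ` {..<d}"
    using p0 by (auto elim!: dvdE)
  also have "(\<Sum>a\<in>(\<lambda>a. p * a) ` {..<d}. of_nat p * ee c (t * (int a)\<^sup>2)) =
     (\<Sum>a<d. of_nat p * ee c (t * (int (p * a))\<^sup>2))"
    using p0 by (subst sum.reindex) (auto simp: inj_on_def)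
  also have "\<dots> = (\<Sum>a<d. of_nat p * ee d (t * (int a)\<^sup>2))"
  proof (intro sum.cong refl)
    fix a
    have "ee c (t * (int (p * a))\<^sup>2) = ee c (int (p * p) * (t * (int a)\<^sup>2))"
      by (simp add: power2_eq_square algebra_simps)
    also have "\<dots> = ee d (t * (int a)\<^sup>2)"
      unfolding c_def using p0 by (intro ee_scale') simp
    finally show "of_nat p * ee c (t * (int (p * a))\<^sup>2) = of_nat p * ee d (t * (int a)\<^sup>2)" by simp
  qed
  also have "\<dots> = of_nat p * gs d t"
    by (simp add: gs_def sum_distrib_left)
  finally show ?thesis by (simp add: c_def)
qed

text \<open>Replacing \<open>x\<close> by \<open>y + x\<close> cancels the square of
  \<open>y\<close>; what remains is linear in \<open>y\<close> with coefficient
  \<open>2 * t * x\<close>. Since \<open>2 * t\<close> is a unit modulo the odd \<open>c\<close>,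
  only \<open>x = 0\<close> survives.\<close>

lemma gs_mult_gs_minus:
  assumes c: "odd c" and t: "coprime t (int c)"
  shows "gs c t * gs c (- t) = of_nat c"
proof -
  have c0: "c > 0" using c by (cases c) auto
  have "gs c t * gs c (- t) = (\<Sum>y<c. \<Sum>x<c. ee c (t * (int x)\<^sup>2) * ee c (- t * (int y)\<^sup>2))"
    unfolding gs_def sum_product by (rule sum.swap)
  also have "\<dots> = (\<Sum>y<c. \<Sum>x<c. ee c (t * (int y + int x)\<^sup>2) * ee c (- t * (int y)\<^sup>2))"
  proof (rule sum.cong[OF refl])
    fix y
    show "(\<Sum>x<c. ee c (t * (int x)\<^sup>2) * ee c (- t * (int y)\<^sup>2)) =
      (\<Sum>x<c. ee c (t * (int y + int x)\<^sup>2) * ee c (- t * (int y)\<^sup>2))"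
      by (rule sum_residues_shift[of c "\<lambda>x. ee c (t * x\<^sup>2) * ee c (- t * (int y)\<^sup>2)", symmetric])
         (auto intro!: ee_cong cong_mult cong_pow simp: c0)
  qed
  also have "\<dots> = (\<Sum>y<c. \<Sum>x<c. ee c (t * (int x)\<^sup>2) * ee c (int y * (2 * t * int x)))"
    by (intro sum.cong refl, simp only: ee_add[symmetric])
       (simp add: power2_eq_square algebra_simps)
  also have "\<dots> = (\<Sum>x<c. ee c (t * (int x)\<^sup>2) * (\<Sum>y<c. ee c (int y * (2 * t * int x))))"
    by (subst sum.swap) (simp add: sum_distrib_left)
  also have "\<dots> = (\<Sum>x<c. if x = 0 then of_nat c else 0)"
  proof (intro sum.cong refl)
    fix x assume x: "x \<in> {..<c}"
    have "coprime (int c) (2 * t)"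
      using c t by (simp add: coprime_commute)
    hence "int c dvd 2 * t * int x \<longleftrightarrow> x = 0"
      using x by (auto simp: coprime_dvd_mult_right_iff dest: dvd_imp_le)
    thus "ee c (t * (int x)\<^sup>2) * (\<Sum>y<c. ee c (int y * (2 * t * int x))) = (if x = 0 then of_nat c else 0)"
      by (simp add: sum_ee[OF c0])
  qed
  also have "\<dots> = of_nat c" using c0 by simp
  finally show ?thesis .
qed

lemma QuadRes_minus_1_iff:
  assumes "prime p" "odd p"
  shows "QuadRes (int p) (- 1) \<longleftrightarrow> p mod 4 = 1"
proof -
  have p2: "p > 2" using assms prime_gt_1_nat[of p] by (cases "p = 2") auto
  have "[Legendre (- 1) (int p) = (- 1) ^ ((p - 1) div 2)] (mod int p)"
    using euler_criterion[of p "- 1"] assms p2 by simp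
  moreover have "\<not> [- 1 = 0] (mod int p)" using p2 by (simp add: cong_iff_dvd_diff)
  hence "Legendre (- 1) (int p) = (if QuadRes (int p) (- 1) then 1 else - 1)"
    by (simp add: Legendre_def)
  moreover have "\<not> [1 = - 1] (mod int p)" "\<not> [- 1 = 1] (mod int p)"
    using p2 by (auto simp: cong_iff_dvd_diff dest!: zdvd_imp_le)
  moreover have "even ((p - 1) div 2) \<longleftrightarrow> p mod 4 = 1"
    using assms(2) by presburger
  ultimately show ?thesis by (auto split: if_splits simp: minus_one_power_iff)
qed

text \<open>Otherwise \<open>x / y\<close> would be a square root of -1 modulo
  \<open>p\<close>.\<close>

lemma prime_3mod4_dvd_sum_squares:
  assumes p: "prime p" "p mod 4 = 3" and d: "int p dvd x\<^sup>2 + y\<^sup>2"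
  shows "int p dvd y"
proof (rule ccontr)
  have prime: "prime (int p)" using p by simp
  assume "\<not> int p dvd y"
  with prime have "coprime (int p) y" by (rule prime_imp_coprime)
  hence "coprime y (int p)" by (simp only: coprime_commute)
  then obtain z where z: "[y * z = 1] (mod int p)" using cong_solve_coprime_int by blast
  have "[(x * z)\<^sup>2 + (y * z)\<^sup>2 = 0] (mod int p)"
    using d by (simp add: cong_0_iff power_mult_distrib flip: distrib_right)
  moreover have "[(y * z)\<^sup>2 = 1\<^sup>2] (mod int p)" using z by (rule cong_pow)
  ultimately have "[(x * z)\<^sup>2 + 1 = 0] (mod int p)"
    by (metis cong_add_lcancel cong_sym cong_trans one_power2)
  hence "[(x * z)\<^sup>2 = - 1] (mod int p)" by (simp add: cong_iff_dvd_diff)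
  moreover have "odd p" using p(2) by presburger
  ultimately show False using QuadRes_minus_1_iff[OF p(1)] p(2) unfolding QuadRes_def by auto
qed

text \<open>The squares of the Gauss sums for \<open>t = 1, \<dots>, p - 1\<close> have absolute value \<open>p\<close> and add up
  to \<open>p - p\<^sup>2\<close>, because \<open>x\<^sup>2 + y\<^sup>2\<close> vanishes modulo \<open>p\<close> only at the origin. Hence each of them is \<open>- p\<close>.\<close>

lemma gs_prime_3mod4_sq:
  assumes p: "prime p" "p mod 4 = 3" and t: "coprime t (int p)"
  shows "(gs p t)\<^sup>2 = - of_nat p"
proof -
  have p1: "p > 1" using p prime_gt_1_nat by blast
  have odd: "odd p" using p(2) by presburger
  have norm: "norm ((gs p s)\<^sup>2) = real p" if "coprime s (int p)" for s
  proof -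
    have "gs p (- s) = cnj (gs p s)" by (simp add: gs_def ee_minus)
    hence "gs p s * cnj (gs p s) = of_nat p" using gs_mult_gs_minus[OF odd that] by simp
    hence "norm (gs p s) * norm (gs p s) = real p" by (metis complex_mod_cnj norm_mult norm_of_nat)
    thus ?thesis by (simp only: norm_mult power2_eq_square)
  qed
  have zero: "int p dvd (int x)\<^sup>2 + (int y)\<^sup>2 \<longleftrightarrow> x = 0 \<and> y = 0" if "x < p" "y < p" for x y
  proof
    assume "int p dvd (int x)\<^sup>2 + (int y)\<^sup>2"
    hence "int p dvd int x" "int p dvd int y"
      using prime_3mod4_dvd_sum_squares[OF p, of "int x" "int y"] prime_3mod4_dvd_sum_squares[OF p, of "int y" "int x"]
      by (simp_all add: add.commute)
    thus "x = 0 \<and> y = 0" using that by (auto dest: dvd_imp_le)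
  qed simp
  have "(\<Sum>s<p. (gs p (int s))\<^sup>2) = (\<Sum>s<p. \<Sum>x<p. \<Sum>y<p. ee p (int s * ((int x)\<^sup>2 + (int y)\<^sup>2)))"
    unfolding gs_def power2_eq_square[of "sum _ _"] sum_product by (simp add: distrib_left ee_add)
  also have "\<dots> = (\<Sum>x<p. \<Sum>s<p. \<Sum>y<p. ee p (int s * ((int x)\<^sup>2 + (int y)\<^sup>2)))" by (rule sum.swap)
  also have "\<dots> = (\<Sum>x<p. \<Sum>y<p. \<Sum>s<p. ee p (int s * ((int x)\<^sup>2 + (int y)\<^sup>2)))"
    by (intro sum.cong refl sum.swap)
  also have "\<dots> = (\<Sum>x<p. \<Sum>y<p. if y = 0 then if x = 0 then of_nat p else 0 else 0)"
    using p1 by (intro sum.cong refl, subst sum_ee) (auto simp: zero)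
  also have "\<dots> = of_nat p" using p1 by simp
  finally have "(\<Sum>s<p. (gs p (int s))\<^sup>2) = of_nat p" .
  moreover have "{..<p} = insert 0 {1..<p}" using p1 by auto
  moreover have "gs p 0 = of_nat p" by (simp add: gs_def)
  ultimately have "(\<Sum>s\<in>{1..<p}. (gs p (int s))\<^sup>2) = of_nat p - (of_nat p)\<^sup>2"
    by (simp add: eq_diff_eq add.commute)
  hence "(\<Sum>s\<in>{1..<p}. Re ((gs p (int s))\<^sup>2)) = Re (of_nat p - (of_nat p)\<^sup>2)" by (metis Re_sum)
  also have "\<dots> = - ((real p - 1) * real p)" by (simp add: power2_eq_square algebra_simps)
  finally have "(\<Sum>s\<in>{1..<p}. Re ((gs p (int s))\<^sup>2) + real p) = 0"
    using p1 by (simp add: sum.distrib of_nat_diff)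
  moreover have "Re ((gs p (int s))\<^sup>2) + real p \<ge> 0" if s: "s \<in> {1..<p}" for s
  proof -
    have "\<not> p dvd s" using s by (simp add: nat_dvd_not_less)
    with p(1) have "coprime p s" by (rule prime_imp_coprime)
    hence "coprime (int s) (int p)" by (simp add: coprime_commute)
    thus ?thesis using norm[of "int s"] abs_Re_le_cmod[of "(gs p (int s))\<^sup>2"] by linarith
  qed
  ultimately have re: "Re ((gs p (int s))\<^sup>2) + real p = 0" if "s \<in> {1..<p}" for s
    using that sum_nonneg_eq_0_iff[of "{1..<p}" "\<lambda>s. Re ((gs p (int s))\<^sup>2) + real p"] by blast
  define s where "s = nat (t mod int p)"
  have s: "int s = t mod int p" using p1 by (simp add: s_def)
  have "\<not> int p dvd t" using t p1 by (auto dest: coprime_common_divisor)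
  hence "int s \<noteq> 0" unfolding s dvd_eq_mod_eq_0 .
  moreover have "int s < int p" unfolding s using p1 by (intro pos_mod_bound) simp
  ultimately have "s \<in> {1..<p}" by simp
  moreover have "gs p t = gs p (int s)"
    unfolding gs_def s by (intro sum.cong refl ee_cong cong_mult) (auto simp: cong_def)
  ultimately have r: "Re ((gs p t)\<^sup>2) = - real p" using re[of s] by simp
  have "(Re ((gs p t)\<^sup>2))\<^sup>2 + (Im ((gs p t)\<^sup>2))\<^sup>2 = (real p)\<^sup>2"
    using norm[OF t] by (metis cmod_power2)
  hence "Im ((gs p t)\<^sup>2) = 0" unfolding r by simp
  thus ?thesis using r by (simp add: complex_eq_iff)
qed

text \<open>For \<open>p = 1\<close> modulo 4 a square root \<open>z\<close> of -1 exists, and the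
  substitution \<open>x -> z * x\<close> turns \<open>t\<close> into \<open>- t\<close>; so the
  square equals the product computed in \<open>gs_mult_gs_minus\<close>. The other residue class is
  the preceding lemma.\<close>

lemma gs_prime_sq:
  assumes p: "prime p" "odd p" and t: "coprime t (int p)"
  shows "(gs p t)\<^sup>2 = of_int (chi4 p) * of_nat p"
proof (cases "p mod 4 = 1")
  case True
  have p0: "p > 0" using p prime_gt_0_nat by blast
  obtain z where z: "[z\<^sup>2 = - 1] (mod int p)"
    using QuadRes_minus_1_iff[OF p] True by (auto simp: QuadRes_def)
  have cz: "coprime z (int p)"
  proof -
    have "[z * (- z) = 1] (mod int p)"
      using cong_minus_minus_iff[of "z\<^sup>2" "- 1"] z by (simp add: power2_eq_square)
    thus ?thesis using coprime_iff_invertible_int by blast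
  qed
  have "gs p (- t) = (\<Sum>x<p. ee p (t * (z * int x)\<^sup>2))"
    unfolding gs_def
  proof (intro sum.cong refl ee_cong)
    fix x
    have "[t * (- 1) * (int x)\<^sup>2 = t * z\<^sup>2 * (int x)\<^sup>2] (mod int p)"
      by (intro cong_mult cong_refl cong_sym[OF z])
    thus "[- t * (int x)\<^sup>2 = t * (z * int x)\<^sup>2] (mod int p)"
      by (simp add: power_mult_distrib mult_ac)
  qed
  also have "\<dots> = gs p t"
    unfolding gs_def by (rule sum_residues_mult) (auto intro!: ee_cong cong_mult cong_pow simp: cz p0)
  finally show ?thesis
    using gs_mult_gs_minus[OF p(2) t] True p(2) by (simp add: chi4_def power2_eq_square)
next
  case False
  hence 3: "p mod 4 = 3" using p(2) odd_mod4 by blast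
  thus ?thesis using gs_prime_3mod4_sq[OF p(1) 3 t] p(2) by (simp add: chi4_def)
qed

text \<open>The square of the Gauss sum does not depend on \<open>t\<close>. Each of the two squared
  coordinates contributes one Gauss sum, so this is what makes the later sum over \<open>t\<close>
  an untwisted Kloosterman sum. The induction removes either a square \<open>p * p\<close> or a
  prime coprime to the rest.\<close>

theorem gauss_sum_sq:
  assumes "odd c" "coprime t (int c)"
  shows "(gs c t)\<^sup>2 = of_int (chi4 c) * of_nat c"
  using assms
proof (induction c arbitrary: t rule: less_induct)
  case (less c)
  have c0: "c > 0" using less.prems by (cases c) auto
  show ?case
  proof (cases "c = 1")
    case True
    thus ?thesis by (simp add: gs_def)
  next
    case False
    then obtain p where p: "prime p" "p dvd c" using prime_factor_nat by blast
    then obtain d where d: "c = p * d" by (auto elim!: dvdE)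
    have odd: "odd p" "odd d" and p1: "p > 1" and d0: "d > 0"
      using less.prems p d c0 prime_gt_1_nat by auto
    have tp: "coprime t (int p)" and td: "coprime t (int d)"
      using less.prems d by auto
    show ?thesis
    proof (cases "p dvd d")
      case True
      then obtain e where e: "d = p * e" by (auto elim!: dvdE)
      have e0: "e > 0" using d0 e by (cases e) auto
      have "gs c t = of_nat p * gs e t"
        using gs_prime_square[OF p(1) odd(1) tp e0] d e by (simp add: mult.assoc)
      moreover have "(gs e t)\<^sup>2 = of_int (chi4 e) * of_nat e"
      proof (rule less.IH)
        have "1 < p * p" using p1 by (rule less_1_mult) (rule p1)
        hence "1 * e < p * p * e" using e0 by (intro mult_strict_right_mono)
        thus "e < c" using d e by (simp add: mult.assoc)
        show "odd e" using odd e by simp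
        show "coprime t (int e)" using td e by auto
      qed
      moreover have "chi4 c = chi4 e"
        using d e chi4_odd_square[OF odd(1)] by (simp add: chi4_mult mult.assoc[symmetric])
      ultimately show ?thesis by (simp add: d e power_mult_distrib power2_eq_square)
    next
      case False
      hence cop: "coprime p d" using p(1) prime_imp_coprime by blast
      have cop': "coprime (int p) (int d)" using cop by simp
      have "gs c t = gs p (t * int d) * gs d (t * int p)"
        unfolding d using cop p1 d0 by (intro gs_mult) auto
      moreover have "(gs p (t * int d))\<^sup>2 = of_int (chi4 p) * of_nat p"
        using tp cop' by (intro gs_prime_sq p odd) (auto simp: coprime_commute)
      moreover have "(gs d (t * int p))\<^sup>2 = of_int (chi4 d) * of_nat d"
        using td cop' d0 p1 d odd by (intro less.IH) auto
      ultimately show ?thesis by (simp add: d power_mult_distrib chi4_mult)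
    qed
  qed
qed

section \<open>Kloosterman sums\<close>

text \<open>Representatives are taken below \<open>c\<close>, so that the case \<open>c = 1\<close>
  is the residue 0, whereas \<open>totatives 1\<close> is \<open>{1}\<close>. This is the range over
  which complete sums modulo \<open>c\<close> run.\<close>

definition units_below :: "nat \<Rightarrow> nat set" where
  "units_below c = {t \<in> {..<c}. coprime t c}"

lemma finite_units_below [simp]: "finite (units_below c)"
  by (simp add: units_below_def)

lemma card_units_below: "c > 0 \<Longrightarrow> card (units_below c) = totient c"
proof (cases "c = 1")
  case True
  hence "units_below c = {0}" by (auto simp: units_below_def)
  thus ?thesis using True by simp
next
  case False
  assume "c > 0"
  hence "units_below c = totatives c"
    using False totatives_less[of _ c]
    by (auto simp: units_below_def totatives_def intro!: Nat.gr0I)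
  thus ?thesis by (simp add: totient_def)
qed

lemma sum_units_eq:
  "(\<Sum>t\<in>units_below c. f (int t)) = (\<Sum>t<c. if coprime (int t) (int c) then f (int t) else (0 :: 'a :: comm_monoid_add))"
  unfolding units_below_def by (subst sum.inter_filter) auto

lemma sum_units_mult:
  fixes f :: "int \<Rightarrow> 'a :: comm_monoid_add"
  assumes f: "\<And>x y. [x = y] (mod int c) \<Longrightarrow> coprime x (int c) \<Longrightarrow> f x = f y"
    and M: "coprime M (int c)" "c > 0"
  shows "(\<Sum>t\<in>units_below c. f (M * int t)) = (\<Sum>t\<in>units_below c. f (int t))"
proof -
  let ?f = "\<lambda>x. if coprime x (int c) then f x else 0"
  have "(\<Sum>t<c. ?f (M * int t)) = (\<Sum>t<c. ?f (int t))"
  proof (rule sum_residues_mult)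
    fix x y assume xy: "[x = y] (mod int c)"
    have "coprime x (int c) \<longleftrightarrow> coprime y (int c)"
      using xy by (metis cong_imp_coprime cong_sym)
    thus "?f x = ?f y" using f[OF xy] by auto
  qed (use M in auto)
  moreover have "(\<Sum>t<c. ?f (M * int t)) = (\<Sum>t\<in>units_below c. f (M * int t))"
    using M unfolding sum_units_eq[of "\<lambda>x. f (M * x)"] by (intro sum.cong) auto
  ultimately show ?thesis by (simp add: sum_units_eq)
qed

abbreviation minv :: "nat \<Rightarrow> int \<Rightarrow> int" where
  "minv c x \<equiv> modular_inverse (int c) x"

lemma minv_cong:
  assumes "[x = y] (mod int c)" "coprime x (int c)" "c > 0"
  shows "minv c x = minv c y"
proof (rule modular_inverse_int_eqI)
  have y: "coprime y (int c)" using assms by (metis cong_imp_coprime)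
  have "[x * minv c y = y * minv c y] (mod int c)" using assms(1) by (intro cong_mult cong_refl)
  also have "[y * minv c y = 1] (mod int c)" by (rule cong_modular_inverse1[OF y])
  finally show "[x * minv c y = 1] (mod int c)" .
  show "minv c y \<in> {0..<int c}"
    using assms(3) modular_inverse_int_nonneg modular_inverse_int_less by force
qed

definition kl :: "nat \<Rightarrow> int \<Rightarrow> int \<Rightarrow> complex" where
  "kl c a b = (\<Sum>t\<in>units_below c. ee c (a * int t + b * minv c (int t)))"

lemma kl_cong:
  assumes "[a = a'] (mod int c)" "[b = b'] (mod int c)"
  shows "kl c a b = kl c a' b'"
  unfolding kl_def using assms by (intro sum.cong refl ee_cong cong_add cong_mult) auto

text \<open>The substitution \<open>t -> s * t\<close>. It produces \<open>totient c\<close> pairs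
  of parameters with the same Kloosterman sum, which lets a mean over all pairs bound a single
  sum.\<close>

lemma kl_invariant:
  assumes s: "coprime s (int c)" and c: "c > 0"
  shows "kl c (a * s) (b * minv c s) = kl c a b"
proof -
  have "(\<Sum>t\<in>units_below c. ee c (a * (s * int t) + b * minv c (s * int t))) = kl c a b"
    unfolding kl_def
    by (rule sum_units_mult[where f = "\<lambda>x. ee c (a * x + b * minv c x)"])
       (auto intro!: ee_cong cong_add cong_mult simp: s c minv_cong)
  moreover have "ee c (a * (s * int t) + b * minv c (s * int t)) =
     ee c (a * s * int t + b * minv c s * minv c (int t))" if "t \<in> units_below c" for t
  proof (rule ee_cong, rule cong_add)
    have t: "coprime (int t) (int c)" using that by (simp add: units_below_def)
    have "[b * minv c (s * int t) = b * (minv c (int t) * minv c s)] (mod int c)"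
      using modular_inverse_int_mult[OF s t] c by (intro cong_mult) (auto simp: cong_def)
    thus "[b * minv c (s * int t) = b * minv c s * minv c (int t)] (mod int c)"
      by (simp add: mult_ac)
  qed (simp add: mult_ac)
  ultimately show ?thesis unfolding kl_def by simp
qed

text \<open>The threefold divisor function: the number of ordered factorisations of \<open>n\<close>
  into three factors, \<open>g\<close> and \<open>e\<close> being the first two.\<close>

definition tau3 :: "nat \<Rightarrow> nat" where
  "tau3 n = (\<Sum>g | g dvd n. card {e. e dvd n div g})"

lemma card_divisors_pos: "n > 0 \<Longrightarrow> card {e. e dvd (n::nat)} > 0"
  by (auto simp: card_gt_0_iff)

lemma card_divisors_le_tau3:
  assumes "n > 0"
  shows "card {e. e dvd n} \<le> tau3 n"
proof -
  have "card {e. e dvd n} = (\<Sum>g | g dvd n. 1)" by simp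
  also have "\<dots> \<le> tau3 n" unfolding tau3_def
  proof (rule sum_mono)
    fix g assume "g \<in> {g. g dvd n}"
    hence "n div g > 0" using assms by (auto elim!: dvdE)
    thus "1 \<le> card {e. e dvd n div g}" using card_divisors_pos[of "n div g"] by linarith
  qed
  finally show ?thesis .
qed

lemma card_multiples_below:
  assumes "k dvd c" "c > (0::nat)"
  shows "card {a \<in> {..<c}. k dvd a} = c div k"
proof -
  from assms obtain j where j: "c = k * j" and "k > 0" by (auto elim!: dvdE)
  hence "{a \<in> {..<c}. k dvd a} = (\<lambda>a. k * a) ` {..<j}"
    by (auto elim!: dvdE)
  hence "card {a \<in> {..<c}. k dvd a} = j"
    using \<open>k > 0\<close> by (simp add: card_image inj_on_def)
  thus ?thesis using j \<open>k > 0\<close> by simp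
qed

lemma dvd_mult_imp_div_gcd_dvd:
  assumes "c dvd x * y" "(c::nat) > 0"
  shows "c div gcd x c dvd y"
proof -
  define g where "g = gcd x c"
  have g: "g > 0" "g dvd x" "g dvd c" using assms by (auto simp: g_def)
  have "g * (c div g) dvd g * ((x div g) * y)" using assms g by (simp flip: mult.assoc)
  hence "c div g dvd (x div g) * y"
    unfolding nat_mult_dvd_cancel_disj using g(1) by blast
  moreover have "coprime (x div g) (c div g)"
    unfolding g_def using assms by (intro div_gcd_coprime) auto
  ultimately show ?thesis
    by (simp add: g_def coprime_commute coprime_dvd_mult_right_iff)
qed

text \<open>With \<open>g = gcd x c\<close> and \<open>e = gcd y (c div g)\<close>, the rest
  \<open>c div g div e\<close> must divide \<open>z\<close>. For each of the \<open>tau3 c\<close>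
  choices of \<open>(g, e)\<close> the three numbers of multiples below \<open>c\<close> multiply to
  \<open>c^3 / c\<close>.\<close>

lemma card_triple_product_dvd:
  assumes "c > 0"
  shows "card {(x, y, z). x < c \<and> y < c \<and> z < c \<and> c dvd x * y * z} \<le> c ^ 2 * tau3 c"
proof -
  let ?M = "\<lambda>k. {a \<in> {..<c}. k dvd a}"
  let ?B = "\<lambda>g e. ?M g \<times> ?M e \<times> ?M (c div g div e)"
  have sub: "{(x, y, z). x < c \<and> y < c \<and> z < c \<and> c dvd x * y * z} \<subseteq>
     (\<Union>g\<in>{g. g dvd c}. \<Union>e\<in>{e. e dvd c div g}. ?B g e)"
  proof clarify
    fix x y z assume *: "x < c" "y < c" "z < c" "c dvd x * y * z"
    define g where "g = gcd x c"
    define e where "e = gcd y (c div g)"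
    have g: "g dvd c" "g > 0" using assms by (auto simp: g_def)
    hence cg: "c div g > 0" using assms by (auto elim!: dvdE)
    have "c div g dvd y * z"
      using dvd_mult_imp_div_gcd_dvd[of c x "y * z"] * assms by (simp add: g_def mult_ac)
    hence "c div g div e dvd z"
      using dvd_mult_imp_div_gcd_dvd[of "c div g" y z] cg by (simp add: e_def)
    moreover have "g dvd x" "e dvd y" "e dvd c div g" by (auto simp: g_def e_def)
    ultimately show "(x, y, z) \<in> (\<Union>g\<in>{g. g dvd c}. \<Union>e\<in>{e. e dvd c div g}. ?B g e)"
      using * g by blast
  qed
  have fin: "finite {g. g dvd c}" "\<And>g. g dvd c \<Longrightarrow> finite {e. e dvd c div g}"
    using assms by (auto elim!: dvdE)
  have card: "card (?B g e) = c ^ 2" if gc: "g dvd c" and ec: "e dvd c div g" for g e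
  proof -
    obtain k where "c div g = e * k" using ec by blast
    hence k: "c = g * (e * k)" using gc by (metis dvd_mult_div_cancel)
    hence pos: "g > 0" "e > 0" "k > 0" using assms by auto
    have "card (?B g e) = (c div g) * ((c div e) * (c div k))"
    proof -
      have "g dvd c" "e dvd c" "k dvd c" "c div g div e = k" using k pos by simp_all
      thus ?thesis using assms by (simp only: card_cartesian_product card_multiples_below)
    qed
    moreover have "c div g = e * k" "c div e = g * k" "c div k = g * e" using k pos by (simp_all add: mult_ac)
    ultimately show ?thesis using k by (simp add: power2_eq_square mult_ac)
  qed
  have "card {(x, y, z). x < c \<and> y < c \<and> z < c \<and> c dvd x * y * z} \<le>
      card (\<Union>g\<in>{g. g dvd c}. \<Union>e\<in>{e. e dvd c div g}. ?B g e)"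
    using fin by (intro card_mono[OF _ sub]) auto
  also have "\<dots> \<le> (\<Sum>g | g dvd c. card (\<Union>e\<in>{e. e dvd c div g}. ?B g e))"
    using fin by (intro card_UN_le) auto
  also have "\<dots> \<le> (\<Sum>g | g dvd c. \<Sum>e | e dvd c div g. card (?B g e))"
    using fin by (intro sum_mono card_UN_le) auto
  also have "\<dots> = (\<Sum>g | g dvd c. \<Sum>e | e dvd c div g. c ^ 2)"
    by (intro sum.cong refl card) auto
  also have "\<dots> = c ^ 2 * tau3 c"
    by (simp add: tau3_def sum_distrib_left mult.commute)
  finally show ?thesis .
qed

definition klset :: "nat \<Rightarrow> ((nat \<times> nat) \<times> (nat \<times> nat)) set" where
  "klset c = {z \<in> (units_below c \<times> units_below c) \<times> (units_below c \<times> units_below c).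
     case z of ((x1, x2), (x3, x4)) \<Rightarrow> [int x1 + int x2 = int x3 + int x4] (mod int c) \<and>
       [minv c (int x1) + minv c (int x2) = minv c (int x3) + minv c (int x4)] (mod int c)}"

text \<open>The two congruences force the product \<open>(x3 - x1) * (x3 - x2) * (x1 + x2)\<close>
  to vanish modulo \<open>c\<close>, and for odd \<open>c\<close> these three factors determine the
  quadruple. So the solutions inject into the triples counted in
  \<open>card_triple_product_dvd\<close>.\<close>

lemma card_klset:
  assumes c: "odd c"
  shows "card (klset c) \<le> c ^ 2 * tau3 c"
proof -
  have c0: "c > 0" using c by (cases c) auto
  let ?f = "\<lambda>((x1, x2), (x3, x4)). (nat ((int x3 - int x1) mod int c), nat ((int x3 - int x2) mod int c),
     nat ((int x1 + int x2) mod int c))"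
  let ?T = "{(x, y, z). x < c \<and> y < c \<and> z < c \<and> c dvd x * y * z}"
  have "?f ` klset c \<subseteq> ?T"
  proof
    fix w assume "w \<in> ?f ` klset c"
    then obtain x1 x2 x3 x4 where w: "w = ?f ((x1, x2), (x3, x4))" and in_set: "((x1, x2), (x3, x4)) \<in> klset c"
      by auto
    define X1 X2 X3 X4 where X: "X1 = int x1" "X2 = int x2" "X3 = int x3" "X4 = int x4"
    define I1 I2 I3 I4 where I: "I1 = minv c X1" "I2 = minv c X2" "I3 = minv c X3" "I4 = minv c X4"
    have cop: "coprime X1 (int c)" "coprime X2 (int c)" "coprime X3 (int c)" "coprime X4 (int c)"
      using in_set by (auto simp: klset_def units_below_def X)
    have inv: "[X1 * I1 = 1] (mod int c)" "[X2 * I2 = 1] (mod int c)"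
       "[X3 * I3 = 1] (mod int c)" "[X4 * I4 = 1] (mod int c)"
      unfolding I by (intro cong_modular_inverse1 cop)+
    have s: "[X1 + X2 = X3 + X4] (mod int c)" and si: "[I1 + I2 = I3 + I4] (mod int c)"
      using in_set by (auto simp: klset_def X I)
    have dvds: "int c dvd X1 * I1 - 1" "int c dvd X2 * I2 - 1" "int c dvd X3 * I3 - 1" "int c dvd X4 * I4 - 1"
      "int c dvd (X1 + X2) - (X3 + X4)" "int c dvd (I1 + I2) - (I3 + I4)"
      using inv s si by (auto simp: cong_iff_dvd_diff)
    have "int c dvd (X3 - X1) * (X3 - X2) * (X1 + X2)"
    proof -
      define d1 d2 d3 d4 e f where
        d: "d1 = X1 * I1 - 1" "d2 = X2 * I2 - 1" "d3 = X3 * I3 - 1" "d4 = X4 * I4 - 1"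
           "e = (X1 + X2) - (X3 + X4)" "f = (I1 + I2) - (I3 + I4)"
      \<comment> \<open>Clearing denominators in the equation for the inverses; \<open>d1\<close> to
        \<open>d4\<close> are the defects of the inverses and \<open>f\<close> the defect of the
        equation.\<close>
      have "X1 * X2 * (X3 + X4) - X3 * X4 * (X1 + X2) =
         - (X1 * X2 * X3 * X4 * f) + X2 * X3 * X4 * d1 + X1 * X3 * X4 * d2 - X1 * X2 * X4 * d3 - X1 * X2 * X3 * d4"
        by (simp add: d algebra_simps)
      \<comment> \<open>Here \<open>X4\<close> is eliminated through the equation for the sums,
        whose defect is \<open>e\<close>.\<close>
      moreover have "(X3 - X1) * (X3 - X2) * (X1 + X2) =
         (X1 * X2 * (X3 + X4) - X3 * X4 * (X1 + X2)) + e * (X1 * X2 - X3 * (X1 + X2))"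
        by (simp add: d algebra_simps)
      ultimately have "(X3 - X1) * (X3 - X2) * (X1 + X2) =
         - (X1 * X2 * X3 * X4 * f) + X2 * X3 * X4 * d1 + X1 * X3 * X4 * d2 - X1 * X2 * X4 * d3 - X1 * X2 * X3 * d4
         + e * (X1 * X2 - X3 * (X1 + X2))" by linarith
      moreover have "int c dvd f" "int c dvd d1" "int c dvd d2" "int c dvd d3" "int c dvd d4" "int c dvd e"
        using dvds unfolding d by auto
      ultimately show ?thesis by (simp add: dvd_add dvd_diff)
    qed
    hence "[(X3 - X1) * (X3 - X2) * (X1 + X2) = 0] (mod int c)"
      by (simp add: cong_0_iff)
    moreover have "[(X3 - X1) mod int c * ((X3 - X2) mod int c) * ((X1 + X2) mod int c) =
        (X3 - X1) * (X3 - X2) * (X1 + X2)] (mod int c)"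
      by (intro cong_mult) auto
    ultimately have "[(X3 - X1) mod int c * ((X3 - X2) mod int c) * ((X1 + X2) mod int c) = 0] (mod int c)"
      by (rule cong_trans[rotated])
    hence "int c dvd int (nat ((X3 - X1) mod int c) * nat ((X3 - X2) mod int c) * nat ((X1 + X2) mod int c))"
      using c0 by (simp add: cong_0_iff)
    hence "c dvd nat ((X3 - X1) mod int c) * nat ((X3 - X2) mod int c) * nat ((X1 + X2) mod int c)"
      using int_dvd_int_iff by blast
    thus "w \<in> ?T" using c0 by (simp add: w X nat_less_iff)
  qed
  moreover have "inj_on ?f (klset c)"
  proof (rule inj_onI)
    fix z w assume zw: "z \<in> klset c" "w \<in> klset c" "?f z = ?f w"
    obtain x1 x2 x3 x4 where z: "z = ((x1, x2), (x3, x4))" by (metis surj_pair)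
    obtain y1 y2 y3 y4 where w: "w = ((y1, y2), (y3, y4))" by (metis surj_pair)
    note in1 = zw(1)[unfolded z] and in2 = zw(2)[unfolded w]
    have "nat ((int x3 - int x1) mod int c) = nat ((int y3 - int y1) mod int c)"
      "nat ((int x3 - int x2) mod int c) = nat ((int y3 - int y2) mod int c)"
      "nat ((int x1 + int x2) mod int c) = nat ((int y1 + int y2) mod int c)"
      using zw(3) by (auto simp: z w)
    hence c1: "[int x3 - int x1 = int y3 - int y1] (mod int c)"
      and c2: "[int x3 - int x2 = int y3 - int y2] (mod int c)"
      and c3: "[int x1 + int x2 = int y1 + int y2] (mod int c)"
      using c0 by (simp_all add: cong_def nat_eq_iff2)
    \<comment> \<open>The three coordinates add up to \<open>2 * x3\<close>, and 2 is invertible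
      modulo \<open>c\<close>; the other entries follow from \<open>x3\<close>.\<close>
    have "[(int x3 - int x1) + (int x3 - int x2) + (int x1 + int x2) =
       (int y3 - int y1) + (int y3 - int y2) + (int y1 + int y2)] (mod int c)"
      by (intro cong_add c1 c2 c3)
    hence "[2 * int x3 = 2 * int y3] (mod int c)" by (simp add: algebra_simps)
    hence x3: "[int x3 = int y3] (mod int c)"
      using c cong_mult_lcancel[of 2 "int c"] by simp
    have "[int x3 - (int x3 - int x1) = int y3 - (int y3 - int y1)] (mod int c)"
      by (intro cong_diff x3 c1)
    hence x1: "[int x1 = int y1] (mod int c)" by simp
    have "[int x3 - (int x3 - int x2) = int y3 - (int y3 - int y2)] (mod int c)"
      by (intro cong_diff x3 c2)
    hence x2: "[int x2 = int y2] (mod int c)" by simp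
    have "[int x1 + int x2 = int x3 + int x4] (mod int c)" "[int y1 + int y2 = int y3 + int y4] (mod int c)"
      using in1 in2 by (auto simp: klset_def)
    hence "[int x3 + int x4 = int y3 + int y4] (mod int c)"
      using c3 by (meson cong_sym cong_trans)
    hence "[int x3 + int x4 - int x3 = int y3 + int y4 - int y3] (mod int c)"
      by (intro cong_diff x3)
    hence x4: "[int x4 = int y4] (mod int c)" by simp
    have "x1 < c" "x2 < c" "x3 < c" "x4 < c" "y1 < c" "y2 < c" "y3 < c" "y4 < c"
      using in1 in2 by (auto simp: klset_def units_below_def)
    thus "z = w"
      using x1 x2 x3 x4 by (simp add: cong_def z w)
  qed
  moreover have "finite ?T"
    by (rule finite_subset[of _ "{..<c} \<times> {..<c} \<times> {..<c}"]) auto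
  ultimately have "card (klset c) \<le> card ?T"
    by (metis (no_types, lifting) card_inj_on_le)
  also have "\<dots> \<le> c ^ 2 * tau3 c" by (rule card_triple_product_dvd[OF c0])
  finally show ?thesis .
qed

text \<open>The fourth power is the squared sum times its conjugate, a sum over quadruples of units.
  Summing over both parameters detects, by orthogonality, the two congruences of
  \<open>klset\<close>.\<close>

lemma kl_fourth_moment:
  assumes c: "c > 0"
  shows "(\<Sum>a<c. \<Sum>b<c. norm (kl c (int a) (int b)) ^ 4) = real (c ^ 2 * card (klset c))"
proof -
  let ?U = "units_below c" and ?V = "units_below c \<times> units_below c"
  let ?s = "\<lambda>v. int (fst v) + int (snd v)"
  let ?i = "\<lambda>v. minv c (int (fst v)) + minv c (int (snd v))"
  have sq: "kl c a b * kl c a b = (\<Sum>v\<in>?V. ee c (a * ?s v + b * ?i v))" for a b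
    unfolding kl_def sum_product
    by (simp add: sum.cartesian_product case_prod_beta flip: ee_add) (simp add: algebra_simps)
  have sq': "cnj (kl c a b * kl c a b) = (\<Sum>v\<in>?V. ee c (- (a * ?s v + b * ?i v)))" for a b
    by (simp only: sq cnj_sum ee_minus)
  have four: "of_real (norm (kl c (int a) (int b)) ^ 4) =
     (\<Sum>v\<in>?V. \<Sum>w\<in>?V. ee c (int a * (?s v - ?s w)) * ee c (int b * (?i v - ?i w)))" for a b
  proof -
    have "complex_of_real (norm (kl c (int a) (int b)) ^ 4) = (of_real (norm (kl c a b)) ^ 2) ^ 2"
      by (simp flip: power_mult)
    also have "\<dots> = (kl c a b * cnj (kl c a b)) ^ 2" by (simp only: complex_norm_square[symmetric] of_real_power)
    also have "\<dots> = (kl c a b * kl c a b) * cnj (kl c a b * kl c a b)" by (simp add: power2_eq_square mult_ac)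
    also have "\<dots> = (\<Sum>v\<in>?V. \<Sum>w\<in>?V. ee c (int a * ?s v + int b * ?i v) * ee c (- (int a * ?s w + int b * ?i w)))"
      unfolding sq' unfolding sq sum_product ..
    also have "\<dots> = (\<Sum>v\<in>?V. \<Sum>w\<in>?V. ee c (int a * (?s v - ?s w)) * ee c (int b * (?i v - ?i w)))"
      by (intro sum.cong refl, simp only: ee_add[symmetric]) (simp add: algebra_simps)
    finally show ?thesis .
  qed
  have "complex_of_real (\<Sum>a<c. \<Sum>b<c. norm (kl c (int a) (int b)) ^ 4) =
     (\<Sum>a<c. \<Sum>b<c. \<Sum>v\<in>?V. \<Sum>w\<in>?V. ee c (int a * (?s v - ?s w)) * ee c (int b * (?i v - ?i w)))"
    unfolding of_real_sum four ..
  also have "\<dots> = (\<Sum>a<c. \<Sum>v\<in>?V. \<Sum>b<c. \<Sum>w\<in>?V. ee c (int a * (?s v - ?s w)) * ee c (int b * (?i v - ?i w)))"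
    by (intro sum.cong refl sum.swap)
  also have "\<dots> = (\<Sum>v\<in>?V. \<Sum>a<c. \<Sum>b<c. \<Sum>w\<in>?V. ee c (int a * (?s v - ?s w)) * ee c (int b * (?i v - ?i w)))"
    by (rule sum.swap)
  also have "\<dots> = (\<Sum>v\<in>?V. \<Sum>a<c. \<Sum>w\<in>?V. \<Sum>b<c. ee c (int a * (?s v - ?s w)) * ee c (int b * (?i v - ?i w)))"
    by (intro sum.cong refl sum.swap)
  also have "\<dots> = (\<Sum>v\<in>?V. \<Sum>w\<in>?V. \<Sum>a<c. \<Sum>b<c. ee c (int a * (?s v - ?s w)) * ee c (int b * (?i v - ?i w)))"
    by (intro sum.cong refl sum.swap)
  also have "\<dots> = (\<Sum>v\<in>?V. \<Sum>w\<in>?V. (\<Sum>a<c. ee c (int a * (?s v - ?s w))) * (\<Sum>b<c. ee c (int b * (?i v - ?i w))))"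
    by (simp add: sum_product)
  also have "\<dots> = (\<Sum>v\<in>?V. \<Sum>w\<in>?V. if (v, w) \<in> klset c then of_nat (c ^ 2) else 0)"
    unfolding sum_ee[OF c]
    by (intro sum.cong refl) (auto simp: klset_def cong_iff_dvd_diff power2_eq_square)
  also have "\<dots> = (\<Sum>z\<in>?V \<times> ?V. if z \<in> klset c then of_nat (c ^ 2) else 0)"
    by (simp add: sum.cartesian_product case_prod_beta)
  also have "\<dots> = (\<Sum>z\<in>klset c. of_nat (c ^ 2))"
  proof -
    have "klset c = {z \<in> ?V \<times> ?V. z \<in> klset c}" by (auto simp: klset_def)
    thus ?thesis by (subst (2) \<open>klset c = _\<close>, subst sum.inter_filter) auto
  qed
  also have "\<dots> = of_real (real (c ^ 2 * card (klset c)))" by simp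
  finally show ?thesis using of_real_eq_iff by blast
qed

text \<open>A solution is unique modulo \<open>k = c / g\<close>, where \<open>g\<close> is the
  greatest common divisor, so it is determined by its quotient \<open>s div k\<close>, which is
  below \<open>g\<close>.\<close>

lemma card_linear_cong_le:
  assumes c: "c > 0"
  shows "card {s \<in> {..<c}. [m * int s = a] (mod int c)} \<le> nat (gcd m (int c))"
proof -
  define g where "g = nat (gcd m (int c))"
  have g: "int g = gcd m (int c)" by (simp add: g_def)
  have g0: "g > 0" using c by (simp add: g_def)
  have gc: "g dvd c" using g by (metis gcd_dvd2 int_dvd_int_iff)
  then obtain k where k: "c = g * k" by (auto elim!: dvdE)
  hence k0: "k > 0" using c by auto
  let ?S = "{s \<in> {..<c}. [m * int s = a] (mod int c)}"
  have "inj_on (\<lambda>s. s div k) ?S"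
  proof (rule inj_onI)
    fix s t assume st: "s \<in> ?S" "t \<in> ?S" "s div k = t div k"
    have "[m * int s = m * int t] (mod int c)" using st by (auto intro: cong_trans cong_sym)
    hence "int c dvd m * (int s - int t)" by (simp add: cong_iff_dvd_diff algebra_simps)
    moreover obtain m' where m': "m = int g * m'" using g by (metis gcd_dvd1 dvdE)
    ultimately have "int g * int k dvd int g * (m' * (int s - int t))" by (simp add: k mult_ac)
    hence "int k dvd m' * (int s - int t)" using g0 by simp
    moreover have "coprime (int k) m'"
    proof -
      have "gcd (int g * m') (int g * int k) = int g" using g m' k by simp
      hence "int g * gcd m' (int k) = int g" by (simp add: gcd_mult_left)
      hence "gcd m' (int k) = 1" using g0 by simp
      thus ?thesis by (simp add: coprime_iff_gcd_eq_1 gcd.commute)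
    qed
    ultimately have "int k dvd int s - int t" by (simp add: coprime_dvd_mult_right_iff)
    hence "[int s = int t] (mod int k)" by (simp add: cong_iff_dvd_diff)
    hence "[s = t] (mod k)" by (simp only: cong_int_iff)
    hence "s mod k = t mod k" by (simp only: cong_def)
    thus "s = t" using st(3) by (metis div_mult_mod_eq)
  qed
  moreover have "(\<lambda>s. s div k) ` ?S \<subseteq> {..<g}"
    using k k0 by (auto simp: less_mult_imp_div_less)
  ultimately have "card ?S \<le> card {..<g}" by (intro card_inj_on_le) auto
  thus ?thesis by (simp add: g_def)
qed

lemma le_divisors_mult_totient:
  assumes "n > 0"
  shows "n \<le> card {e. e dvd n} * totient n"
proof -
  have "n = (\<Sum>d | d dvd n. totient d)" by (simp add: totient_divisor_sum)
  also have "\<dots> \<le> (\<Sum>d | d dvd n. totient n)"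
    using assms by (intro sum_mono totient_dvd_mono) auto
  finally show ?thesis by simp
qed

text \<open>Kloosterman's own argument. By \<open>kl_invariant\<close> the value is attained at all
  pairs \<open>(m * s, n / s)\<close>, each pair arising from at most \<open>gcd m c\<close> units
  \<open>s\<close>; hence \<open>totient c\<close> copies of the fourth power are bounded by that
  gcd times the full fourth moment. Trading the totient for \<open>c\<close> costs a divisor count,
  absorbed in the second factor \<open>tau3 c\<close>. Up to divisors the sum is at most
  \<open>c^(3/4)\<close>.\<close>

theorem kloosterman_bound:
  assumes c: "odd c"
  shows "norm (kl c m n) ^ 4 \<le> real (nat (gcd m (int c)) * c ^ 3 * tau3 c ^ 2)"
proof -
  have c0: "c > 0" using c by (cases c) auto
  define g where "g = nat (gcd m (int c))"
  let ?F = "\<lambda>(a, b). norm (kl c (int a) (int b)) ^ 4"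
  let ?h = "\<lambda>s. (nat ((m * int s) mod int c), nat ((n * minv c (int s)) mod int c))"
  have inv: "?F (?h s) = norm (kl c m n) ^ 4" if "s \<in> units_below c" for s
  proof -
    have "kl c (int (fst (?h s))) (int (snd (?h s))) = kl c (m * int s) (n * minv c (int s))"
      using c0 by (intro kl_cong) (auto simp: cong_def)
    also have "\<dots> = kl c m n"
      using that c0 by (intro kl_invariant) (auto simp: units_below_def)
    finally show ?thesis by simp
  qed
  have "real (totient c) * norm (kl c m n) ^ 4 = (\<Sum>s\<in>units_below c. ?F (?h s))"
    using inv by (simp add: card_units_below[OF c0])
  also have "\<dots> = (\<Sum>z\<in>{..<c} \<times> {..<c}. \<Sum>s\<in>{s \<in> units_below c. ?h s = z}. ?F (?h s))"
    using c0 by (intro sum.group[symmetric]) (auto simp: nat_less_iff)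
  also have "\<dots> \<le> (\<Sum>z\<in>{..<c} \<times> {..<c}. real g * ?F z)"
  proof (rule sum_mono)
    fix z assume "z \<in> {..<c} \<times> {..<c}"
    have "(\<Sum>s\<in>{s \<in> units_below c. ?h s = z}. ?F (?h s)) = real (card {s \<in> units_below c. ?h s = z}) * ?F z"
      by simp
    also have "card {s \<in> units_below c. ?h s = z} \<le> card {s \<in> {..<c}. [m * int s = int (fst z)] (mod int c)}"
      using c0 by (intro card_mono) (auto simp: units_below_def cong_def)
    also have "\<dots> \<le> g" unfolding g_def by (rule card_linear_cong_le[OF c0])
    finally show "(\<Sum>s\<in>{s \<in> units_below c. ?h s = z}. ?F (?h s)) \<le> real g * ?F z"
      by (simp add: mult_right_mono case_prod_beta)
  qed
  also have "\<dots> = real g * (\<Sum>a<c. \<Sum>b<c. norm (kl c (int a) (int b)) ^ 4)"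
    by (simp add: sum_distrib_left sum.cartesian_product case_prod_beta)
  also have "\<dots> = real (g * (c ^ 2 * card (klset c)))" by (simp add: kl_fourth_moment[OF c0])
  also have "\<dots> \<le> real (g * (c ^ 2 * (c ^ 2 * tau3 c)))"
    using card_klset[OF c] by (intro of_nat_mono mult_left_mono) auto
  finally have 1: "real (totient c) * norm (kl c m n) ^ 4 \<le> real (g * (c ^ 2 * (c ^ 2 * tau3 c)))" .
  have "real c * norm (kl c m n) ^ 4 \<le> real (card {e. e dvd c} * totient c) * norm (kl c m n) ^ 4"
    using le_divisors_mult_totient[OF c0] by (intro mult_right_mono of_nat_mono) auto
  also have "\<dots> = real (card {e. e dvd c}) * (real (totient c) * norm (kl c m n) ^ 4)" by simp
  also have "\<dots> \<le> real (tau3 c) * real (g * (c ^ 2 * (c ^ 2 * tau3 c)))"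
    using card_divisors_le_tau3[OF c0] 1 by (intro mult_mono) auto
  also have "\<dots> = real c * real (g * c ^ 3 * tau3 c ^ 2)"
    by (simp add: power2_eq_square power3_eq_cube mult_ac)
  finally show ?thesis using c0 by (simp add: g_def)
qed

section \<open>Completion of incomplete quadratic Gauss sums\<close>

lemma sin_ge_linear:
  assumes "0 \<le> x" "x \<le> pi / 2"
  shows "sin x \<ge> 2 * x / pi"
proof -
  have conc: "concave_on {0..pi/2} sin"
    by (rule f''_le0_imp_concave[where f' = cos and f'' = "\<lambda>x. - sin x"])
       (auto intro!: derivative_eq_intros sin_ge_zero)
  define t where "t = 2 * x / pi"
  have t: "t \<ge> 0" "t \<le> 1" using assms by (auto simp: t_def field_simps)
  have "(1 - t) * sin 0 + t * sin (pi / 2) \<le> sin ((1 - t) *\<^sub>R 0 + t *\<^sub>R (pi / 2))"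
    using concave_onD[OF conc t, of 0 "pi/2"] by simp
  moreover have "t * (pi / 2) = x" by (simp add: t_def)
  ultimately show ?thesis by (simp add: t_def)
qed

text \<open>The lower bound is chosen symmetric under \<open>x -> 1 - x\<close>: its reciprocal
  splits into partial fractions, so that no distance to the nearest integer has to be introduced. On
  the first half it follows from Jordan's inequality \<open>sin_ge_linear\<close>.\<close>

lemma sin_pi_mult_ge:
  assumes "0 < x" "x < 1"
  shows "sin (pi * x) \<ge> 2 * x * (1 - x)"
proof -
  have *: "sin (pi * y) \<ge> 2 * y * (1 - y)" if "0 < y" "y \<le> 1/2" for y
  proof -
    have "2 * y * (1 - y) \<le> 2 * y" using that by (simp add: algebra_simps)
    also have "\<dots> \<le> sin (pi * y)" using sin_ge_linear[of "pi * y"] that by simp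
    finally show ?thesis .
  qed
  show ?thesis
  proof (cases "x \<le> 1/2")
    case False
    have "sin (pi * x) = sin (pi - pi * x)" by simp
    also have "pi - pi * x = pi * (1 - x)" by (simp add: algebra_simps)
    finally have "sin (pi * x) = sin (pi * (1 - x))" .
    moreover have "2 * (1 - x) * (1 - (1 - x)) \<le> sin (pi * (1 - x))"
      using False assms by (intro *) auto
    moreover have "2 * (1 - x) * (1 - (1 - x)) = 2 * x * (1 - x)" by simp
    ultimately show ?thesis by linarith
  qed (use * assms in simp)
qed

lemma norm_sum_ee_le:
  assumes h: "0 < h" "h < c"
  shows "norm (\<Sum>x<A. ee c (- (int h * int x))) \<le> real c / 2 * (1 / real h + 1 / real (c - h))"
proof -
  define z where "z = ee c (- int h)"
  define u where "u = real h / real c"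
  have u: "0 < u" "u < 1" using h by (auto simp: u_def)
  have "norm (z - 1) = norm (cnj (z - 1))" by (metis complex_mod_cnj)
  also have "cnj (z - 1) = ee c (int h) - 1" by (simp add: z_def ee_minus)
  also have "ee c (int h) = exp (\<i> * of_real (2 * pi * u))"
    by (simp add: ee_def cis_conv_exp u_def)
  also have "norm (\<dots> - 1) = 2 * \<bar>sin (pi * u)\<bar>"
    by (subst dist_exp_i_1) simp
  finally have nz: "norm (z - 1) = 2 * \<bar>sin (pi * u)\<bar>" .
  have s: "sin (pi * u) \<ge> 2 * u * (1 - u)" using sin_pi_mult_ge u by simp
  have pos: "2 * u * (1 - u) > 0" using u by simp
  hence ge: "norm (z - 1) \<ge> 4 * u * (1 - u)" using s unfolding nz by simp
  have z1: "z \<noteq> 1" using ge pos by auto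
  have "(\<Sum>x<A. ee c (- (int h * int x))) = (\<Sum>x<A. z ^ x)"
    by (simp add: z_def mult.commute flip: ee_mult_nat)
  also have "norm \<dots> = norm (z ^ A - 1) / norm (z - 1)"
    using geometric_sum[OF z1] by (simp add: norm_divide)
  also have "\<dots> \<le> 2 / (4 * u * (1 - u))"
  proof (rule frac_le)
    have "norm (z ^ A - 1) \<le> norm (z ^ A) + norm (1 :: complex)" by (rule norm_triangle_ineq4)
    thus "norm (z ^ A - 1) \<le> 2" by (simp add: norm_power z_def)
  qed (use pos ge in auto)
  also have "\<dots> = 1 / 2 * (1 / u + 1 / (1 - u))" using u by (simp add: field_simps)
  also have "1 - u = real (c - h) / real c" using h by (simp add: u_def field_simps of_nat_diff)
  also have "1 / 2 * (1 / u + 1 / (real (c - h) / real c)) = real c / 2 * (1 / real h + 1 / real (c - h))"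
    using h by (simp add: u_def field_simps)
  finally show ?thesis .
qed

lemma sum_norm_sum_ee_le:
  "(\<Sum>h\<in>{1..<c}. norm (\<Sum>x<A. ee c (- (int h * int x)))) \<le> real c * (\<Sum>h\<in>{1..<c}. 1 / real h)"
proof -
  have "(\<Sum>h\<in>{1..<c}. norm (\<Sum>x<A. ee c (- (int h * int x)))) \<le>
     (\<Sum>h\<in>{1..<c}. real c / 2 * (1 / real h + 1 / real (c - h)))"
    by (intro sum_mono norm_sum_ee_le) auto
  also have "\<dots> = real c / 2 * ((\<Sum>h\<in>{1..<c}. 1 / real h) + (\<Sum>h\<in>{1..<c}. 1 / real (c - h)))"
    by (simp only: sum_distrib_left[symmetric] sum.distrib)
  also have "(\<Sum>h\<in>{1..<c}. 1 / real (c - h)) = (\<Sum>h\<in>{1..<c}. 1 / real h)"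
    by (rule sum.reindex_bij_witness[of _ "\<lambda>x. c - x" "\<lambda>x. c - x"]) auto
  finally show ?thesis by simp
qed

text \<open>Completing the square with \<open>s = h / (2 * t)\<close>. The phase left over is a
  multiple of the inverse of \<open>t\<close>, which is where the second parameter of the
  Kloosterman sum comes from.\<close>

lemma gs_quadratic_completion:
  assumes c: "odd c" and t: "coprime t (int c)"
  shows "(\<Sum>y<c. ee c (- t * (int y)\<^sup>2 + h * int y)) =
    gs c (- t) * ee c ((minv c 2)\<^sup>2 * h\<^sup>2 * minv c t)"
proof -
  have c0: "c > 0" using c by (cases c) auto
  have c2: "coprime 2 (int c)" using c by simp
  define s where "s = minv c 2 * minv c t * h"
  have two: "[2 * minv c 2 = 1] (mod int c)" and tt: "[t * minv c t = 1] (mod int c)"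
    by (intro cong_modular_inverse1 c2 t)+
  have s2: "[2 * t * s = h] (mod int c)"
  proof -
    have "[(2 * minv c 2) * (t * minv c t) * h = 1 * 1 * h] (mod int c)"
      by (intro cong_mult two tt cong_refl)
    thus ?thesis by (simp add: s_def mult_ac)
  qed
  have ts: "[t * s\<^sup>2 = (minv c 2)\<^sup>2 * h\<^sup>2 * minv c t] (mod int c)"
  proof -
    have "[(t * minv c t) * ((minv c 2)\<^sup>2 * h\<^sup>2 * minv c t) = 1 * ((minv c 2)\<^sup>2 * h\<^sup>2 * minv c t)] (mod int c)"
      by (intro cong_mult tt cong_refl)
    thus ?thesis by (simp add: s_def power2_eq_square mult_ac)
  qed
  have "(\<Sum>y<c. ee c (- t * (int y)\<^sup>2 + h * int y)) = (\<Sum>y<c. ee c (- t * (s + int y)\<^sup>2 + h * (s + int y)))"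
    by (rule sum_residues_shift[of c "\<lambda>y. ee c (- t * y\<^sup>2 + h * y)", symmetric])
       (auto intro!: ee_cong cong_mult cong_diff cong_pow simp: c0)
  also have "\<dots> = (\<Sum>y<c. ee c (- t * (int y)\<^sup>2) * ee c ((minv c 2)\<^sup>2 * h\<^sup>2 * minv c t))"
  proof (intro sum.cong refl, subst ee_add[symmetric], rule ee_cong)
    fix y
    have e: "- t * (s + int y)\<^sup>2 + h * (s + int y) - (- t * (int y)\<^sup>2 + (minv c 2)\<^sup>2 * h\<^sup>2 * minv c t) =
      (t * s\<^sup>2 - (minv c 2)\<^sup>2 * h\<^sup>2 * minv c t) - (2 * t * s - h) * (s + int y)"
      by (simp add: power2_eq_square algebra_simps)
    have "int c dvd t * s\<^sup>2 - (minv c 2)\<^sup>2 * h\<^sup>2 * minv c t" "int c dvd 2 * t * s - h"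
      using ts s2 by (simp_all add: cong_iff_dvd_diff)
    thus "[- t * (s + int y)\<^sup>2 + h * (s + int y) =
        - t * (int y)\<^sup>2 + (minv c 2)\<^sup>2 * h\<^sup>2 * minv c t] (mod int c)"
      unfolding cong_iff_dvd_diff e by (rule dvd_diff[OF _ dvd_mult2])
  qed
  also have "\<dots> = gs c (- t) * ee c ((minv c 2)\<^sup>2 * h\<^sup>2 * minv c t)"
    by (simp add: gs_def sum_distrib_right)
  finally show ?thesis .
qed

text \<open>The Fourier coefficient at frequency \<open>h\<close> of the interval
  \<open>{..<A}\<close>, together with the phase caused by the affine map
  \<open>x -> a + M * x\<close>.\<close>

definition bcoef :: "nat \<Rightarrow> int \<Rightarrow> int \<Rightarrow> nat \<Rightarrow> nat \<Rightarrow> complex" where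
  "bcoef c a M A h = (\<Sum>x<A. ee c (- (int h * int x))) * ee c (- (int h * minv c M * a))"

text \<open>The residue \<open>(h / (2 * M))^2\<close> modulo \<open>c\<close>: the coefficient of
  the inverse of \<open>t\<close> that completing the square leaves for frequency
  \<open>h\<close>.\<close>

definition bfreq :: "nat \<Rightarrow> int \<Rightarrow> nat \<Rightarrow> int" where
  "bfreq c M h = (minv c 2)\<^sup>2 * (int h * minv c M)\<^sup>2"

text \<open>Fourier inversion modulo \<open>c\<close> turns the short sum into complete sums with a
  linear phase. After undoing the affine map each of these is evaluated by
  \<open>gs_quadratic_completion\<close>, so the same Gauss sum factors out of all
  frequencies.\<close>

lemma incomplete_gauss_sum:
  assumes c: "odd c" and t: "coprime t (int c)" and M: "coprime M (int c)"
  shows "(\<Sum>x<A. ee c (- t * (a + M * int x)\<^sup>2)) =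
    gs c (- t) / of_nat c * (\<Sum>h<c. bcoef c a M A h * ee c (bfreq c M h * minv c t))"
proof -
  have c0: "c > 0" using c by (cases c) auto
  define w where "w = minv c M"
  have w: "[M * w = 1] (mod int c)" unfolding w_def by (rule cong_modular_inverse1[OF M])
  have cw: "coprime w (int c)" unfolding w_def using M by simp
  define f where "f = (\<lambda>x. ee c (- t * (a + M * x)\<^sup>2))"
  have fc: "f x = f y" if "[x = y] (mod int c)" for x y
    unfolding f_def by (rule ee_cong) (intro cong_mult cong_add cong_pow cong_refl that)
  have inner: "(\<Sum>z<c. f (int z) * ee c (int h * int z)) =
     gs c (- t) * (ee c (- (int h * w * a)) * ee c (bfreq c M h * minv c t))" for h
  proof -
    have "(\<Sum>z<c. f (int z) * ee c (int h * int z)) = (\<Sum>y<c. f (- (w * a) + w * int y) * ee c (int h * (- (w * a) + w * int y)))"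
      by (rule sum_residues_affine[of c "\<lambda>z. f z * ee c (int h * z)", symmetric])
         (auto intro!: arg_cong2[of _ _ _ _ "(*)"] fc ee_cong cong_mult simp: c0 cw)
    also have "\<dots> = (\<Sum>y<c. ee c (- t * (int y)\<^sup>2 + (int h * w) * int y) * ee c (- (int h * w * a)))"
    proof (intro sum.cong refl)
      fix y
      have "[a + M * (- (w * a) + w * int y) = int y] (mod int c)"
      proof -
        have "[a + (M * w) * (int y - a) = a + 1 * (int y - a)] (mod int c)"
          by (intro cong_add cong_mult w cong_refl)
        thus ?thesis by (simp add: algebra_simps)
      qed
      hence "f (- (w * a) + w * int y) = ee c (- t * (int y)\<^sup>2)"
        unfolding f_def by (intro ee_cong cong_mult cong_pow cong_refl)
      thus "f (- (w * a) + w * int y) * ee c (int h * (- (w * a) + w * int y)) =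
        ee c (- t * (int y)\<^sup>2 + (int h * w) * int y) * ee c (- (int h * w * a))"
        by (simp add: algebra_simps flip: ee_add)
    qed
    also have "\<dots> = gs c (- t) * ee c ((minv c 2)\<^sup>2 * (int h * w)\<^sup>2 * minv c t) * ee c (- (int h * w * a))"
      by (simp only: sum_distrib_right[symmetric] gs_quadratic_completion[OF c t])
    finally show ?thesis by (simp add: bfreq_def w_def mult_ac)
  qed
  \<comment> \<open>Fourier inversion: the inner orthogonality picks out the residue
    \<open>z = x mod c\<close>.\<close>
  have f_eq: "f (int x) = (\<Sum>h<c. (\<Sum>z<c. f (int z) * ee c (int h * int z)) * ee c (- (int h * int x))) / of_nat c" for x
  proof -
    have "(\<Sum>h<c. (\<Sum>z<c. f (int z) * ee c (int h * int z)) * ee c (- (int h * int x))) =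
       (\<Sum>h<c. \<Sum>z<c. f (int z) * ee c (int h * (int z - int x)))"
      unfolding sum_distrib_right
      by (intro sum.cong refl) (simp add: mult.assoc right_diff_distrib flip: ee_add)
    also have "\<dots> = (\<Sum>z<c. f (int z) * (\<Sum>h<c. ee c (int h * (int z - int x))))"
      by (subst sum.swap) (simp add: sum_distrib_left)
    also have "\<dots> = (\<Sum>z<c. if z = x mod c then f (int x) * of_nat c else 0)"
    proof (intro sum.cong refl)
      fix z assume z: "z \<in> {..<c}"
      have "int c dvd int z - int x \<longleftrightarrow> [int z = int x] (mod int c)" by (simp add: cong_iff_dvd_diff)
      also have "\<dots> \<longleftrightarrow> [z = x] (mod c)" by (rule cong_int_iff)
      also have "\<dots> \<longleftrightarrow> z = x mod c" using z by (simp add: cong_def)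
      finally have iff: "int c dvd int z - int x \<longleftrightarrow> z = x mod c" .
      show "f (int z) * (\<Sum>h<c. ee c (int h * (int z - int x))) = (if z = x mod c then f (int x) * of_nat c else 0)"
        using fc[of "int z" "int x"] iff by (simp add: sum_ee[OF c0] cong_iff_dvd_diff)
    qed
    also have "\<dots> = f (int x) * of_nat c" using c0 by simp
    finally show ?thesis using c0 by simp
  qed
  have "(\<Sum>x<A. ee c (- t * (a + M * int x)\<^sup>2)) = (\<Sum>x<A. f (int x))" by (simp add: f_def)
  also have "\<dots> = (\<Sum>x<A. (\<Sum>h<c. gs c (- t) * (ee c (- (int h * w * a)) * ee c (bfreq c M h * minv c t)) *
       ee c (- (int h * int x))) / of_nat c)"
    by (intro sum.cong refl, subst f_eq, subst inner) (rule refl)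
  also have "\<dots> = (\<Sum>h<c. \<Sum>x<A. gs c (- t) * (ee c (- (int h * w * a)) * ee c (bfreq c M h * minv c t)) *
       ee c (- (int h * int x))) / of_nat c"
    by (subst sum.swap) (simp add: sum_divide_distrib)
  also have "\<dots> = gs c (- t) / of_nat c * (\<Sum>h<c. bcoef c a M A h * ee c (bfreq c M h * minv c t))"
    by (simp add: bcoef_def w_def sum_distrib_left sum_distrib_right sum_divide_distrib mult_ac)
  finally show ?thesis .
qed

definition csum :: "nat \<Rightarrow> int \<Rightarrow> int \<Rightarrow> int \<Rightarrow> int \<Rightarrow> nat \<Rightarrow> nat \<Rightarrow> complex" where
  "csum c m a b M A B = (\<Sum>t\<in>units_below c. ee c (int t * m) *
     (\<Sum>x<A. ee c (- int t * (a + M * int x)\<^sup>2)) * (\<Sum>y<B. ee c (- int t * (b + M * int y)\<^sup>2)))"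

text \<open>Both coordinates give the same Gauss sum, and by \<open>gauss_sum_sq\<close> the product
  is \<open>chi4 c * c\<close> for every \<open>t\<close>. The sum over \<open>t\<close> of what
  remains is exactly a Kloosterman sum whose second parameter is the sum of the two
  frequencies.\<close>

lemma csum_eq:
  assumes c: "odd c" and M: "coprime M (int c)"
  shows "csum c m a b M A B = of_int (chi4 c) / of_nat c *
    (\<Sum>h<c. \<Sum>k<c. bcoef c a M A h * bcoef c b M B k * kl c m (bfreq c M h + bfreq c M k))"
proof -
  let ?E = "\<lambda>h k t. m * int t + (bfreq c M h + bfreq c M k) * minv c (int t)"
  have c0: "c > 0" using c by (cases c) auto
  have "csum c m a b M A B = (\<Sum>t\<in>units_below c. of_int (chi4 c) / of_nat c *
     (\<Sum>h<c. \<Sum>k<c. bcoef c a M A h * bcoef c b M B k *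
       ee c (?E h k t)))"
    unfolding csum_def
  proof (intro sum.cong refl)
    fix t assume "t \<in> units_below c"
    hence t: "coprime (int t) (int c)" by (simp add: units_below_def)
    have "gs c (- int t) * gs c (- int t) = of_int (chi4 c) * of_nat c"
      using gauss_sum_sq[OF c, of "- int t"] t by (simp add: power2_eq_square)
    hence gg: "gs c (- int t) / of_nat c * (gs c (- int t) / of_nat c) = of_int (chi4 c) / of_nat c"
      using c0 by (simp add: field_simps)
    have "ee c (int t * m) * (\<Sum>x<A. ee c (- int t * (a + M * int x)\<^sup>2)) * (\<Sum>y<B. ee c (- int t * (b + M * int y)\<^sup>2)) =
      (gs c (- int t) / of_nat c * (gs c (- int t) / of_nat c)) *
      (ee c (int t * m) * ((\<Sum>h<c. bcoef c a M A h * ee c (bfreq c M h * minv c (int t))) *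
        (\<Sum>k<c. bcoef c b M B k * ee c (bfreq c M k * minv c (int t)))))"
      unfolding incomplete_gauss_sum[OF c t M] by (simp only: mult_ac)
    also have "\<dots> = of_int (chi4 c) / of_nat c * (ee c (int t * m) * (\<Sum>h<c. \<Sum>k<c.
       (bcoef c a M A h * ee c (bfreq c M h * minv c (int t))) *
       (bcoef c b M B k * ee c (bfreq c M k * minv c (int t)))))"
      by (simp only: gg sum_product)
    also have "\<dots> = of_int (chi4 c) / of_nat c * (\<Sum>h<c. \<Sum>k<c. bcoef c a M A h * bcoef c b M B k *
       ee c (?E h k t))"
      unfolding sum_distrib_left
      by (intro sum.cong refl) (simp add: ee_add ring_distribs mult_ac)
    finally show "ee c (int t * m) * (\<Sum>x<A. ee c (- int t * (a + M * int x)\<^sup>2)) * (\<Sum>y<B. ee c (- int t * (b + M * int y)\<^sup>2)) =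
       of_int (chi4 c) / of_nat c * (\<Sum>h<c. \<Sum>k<c. bcoef c a M A h * bcoef c b M B k *
       ee c (?E h k t))" .
  qed
  also have "\<dots> = of_int (chi4 c) / of_nat c * (\<Sum>t\<in>units_below c.
     (\<Sum>h<c. \<Sum>k<c. bcoef c a M A h * bcoef c b M B k *
       ee c (?E h k t)))"
    by (rule sum_distrib_left[symmetric])
  also have "(\<Sum>t\<in>units_below c. (\<Sum>h<c. \<Sum>k<c. bcoef c a M A h * bcoef c b M B k *
       ee c (?E h k t))) =
    (\<Sum>h<c. \<Sum>t\<in>units_below c. \<Sum>k<c. bcoef c a M A h * bcoef c b M B k *
       ee c (?E h k t))"
    by (rule sum.swap)
  also have "\<dots> = (\<Sum>h<c. \<Sum>k<c. \<Sum>t\<in>units_below c. bcoef c a M A h * bcoef c b M B k *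
       ee c (?E h k t))"
    by (intro sum.cong refl sum.swap)
  finally show ?thesis by (simp add: kl_def sum_distrib_left)
qed

lemma bcoef_0 [simp]: "bcoef c a M A 0 = of_nat A"
  by (simp add: bcoef_def)

lemma bfreq_0 [simp]: "bfreq c M 0 = 0"
  by (simp add: bfreq_def)

lemma norm_bcoef: "norm (bcoef c a M A h) = norm (\<Sum>x<A. ee c (- (int h * int x)))"
  by (simp add: bcoef_def norm_mult)

lemma sum_lessThan_split0:
  fixes c :: nat and f :: "nat \<Rightarrow> 'a :: comm_monoid_add"
  assumes "c > 0"
  shows "(\<Sum>h<c. f h) = f 0 + (\<Sum>h\<in>{1..<c}. f h)"
proof -
  note assms
  hence "{..<c} = insert 0 {1..<c}" by auto
  thus ?thesis by simp
qed

lemma sum_lessThan_split0_double: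
  fixes f :: "nat \<Rightarrow> nat \<Rightarrow> 'a :: comm_monoid_add"
  assumes "c > 0"
  shows "(\<Sum>h<c. \<Sum>k<c. f h k) =
    f 0 0 + ((\<Sum>k\<in>{1..<c}. f 0 k) + (\<Sum>h\<in>{1..<c}. f h 0) + (\<Sum>h\<in>{1..<c}. \<Sum>k\<in>{1..<c}. f h k))"
  unfolding sum_lessThan_split0[OF assms] sum.distrib by (simp add: add_ac)

text \<open>The main term is \<open>h = k = 0\<close>. The coefficients at nonzero frequencies have
  total size at most \<open>c * L\<close>, so after the prefactor \<open>1 / c\<close> the terms
  with one nonzero frequency give \<open>(A + B) * L\<close> and those with two give
  \<open>c * L^2\<close>.\<close>

lemma csum_bound:
  assumes c: "odd c" and M: "coprime M (int c)"
    and K: "\<And>n. norm (kl c m n) \<le> K" and L: "(\<Sum>h\<in>{1..<c}. 1 / real h) \<le> L"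
  shows "norm (csum c m a b M A B - of_int (chi4 c) / of_nat c * of_nat A * of_nat B * kl c m 0) \<le>
     K * (real (A + B) * L + real c * L ^ 2)"
proof -
  have c0: "c > 0" using c by (cases c) auto
  have K0: "K \<ge> 0" using K[of 0] norm_ge_zero order_trans by blast
  have L0: "L \<ge> 0" using L by (meson divide_nonneg_nonneg order_trans of_nat_0_le_iff sum_nonneg zero_le_one)
  let ?\<alpha> = "bcoef c a M A" and ?\<beta> = "bcoef c b M B" and ?\<nu> = "bfreq c M"
  let ?T = "\<lambda>h k. ?\<alpha> h * ?\<beta> k * kl c m (?\<nu> h + ?\<nu> k)"
  have S: "(\<Sum>h\<in>{1..<c}. norm (bcoef c a M A h)) \<le> real c * L" for a A
    unfolding norm_bcoef using sum_norm_sum_ee_le[of c A] L c0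
    by (meson mult_left_mono of_nat_0_le_iff order_trans)
  have split: "(\<Sum>h<c. \<Sum>k<c. ?T h k) = ?T 0 0 + ((\<Sum>k\<in>{1..<c}. ?T 0 k) + (\<Sum>h\<in>{1..<c}. ?T h 0) + (\<Sum>h\<in>{1..<c}. \<Sum>k\<in>{1..<c}. ?T h k))"
    by (rule sum_lessThan_split0_double[OF c0])
  have T0: "of_int (chi4 c) / of_nat c * of_nat A * of_nat B * kl c m 0 = of_int (chi4 c) / of_nat c * ?T 0 0"
    by simp
  define R where "R = (\<Sum>k\<in>{1..<c}. ?T 0 k) + (\<Sum>h\<in>{1..<c}. ?T h 0) + (\<Sum>h\<in>{1..<c}. \<Sum>k\<in>{1..<c}. ?T h k)"
  have "csum c m a b M A B - of_int (chi4 c) / of_nat c * of_nat A * of_nat B * kl c m 0 =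
     of_int (chi4 c) / of_nat c * R"
    unfolding csum_eq[OF c M] split T0 ring_distribs(1) R_def by (rule add_diff_cancel_left')
  hence "norm (csum c m a b M A B - of_int (chi4 c) / of_nat c * of_nat A * of_nat B * kl c m 0) =
     norm (of_int (chi4 c) / of_nat c :: complex) * norm R"
    by (simp only: norm_mult)
  also have "\<dots> \<le> (1 / real c) * (real A * (real c * L) * K + (real c * L) * real B * K + (real c * L) * (real c * L) * K)"
  proof (rule mult_mono)
    have "\<bar>chi c\<bar> \<le> 1" using abs_chi4_le[of c] by linarith
    thus "norm (of_int (chi4 c) / of_nat c :: complex) \<le> 1 / real c"
      by (simp add: norm_divide divide_right_mono)
    have T: "norm (?T h k) \<le> norm (?\<alpha> h) * norm (?\<beta> k) * K" for h k
      unfolding norm_mult using K by (intro mult_left_mono) auto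
    have 1: "norm (\<Sum>k\<in>{1..<c}. ?T 0 k) \<le> real A * (real c * L) * K"
    proof -
      have "norm (\<Sum>k\<in>{1..<c}. ?T 0 k) \<le> (\<Sum>k\<in>{1..<c}. norm (?\<alpha> 0) * norm (?\<beta> k) * K)"
        by (rule sum_norm_le) (rule T)
      also have "\<dots> = real A * (\<Sum>k\<in>{1..<c}. norm (?\<beta> k)) * K"
        by (simp add: sum_distrib_left sum_distrib_right)
      also have "\<dots> \<le> real A * (real c * L) * K"
        using S[of b B] K0 by (intro mult_right_mono mult_left_mono) auto
      finally show ?thesis .
    qed
    have 2: "norm (\<Sum>h\<in>{1..<c}. ?T h 0) \<le> (real c * L) * real B * K"
    proof -
      have "norm (\<Sum>h\<in>{1..<c}. ?T h 0) \<le> (\<Sum>h\<in>{1..<c}. norm (?\<alpha> h) * norm (?\<beta> 0) * K)"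
        by (rule sum_norm_le) (rule T)
      also have "\<dots> = (\<Sum>h\<in>{1..<c}. norm (?\<alpha> h)) * real B * K"
        by (simp add: sum_distrib_left sum_distrib_right)
      also have "\<dots> \<le> (real c * L) * real B * K"
        using S[of a A] K0 by (intro mult_right_mono) auto
      finally show ?thesis .
    qed
    have 3: "norm (\<Sum>h\<in>{1..<c}. \<Sum>k\<in>{1..<c}. ?T h k) \<le> (real c * L) * (real c * L) * K"
    proof -
      have "norm (\<Sum>h\<in>{1..<c}. \<Sum>k\<in>{1..<c}. ?T h k) \<le> (\<Sum>h\<in>{1..<c}. \<Sum>k\<in>{1..<c}. norm (?\<alpha> h) * norm (?\<beta> k) * K)"
        by (intro sum_norm_le) (rule T)
      also have "\<dots> = (\<Sum>h\<in>{1..<c}. norm (?\<alpha> h)) * (\<Sum>k\<in>{1..<c}. norm (?\<beta> k)) * K"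
        by (subst sum_product) (simp only: sum_distrib_right)
      also have "\<dots> \<le> (real c * L) * (real c * L) * K"
        using S[of a A] S[of b B] K0 L0 by (intro mult_right_mono mult_mono sum_nonneg) auto
      finally show ?thesis .
    qed
    show "norm R \<le> real A * (real c * L) * K + (real c * L) * real B * K + (real c * L) * (real c * L) * K"
      unfolding R_def
      by (intro norm_triangle_le add_mono 1 2 3)
  qed auto
  also have "\<dots> = K * (real (A + B) * L + real c * L ^ 2)"
    using c0 by (simp add: field_simps power2_eq_square)
  finally show ?thesis .
qed

text \<open>Over whole periods every nonzero frequency cancels. This identifies the main term of
  \<open>csum_bound\<close> with the density of solutions modulo \<open>q\<close>.\<close>

lemma csum_complete:
  assumes c: "odd c" "c dvd q" "q > 0"
  shows "csum c m 0 0 1 q q = of_int (chi4 c) / of_nat c * (of_nat q)\<^sup>2 * kl c m 0"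
proof -
  have c0: "c > 0" using c by (cases c) auto
  have z: "bcoef c 0 1 q h = 0" if h: "h \<in> {1..<c}" for h
  proof -
    have "\<not> int c dvd - int h" using h by (auto dest: zdvd_imp_le)
    hence 1: "ee c (- int h) \<noteq> 1" using ee_eq_1_iff[OF c0] by blast
    have "ee c (int q * - int h) = 1"
      by (intro ee_eq_1_iff[OF c0, THEN iffD2] dvd_mult2) (use c in simp)
    hence "(\<Sum>x<q. ee c (- int h) ^ x) = 0" using geometric_sum[OF 1, of q] by (simp only: ee_mult_nat) simp
    hence "(\<Sum>x<q. ee c (int x * - int h)) = 0" by (simp only: ee_mult_nat)
    thus ?thesis by (simp add: bcoef_def mult.commute)
  qed
  show ?thesis
    unfolding csum_eq[OF c(1), of 1, simplified]
    by (simp add: sum_lessThan_split0[OF c0] z power2_eq_square)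
qed

text \<open>Each fraction \<open>t / q\<close> is written in lowest terms, with denominator
  \<open>c\<close> dividing \<open>q\<close>.\<close>

lemma sum_ee_eq_sum_units:
  assumes "q > 0"
  shows "(\<Sum>t<q. ee q (int t * n)) = (\<Sum>c | c dvd q. \<Sum>t\<in>units_below c. ee c (int t * n))"
proof -
  have fin: "finite {c. c dvd q}" using assms by simp
  have "(\<Sum>c | c dvd q. \<Sum>t\<in>units_below c. ee c (int t * n)) =
     (\<Sum>z\<in>(SIGMA c:{c. c dvd q}. units_below c). ee (fst z) (int (snd z) * n))"
    using fin by (simp add: sum.Sigma case_prod_beta)
  also have "\<dots> = (\<Sum>t<q. ee q (int t * n))"
  proof (rule sum.reindex_bij_witness[of _ "\<lambda>t. (q div gcd t q, t div gcd t q)" "\<lambda>z. snd z * (q div fst z)"])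
    fix z assume "z \<in> (SIGMA c:{c. c dvd q}. units_below c)"
    then obtain c t where z: "z = (c, t)" "c dvd q" "t < c" "coprime t c"
      by (auto simp: units_below_def)
    then obtain j where j: "q = c * j" by (auto elim!: dvdE)
    have pos: "c > 0" "j > 0" using assms j by auto
    have "gcd (t * j) q = j * gcd t c"
      unfolding j using gcd_mult_distrib_nat[of j t c] by (simp only: mult.commute)
    hence g: "gcd (t * j) q = j" using z by simp
    show "(q div gcd (snd z * (q div fst z)) q, snd z * (q div fst z) div gcd (snd z * (q div fst z)) q) = z"
      using z j pos g by simp
    show "snd z * (q div fst z) \<in> {..<q}" using z j pos by simp
    show "ee q (int (snd z * (q div fst z)) * n) = ee (fst z) (int (snd z) * n)"
      using z j pos ee_scale[of j c "int t * n"] by (simp add: mult_ac)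
  next
    fix t assume t: "t \<in> {..<q}"
    define g where "g = gcd t q"
    have g: "g > 0" "g dvd t" "g dvd q" using assms by (auto simp: g_def)
    show "snd (q div gcd t q, t div gcd t q) * (q div fst (q div gcd t q, t div gcd t q)) = t"
      using g assms unfolding g_def[symmetric] by (auto elim!: dvdE)
    have "coprime (t div g) (q div g)" unfolding g_def using assms by (intro div_gcd_coprime) auto
    moreover have "q div g dvd q" using g by (metis dvd_div_mult_self dvd_triv_left)
    moreover have "t div g < q div g" using t g by (auto elim!: dvdE)
    ultimately show "(q div gcd t q, t div gcd t q) \<in> (SIGMA c:{c. c dvd q}. units_below c)"
      unfolding g_def[symmetric] by (simp add: units_below_def)
  qed
  finally show ?thesis ..
qed

section \<open>Pairs in a box with \<open>q\<close> dividing \<open>m - u^2 - v^2\<close>\<close>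

definition zcount :: "nat \<Rightarrow> int \<Rightarrow> int \<Rightarrow> int \<Rightarrow> int \<Rightarrow> nat \<Rightarrow> nat \<Rightarrow> nat" where
  "zcount q m a b M A B = card {(x, y) \<in> {..<A} \<times> {..<B}. int q dvd m - (a + M * int x)\<^sup>2 - (b + M * int y)\<^sup>2}"

lemma zcount_eq_csum:
  assumes "q > 0"
  shows "of_nat (zcount q m a b M A B) = (\<Sum>c | c dvd q. csum c m a b M A B) / of_nat q"
proof -
  let ?n = "\<lambda>z. m - (a + M * int (fst z))\<^sup>2 - (b + M * int (snd z))\<^sup>2"
  let ?Z = "{..<A} \<times> {..<B}"
  have "{(x, y) \<in> ?Z. int q dvd m - (a + M * int x)\<^sup>2 - (b + M * int y)\<^sup>2} = {z \<in> ?Z. int q dvd ?n z}"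
    by auto
  hence "of_nat (zcount q m a b M A B) = (\<Sum>z\<in>{z \<in> ?Z. int q dvd ?n z}. 1 :: complex)"
    unfolding zcount_def by simp
  also have "\<dots> = (\<Sum>z\<in>?Z. if int q dvd ?n z then 1 else 0)"
    by (rule sum.inter_filter) simp
  also have "\<dots> = (\<Sum>z\<in>?Z. (\<Sum>c | c dvd q. \<Sum>t\<in>units_below c. ee c (int t * ?n z)) / of_nat q)"
    using assms by (intro sum.cong refl) (simp add: sum_ee flip: sum_ee_eq_sum_units)
  also have "\<dots> = (\<Sum>z\<in>?Z. \<Sum>c | c dvd q. \<Sum>t\<in>units_below c. ee c (int t * ?n z)) / of_nat q"
    by (simp add: sum_divide_distrib)
  also have "(\<Sum>z\<in>?Z. \<Sum>c | c dvd q. \<Sum>t\<in>units_below c. ee c (int t * ?n z)) =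
     (\<Sum>c | c dvd q. \<Sum>z\<in>?Z. \<Sum>t\<in>units_below c. ee c (int t * ?n z))"
    by (rule sum.swap)
  also have "\<dots> = (\<Sum>c | c dvd q. csum c m a b M A B)"
  proof (intro sum.cong refl)
    fix c
    have "(\<Sum>z\<in>?Z. \<Sum>t\<in>units_below c. ee c (int t * ?n z)) = (\<Sum>t\<in>units_below c. \<Sum>z\<in>?Z. ee c (int t * ?n z))"
      by (rule sum.swap)
    also have "\<dots> = (\<Sum>t\<in>units_below c. \<Sum>x<A. \<Sum>y<B. ee c (int t * m) *
        (ee c (- int t * (a + M * int x)\<^sup>2) * ee c (- int t * (b + M * int y)\<^sup>2)))"
    proof -
      have "ee c (int t * ?n z) = ee c (int t * m) *
        (ee c (- int t * (a + M * int (fst z))\<^sup>2) * ee c (- int t * (b + M * int (snd z))\<^sup>2))" for t z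
        unfolding ee_add[symmetric] by (rule arg_cong[of _ _ "ee c"]) (simp add: algebra_simps)
      thus ?thesis by (simp only: sum.cartesian_product' fst_conv snd_conv)
    qed
    also have "\<dots> = csum c m a b M A B"
      unfolding csum_def mult.assoc sum_product by (simp only: sum_distrib_left)
    finally show "(\<Sum>z\<in>?Z. \<Sum>t\<in>units_below c. ee c (int t * ?n z)) = csum c m a b M A B" .
  qed
  finally show ?thesis .
qed

text \<open>The proportion of all pairs modulo \<open>q\<close> that solve the congruence; it is of
  size about \<open>1 / q\<close>.\<close>

definition zdens :: "int \<Rightarrow> nat \<Rightarrow> real" where
  "zdens m q = real (zcount q m 0 0 1 q q) / (real q)\<^sup>2"

lemma zdens_eq:
  assumes "odd q"
  shows "of_real (zdens m q) = (\<Sum>c | c dvd q. of_int (chi4 c) / of_nat c * kl c m 0) / of_nat q"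
proof -
  have q: "q > 0" using assms by (cases q) auto
  have "of_nat (zcount q m 0 0 1 q q) = (\<Sum>c | c dvd q. csum c m 0 0 1 q q) / of_nat q"
    by (rule zcount_eq_csum[OF q])
  also have "(\<Sum>c | c dvd q. csum c m 0 0 1 q q) = (\<Sum>c | c dvd q. of_int (chi4 c) / of_nat c * (of_nat q)\<^sup>2 * kl c m 0)"
    using assms q by (intro sum.cong refl csum_complete) (auto elim!: dvdE)
  also have "\<dots> = (of_nat q)\<^sup>2 * (\<Sum>c | c dvd q. of_int (chi4 c) / of_nat c * kl c m 0)"
    by (simp add: sum_distrib_left mult_ac)
  finally show ?thesis using q by (simp add: zdens_def)
qed

text \<open>The bound \<open>K\<close> for Kloosterman sums and the bound \<open>L\<close> for
  harmonic sums are parameters, so that one \<open>L\<close> can serve all moduli up to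
  \<open>X\<close>.\<close>

theorem zcount_bound:
  assumes q: "odd q" and M: "coprime M (int q)"
    and K: "\<And>c n. c dvd q \<Longrightarrow> norm (kl c m n) \<le> K c"
    and L: "(\<Sum>h\<in>{1..<q}. 1 / real h) \<le> L"
  shows "\<bar>real (zcount q m a b M A B) - real A * real B * zdens m q\<bar> \<le>
    (\<Sum>c | c dvd q. K c * (real (A + B) * L + real c * L ^ 2)) / real q"
proof -
  have q0: "q > 0" using q by (cases q) auto
  have "of_real (real (zcount q m a b M A B) - real A * real B * zdens m q) =
    (\<Sum>c | c dvd q. csum c m a b M A B - of_int (chi4 c) / of_nat c * of_nat A * of_nat B * kl c m 0) / of_nat q"
    by (simp add: zcount_eq_csum[OF q0] zdens_eq[OF q] sum_subtractf diff_divide_distrib sum_distrib_left mult_ac)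
  also have "norm \<dots> = norm (\<Sum>c | c dvd q. csum c m a b M A B - of_int (chi4 c) / of_nat c * of_nat A * of_nat B * kl c m 0) / real q"
    by (simp add: norm_divide)
  also have "\<dots> \<le> (\<Sum>c | c dvd q. K c * (real (A + B) * L + real c * L ^ 2)) / real q"
  proof (intro divide_right_mono sum_norm_le)
    fix c assume c: "c \<in> {c. c dvd q}"
    hence "c > 0" "c \<le> q" using q0 by (auto intro: dvd_imp_le Nat.gr0I)
    hence "(\<Sum>h\<in>{1..<c}. 1 / real h) \<le> (\<Sum>h\<in>{1..<q}. 1 / real h)" by (intro sum_mono2) auto
    hence "(\<Sum>h\<in>{1..<c}. 1 / real h) \<le> L" using L by simp
    moreover have "odd c" using c q by (auto elim!: dvdE)
    moreover have "coprime M (int c)" using c M by (auto elim!: dvdE)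
    ultimately show "norm (csum c m a b M A B - of_int (chi4 c) / of_nat c * of_nat A * of_nat B * kl c m 0) \<le>
      K c * (real (A + B) * L + real c * L ^ 2)"
      using c K by (intro csum_bound) auto
  qed auto
  finally show ?thesis by (simp only: norm_of_real)
qed

section \<open>Divisor sums\<close>

lemma sum_divisors_swap:
  fixes f :: "nat \<Rightarrow> nat \<Rightarrow> 'a :: comm_monoid_add"
  shows "(\<Sum>q\<in>{1..N}. \<Sum>c | c dvd q. f c (q div c)) = (\<Sum>c\<in>{1..N}. \<Sum>a\<in>{1..N div c}. f c a)"
proof -
  have "(\<Sum>q\<in>{1..N}. \<Sum>c | c dvd q. f c (q div c)) =
     (\<Sum>z\<in>(SIGMA q:{1..N}. {c. c dvd q}). f (snd z) (fst z div snd z))"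
    by (subst sum.Sigma) (auto simp: case_prod_beta)
  also have "\<dots> = (\<Sum>z\<in>(SIGMA c:{1..N}. {1..N div c}). f (fst z) (snd z))"
  proof (rule sum.reindex_bij_witness[of _ "\<lambda>z. (fst z * snd z, fst z)" "\<lambda>z. (snd z, fst z div snd z)"])
    fix z assume "z \<in> (SIGMA q:{1..N}. {c. c dvd q})"
    then obtain q c where z: "z = (q, c)" "q \<in> {1..N}" "c dvd q" by auto
    then obtain a where a: "q = c * a" by (auto elim!: dvdE)
    hence pos: "c > 0" "a > 0" using z by (auto intro: Nat.gr0I)
    have "a \<le> N div c" using z a pos by (simp add: less_eq_div_iff_mult_less_eq mult.commute)
    moreover have "c \<le> N" using z a pos by (meson atLeastAtMost_iff dvd_imp_le order_trans less_le_trans zero_less_one)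
    ultimately show "(snd z, fst z div snd z) \<in> (SIGMA c:{1..N}. {1..N div c})" using z a pos by simp
    show "(fst (snd z, fst z div snd z) * snd (snd z, fst z div snd z), fst (snd z, fst z div snd z)) = z"
      using z a by simp
  next
    fix z assume "z \<in> (SIGMA c:{1..N}. {1..N div c})"
    then obtain c a where z: "z = (c, a)" "c \<in> {1..N}" "a \<in> {1..N div c}" by auto
    have "c * a \<le> N" using z by (simp add: less_eq_div_iff_mult_less_eq mult.commute)
    thus "(fst z * snd z, fst z) \<in> (SIGMA q:{1..N}. {c. c dvd q})" using z by auto
    show "(snd (fst z * snd z, fst z), fst (fst z * snd z, fst z) div snd (fst z * snd z, fst z)) = z"
      using z by simp
  qed simp
  also have "\<dots> = (\<Sum>c\<in>{1..N}. \<Sum>a\<in>{1..N div c}. f c a)"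
    by (subst sum.Sigma) (auto simp: case_prod_beta)
  finally show ?thesis .
qed

definition hsum :: "nat \<Rightarrow> real" where "hsum n = (\<Sum>k\<in>{1..n}. 1 / real k)"

lemma hsum_nonneg: "hsum n \<ge> 0"
  by (simp add: hsum_def sum_nonneg)

lemma hsum_mono: "m \<le> n \<Longrightarrow> hsum m \<le> hsum n"
  unfolding hsum_def by (intro sum_mono2) auto

lemma hsum_le_ln: "n > 0 \<Longrightarrow> hsum n \<le> 1 + ln (real n)"
proof (induction n)
  case (Suc n)
  show ?case
  proof (cases "n = 0")
    case False
    have "ln (real n / real (Suc n)) \<le> real n / real (Suc n) - 1"
      using False by (intro ln_le_minus_one) simp
    also have "\<dots> = - (1 / real (Suc n))" by (simp add: field_simps)
    finally have "1 / real (Suc n) \<le> ln (real (Suc n)) - ln (real n)"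
      using False by (simp add: ln_div)
    moreover have "hsum (Suc n) = hsum n + 1 / real (Suc n)" by (simp add: hsum_def)
    ultimately show ?thesis using Suc.IH False by simp
  qed (simp add: hsum_def)
qed simp

abbreviation tau :: "nat \<Rightarrow> nat" where "tau n \<equiv> card {e. e dvd n}"

lemma sum_tau_le:
  "(\<Sum>a\<in>{1..x}. real (tau a) / real a) \<le> hsum x ^ 2"
proof -
  have "(\<Sum>a\<in>{1..x}. real (tau a) / real a) = (\<Sum>a\<in>{1..x}. \<Sum>e | e dvd a. (1 / real e) * (1 / real (a div e)))"
  proof (intro sum.cong refl)
    fix a assume "a \<in> {1..x}"
    have "(\<Sum>e | e dvd a. (1 / real e) * (1 / real (a div e))) = (\<Sum>e | e dvd a. 1 / real a)"
      by (intro sum.cong refl) (auto simp flip: of_nat_mult)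
    thus "real (tau a) / real a = (\<Sum>e | e dvd a. (1 / real e) * (1 / real (a div e)))" by simp
  qed
  also have "\<dots> = (\<Sum>e\<in>{1..x}. \<Sum>b\<in>{1..x div e}. (1 / real e) * (1 / real b))"
    by (rule sum_divisors_swap)
  also have "\<dots> = (\<Sum>e\<in>{1..x}. (1 / real e) * hsum (x div e))"
    by (simp add: hsum_def sum_distrib_left)
  also have "\<dots> \<le> (\<Sum>e\<in>{1..x}. (1 / real e) * hsum x)"
    by (intro sum_mono mult_left_mono hsum_mono) auto
  also have "\<dots> = hsum x ^ 2"
    by (simp add: hsum_def power2_eq_square sum_distrib_right)
  finally show ?thesis .
qed

lemma sum_tau3_le:
  "(\<Sum>c\<in>{1..x}. real (tau3 c) / real c) \<le> hsum x ^ 3"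
proof -
  have "(\<Sum>c\<in>{1..x}. real (tau3 c) / real c) =
      (\<Sum>c\<in>{1..x}. \<Sum>g | g dvd c. (1 / real g) * (real (tau (c div g)) / real (c div g)))"
  proof (intro sum.cong refl)
    fix c assume "c \<in> {1..x}"
    have "(\<Sum>g | g dvd c. (1 / real g) * (real (tau (c div g)) / real (c div g))) =
      (\<Sum>g | g dvd c. real (tau (c div g)) / real c)"
      by (intro sum.cong refl) (auto simp flip: of_nat_mult)
    thus "real (tau3 c) / real c = (\<Sum>g | g dvd c. (1 / real g) * (real (tau (c div g)) / real (c div g)))"
      by (simp add: tau3_def sum_divide_distrib)
  qed
  also have "\<dots> = (\<Sum>g\<in>{1..x}. \<Sum>a\<in>{1..x div g}. (1 / real g) * (real (tau a) / real a))"
    by (rule sum_divisors_swap)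
  also have "\<dots> = (\<Sum>g\<in>{1..x}. (1 / real g) * (\<Sum>a\<in>{1..x div g}. real (tau a) / real a))"
    by (simp add: sum_distrib_left)
  also have "\<dots> \<le> (\<Sum>g\<in>{1..x}. (1 / real g) * hsum x ^ 2)"
  proof (intro sum_mono mult_left_mono)
    fix g
    have "(\<Sum>a\<in>{1..x div g}. real (tau a) / real a) \<le> hsum (x div g) ^ 2" by (rule sum_tau_le)
    also have "\<dots> \<le> hsum x ^ 2" by (intro power_mono hsum_mono hsum_nonneg) auto
    finally show "(\<Sum>a\<in>{1..x div g}. real (tau a) / real a) \<le> hsum x ^ 2" .
  qed auto
  also have "\<dots> = hsum x ^ 3"
    by (simp add: hsum_def power2_eq_square power3_eq_cube sum_distrib_right mult_ac)
  finally show ?thesis .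
qed

text \<open>The divisor function of exponent -1/2. It collects the loss from common factors of
  \<open>m\<close> and the modulus in the Kloosterman bound.\<close>

definition gsig :: "nat \<Rightarrow> real" where "gsig m = (\<Sum>g | g dvd m. 1 / sqrt (real g))"

lemma gsig_ge_1: "m > 0 \<Longrightarrow> gsig m \<ge> 1"
  unfolding gsig_def by (rule order_trans[OF _ member_le_sum[of 1]]) auto

text \<open>The square root of the gcd is one term of the sum of \<open>sqrt g\<close> over common
  divisors \<open>g\<close>. Each \<open>g\<close> has at most \<open>x / g\<close> multiples, which
  leaves \<open>1 / sqrt g\<close>.\<close>

lemma sum_sqrt_gcd_le:
  assumes "m > 0"
  shows "(\<Sum>c\<in>{1..x}. sqrt (real (gcd m c))) \<le> real x * gsig m"
proof -
  have fin: "finite {g. g dvd m}" using assms by simp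
  have "(\<Sum>c\<in>{1..x}. sqrt (real (gcd m c))) \<le> (\<Sum>c\<in>{1..x}. \<Sum>g | g dvd m. if g dvd c then sqrt (real g) else 0)"
  proof (rule sum_mono)
    fix c
    have "sqrt (real (gcd m c)) = (if gcd m c dvd c then sqrt (real (gcd m c)) else 0)" by simp
    also have "\<dots> \<le> (\<Sum>g | g dvd m. if g dvd c then sqrt (real g) else 0)"
      by (rule member_le_sum) (use fin in auto)
    finally show "sqrt (real (gcd m c)) \<le> (\<Sum>g | g dvd m. if g dvd c then sqrt (real g) else 0)" .
  qed
  also have "\<dots> = (\<Sum>g | g dvd m. \<Sum>c\<in>{1..x}. if g dvd c then sqrt (real g) else 0)" by (rule sum.swap)
  also have "\<dots> \<le> (\<Sum>g | g dvd m. real x * (1 / sqrt (real g)))"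
  proof (rule sum_mono)
    fix g assume "g \<in> {g. g dvd m}"
    hence g0: "g > 0" using assms by (auto intro: Nat.gr0I)
    have sub: "{c \<in> {1..x}. g dvd c} = (\<lambda>a. g * a) ` {1..x div g}"
    proof (intro Set.set_eqI iffI)
      fix c assume "c \<in> {c \<in> {1..x}. g dvd c}"
      then obtain a where "c = g * a" "c \<in> {1..x}" by auto
      thus "c \<in> (\<lambda>a. g * a) ` {1..x div g}" using g0
        by (auto simp: less_eq_div_iff_mult_less_eq mult.commute intro!: Nat.gr0I)
    next
      fix c assume "c \<in> (\<lambda>a. g * a) ` {1..x div g}"
      thus "c \<in> {c \<in> {1..x}. g dvd c}" using g0
        by (auto simp: less_eq_div_iff_mult_less_eq mult.commute)
    qed
    have "(\<Sum>c\<in>{1..x}. if g dvd c then sqrt (real g) else 0) = real (card {c \<in> {1..x}. g dvd c}) * sqrt (real g)"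
      by (subst sum.inter_filter[symmetric]) auto
    also have "card {c \<in> {1..x}. g dvd c} = x div g"
      unfolding sub using g0 by (subst card_image) (auto simp: inj_on_def)
    also have "real (x div g) * sqrt (real g) \<le> (real x / real g) * sqrt (real g)"
      by (intro mult_right_mono) (auto simp: of_nat_div_le_of_nat)
    also have "\<dots> = real x * (1 / sqrt (real g))"
      using g0 by (simp add: field_simps)
    finally show "(\<Sum>c\<in>{1..x}. if g dvd c then sqrt (real g) else 0) \<le> real x * (1 / sqrt (real g))" .
  qed
  also have "\<dots> = real x * gsig m" by (simp add: gsig_def sum_distrib_left)
  finally show ?thesis .
qed

section \<open>The Kloosterman bound on average over the modulus\<close>

definition kb :: "nat \<Rightarrow> nat \<Rightarrow> real" where
  "kb m c = sqrt (sqrt (real (gcd m c * c ^ 3 * tau3 c ^ 2)))"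

lemma kb_nonneg: "kb m c \<ge> 0"
  by (simp add: kb_def)

lemma norm_kl_le_kb:
  assumes "odd c"
  shows "norm (kl c (int m) n) \<le> kb m c"
proof -
  have "norm (kl c (int m) n) ^ 4 \<le> real (gcd m c * c ^ 3 * tau3 c ^ 2)"
    using kloosterman_bound[OF assms, of "int m" n] by simp
  hence "sqrt (sqrt (norm (kl c (int m) n) ^ 4)) \<le> kb m c"
    unfolding kb_def by (intro real_sqrt_le_mono)
  moreover have "norm (kl c (int m) n) ^ 4 = (norm (kl c (int m) n) ^ 2) ^ 2" by simp
  ultimately show ?thesis by (simp only: real_sqrt_abs abs_power2)
qed

text \<open>The summand is the fourth root of the gcd, times the square root of
  \<open>tau3 c\<close>, times \<open>c^(-1/4)\<close>. Cauchy-Schwarz separates the gcd from the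
  divisor function; both then have bounded averages up to logarithms, and \<open>x^(3/4)\<close>
  remains.\<close>

lemma sum_kb_le:
  assumes m: "m > 0" and L: "hsum x \<le> L" "L \<ge> 1"
  shows "(\<Sum>c\<in>{1..x}. kb m c / real c) \<le> sqrt (gsig m) * L ^ 2 * real x powr (3/4)"
proof -
  let ?a = "\<lambda>c. sqrt (sqrt (real (gcd m c)))" and ?b = "\<lambda>c. sqrt (real (tau3 c) / sqrt (real c))"
  have eq: "kb m c / real c = ?a c * ?b c" if "c \<in> {1..x}" for c
  proof -
    have c: "real c > 0" using that by simp
    have s3: "sqrt (real c ^ 3) = real c * sqrt (real c)"
      using c by (simp add: power3_eq_cube real_sqrt_mult)
    have "kb m c = ?a c * sqrt (sqrt (real c ^ 3 * real (tau3 c) ^ 2))"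
      by (simp add: kb_def real_sqrt_mult mult.assoc)
    also have "sqrt (real c ^ 3 * real (tau3 c) ^ 2) = (real c)\<^sup>2 * (real (tau3 c) / sqrt (real c))"
      using c s3 by (simp add: real_sqrt_mult field_simps power2_eq_square)
    also have "sqrt \<dots> = real c * ?b c" using c by (simp only: real_sqrt_mult real_sqrt_abs abs_of_pos)
    finally show ?thesis using c by simp
  qed
  have "(\<Sum>c\<in>{1..x}. kb m c / real c)\<^sup>2 = (\<Sum>c\<in>{1..x}. ?a c * ?b c)\<^sup>2"
    using eq by simp
  also have "\<dots> \<le> (\<Sum>c\<in>{1..x}. (?a c)\<^sup>2) * (\<Sum>c\<in>{1..x}. (?b c)\<^sup>2)"
    by (rule Cauchy_Schwarz_ineq_sum)
  also have "\<dots> = (\<Sum>c\<in>{1..x}. sqrt (real (gcd m c))) * (\<Sum>c\<in>{1..x}. real (tau3 c) / sqrt (real c))"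
    by simp
  also have "\<dots> \<le> (real x * gsig m) * (sqrt (real x) * L ^ 3)"
  proof (intro mult_mono sum_sqrt_gcd_le m)
    have "(\<Sum>c\<in>{1..x}. real (tau3 c) / sqrt (real c)) \<le> (\<Sum>c\<in>{1..x}. sqrt (real x) * (real (tau3 c) / real c))"
    proof (rule sum_mono)
      fix c assume c: "c \<in> {1..x}"
      have "real (tau3 c) / sqrt (real c) = sqrt (real c) * (real (tau3 c) / real c)"
        using c by (simp add: field_simps)
      also have "\<dots> \<le> sqrt (real x) * (real (tau3 c) / real c)"
        using c by (intro mult_right_mono) auto
      finally show "real (tau3 c) / sqrt (real c) \<le> sqrt (real x) * (real (tau3 c) / real c)" .
    qed
    also have "\<dots> = sqrt (real x) * (\<Sum>c\<in>{1..x}. real (tau3 c) / real c)" by (simp only: sum_distrib_left)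
    also have "\<dots> \<le> sqrt (real x) * hsum x ^ 3"
      by (intro mult_left_mono sum_tau3_le) auto
    also have "\<dots> \<le> sqrt (real x) * L ^ 3"
      using L by (intro mult_left_mono power_mono hsum_nonneg) auto
    finally show "(\<Sum>c\<in>{1..x}. real (tau3 c) / sqrt (real c)) \<le> sqrt (real x) * L ^ 3" .
  qed (use gsig_ge_1[OF m] in \<open>auto intro!: sum_nonneg\<close>)
  \<comment> \<open>The exponent 3 is rounded up to 4 so that the square root is an integral power
    of \<open>L\<close>.\<close>
  also have "\<dots> \<le> (real x * gsig m) * (sqrt (real x) * L ^ 4)"
    using L gsig_ge_1[OF m] by (intro mult_left_mono power_increasing) auto
  also have "\<dots> = (sqrt (gsig m) * L ^ 2 * real x powr (3/4))\<^sup>2"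
  proof -
    have "(real x powr (3/4))\<^sup>2 = real x * sqrt (real x)"
    proof (cases "x = 0")
      case False
      have "(real x powr (3/4))\<^sup>2 = real x powr (3/2)"
        by (simp add: power2_eq_square flip: powr_add)
      also have "\<dots> = real x powr (1 + 1/2)" by simp
      also have "\<dots> = real x * sqrt (real x)" unfolding powr_add using False by (simp add: powr_half_sqrt)
      finally show ?thesis .
    qed simp
    moreover have "(sqrt (gsig m))\<^sup>2 = gsig m" using gsig_ge_1[OF m] by simp
    ultimately show ?thesis by (simp add: power_mult_distrib mult_ac flip: power_mult)
  qed
  finally have "(\<Sum>c\<in>{1..x}. kb m c / real c)\<^sup>2 \<le> (sqrt (gsig m) * L ^ 2 * real x powr (3/4))\<^sup>2" .
  thus ?thesis
    by (rule power2_le_imp_le) (use L gsig_ge_1[OF m] in auto)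
qed

text \<open>The error term of \<open>zcount_bound\<close> for modulus \<open>q\<close>, with
  \<open>s\<close> in place of the sum of the two side lengths and \<open>kb\<close> as Kloosterman
  bound.\<close>

definition theta :: "nat \<Rightarrow> real \<Rightarrow> real \<Rightarrow> nat \<Rightarrow> real" where
  "theta m L s q = (\<Sum>c | c dvd q. kb m c * (s * L + real c * L ^ 2)) / real q"

lemma theta_nonneg: "s \<ge> 0 \<Longrightarrow> L \<ge> 0 \<Longrightarrow> theta m L s q \<ge> 0"
  unfolding theta_def by (intro divide_nonneg_nonneg sum_nonneg mult_nonneg_nonneg add_nonneg_nonneg kb_nonneg) auto

lemma theta_mono: "s \<le> s' \<Longrightarrow> L \<ge> 0 \<Longrightarrow> theta m L s q \<le> theta m L s' q"
  unfolding theta_def by (intro divide_right_mono sum_mono mult_left_mono add_mono mult_right_mono kb_nonneg) auto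

text \<open>Writing \<open>q = c * a\<close>, the cofactor \<open>a\<close> contributes one harmonic
  sum and \<open>sum_kb_le\<close> handles \<open>c\<close>. For lengths and moduli up to
  \<open>X\<close> the result is \<open>X^(7/4)\<close> times logarithms and
  \<open>sqrt (gsig m)\<close>.\<close>

lemma sum_theta_le:
  assumes m: "m > 0" and L: "hsum x \<le> L" "L \<ge> 1" and s: "s \<ge> 0"
  shows "(\<Sum>q\<in>{1..x}. theta m L s q) \<le> sqrt (gsig m) * L ^ 5 * (s + real x) * real x powr (3/4)"
proof -
  let ?w = "\<lambda>c. kb m c / real c * (s * L + real c * L ^ 2)"
  have w0: "?w c \<ge> 0" for c using s L kb_nonneg by (intro mult_nonneg_nonneg divide_nonneg_nonneg) auto
  have "(\<Sum>q\<in>{1..x}. theta m L s q) = (\<Sum>q\<in>{1..x}. \<Sum>c | c dvd q. ?w c * (1 / real (q div c)))"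
  proof (intro sum.cong refl)
    fix q assume q: "q \<in> {1..x}"
    show "theta m L s q = (\<Sum>c | c dvd q. ?w c * (1 / real (q div c)))"
      unfolding theta_def sum_divide_distrib
    proof (intro sum.cong refl)
      fix c assume c: "c \<in> {c. c dvd q}"
      hence "real q = real c * real (q div c)" by (simp flip: of_nat_mult)
      thus "kb m c * (s * L + real c * L ^ 2) / real q = ?w c * (1 / real (q div c))" by simp
    qed
  qed
  also have "\<dots> = (\<Sum>c\<in>{1..x}. \<Sum>a\<in>{1..x div c}. ?w c * (1 / real a))"
    by (rule sum_divisors_swap)
  also have "\<dots> = (\<Sum>c\<in>{1..x}. ?w c * hsum (x div c))" by (simp add: hsum_def sum_distrib_left)
  also have "\<dots> \<le> (\<Sum>c\<in>{1..x}. ((s + real x) * L ^ 3) * (kb m c / real c))"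
  proof (rule sum_mono)
    fix c assume c: "c \<in> {1..x}"
    have "hsum (x div c) \<le> L" using hsum_mono[of "x div c" x] L by simp
    hence "?w c * hsum (x div c) \<le> ?w c * L" using w0 by (intro mult_left_mono)
    also have "\<dots> = (s * L ^ 2 + real c * L ^ 3) * (kb m c / real c)"
      by (simp add: algebra_simps power2_eq_square power3_eq_cube)
    also have "\<dots> \<le> (s * L ^ 3 + real x * L ^ 3) * (kb m c / real c)"
      using L c s kb_nonneg[of m c]
      by (intro mult_right_mono add_mono mult_left_mono mult_right_mono power_increasing) auto
    also have "\<dots> = ((s + real x) * L ^ 3) * (kb m c / real c)" by (simp only: ring_distribs)
    finally show "?w c * hsum (x div c) \<le> ((s + real x) * L ^ 3) * (kb m c / real c)" .
  qed
  also have "\<dots> = ((s + real x) * L ^ 3) * (\<Sum>c\<in>{1..x}. kb m c / real c)" by (simp only: sum_distrib_left)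
  also have "\<dots> \<le> ((s + real x) * L ^ 3) * (sqrt (gsig m) * L ^ 2 * real x powr (3/4))"
    using L s by (intro mult_left_mono sum_kb_le m) auto
  also have "\<dots> = sqrt (gsig m) * L ^ 5 * (s + real x) * real x powr (3/4)"
  proof -
    have "L ^ 5 = L ^ 3 * L ^ 2" by (simp flip: power_add)
    thus ?thesis by (simp only: mult_ac)
  qed
  finally show ?thesis .
qed

section \<open>The Moebius function and Ramanujan sums\<close>

definition mu :: "nat \<Rightarrow> int" where
  "mu n = (if squarefree n then (- 1) ^ card (prime_factors n) else 0)"

lemma abs_mu_le: "\<bar>mu n\<bar> \<le> 1"
  by (simp add: mu_def power_abs)

lemma mu_1 [simp]: "mu 1 = 1" "mu (Suc 0) = 1"
  by (simp_all add: mu_def)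

lemma mu_prime_mult:
  assumes p: "prime p" and e: "\<not> p dvd e"
  shows "mu (p * e) = - mu e"
proof -
  have e0: "e \<noteq> 0" using e by (intro notI) simp
  have p0: "p \<noteq> 0" using p by (intro notI) simp
  have cop: "coprime p e" using p e prime_imp_coprime by blast
  have "squarefree (p * e) \<longleftrightarrow> squarefree e"
  proof
    assume "squarefree (p * e)"
    thus "squarefree e" by (rule squarefree_mono[rotated]) simp
  next
    assume "squarefree e"
    thus "squarefree (p * e)" using cop p squarefree_prime by (intro squarefree_mult_coprime) auto
  qed
  moreover have "prime_factors (p * e) = insert p (prime_factors e)"
    using p0 e0 p by (simp add: prime_factors_product prime_prime_factors)
  moreover have "p \<notin> prime_factors e" using e by auto
  ultimately show ?thesis by (simp add: mu_def)
qed

lemma mu_square_mult: "prime p \<Longrightarrow> p dvd e \<Longrightarrow> mu (p * e) = 0"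
proof -
  assume p: "prime p" "p dvd e"
  have "\<not> squarefree (p * e)"
  proof
    assume "squarefree (p * e)"
    moreover have "p ^ 2 dvd p * e" using p by (simp add: power2_eq_square)
    ultimately have "is_unit p" unfolding squarefree_def by blast
    thus False using p by (auto dest: not_prime_unit)
  qed
  thus ?thesis by (simp add: mu_def)
qed

text \<open>Fix a prime \<open>p\<close> dividing \<open>n\<close>. A divisor \<open>p * e\<close>
  with \<open>p\<close> not dividing \<open>e\<close> cancels against \<open>e\<close>, and
  multiples of \<open>p * p\<close> contribute 0.\<close>

lemma sum_mu:
  assumes "n > 0"
  shows "(\<Sum>d | d dvd n. mu d) = (if n = 1 then 1 else 0)"
proof (cases "n = 1")
  case False
  then obtain p where p: "prime p" "p dvd n" using prime_factor_nat by blast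
  have p0: "p > 0" using p prime_gt_0_nat by blast
  let ?A = "{d. d dvd n \<and> \<not> p dvd d}" and ?B = "{d. d dvd n \<and> p dvd d}"
  let ?E = "{e. p * e dvd n}"
  have fin: "finite {d. d dvd n}" using assms by simp
  have finE: "finite ?E" by (rule finite_subset[OF _ fin]) (auto dest: dvd_mult_right)
  have B: "?B = (\<lambda>e. p * e) ` ?E" by (auto elim!: dvdE)
  have "(\<Sum>d\<in>?B. mu d) = (\<Sum>e\<in>?E. mu (p * e))"
    unfolding B using p0 by (subst sum.reindex) (auto simp: inj_on_def)
  also have "\<dots> = (\<Sum>e\<in>?A. mu (p * e))"
  proof (rule sum.mono_neutral_right[OF finE])
    show "?A \<subseteq> ?E"
    proof
      fix d assume d: "d \<in> ?A"
      hence "coprime p d" using p prime_imp_coprime by blast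
      thus "d \<in> ?E" using d p by (simp add: divides_mult)
    qed
    show "\<forall>e\<in>?E - ?A. mu (p * e) = 0"
    proof
      fix e assume "e \<in> ?E - ?A"
      hence "p dvd e" by (auto dest: dvd_mult_right)
      thus "mu (p * e) = 0" using p mu_square_mult by blast
    qed
  qed
  also have "\<dots> = (\<Sum>e\<in>?A. - mu e)" using p by (intro sum.cong refl mu_prime_mult) auto
  finally have "(\<Sum>d\<in>?B. mu d) = - (\<Sum>d\<in>?A. mu d)" by (simp add: sum_negf)
  moreover have "(\<Sum>d | d dvd n. mu d) = (\<Sum>d\<in>?A. mu d) + (\<Sum>d\<in>?B. mu d)"
    by (subst sum.union_disjoint[symmetric]) (auto intro!: sum.cong finite_subset[OF _ fin])
  ultimately show ?thesis using False by simp
qed simp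

text \<open>Ramanujan's sum modulo \<open>c\<close> at \<open>m\<close>, in its divisor form,
  indexed by the complementary divisor \<open>s\<close>.\<close>

definition ramr :: "nat \<Rightarrow> nat \<Rightarrow> real" where
  "ramr m c = (\<Sum>s | s dvd c. if (c div s) dvd m then real_of_int (mu s) * real (c div s) else 0)"

text \<open>Coprimality is detected by \<open>sum_mu\<close>; for each \<open>s\<close> the
  multiples of \<open>s\<close> form a complete sum modulo \<open>c div s\<close>.\<close>

lemma kl_0_eq_ramr:
  assumes c: "c > 0"
  shows "kl c (int m) 0 = of_real (ramr m c)"
proof -
  have fin: "finite {s. s dvd c}" using c by simp
  have "kl c (int m) 0 = (\<Sum>t<c. if coprime t c then ee c (int t * int m) else 0)"
    unfolding kl_def units_below_def by (subst sum.inter_filter) (simp_all add: mult.commute[of "int m"] cong: if_cong)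
  also have "\<dots> = (\<Sum>t<c. \<Sum>s | s dvd c. if s dvd t then of_int (mu s) * ee c (int t * int m) else 0)"
  proof (intro sum.cong refl)
    fix t
    have g: "gcd t c > 0" using c by simp
    have "(\<Sum>s | s dvd c. if s dvd t then of_int (mu s) * ee c (int t * int m) else 0) =
       (\<Sum>s\<in>{s\<in>{s. s dvd c}. s dvd t}. of_int (mu s) * ee c (int t * int m))"
      using fin by (subst sum.inter_filter) auto
    also have "{s\<in>{s. s dvd c}. s dvd t} = {s. s dvd gcd t c}" by auto
    also have "(\<Sum>s | s dvd gcd t c. of_int (mu s) * ee c (int t * int m)) =
       of_int (\<Sum>s | s dvd gcd t c. mu s) * ee c (int t * int m)"
      by (simp add: sum_distrib_right)
    also have "\<dots> = (if coprime t c then ee c (int t * int m) else 0)"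
      unfolding sum_mu[OF g] coprime_iff_gcd_eq_1 by simp
    finally show "(if coprime t c then ee c (int t * int m) else 0) =
      (\<Sum>s | s dvd c. if s dvd t then of_int (mu s) * ee c (int t * int m) else 0)" ..
  qed
  also have "\<dots> = (\<Sum>s | s dvd c. \<Sum>t<c. if s dvd t then of_int (mu s) * ee c (int t * int m) else 0)"
    by (rule sum.swap)
  also have "\<dots> = (\<Sum>s | s dvd c. of_real (if (c div s) dvd m then real_of_int (mu s) * real (c div s) else 0))"
  proof (intro sum.cong refl)
    fix s assume "s \<in> {s. s dvd c}"
    then obtain k where k: "c = s * k" by (auto elim!: dvdE)
    hence pos: "s > 0" "k > 0" using c by auto
    have "(\<Sum>t<c. if s dvd t then of_int (mu s) * ee c (int t * int m) else 0) =
       (\<Sum>t\<in>{t\<in>{..<c}. s dvd t}. of_int (mu s) * ee c (int t * int m))"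
      by (subst sum.inter_filter) auto
    also have "{t\<in>{..<c}. s dvd t} = (\<lambda>t. s * t) ` {..<k}"
      using k pos by (auto elim!: dvdE)
    also have "(\<Sum>t\<in>(\<lambda>t. s * t) ` {..<k}. of_int (mu s) * ee c (int t * int m)) =
       (\<Sum>t<k. of_int (mu s) * ee c (int (s * t) * int m))"
      using pos by (subst sum.reindex) (auto simp: inj_on_def)
    also have "\<dots> = of_int (mu s) * (\<Sum>t<k. ee k (int t * int m))"
      using pos ee_scale'[of s k] by (simp add: k sum_distrib_left mult.assoc)
    also have "\<dots> = of_real (if (c div s) dvd m then real_of_int (mu s) * real (c div s) else 0)"
      using pos k by (simp add: sum_ee)
    finally show "(\<Sum>t<c. if s dvd t then of_int (mu s) * ee c (int t * int m) else 0) =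
      of_real (if (c div s) dvd m then real_of_int (mu s) * real (c div s) else 0)" .
  qed
  finally show ?thesis by (simp add: ramr_def)
qed

lemma zdens_eq_ramr:
  assumes q: "odd q"
  shows "zdens (int m) q = (\<Sum>c | c dvd q. chi c * ramr m c / real c) / real q"
proof -
  have q0: "q > 0" using q by (cases q) auto
  have "complex_of_real (zdens (int m) q) = (\<Sum>c | c dvd q. of_int (chi4 c) / of_nat c * kl c (int m) 0) / of_nat q"
    by (rule zdens_eq[OF q])
  also have "(\<Sum>c | c dvd q. of_int (chi4 c) / of_nat c * kl c (int m) 0) =
     (\<Sum>c | c dvd q. of_real (chi c * ramr m c / real c))"
    using q0 by (intro sum.cong refl, subst kl_0_eq_ramr) (auto intro: Nat.gr0I)
  finally have "complex_of_real (zdens (int m) q) = of_real ((\<Sum>c | c dvd q. chi c * ramr m c / real c) / real q)"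
    by simp
  thus ?thesis using of_real_eq_iff by blast
qed

lemma sum_divisors_flip:
  fixes f :: "nat \<Rightarrow> 'a :: comm_monoid_add"
  assumes "n > 0"
  shows "(\<Sum>d | d dvd n. f (n div d)) = (\<Sum>d | d dvd n. f d)"
  by (rule sum.reindex_bij_witness[of _ "\<lambda>d. n div d" "\<lambda>d. n div d"])
     (use assms in \<open>auto elim!: dvdE\<close>)

lemma abs_ramr_le:
  assumes "c > 0"
  shows "\<bar>ramr m c\<bar> \<le> real c * real (tau c)"
proof -
  have "\<bar>ramr m c\<bar> \<le> (\<Sum>s | s dvd c. \<bar>if (c div s) dvd m then real_of_int (mu s) * real (c div s) else 0\<bar>)"
    unfolding ramr_def by (rule sum_abs)
  also have "\<dots> \<le> (\<Sum>s | s dvd c. real c)"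
  proof (rule sum_mono)
    fix s
    have "\<bar>real_of_int (mu s)\<bar> * real (c div s) \<le> 1 * real c"
      using abs_mu_le[of s] by (intro mult_mono) (auto simp: div_le_dividend simp flip: of_int_abs)
    thus "\<bar>if (c div s) dvd m then real_of_int (mu s) * real (c div s) else 0\<bar> \<le> real c"
      by (simp add: abs_mult)
  qed
  finally show ?thesis by (simp add: mult.commute)
qed

lemma zdens_nonneg: "zdens m q \<ge> 0"
  by (simp add: zdens_def)

lemma zdens_le:
  assumes q: "odd q"
  shows "zdens (int m) q \<le> real (tau3 q) / real q"
proof -
  have q0: "q > 0" using q by (cases q) auto
  have "(\<Sum>c | c dvd q. chi c * ramr m c / real c) \<le> (\<Sum>c | c dvd q. real (tau c))"
  proof (rule sum_mono)
    fix c assume "c \<in> {c. c dvd q}"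
    hence c: "c > 0" using q0 by (auto intro: Nat.gr0I)
    have "chi c * ramr m c \<le> \<bar>chi c\<bar> * \<bar>ramr m c\<bar>"
      by (simp flip: abs_mult)
    also have "\<dots> \<le> 1 * (real c * real (tau c))"
      using abs_chi4_le[of c] abs_ramr_le[OF c] by (intro mult_mono) (auto simp flip: of_int_abs)
    finally show "chi c * ramr m c / real c \<le> real (tau c)"
      using c by (simp add: field_simps)
  qed
  also have "\<dots> = (\<Sum>c | c dvd q. real (tau (q div c)))"
    by (rule sum_divisors_flip[OF q0, symmetric])
  also have "\<dots> = real (tau3 q)" by (simp add: tau3_def)
  finally show ?thesis unfolding zdens_eq_ramr[OF q] by (rule divide_right_mono) simp
qed

section \<open>The truncated singular series\<close>

definition chs :: "nat \<Rightarrow> nat \<Rightarrow> real" where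
  "chs P y = (\<Sum>a\<in>{1..y}. if coprime a P then chi a / real a else 0)"

text \<open>Partial sum of the singular series of the divisor problem, with the primes of
  \<open>P\<close> left out. Those primes are treated separately, together with the congruence
  conditions imposed on the box.\<close>

definition zs :: "nat \<Rightarrow> nat \<Rightarrow> nat \<Rightarrow> real" where
  "zs m P Y = (\<Sum>q\<in>{1..Y}. if odd q \<and> coprime q P then chi q * zdens (int m) q else 0)"

definition zw :: "nat \<Rightarrow> nat \<Rightarrow> nat \<Rightarrow> nat \<Rightarrow> real" where
  "zw m P s g = (if odd s \<and> odd g \<and> coprime s P \<and> coprime g P \<and> g dvd m then
     real_of_int (mu s) / ((real s)\<^sup>2 * real g) else 0)"

lemma chs_0 [simp]: "chs P 0 = 0"
  by (simp add: chs_def)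

text \<open>In \<open>q = c * a\<close> the sign is \<open>chi q * chi c = chi a\<close>, since
  \<open>chi c\<close> squares to 1; in \<open>c = s * g\<close> Ramanujan's sum becomes
  \<open>zw\<close>. So the series is a truncation of \<open>L(1, chi4)\<close> times the sum of
  \<open>mu s / s^2\<close> times the sum of \<open>1 / g\<close> over \<open>g dvd m\<close>. The
  outer ranges use \<open>Y'\<close> instead of \<open>Y\<close>, at no cost because
  \<open>chs P 0 = 0\<close>, so that the sums for two cut-offs can be subtracted termwise.\<close>

lemma zs_eq:
  assumes "Y \<le> Y'"
  shows "zs m P Y = (\<Sum>s\<in>{1..Y'}. \<Sum>g\<in>{1..Y' div s}. zw m P s g * chs P (Y div s div g))"
proof -
  let ?ok = "\<lambda>c. odd c \<and> coprime c P"
  let ?r = "\<lambda>c. if ?ok c then ramr m c / (real c)\<^sup>2 else 0"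
  let ?v = "\<lambda>a. if coprime a P then chi a / real a else 0"
  have "zs m P Y = (\<Sum>q\<in>{1..Y}. \<Sum>c | c dvd q. ?r c * ?v (q div c))"
    unfolding zs_def
  proof (intro sum.cong refl)
    fix q assume q: "q \<in> {1..Y}"
    show "(if odd q \<and> coprime q P then chi q * zdens (int m) q else 0) =
      (\<Sum>c | c dvd q. ?r c * ?v (q div c))"
    proof (cases "odd q \<and> coprime q P")
      case True
      have "chi q * zdens (int m) q = (\<Sum>c | c dvd q. chi q * (chi c * ramr m c / real c / real q))"
        using True by (simp add: zdens_eq_ramr sum_divide_distrib sum_distrib_left)
      also have "\<dots> = (\<Sum>c | c dvd q. ?r c * ?v (q div c))"
      proof (intro sum.cong refl)
        fix c assume "c \<in> {c. c dvd q}"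
        then obtain a where a: "q = c * a" by (auto elim!: dvdE)
        have pos: "c > 0" "a > 0" using a q by (auto intro: Nat.gr0I)
        have ok: "odd c" "odd a" "coprime c P" "coprime a P" using True a by auto
        have "chi c * chi c = 1"
          using chi4_odd_square[OF ok(1)] by (simp flip: of_int_mult)
        hence "chi c * (chi c * x) = x" for x
          by (simp flip: mult.assoc)
        thus "chi q * (chi c * ramr m c / real c / real q) =
          ?r c * ?v (q div c)"
          using a pos ok by (simp add: chi4_mult power2_eq_square field_simps)
      qed
      finally show ?thesis using True by simp
    next
      case False
      have "(\<Sum>c | c dvd q. ?r c * ?v (q div c)) = (\<Sum>c | c dvd q. 0)"
      proof (intro sum.cong refl)
        fix c assume "c \<in> {c. c dvd q}"
        then obtain a where a: "q = c * a" by (auto elim!: dvdE)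
        have pos: "c > 0" "a > 0" using a q by (auto intro: Nat.gr0I)
        show "?r c * ?v (q div c) = 0"
          using False a pos by (auto simp: chi4_def)
      qed
      thus ?thesis using False by auto
    qed
  qed
  also have "\<dots> = (\<Sum>c\<in>{1..Y}. \<Sum>a\<in>{1..Y div c}. ?r c * (if coprime a P then chi a / real a else 0))"
    by (rule sum_divisors_swap)
  also have "\<dots> = (\<Sum>c\<in>{1..Y}. ?r c * chs P (Y div c))"
    by (simp only: chs_def sum_distrib_left)
  also have "\<dots> = (\<Sum>c\<in>{1..Y'}. ?r c * chs P (Y div c))"
    using assms by (intro sum.mono_neutral_left) auto
  also have "\<dots> = (\<Sum>c\<in>{1..Y'}. \<Sum>s | s dvd c. zw m P s (c div s) * chs P (Y div s div (c div s)))"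
  proof (intro sum.cong refl)
    fix c assume c: "c \<in> {1..Y'}"
    have "?r c = (\<Sum>s | s dvd c. zw m P s (c div s))"
    proof (cases "?ok c")
      case True
      have "?r c = (\<Sum>s | s dvd c. (if (c div s) dvd m then real_of_int (mu s) * real (c div s) else 0) / (real c)\<^sup>2)"
        using True by (simp add: ramr_def sum_divide_distrib)
      also have "\<dots> = (\<Sum>s | s dvd c. zw m P s (c div s))"
      proof (intro sum.cong refl)
        fix s assume "s \<in> {s. s dvd c}"
        then obtain g where g: "c = s * g" by (auto elim!: dvdE)
        have pos: "s > 0" "g > 0" using g c by (auto intro: Nat.gr0I)
        show "(if (c div s) dvd m then real_of_int (mu s) * real (c div s) else 0) / (real c)\<^sup>2 = zw m P s (c div s)"
          using True g pos by (simp add: zw_def power2_eq_square field_simps)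
      qed
      finally show ?thesis .
    next
      case False
      have "(\<Sum>s | s dvd c. zw m P s (c div s)) = (\<Sum>s | s dvd c. 0)"
      proof (intro sum.cong refl)
        fix s assume "s \<in> {s. s dvd c}"
        then obtain g where g: "c = s * g" by (auto elim!: dvdE)
        have pos: "s > 0" "g > 0" using g c by (auto intro: Nat.gr0I)
        show "zw m P s (c div s) = 0" using False g pos by (auto simp: zw_def)
      qed
      thus ?thesis using False by auto
    qed
    moreover have "Y div s div (c div s) = Y div c" if "s dvd c" for s
      using that by (simp flip: div_mult2_eq)
    ultimately show "?r c * chs P (Y div c) = (\<Sum>s | s dvd c. zw m P s (c div s) * chs P (Y div s div (c div s)))"
      by (simp add: sum_distrib_right)
  qed
  also have "\<dots> = (\<Sum>s\<in>{1..Y'}. \<Sum>g\<in>{1..Y' div s}. zw m P s g * chs P (Y div s div g))"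
    by (rule sum_divisors_swap)
  finally show ?thesis .
qed

definition altsum :: "nat \<Rightarrow> nat \<Rightarrow> real" where
  "altsum n k = (\<Sum>j\<in>{n..<n + k}. (- 1) ^ j / real (2 * j + 1))"

lemma altsum_Suc: "altsum n (Suc k) = (- 1) ^ n / real (2 * n + 1) + altsum (Suc n) k"
  unfolding altsum_def by (subst sum.atLeast_Suc_lessThan) auto

text \<open>The tail of an alternating series with decreasing terms has the sign of its first term
  and at most its size. Applied to Leibniz's series this bounds the tails of
  \<open>L(1, chi4)\<close>.\<close>

lemma altsum_sign:
  "0 \<le> (- 1) ^ n * altsum n k \<and> (- 1) ^ n * altsum n k \<le> 1 / real (2 * n + 1)"
proof (induction k arbitrary: n)
  case (Suc k)
  have "(- 1) ^ n * altsum n (Suc k) = 1 / real (2 * n + 1) - (- 1) ^ Suc n * altsum (Suc n) k"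
    by (simp add: altsum_Suc algebra_simps flip: power_add)
  moreover have "1 / real (2 * Suc n + 1) \<le> 1 / real (2 * n + 1)"
    by (intro divide_left_mono) auto
  ultimately show ?case using Suc.IH[of "Suc n"] by linarith
qed (simp add: altsum_def)

lemma chs_1_eq: "chs 1 y = altsum 0 ((y + 1) div 2)"
proof (induction y)
  case (Suc y)
  have "chs 1 (Suc y) = chs 1 y + chi (Suc y) / real (Suc y)"
    by (simp add: chs_def)
  also have "\<dots> = altsum 0 ((Suc y + 1) div 2)"
  proof (cases "even y")
    case True
    then obtain k where k: "y = 2 * k" by auto
    have "chi4 (Suc y) = (- 1) ^ k"
    proof (cases "even k")
      case True
      then obtain j where "k = 2 * j" by auto
      hence "Suc y mod 4 = 1" using k by (simp add: mod_Suc)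
      thus ?thesis using True k by (simp add: chi4_def)
    next
      case False
      then obtain j where "k = 2 * j + 1" by (auto elim!: oddE)
      hence "Suc y = 3 + 4 * j" using k by simp
      hence "Suc y mod 4 = 3" by presburger
      thus ?thesis using False k by (simp add: chi4_def)
    qed
    thus ?thesis using Suc.IH k by (simp add: altsum_def)
  next
    case False
    then obtain k where "y = 2 * k + 1" by (auto elim!: oddE)
    thus ?thesis using Suc.IH by (simp add: chi4_def altsum_def)
  qed
  finally show ?case .
qed (simp add: chs_def altsum_def)

lemma chs_1_diff:
  assumes "y \<le> y'"
  shows "\<bar>chs 1 y' - chs 1 y\<bar> \<le> 1 / real (y + 1)"
proof -
  define n where "n = (y + 1) div 2"
  define k where "k = (y' + 1) div 2 - n"
  have nk: "(y' + 1) div 2 = n + k" using assms by (simp add: n_def k_def div_le_mono)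
  have "altsum 0 (n + k) = altsum 0 n + altsum n k"
    unfolding altsum_def by (simp add: sum.atLeastLessThan_concat)
  hence "chs 1 y' - chs 1 y = altsum n k"
    by (simp only: chs_1_eq nk n_def[symmetric])
  moreover have "\<bar>altsum n k\<bar> = \<bar>(- 1) ^ n * altsum n k\<bar>" by (simp add: abs_mult power_abs)
  moreover have "\<bar>(- 1) ^ n * altsum n k\<bar> \<le> 1 / real (2 * n + 1)" using altsum_sign[of n k] by linarith
  moreover have "y + 1 \<le> 2 * n + 1" by (simp add: n_def)
  hence "1 / real (2 * n + 1) \<le> 1 / real (y + 1)" by (intro divide_left_mono) auto
  ultimately show ?thesis by linarith
qed

lemma chs_1_bounds:
  assumes "y \<ge> 1"
  shows "2 / 3 \<le> chs 1 y" "chs 1 y \<le> 1"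
proof -
  define n where "n = (y + 1) div 2"
  have n1: "n \<ge> 1" using assms by (simp add: n_def)
  have eq: "chs 1 y = altsum 0 n" by (simp only: chs_1_eq n_def)
  show "chs 1 y \<le> 1" using altsum_sign[of 0 n] unfolding eq by simp
  show "2 / 3 \<le> chs 1 y"
  proof (cases "n = 1")
    case True
    thus ?thesis unfolding eq by (simp add: altsum_def)
  next
    case False
    then obtain k where "n = Suc (Suc k)" using n1 by (metis One_nat_def not0_implies_Suc not_one_le_zero)
    hence "altsum 0 n = 2 / 3 + altsum 2 k" by (simp add: altsum_Suc numeral_2_eq_2)
    thus ?thesis using altsum_sign[of 2 k] unfolding eq by simp
  qed
qed

lemma chs_prime:
  assumes p: "prime p" "\<not> p dvd P"
  shows "chs (p * P) y = chs P y - chi p / real p * chs P (y div p)"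
proof -
  have p0: "p > 0" using p prime_gt_0_nat by blast
  let ?f = "\<lambda>a. if coprime a P then chi a / real a else 0"
  have cp: "coprime p P" using p prime_imp_coprime by blast
  have "chs P y = (\<Sum>a\<in>{a\<in>{1..y}. \<not> p dvd a}. ?f a) + (\<Sum>a\<in>{a\<in>{1..y}. p dvd a}. ?f a)"
    unfolding chs_def by (subst sum.union_disjoint[symmetric]) (auto intro!: sum.cong)
  also have "(\<Sum>a\<in>{a\<in>{1..y}. \<not> p dvd a}. ?f a) = chs (p * P) y"
  proof -
    have "(\<Sum>a\<in>{a\<in>{1..y}. \<not> p dvd a}. ?f a) = (\<Sum>a\<in>{1..y}. if \<not> p dvd a then ?f a else 0)"
      by (rule sum.inter_filter) simp
    also have "\<dots> = chs (p * P) y"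
      unfolding chs_def
    proof (intro sum.cong refl)
      fix a
      have "coprime a (p * P) \<longleftrightarrow> \<not> p dvd a \<and> coprime a P"
        using p(1) prime_imp_coprime[of p a] by (auto simp: coprime_commute dest: coprime_common_divisor)
      thus "(if \<not> p dvd a then ?f a else 0) = (if coprime a (p * P) then chi a / real a else 0)"
        by auto
    qed
    finally show ?thesis .
  qed
  also have "{a\<in>{1..y}. p dvd a} = (\<lambda>b. p * b) ` {1..y div p}"
  proof (intro Set.set_eqI iffI)
    fix c assume "c \<in> {c \<in> {1..y}. p dvd c}"
    then obtain a where "c = p * a" "c \<in> {1..y}" by auto
    thus "c \<in> (\<lambda>a. p * a) ` {1..y div p}" using p0
      by (auto simp: less_eq_div_iff_mult_less_eq mult.commute intro!: Nat.gr0I)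
  next
    fix c assume "c \<in> (\<lambda>a. p * a) ` {1..y div p}"
    thus "c \<in> {c \<in> {1..y}. p dvd c}" using p0
      by (auto simp: less_eq_div_iff_mult_less_eq mult.commute)
  qed
  also have "(\<Sum>a\<in>(\<lambda>b. p * b) ` {1..y div p}. ?f a) = (\<Sum>b\<in>{1..y div p}. ?f (p * b))"
    using p0 by (subst sum.reindex) (auto simp: inj_on_def)
  also have "\<dots> = (\<Sum>b\<in>{1..y div p}. chi p / real p * ?f b)"
    using cp by (intro sum.cong refl) (auto simp: chi4_mult)
  also have "\<dots> = chi p / real p * chs P (y div p)"
    by (simp only: chs_def sum_distrib_left)
  finally show ?thesis by simp
qed

text \<open>By \<open>chs_prime\<close> a further prime \<open>p\<close> adds a copy of the
  difference at \<open>y div p\<close>, weighted by \<open>1 / p\<close>. As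
  \<open>p * (y div p + 1) > y\<close>, the copy obeys the same bound, so each prime costs a factor
  2.\<close>

lemma chs_diff:
  assumes "finite S" "\<And>p. p \<in> S \<Longrightarrow> prime p" "y \<le> y'"
  shows "\<bar>chs (\<Prod>S) y' - chs (\<Prod>S) y\<bar> \<le> 2 ^ card S / real (y + 1)"
  using assms
proof (induction S arbitrary: y y' rule: finite_induct)
  case empty
  thus ?case using chs_1_diff by simp
next
  case (insert p S)
  have p: "prime p" using insert.prems by blast
  have p0: "p > 0" using p prime_gt_0_nat by blast
  have "\<not> p dvd \<Prod>S"
  proof
    assume "p dvd \<Prod>S"
    then obtain r where "r \<in> S" "p dvd r" using p insert.hyps by (auto simp: prime_dvd_prod_iff)
    thus False using insert.prems insert.hyps p by (metis insertCI primes_dvd_imp_eq)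
  qed
  note rec = chs_prime[OF p this]
  have "\<bar>chs (p * \<Prod>S) y' - chs (p * \<Prod>S) y\<bar> =
     \<bar>(chs (\<Prod>S) y' - chs (\<Prod>S) y) - chi p / real p * (chs (\<Prod>S) (y' div p) - chs (\<Prod>S) (y div p))\<bar>"
    unfolding rec by (simp add: algebra_simps)
  also have "\<dots> \<le> \<bar>chs (\<Prod>S) y' - chs (\<Prod>S) y\<bar> + \<bar>chi p / real p * (chs (\<Prod>S) (y' div p) - chs (\<Prod>S) (y div p))\<bar>"
    by (rule abs_triangle_ineq4)
  also have "\<bar>chi p / real p * (chs (\<Prod>S) (y' div p) - chs (\<Prod>S) (y div p))\<bar> \<le>
     1 / real p * (2 ^ card S / real (y div p + 1))"
    unfolding abs_mult
  proof (rule mult_mono)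
    show "\<bar>chi p / real p\<bar> \<le> 1 / real p"
      using abs_chi4_le[of p] p0 by (simp add: abs_divide divide_right_mono flip: of_int_abs)
    show "\<bar>chs (\<Prod>S) (y' div p) - chs (\<Prod>S) (y div p)\<bar> \<le> 2 ^ card S / real (y div p + 1)"
      using insert.prems by (intro insert.IH) (auto intro: div_le_mono)
  qed auto
  also have "\<dots> = 2 ^ card S / real (p * (y div p + 1))" using p0 by (simp only: of_nat_mult) simp
  also have "\<dots> \<le> 2 ^ card S / real (y + 1)"
  proof (intro divide_left_mono)
    have "y < p * (y div p + 1)" using p0 dividend_less_times_div[of p y] by simp
    thus "real (y + 1) \<le> real (p * (y div p + 1))" by linarith
    show "0 < real (p * (y div p + 1)) * real (y + 1)"
      using p0 by (simp only: of_nat_mult[symmetric] of_nat_0_less_iff) simp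
  qed simp
  also have "\<bar>chs (\<Prod>S) y' - chs (\<Prod>S) y\<bar> \<le> 2 ^ card S / real (y + 1)"
    using insert.prems by (intro insert.IH) auto
  finally show ?case using insert.hyps by simp
qed

text \<open>The summand is \<open>g^(-3/4) = g^(-1/4) * g^(-1/2)\<close>. Cauchy-Schwarz pairs
  \<open>gsig\<close> with a harmonic sum, so that \<open>gsig m\<close> enters only through its
  square root, as in the other error terms.\<close>

lemma sum_recip_divisors_le:
  assumes m: "m > 0" and L: "hsum N \<le> L"
  shows "(\<Sum>g\<in>{g\<in>{1..N}. g dvd m}. 1 / (sqrt (real g) * sqrt (sqrt (real g)))) \<le> sqrt (gsig m) * sqrt L"
proof -
  let ?G = "{g\<in>{1..N}. g dvd m}"
  have "(\<Sum>g\<in>?G. (1 / sqrt (sqrt (real g))) * (1 / sqrt (real g)))\<^sup>2 \<le>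
    (\<Sum>g\<in>?G. (1 / sqrt (sqrt (real g)))\<^sup>2) * (\<Sum>g\<in>?G. (1 / sqrt (real g))\<^sup>2)"
    by (rule Cauchy_Schwarz_ineq_sum)
  also have "\<dots> = (\<Sum>g\<in>?G. 1 / sqrt (real g)) * (\<Sum>g\<in>?G. 1 / real g)"
    by (simp add: power_divide)
  also have "\<dots> \<le> gsig m * L"
  proof (rule mult_mono)
    show "(\<Sum>g\<in>?G. 1 / sqrt (real g)) \<le> gsig m"
      unfolding gsig_def using m by (intro sum_mono2) auto
    have "(\<Sum>g\<in>?G. 1 / real g) \<le> hsum N" unfolding hsum_def by (intro sum_mono2) auto
    thus "(\<Sum>g\<in>?G. 1 / real g) \<le> L" using L by simp
  qed (use gsig_ge_1[OF m] in \<open>auto intro!: sum_nonneg\<close>)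
  finally have "(\<Sum>g\<in>?G. (1 / sqrt (sqrt (real g))) * (1 / sqrt (real g))) \<le> sqrt (gsig m * L)"
    by (rule real_le_rsqrt)
  thus ?thesis by (simp add: real_sqrt_mult mult.commute)
qed

text \<open>Convergence rate \<open>Y^(-1/4)\<close> of the singular series. The tail bound
  \<open>chs_diff\<close> applies to each pair \<open>(s, g)\<close>; the weaker exponent keeps the
  sums over \<open>s\<close> and over the divisors \<open>g\<close> of \<open>m\<close> within
  logarithms and \<open>sqrt (gsig m)\<close>.\<close>

lemma zs_diff:
  assumes S: "finite S" "\<And>p. p \<in> S \<Longrightarrow> prime p" and Y: "1 \<le> Y" "Y \<le> Y'"
    and m: "m > 0" and L: "hsum Y' \<le> L" "L \<ge> 1"
  shows "\<bar>zs m (\<Prod>S) Y' - zs m (\<Prod>S) Y\<bar> \<le> 2 ^ card S * L\<^sup>2 * sqrt (gsig m) / sqrt (sqrt (real Y))"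
proof -
  let ?P = "\<Prod>S" and ?Y4 = "sqrt (sqrt (real Y))"
  let ?k = "\<lambda>g. 1 / (sqrt (real g) * sqrt (sqrt (real g)))"
  have Y4: "?Y4 > 0" using Y by simp
  have "zs m ?P Y' - zs m ?P Y = (\<Sum>s\<in>{1..Y'}. \<Sum>g\<in>{1..Y' div s}. zw m ?P s g * (chs ?P (Y' div s div g) - chs ?P (Y div s div g)))"
    unfolding zs_eq[OF order_refl, of m ?P Y'] zs_eq[OF Y(2)] by (simp only: sum_subtractf[symmetric] right_diff_distrib)
  hence "\<bar>zs m ?P Y' - zs m ?P Y\<bar> \<le> (\<Sum>s\<in>{1..Y'}. \<Sum>g\<in>{1..Y' div s}. \<bar>zw m ?P s g * (chs ?P (Y' div s div g) - chs ?P (Y div s div g))\<bar>)"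
    by (simp only:) (rule order_trans[OF sum_abs sum_mono[OF sum_abs]])
  also have "\<dots> \<le> (\<Sum>s\<in>{1..Y'}. \<Sum>g\<in>{1..Y' div s}. (2 ^ card S / ?Y4) * (1 / real s) * (if g dvd m then ?k g else 0))"
  proof (intro sum_mono)
    fix s g assume s: "s \<in> {1..Y'}" and g: "g \<in> {1..Y' div s}"
    let ?n = "Y div s div g"
    have "?n = Y div (s * g)" by (simp add: div_mult2_eq)
    hence n: "Y < s * g * (?n + 1)" using dividend_less_times_div[of "s * g" Y] s g by simp
    have "Y div s div g \<le> Y' div s div g" using Y by (intro div_le_mono)
    hence d: "\<bar>chs ?P (Y' div s div g) - chs ?P ?n\<bar> \<le> 2 ^ card S / real (?n + 1)"
      using S by (intro chs_diff)
    \<comment> \<open>The tail is at most the minimum of 1 and \<open>s * g / Y\<close>; taking a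
      fourth root of \<open>g / Y\<close> interpolates between the two. Combined with the weight
      \<open>1 / (s^2 * g)\<close> this gives \<open>1 / s\<close> and
      \<open>g^(-3/4)\<close>.\<close>
    have e: "1 / real (?n + 1) \<le> real s * sqrt (sqrt (real g / real Y))"
    proof (cases "g \<ge> Y")
      case True
      have "1 / real (?n + 1) \<le> 1 * 1" by simp
      also have "\<dots> \<le> real s * sqrt (sqrt (real g / real Y))"
        using True Y s by (intro mult_mono) auto
      finally show ?thesis .
    next
      case False
      define u where "u = real g / real Y"
      have u: "0 < u" "u \<le> 1" using False g Y by (auto simp: u_def)
      have "real Y < real (s * g * (?n + 1))" using n by (rule of_nat_less_iff[THEN iffD2])
      hence "real Y < real s * real g * real (?n + 1)" by (simp only: of_nat_mult)
      hence "1 / real (?n + 1) \<le> real s * u" using Y by (simp add: u_def field_simps)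
      also have "u \<le> sqrt (sqrt u)"
      proof -
        have *: "x \<le> sqrt x" if "0 < x" "x \<le> 1" for x :: real
          using that by (intro real_le_rsqrt) (simp add: power2_eq_square mult_left_le)
        have "u \<le> sqrt u" using * u by blast
        also have "\<dots> \<le> sqrt (sqrt u)" using u by (intro *) auto
        finally show ?thesis .
      qed
      finally show ?thesis using s by (simp add: u_def)
    qed
    show "\<bar>zw m ?P s g * (chs ?P (Y' div s div g) - chs ?P (Y div s div g))\<bar> \<le>
      (2 ^ card S / ?Y4) * (1 / real s) * (if g dvd m then ?k g else 0)"
    proof (cases "g dvd m")
      case True
      have sg: "real s > 0" "real g > 0" using s g by auto
      have "\<bar>zw m ?P s g\<bar> \<le> 1 / ((real s)\<^sup>2 * real g)"
        using abs_mu_le[of s] sg by (simp add: zw_def abs_mult divide_right_mono flip: of_int_abs)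
      hence "\<bar>zw m ?P s g * (chs ?P (Y' div s div g) - chs ?P ?n)\<bar> \<le> 1 / ((real s)\<^sup>2 * real g) * (2 ^ card S / real (?n + 1))"
        unfolding abs_mult using d by (intro mult_mono) auto
      also have "\<dots> = (2 ^ card S / ((real s)\<^sup>2 * real g)) * (1 / real (?n + 1))" by simp
      also have "\<dots> \<le> (2 ^ card S / ((real s)\<^sup>2 * real g)) * (real s * sqrt (sqrt (real g / real Y)))"
        using e by (intro mult_left_mono) auto
      also have "\<dots> = (2 ^ card S / ?Y4) * (1 / real s) * (sqrt (sqrt (real g)) / real g)"
        using sg by (simp add: real_sqrt_divide power2_eq_square)
      also have "sqrt (sqrt (real g)) / real g = ?k g"
      proof -
        define r where "r = sqrt (sqrt (real g))"
        have r: "r * r = sqrt (real g)" "r > 0" using sg by (auto simp: r_def)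
        have "real g = sqrt (real g) * (r * r)" unfolding r(1) by simp
        hence "r / real g = r / (sqrt (real g) * (r * r))" by (rule arg_cong)
        also have "\<dots> = 1 / (sqrt (real g) * r)" using r(2) by simp
        finally show ?thesis by (simp only: r_def)
      qed
      finally show ?thesis using True by simp
    next
      case False
      thus ?thesis by (simp add: zw_def)
    qed
  qed
  also have "\<dots> \<le> (\<Sum>s\<in>{1..Y'}. (2 ^ card S / ?Y4) * (1 / real s) * (sqrt (gsig m) * sqrt L))"
  proof (rule sum_mono)
    fix s assume s: "s \<in> {1..Y'}"
    have "(\<Sum>g\<in>{1..Y' div s}. if g dvd m then ?k g else 0) = (\<Sum>g\<in>{g\<in>{1..Y' div s}. g dvd m}. ?k g)"
      by (rule sum.inter_filter[symmetric]) simp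
    also have "\<dots> \<le> sqrt (gsig m) * sqrt L"
      using hsum_mono[of "Y' div s" Y'] L by (intro sum_recip_divisors_le m) auto
    finally show "(\<Sum>g\<in>{1..Y' div s}. (2 ^ card S / ?Y4) * (1 / real s) * (if g dvd m then ?k g else 0)) \<le>
      (2 ^ card S / ?Y4) * (1 / real s) * (sqrt (gsig m) * sqrt L)"
      unfolding sum_distrib_left[symmetric] using Y4 by (intro mult_left_mono) auto
  qed
  also have "\<dots> = (2 ^ card S / ?Y4) * hsum Y' * (sqrt (gsig m) * sqrt L)"
    by (simp only: hsum_def sum_distrib_left[symmetric] sum_distrib_right[symmetric])
  also have "\<dots> \<le> (2 ^ card S / ?Y4) * L * (sqrt (gsig m) * L)"
  proof (intro mult_mono mult_left_mono)
    show "sqrt L \<le> L" using L by (intro real_le_lsqrt) (auto simp: power2_eq_square)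
  qed (use L Y4 gsig_ge_1[OF m] in \<open>auto simp: hsum_nonneg\<close>)
  also have "\<dots> = 2 ^ card S * L\<^sup>2 * sqrt (gsig m) / ?Y4" by (simp add: power2_eq_square)
  finally show ?thesis .
qed

text \<open>\<open>(2 * k + 1)^2\<close> exceeds \<open>4 * k * (k + 1)\<close>, and the reciprocals
  of the latter telescope to 1/4.\<close>

lemma sum_odd_inverse_squares: "(\<Sum>s\<in>{s\<in>{3..N}. odd s}. 1 / (real s)\<^sup>2) \<le> 1 / 4"
proof -
  have "(\<Sum>s\<in>{s\<in>{3..N}. odd s}. 1 / (real s)\<^sup>2) \<le> (\<Sum>k\<in>{1..N}. 1 / (real (2 * k + 1))\<^sup>2)"
  proof -
    have "{s\<in>{3..N}. odd s} \<subseteq> (\<lambda>k. 2 * k + 1) ` {1..N}" by (auto elim!: oddE)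
    hence "(\<Sum>s\<in>{s\<in>{3..N}. odd s}. 1 / (real s)\<^sup>2) \<le> (\<Sum>s\<in>(\<lambda>k. 2 * k + 1) ` {1..N}. 1 / (real s)\<^sup>2)"
      by (intro sum_mono2) auto
    also have "\<dots> = (\<Sum>k\<in>{1..N}. 1 / (real (2 * k + 1))\<^sup>2)"
      by (subst sum.reindex) (auto simp: inj_on_def)
    finally show ?thesis .
  qed
  also have "\<dots> \<le> (\<Sum>k\<in>{1..N}. (1 / 4) * (1 / real k - 1 / real (Suc k)))"
  proof (rule sum_mono)
    fix k assume "k \<in> {1..N}"
    hence k: "real k > 0" by simp
    have "1 / (real (2 * k + 1))\<^sup>2 \<le> 1 / (4 * real k * real (Suc k))"
    proof (intro divide_left_mono)
      show "4 * real k * real (Suc k) \<le> (real (2 * k + 1))\<^sup>2" by (simp add: power2_eq_square algebra_simps)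
      show "0 < (real (2 * k + 1))\<^sup>2 * (4 * real k * real (Suc k))"
        using k by (intro mult_pos_pos zero_less_power) auto
    qed simp
    also have "\<dots> = (1 / 4) * (1 / real k - 1 / real (Suc k))" using k by (simp add: field_simps)
    finally show "1 / (real (2 * k + 1))\<^sup>2 \<le> (1 / 4) * (1 / real k - 1 / real (Suc k))" .
  qed
  also have "\<dots> = (1 / 4) * (1 - 1 / real (Suc N))"
  proof -
    have "(\<Sum>k\<in>{1..N}. 1 / real k - 1 / real (Suc k)) = 1 - 1 / real (Suc N)"
      by (induction N) auto
    thus ?thesis by (simp only: sum_distrib_left[symmetric])
  qed
  also have "\<dots> \<le> 1 / 4" by simp
  finally show ?thesis .
qed

text \<open>For each odd \<open>g dvd m\<close> the term \<open>s = 1\<close> gives at least 2/3 of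
  \<open>1 / g\<close>, the first two terms of Leibniz's series, and all odd
  \<open>s \<ge> 3\<close> together at most 1/4 of it. So every \<open>g\<close> contributes
  nonnegatively and \<open>g = 1\<close> alone gives 2/3 - 1/4 = 5/12.\<close>

lemma zs_1_lower:
  assumes Y: "Y \<ge> 1"
  shows "zs m 1 Y \<ge> 5 / 12"
proof -
  have sw: "(\<Sum>s\<in>{1..Y}. \<Sum>g\<in>{1..Y div s}. f s g) = (\<Sum>g\<in>{1..Y}. \<Sum>s\<in>{1..Y div g}. (f s g :: real))" for f
  proof -
    have div: "{1..Y div s} = {g\<in>{1..Y}. s * g \<le> Y}" if "s \<in> {1..Y}" for s
    proof -
      have 1: "g \<le> Y div s \<longleftrightarrow> s * g \<le> Y" for g
        using that by (simp add: less_eq_div_iff_mult_less_eq mult.commute)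
      have 2: "g \<le> Y" if "g \<le> Y div s" for g using that div_le_dividend by (rule le_trans)
      show ?thesis
      proof (rule Set.set_eqI)
        fix g show "g \<in> {1..Y div s} \<longleftrightarrow> g \<in> {g\<in>{1..Y}. s * g \<le> Y}"
          using 1[of g] 2[of g] unfolding atLeastAtMost_iff mem_Collect_eq by blast
      qed
    qed
    have "(\<Sum>s\<in>{1..Y}. \<Sum>g\<in>{1..Y div s}. f s g) = (\<Sum>s\<in>{1..Y}. \<Sum>g\<in>{g\<in>{1..Y}. s * g \<le> Y}. f s g)"
      by (intro sum.cong div refl)
    also have "\<dots> = (\<Sum>g\<in>{1..Y}. \<Sum>s\<in>{s\<in>{1..Y}. s * g \<le> Y}. f s g)" by (rule sum.swap_restrict) auto
    also have "\<dots> = (\<Sum>g\<in>{1..Y}. \<Sum>s\<in>{1..Y div g}. f s g)"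
    proof (rule sum.cong[OF refl])
      fix g assume "g \<in> {1..Y}"
      hence "{s\<in>{1..Y}. s * g \<le> Y} = {1..Y div g}" unfolding mult.commute[of _ g] by (rule div[symmetric])
      thus "(\<Sum>s\<in>{s\<in>{1..Y}. s * g \<le> Y}. f s g) = (\<Sum>s\<in>{1..Y div g}. f s g)" by (rule sum.cong) (rule refl)
    qed
    finally show ?thesis .
  qed
  have inner: "(\<Sum>s\<in>{1..Y div g}. zw m 1 s g * chs 1 (Y div s div g)) \<ge> (if odd g \<and> g dvd m then 5 / 12 / real g else 0)"
    if g: "g \<in> {1..Y}" for g
  proof (cases "odd g \<and> g dvd m")
    case True
    have gp: "real g > 0" using g by simp
    have Yg: "Y div g \<ge> 1" using g by (simp add: less_eq_div_iff_mult_less_eq)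
    let ?h = "\<lambda>s. (if odd s then real_of_int (mu s) / (real s)\<^sup>2 else 0) * chs 1 (Y div g div s)"
    have "(\<Sum>s\<in>{1..Y div g}. zw m 1 s g * chs 1 (Y div s div g)) = (\<Sum>s\<in>{1..Y div g}. (1 / real g) * ?h s)"
      using True by (intro sum.cong refl) (simp add: zw_def mult.commute flip: div_mult2_eq)
    also have "\<dots> = (1 / real g) * (\<Sum>s\<in>{1..Y div g}. ?h s)" by (simp only: sum_distrib_left)
    finally have eq: "(\<Sum>s\<in>{1..Y div g}. zw m 1 s g * chs 1 (Y div s div g)) = (1 / real g) * (\<Sum>s\<in>{1..Y div g}. ?h s)" .
    have "(\<Sum>s\<in>{1..Y div g}. ?h s) \<ge> 5 / 12"
    proof -
      have "{1..Y div g} = insert 1 {2..Y div g}" using Yg by auto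
      hence "(\<Sum>s\<in>{1..Y div g}. ?h s) = chs 1 (Y div g) + (\<Sum>s\<in>{2..Y div g}. ?h s)" by simp
      moreover have "\<bar>\<Sum>s\<in>{2..Y div g}. ?h s\<bar> \<le> 1 / 4"
      proof -
        have "\<bar>\<Sum>s\<in>{2..Y div g}. ?h s\<bar> \<le> (\<Sum>s\<in>{2..Y div g}. \<bar>?h s\<bar>)" by (rule sum_abs)
        also have "\<dots> \<le> (\<Sum>s\<in>{2..Y div g}. if odd s then 1 / (real s)\<^sup>2 else 0)"
        proof (rule sum_mono)
          fix s assume s: "s \<in> {2..Y div g}"
          hence "Y div g div s \<ge> 1" by (simp add: less_eq_div_iff_mult_less_eq)
          hence c: "\<bar>chs 1 (Y div g div s)\<bar> \<le> 1" using chs_1_bounds[of "Y div g div s"] by linarith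
          have "\<bar>real_of_int (mu s) / (real s)\<^sup>2\<bar> \<le> 1 / (real s)\<^sup>2"
            using abs_mu_le[of s] by (simp add: divide_right_mono flip: of_int_abs)
          hence "\<bar>real_of_int (mu s) / (real s)\<^sup>2 * chs 1 (Y div g div s)\<bar> \<le> 1 / (real s)\<^sup>2 * 1"
            unfolding abs_mult using c by (intro mult_mono) auto
          thus "\<bar>?h s\<bar> \<le> (if odd s then 1 / (real s)\<^sup>2 else 0)" by simp
        qed
        also have "\<dots> = (\<Sum>s\<in>{s\<in>{2..Y div g}. odd s}. 1 / (real s)\<^sup>2)"
          by (rule sum.inter_filter[symmetric]) simp
        also have "{s\<in>{2..Y div g}. odd s} = {s\<in>{3..Y div g}. odd s}"
        proof -
          have "2 \<le> s \<and> odd s \<longleftrightarrow> 3 \<le> s \<and> odd s" for s :: nat by presburger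
          thus ?thesis by auto
        qed
        also have "(\<Sum>s\<in>{s\<in>{3..Y div g}. odd s}. 1 / (real s)\<^sup>2) \<le> 1 / 4" by (rule sum_odd_inverse_squares)
        finally show ?thesis .
      qed
      ultimately show ?thesis using chs_1_bounds(1)[OF Yg] by linarith
    qed
    hence "(1 / real g) * (5 / 12) \<le> (1 / real g) * (\<Sum>s\<in>{1..Y div g}. ?h s)"
      by (rule mult_left_mono) simp
    thus ?thesis unfolding eq using True by simp
  next
    case False
    thus ?thesis by (auto simp: zw_def)
  qed
  have "zs m 1 Y = (\<Sum>g\<in>{1..Y}. \<Sum>s\<in>{1..Y div g}. zw m 1 s g * chs 1 (Y div s div g))"
    unfolding zs_eq[OF order_refl] by (rule sw)
  also have "\<dots> \<ge> (\<Sum>g\<in>{1..Y}. if odd g \<and> g dvd m then 5 / 12 / real g else 0)"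
    by (intro sum_mono inner)
  also have "(\<Sum>g\<in>{1..Y}. if odd g \<and> g dvd m then 5 / 12 / real g else 0) \<ge> (if odd (1 :: nat) \<and> 1 dvd m then 5 / 12 / real 1 else 0)"
    using Y by (intro member_le_sum) auto
  finally show ?thesis by simp
qed

lemma abs_zs_le:
  assumes "hsum Y \<le> L"
  shows "\<bar>zs m P Y\<bar> \<le> L ^ 3"
proof -
  let ?z = "\<lambda>q. if odd q \<and> coprime q P then chi q * zdens (int m) q else 0"
  have "\<bar>zs m P Y\<bar> \<le> (\<Sum>q\<in>{1..Y}. \<bar>?z q\<bar>)"
    unfolding zs_def by (rule sum_abs)
  also have "\<dots> \<le> (\<Sum>q\<in>{1..Y}. real (tau3 q) / real q)"
  proof (rule sum_mono)
    fix q
    show "\<bar>?z q\<bar> \<le> real (tau3 q) / real q"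
    proof (cases "odd q")
      case True
      have "\<bar>chi q\<bar> * \<bar>zdens (int m) q\<bar> \<le> 1 * zdens (int m) q"
        using abs_chi4_le[of q] zdens_nonneg[of "int m" q] by (intro mult_mono) (auto simp flip: of_int_abs)
      also have "\<dots> \<le> real (tau3 q) / real q" using zdens_le[OF True] by simp
      finally show ?thesis by (simp add: abs_mult)
    qed simp
  qed
  also have "\<dots> \<le> hsum Y ^ 3" by (rule sum_tau3_le)
  also have "\<dots> \<le> L ^ 3" using assms by (intro power_mono hsum_nonneg)
  finally show ?thesis .
qed

section \<open>The divisor sum of chi4 over the box\<close>

type_synonym box_fun = "int \<Rightarrow> int \<Rightarrow> real"
abbreviation box1 :: box_fun where "box1 \<equiv> \<lambda>_ _. 1"

definition per2 :: "nat \<Rightarrow> box_fun \<Rightarrow> bool" where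
  "per2 N F \<longleftrightarrow> (\<forall>i j i' j'. [i = i'] (mod int N) \<longrightarrow> [j = j'] (mod int N) \<longrightarrow> F i j = F i' j')"

definition mean2 :: "nat \<Rightarrow> box_fun \<Rightarrow> real" where
  "mean2 N F = (\<Sum>a<N. \<Sum>b<N. F (int a) (int b)) / (real N)\<^sup>2"

lemma per2D: "per2 N F \<Longrightarrow> [i = i'] (mod int N) \<Longrightarrow> [j = j'] (mod int N) \<Longrightarrow> F i j = F i' j'"
  by (auto simp: per2_def)

lemma per2_dvd:
  assumes "per2 N F" "N dvd N'"
  shows "per2 N' F"
  unfolding per2_def
proof (intro allI impI)
  fix i j i' j' :: int assume "[i = i'] (mod int N')" "[j = j'] (mod int N')"
  hence "[i = i'] (mod int N)" "[j = j'] (mod int N)"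
    using assms(2) by (meson cong_dvd_modulus int_dvd_int_iff)+
  thus "F i j = F i' j'" using assms(1) by (rule per2D[rotated])
qed

lemma per2_mult: "per2 N F \<Longrightarrow> per2 N G \<Longrightarrow> per2 N (\<lambda>i j. F i j * G i j)"
  unfolding per2_def by metis

lemma sum_period_mult:
  fixes f :: "int \<Rightarrow> real"
  assumes per: "\<And>x y. [x = y] (mod int N) \<Longrightarrow> f x = f y"
  shows "(\<Sum>a<N * k. f (int a)) = real k * (\<Sum>a<N. f (int a))"
proof -
  have "(\<Sum>a<N * k. f (int a)) = (\<Sum>i<k. \<Sum>x = i * N..<i * N + N. f (int x))"
    unfolding mult.commute[of N k] by (rule sum.nat_group[symmetric])
  also have "\<dots> = (\<Sum>i<k. \<Sum>a<N. f (int a))"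
  proof (rule sum.cong[OF refl])
    fix i
    have "(\<Sum>x = i * N..<i * N + N. f (int x)) = (\<Sum>x = 0 + i * N..<N + i * N. f (int x))"
      by (simp add: add.commute)
    also have "\<dots> = (\<Sum>x = 0..<N. f (int (x + i * N)))" by (rule sum.shift_bounds_nat_ivl)
    also have "\<dots> = (\<Sum>a<N. f (int a))"
      unfolding lessThan_atLeast0 by (intro sum.cong refl per) (simp add: cong_iff_dvd_diff)
    finally show "(\<Sum>x = i * N..<i * N + N. f (int x)) = (\<Sum>a<N. f (int a))" .
  qed
  finally show ?thesis by simp
qed

lemma mean2_dvd:
  assumes per: "per2 N F" and N: "N dvd N'" "N' > 0"
  shows "mean2 N' F = mean2 N F"
proof -
  obtain k where k: "N' = N * k" using N by (auto elim!: dvdE)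
  hence pos: "N > 0" "k > 0" using N by auto
  have "(\<Sum>a<N'. \<Sum>b<N'. F (int a) (int b)) = (\<Sum>a<N'. real k * (\<Sum>b<N. F (int a) (int b)))"
    unfolding k by (intro sum.cong refl sum_period_mult per2D[OF per]) auto
  also have "\<dots> = real k * (\<Sum>a<N * k. (\<lambda>x. \<Sum>b<N. F x (int b)) (int a))"
    by (simp add: k sum_distrib_left)
  also have "(\<Sum>a<N * k. (\<lambda>x. \<Sum>b<N. F x (int b)) (int a)) = real k * (\<Sum>a<N. \<Sum>b<N. F (int a) (int b))"
    by (rule sum_period_mult) (auto intro!: sum.cong per2D[OF per])
  finally show ?thesis using pos by (simp add: mean2_def k power2_eq_square)
qed

lemma mean2_mono: "(\<And>i j. F i j \<le> G i j) \<Longrightarrow> mean2 N F \<le> mean2 N G"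
  unfolding mean2_def by (intro divide_right_mono sum_mono) auto

lemma abs_sum_mult_diff_le:
  fixes c f g w :: "'a \<Rightarrow> real"
  assumes "\<And>q. q \<in> A \<Longrightarrow> \<bar>c q\<bar> \<le> 1" "\<And>q. q \<in> A \<Longrightarrow> \<bar>f q - g q\<bar> \<le> w q"
  shows "\<bar>(\<Sum>q\<in>A. c q * f q) - (\<Sum>q\<in>A. c q * g q)\<bar> \<le> (\<Sum>q\<in>A. w q)"
proof -
  have "(\<Sum>q\<in>A. c q * f q) - (\<Sum>q\<in>A. c q * g q) = (\<Sum>q\<in>A. c q * (f q - g q))"
    by (simp add: sum_subtractf right_diff_distrib)
  also have "\<bar>\<dots>\<bar> \<le> (\<Sum>q\<in>A. \<bar>c q\<bar> * \<bar>f q - g q\<bar>)" unfolding abs_mult[symmetric] by (rule sum_abs)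
  also have "\<dots> \<le> (\<Sum>q\<in>A. 1 * w q)" using assms by (intro sum_mono mult_mono) auto
  finally show ?thesis by simp
qed

lemma abs_mean2_le: "\<bar>mean2 N F\<bar> \<le> mean2 N (\<lambda>i j. \<bar>F i j\<bar>)"
proof -
  have "\<bar>\<Sum>a<N. \<Sum>b<N. F (int a) (int b)\<bar> \<le> (\<Sum>a<N. \<Sum>b<N. \<bar>F (int a) (int b)\<bar>)"
    by (rule order_trans[OF sum_abs sum_mono[OF sum_abs]])
  thus ?thesis unfolding mean2_def by (simp add: abs_divide divide_right_mono)
qed

text \<open>Residue classes are represented by \<open>1, ..., D\<close>, matching the range
  \<open>{1..H}\<close>. The class of \<open>a\<close> has \<open>(H + D - a) div D\<close> members,
  an expression that involves no truncated subtraction for \<open>a \<le> D\<close>.\<close>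

lemma sum_classes:
  fixes f :: "nat \<Rightarrow> 'a :: comm_monoid_add"
  assumes D: "D > 0"
  shows "(\<Sum>i\<in>{1..H}. f i) = (\<Sum>a\<in>{1..D}. \<Sum>x<(H + D - a) div D. f (a + D * x))"
proof -
  have "(\<Sum>i\<in>{1..H}. f i) = (\<Sum>z\<in>(SIGMA a:{1..D}. {..<(H + D - a) div D}). f (fst z + D * snd z))"
  proof (rule sum.reindex_bij_witness[of _ "\<lambda>z. fst z + D * snd z" "\<lambda>i. ((i - 1) mod D + 1, (i - 1) div D)"])
    fix i assume i: "i \<in> {1..H}"
    define a x where "a = (i - 1) mod D" and "x = (i - 1) div D"
    have ix: "i = a + D * x + 1" "a < D" using i D by (auto simp: a_def x_def)
    show "fst ((i - 1) mod D + 1, (i - 1) div D) + D * snd ((i - 1) mod D + 1, (i - 1) div D) = i"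
      using ix unfolding a_def[symmetric] x_def[symmetric] by simp
    have "(Suc x) * D \<le> H + D - (a + 1)" using ix i by (simp add: algebra_simps)
    hence "Suc x \<le> (H + D - (a + 1)) div D" using D less_eq_div_iff_mult_less_eq by blast
    thus "((i - 1) mod D + 1, (i - 1) div D) \<in> (SIGMA a:{1..D}. {..<(H + D - a) div D})"
      using ix unfolding a_def[symmetric] x_def[symmetric] by simp
    show "f (fst ((i - 1) mod D + 1, (i - 1) div D) + D * snd ((i - 1) mod D + 1, (i - 1) div D)) = f i"
      using ix unfolding a_def[symmetric] x_def[symmetric] by simp
  next
    fix z assume "z \<in> (SIGMA a:{1..D}. {..<(H + D - a) div D})"
    then obtain a x where z: "z = (a, x)" "a \<in> {1..D}" "x < (H + D - a) div D" by auto
    have "Suc x \<le> (H + D - a) div D" using z by simp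
    hence "Suc x * D \<le> H + D - a" using D less_eq_div_iff_mult_less_eq by blast
    hence "D + D * x \<le> H + D - a" by (simp add: algebra_simps)
    hence "a + D * x \<le> H" using z(2) D by (simp only: atLeastAtMost_iff)
    thus "fst z + D * snd z \<in> {1..H}" using z by simp
    have "a + D * x - 1 = (a - 1) + D * x" using z by simp
    moreover have "a - 1 < D" using z by auto
    hence "(a - 1 + D * x) mod D = a - 1" "(a - 1 + D * x) div D = x" by simp_all
    ultimately have "(a + D * x - 1) mod D = a - 1" "(a + D * x - 1) div D = x" by simp_all
    thus "((fst z + D * snd z - 1) mod D + 1, (fst z + D * snd z - 1) div D) = z" using z by simp
  qed
  also have "\<dots> = (\<Sum>a\<in>{1..D}. \<Sum>x<(H + D - a) div D. f (a + D * x))"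
    by (subst sum.Sigma) (auto simp: case_prod_beta)
  finally show ?thesis .
qed

lemma real_div_minus_div_le: "real n / real k - real (n div k) \<le> 1"
  using real_of_int_div3[of "int n" "int k"] by (simp flip: zdiv_int)

lemma class_size:
  assumes "a \<in> {1..D}"
  shows "\<bar>real ((H + D - a) div D) - real H / real D\<bar> \<le> 1"
proof -
  have D: "real D > 0" using assms by simp
  define N where "N = H + D - a"
  have "real N / real D = real H / real D + (1 - real a / real D)"
    using assms D by (simp add: N_def of_nat_diff field_simps)
  moreover have "0 \<le> real a / real D" "real a / real D \<le> 1" using assms D by (auto simp: field_simps)
  moreover have "real (N div D) \<le> real N / real D" by (rule of_nat_div_le_of_nat)
  moreover have "real N / real D - real (N div D) \<le> 1" by (rule real_div_minus_div_le)
  ultimately show ?thesis unfolding N_def by linarith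
qed

lemma zcount_of_bool:
  "real (zcount q m a b M A B) = (\<Sum>x<A. \<Sum>y<B. of_bool (int q dvd m - (a + M * int x)\<^sup>2 - (b + M * int y)\<^sup>2))"
proof -
  let ?P = "\<lambda>z. int q dvd m - (a + M * int (fst z))\<^sup>2 - (b + M * int (snd z))\<^sup>2"
  have "{(x, y) \<in> {..<A} \<times> {..<B}. int q dvd m - (a + M * int x)\<^sup>2 - (b + M * int y)\<^sup>2} = {z \<in> {..<A} \<times> {..<B}. ?P z}"
    by auto
  hence "real (zcount q m a b M A B) = (\<Sum>z\<in>{z \<in> {..<A} \<times> {..<B}. ?P z}. 1)" by (simp add: zcount_def)
  also have "\<dots> = (\<Sum>z\<in>{..<A} \<times> {..<B}. of_bool (?P z))"
    by (subst sum.inter_filter) (auto simp: of_bool_def)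
  also have "\<dots> = (\<Sum>x<A. \<Sum>y<B. of_bool (?P (x, y)))" by (rule sum.cartesian_product')
  finally show ?thesis by simp
qed

text \<open>For positive \<open>n\<close> this is, by Jacobi's formula, a quarter of the number of
  representations as a sum of two squares. What is proved below is that it is nonnegative and that
  positivity implies a representation.\<close>

definition rr :: "nat \<Rightarrow> int" where "rr n = (\<Sum>q | q dvd n. chi4 q)"

text \<open>Dirichlet's hyperbola method with a cut-off \<open>Q\<close> that is the same for all
  \<open>n\<close> of the box, so that the sums over \<open>n\<close> and \<open>q\<close> can be
  exchanged. As \<open>n = 1\<close> modulo 4, \<open>chi4\<close> agrees on \<open>q\<close> and
  \<open>n div q\<close>, and the divisors up to \<open>Q\<close> match those with cofactor up to
  \<open>Q\<close>. The error consists of divisors with both \<open>q\<close> and its cofactor above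
  \<open>Q\<close>.\<close>

lemma rr_hyperbola:
  assumes n: "n mod 4 = 1" "Q ^ 2 < n" "n \<le> X ^ 2"
  shows "\<bar>rr n - 2 * (\<Sum>q\<in>{q\<in>{1..Q}. odd q}. chi4 q * of_bool (q dvd n))\<bar> \<le>
    2 * (\<Sum>q\<in>{q\<in>{Q<..X}. odd q}. of_bool (q dvd n))"
proof -
  have n0: "n > 0" using n by (intro Nat.gr0I) simp
  have oddn: "odd n" using n by presburger
  let ?D = "{q. q dvd n}"
  have fin: "finite ?D" using n0 by simp
  let ?A = "{q \<in> ?D. q \<le> Q}" and ?B = "{q \<in> ?D. Q < q \<and> n div q \<le> Q}" and ?C = "{q \<in> ?D. Q < q \<and> Q < n div q}"
  have oddD: "odd q" if "q dvd n" for q using that oddn by (auto elim!: dvdE)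
  have flip: "chi4 (n div q) = chi4 q" if q: "q dvd n" for q
  proof -
    have "chi4 q * chi4 (n div q) = chi4 n" using q by (simp flip: chi4_mult)
    also have "chi4 n = 1" using n oddn by (simp add: chi4_def)
    finally show ?thesis using oddD[OF q] by (simp add: chi4_def split: if_splits)
  qed
  have "?D = ?A \<union> (?B \<union> ?C)" by auto
  hence "rr n = (\<Sum>q\<in>?A \<union> (?B \<union> ?C). chi4 q)"
    unfolding rr_def by (rule arg_cong[of _ _ "sum chi4"])
  also have "\<dots> = (\<Sum>q\<in>?A. chi4 q) + ((\<Sum>q\<in>?B. chi4 q) + (\<Sum>q\<in>?C. chi4 q))"
  proof -
    have "(\<Sum>q\<in>?A \<union> (?B \<union> ?C). chi4 q) = (\<Sum>q\<in>?A. chi4 q) + (\<Sum>q\<in>?B \<union> ?C. chi4 q)"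
      using fin by (intro sum.union_disjoint) auto
    also have "(\<Sum>q\<in>?B \<union> ?C. chi4 q) = (\<Sum>q\<in>?B. chi4 q) + (\<Sum>q\<in>?C. chi4 q)"
      using fin by (intro sum.union_disjoint) auto
    finally show ?thesis .
  qed
  also have "(\<Sum>q\<in>?B. chi4 q) = (\<Sum>q\<in>?A. chi4 q)"
  proof (rule sum.reindex_bij_witness[of _ "\<lambda>q. n div q" "\<lambda>q. n div q"])
    fix q assume q: "q \<in> ?A"
    then obtain e where e: "n = q * e" by (auto elim!: dvdE)
    have pos: "q > 0" "e > 0" using e n0 by auto
    have "Q < e"
    proof (rule ccontr)
      assume "\<not> Q < e"
      hence "q * e \<le> Q * Q" using q by (intro mult_mono) auto
      thus False using n(2) e by (simp add: power2_eq_square)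
    qed
    thus "n div q \<in> ?B" using q e pos by auto
    show "n div (n div q) = q" using e pos by simp
  next
    fix q assume q: "q \<in> ?B"
    then obtain e where e: "n = q * e" by (auto elim!: dvdE)
    have pos: "q > 0" "e > 0" using e n0 by auto
    show "n div q \<in> ?A" using q e pos by auto
    show "n div (n div q) = q" using e pos by simp
    show "chi4 (n div q) = chi4 q" using q flip by auto
  qed
  finally have 1: "rr n - 2 * (\<Sum>q\<in>?A. chi4 q) = (\<Sum>q\<in>?C. chi4 q)" by simp
  have "(\<Sum>q\<in>{q\<in>{1..Q}. odd q}. chi4 q * of_bool (q dvd n)) = (\<Sum>q\<in>?A. chi4 q)"
  proof (rule sum.mono_neutral_cong_right)
    show "?A \<subseteq> {q \<in> {1..Q}. odd q}" using oddD n0 by (auto simp: Suc_le_eq intro: Nat.gr0I)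
  qed auto
  hence "\<bar>rr n - 2 * (\<Sum>q\<in>{q\<in>{1..Q}. odd q}. chi4 q * of_bool (q dvd n))\<bar> = \<bar>\<Sum>q\<in>?C. chi4 q\<bar>" using 1 by simp
  also have "\<dots> \<le> (\<Sum>q\<in>?C. \<bar>chi4 q\<bar>)" by (rule sum_abs)
  also have "\<dots> \<le> (\<Sum>q\<in>?C. 1)" by (intro sum_mono abs_chi4_le)
  also have "\<dots> = int (card ?C)" by simp
  \<comment> \<open>As \<open>n \<le> X^2\<close>, either \<open>q\<close> or its cofactor is at
    most \<open>X\<close>, so the leftover divisors are covered by those in \<open>{Q<..X}\<close>
    and their cofactors.\<close>
  also have "int (card ?C) \<le> int (2 * card {q\<in>?D. Q < q \<and> q \<le> X})"
  proof -
    let ?E = "{q\<in>?D. Q < q \<and> q \<le> X}"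
    have "?C \<subseteq> ?E \<union> (\<lambda>q. n div q) ` ?E"
    proof
      fix q assume q: "q \<in> ?C"
      then obtain e where e: "n = q * e" by (auto elim!: dvdE)
      have pos: "q > 0" "e > 0" using e n0 by auto
      show "q \<in> ?E \<union> (\<lambda>q. n div q) ` ?E"
      proof (cases "q \<le> X")
        case False
        have "e \<le> X"
        proof (rule ccontr)
          assume "\<not> e \<le> X"
          hence "Suc X * Suc X \<le> q * e" using False by (intro mult_mono) auto
          thus False using n(3) e by (simp add: power2_eq_square)
        qed
        hence "e \<in> ?E" using q e pos by auto
        moreover have "q = n div e" using e pos by simp
        ultimately show ?thesis by blast
      qed (use q in auto)
    qed
    hence "card ?C \<le> card (?E \<union> (\<lambda>q. n div q) ` ?E)" using fin by (intro card_mono) auto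
    also have "\<dots> \<le> card ?E + card ((\<lambda>q. n div q) ` ?E)" by (rule card_Un_le)
    also have "\<dots> \<le> 2 * card ?E" using card_image_le[of ?E "\<lambda>q. n div q"] fin by auto
    finally show ?thesis by (rule of_nat_mono)
  qed
  also have "card {q\<in>?D. Q < q \<and> q \<le> X} = card {q\<in>{q\<in>{Q<..X}. odd q}. q dvd n}"
    using oddD by (intro arg_cong[of _ _ card]) auto
  also have "int (2 * card {q\<in>{q\<in>{Q<..X}. odd q}. q dvd n}) = 2 * (\<Sum>q\<in>{q\<in>{Q<..X}. odd q}. of_bool (q dvd n))"
  proof -
    have "{q\<in>{q\<in>{Q<..X}. odd q}. q dvd n} = {q\<in>{Q<..X}. odd q} \<inter> {q. q dvd n}" by blast
    moreover have "finite {q\<in>{Q<..X}. odd q}" by simp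
    ultimately show ?thesis by (simp only: sum_of_bool_eq of_nat_mult of_nat_numeral)
  qed
  finally show ?thesis .
qed

text \<open>The squared coordinates are \<open>2 * i + al\<close> and \<open>2 * j + be\<close>; the
  condition on \<open>m mod 4\<close> says that their parities leave \<open>n = 1\<close> modulo 4.
  The two inequalities for \<open>m\<close> give \<open>Q^2 < n \<le> X^2\<close> throughout the
  box, as the hyperbola method requires.\<close>

locale four_sq_box =
  fixes m al be H Q X :: nat and L :: real
  assumes al: "al \<le> 1" and be: "be \<le> 1" and m_mod: "m mod 4 = 1 + al + be"
    and Qm: "Q ^ 2 + 2 * (2 * H + 1) ^ 2 < m" and mX: "m \<le> X ^ 2" and Q1: "Q \<ge> 1"
    and hX: "hsum X \<le> L" and L1: "L \<ge> 1"
begin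

definition nn :: "int \<Rightarrow> int \<Rightarrow> int" where
  "nn i j = int m - (2 * i + int al)\<^sup>2 - (2 * j + int be)\<^sup>2"

abbreviation rn :: "nat \<Rightarrow> nat \<Rightarrow> real" where
  "rn i j \<equiv> real_of_int (rr (nat (nn (int i) (int j))))"

abbreviation dn :: "nat \<Rightarrow> box_fun" where
  "dn q i j \<equiv> of_bool (int q dvd nn i j)"

definition SF :: "box_fun \<Rightarrow> real" where
  "SF F = (\<Sum>i\<in>{1..H}. \<Sum>j\<in>{1..H}. F (int i) (int j) * rn i j)"

definition CF :: "nat \<Rightarrow> box_fun \<Rightarrow> real" where
  "CF q F = (\<Sum>i\<in>{1..H}. \<Sum>j\<in>{1..H}. F (int i) (int j) * of_bool (int q dvd nn (int i) (int j)))"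

lemma m0: "m > 0" using Qm by simp

lemma QX: "Q \<le> X"
proof (rule ccontr)
  assume "\<not> Q \<le> X"
  hence "X ^ 2 \<le> Q ^ 2" by (intro power_mono) auto
  thus False using Qm mX by linarith
qed

lemma HX: "H \<le> X"
proof (rule ccontr)
  assume "\<not> H \<le> X"
  hence "X ^ 2 \<le> H ^ 2" by (intro power_mono) auto
  moreover have "H ^ 2 \<le> (2 * H + 1) ^ 2" by (intro power_mono) auto
  ultimately show False using Qm mX by linarith
qed

lemma X1: "X \<ge> 1" using QX Q1 by simp

lemma nn_bounds:
  assumes "i \<in> {1..H}" "j \<in> {1..H}"
  shows "int (Q ^ 2) < nn (int i) (int j)" "nn (int i) (int j) \<le> int (X ^ 2)"
proof -
  have "(2 * int i + int al)\<^sup>2 \<le> (2 * int H + 1)\<^sup>2" "(2 * int j + int be)\<^sup>2 \<le> (2 * int H + 1)\<^sup>2"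
    using assms al be by (intro power_mono; simp)+
  moreover have "int (Q ^ 2) + 2 * (2 * int H + 1)\<^sup>2 < int m"
    using of_nat_less_iff[where 'a = int, THEN iffD2, OF Qm]
    by (simp only: of_nat_add of_nat_mult of_nat_power of_nat_1 of_nat_numeral)
  ultimately show "int (Q ^ 2) < nn (int i) (int j)" unfolding nn_def by linarith
  have "int m \<le> int (X ^ 2)" using mX by (rule of_nat_mono)
  moreover have "(2 * int i + int al)\<^sup>2 \<ge> 0" "(2 * int j + int be)\<^sup>2 \<ge> 0" by auto
  ultimately show "nn (int i) (int j) \<le> int (X ^ 2)" unfolding nn_def by linarith
qed

lemma nn_mod4: "nn i j mod 4 = 1"
proof -
  have al2: "(int al)\<^sup>2 = int al" "(int be)\<^sup>2 = int be" using al be by (auto simp: le_Suc_eq)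
  define k where "k = i\<^sup>2 + i * int al + j\<^sup>2 + j * int be"
  have "nn i j = int m - int al - int be - 4 * k"
    unfolding nn_def power2_sum al2 k_def by (simp add: power2_eq_square algebra_simps)
  moreover have "(int m - int al - int be) mod 4 = 1"
  proof -
    have "int m mod 4 = 1 + int al + int be" using m_mod by (metis of_nat_1 of_nat_add of_nat_numeral zmod_int)
    thus ?thesis by presburger
  qed
  ultimately show ?thesis by presburger
qed

lemma nat_nn:
  assumes "i \<in> {1..H}" "j \<in> {1..H}"
  shows "nat (nn (int i) (int j)) mod 4 = 1" "Q ^ 2 < nat (nn (int i) (int j))"
    "nat (nn (int i) (int j)) \<le> X ^ 2" "int q dvd nn (int i) (int j) \<longleftrightarrow> q dvd nat (nn (int i) (int j))"
proof -
  define k where "k = nat (nn (int i) (int j))"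
  have "nn (int i) (int j) > 0" using nn_bounds(1)[OF assms] by linarith
  hence k: "nn (int i) (int j) = int k" by (simp add: k_def)
  show "nat (nn (int i) (int j)) mod 4 = 1" using nn_mod4[of "int i" "int j"] unfolding k nat_int by presburger
  show "Q ^ 2 < nat (nn (int i) (int j))" using nn_bounds(1)[OF assms] unfolding k by (simp only: of_nat_less_iff nat_int)
  show "nat (nn (int i) (int j)) \<le> X ^ 2" using nn_bounds(2)[OF assms] unfolding k by (simp only: of_nat_le_iff nat_int)
  show "int q dvd nn (int i) (int j) \<longleftrightarrow> q dvd nat (nn (int i) (int j))" unfolding k by simp
qed

text \<open>Divisors between \<open>Q\<close> and \<open>X\<close>, counted without sign over the
  whole box: the error of the hyperbola method.\<close>

definition Tsum :: real where
  "Tsum = (\<Sum>q\<in>{q\<in>{Q<..X}. odd q}. CF q box1)"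

lemma SF_approx:
  assumes F: "\<And>i j. \<bar>F i j\<bar> \<le> 1"
  shows "\<bar>SF F - 2 * (\<Sum>q\<in>{q\<in>{1..Q}. odd q}. chi q * CF q F)\<bar> \<le> 2 * Tsum"
proof -
  let ?A = "{q\<in>{1..Q}. odd q}" and ?B = "{q\<in>{Q<..X}. odd q}"
  let ?d = "\<lambda>q i j. of_bool (int q dvd nn (int i) (int j)) :: real"
  have pt: "\<bar>rn i j - 2 * (\<Sum>q\<in>?A. chi q * ?d q i j)\<bar> \<le> 2 * (\<Sum>q\<in>?B. ?d q i j)"
    if ij: "i \<in> {1..H}" "j \<in> {1..H}" for i j
  proof -
    define k where "k = nat (nn (int i) (int j))"
    have "\<bar>rr k - 2 * (\<Sum>q\<in>?A. chi4 q * of_bool (q dvd k))\<bar> \<le> 2 * (\<Sum>q\<in>?B. of_bool (q dvd k))"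
      using nat_nn[OF ij] unfolding k_def by (intro rr_hyperbola)
    hence "real_of_int \<bar>rr k - 2 * (\<Sum>q\<in>?A. chi4 q * of_bool (q dvd k))\<bar> \<le> real_of_int (2 * (\<Sum>q\<in>?B. of_bool (q dvd k)))"
      by (rule of_int_le_iff[THEN iffD2])
    thus ?thesis unfolding k_def by (simp add: nat_nn(4)[OF ij])
  qed
  have swap: "(\<Sum>q\<in>A. c q * CF q G) = (\<Sum>i\<in>{1..H}. \<Sum>j\<in>{1..H}. G (int i) (int j) * (\<Sum>q\<in>A. c q * ?d q i j))" for A c G
  proof -
    have "(\<Sum>q\<in>A. c q * CF q G) = (\<Sum>q\<in>A. \<Sum>i\<in>{1..H}. \<Sum>j\<in>{1..H}. G (int i) (int j) * (c q * ?d q i j))"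
      unfolding CF_def sum_distrib_left by (intro sum.cong refl) (simp only: mult_ac)
    also have "\<dots> = (\<Sum>i\<in>{1..H}. \<Sum>q\<in>A. \<Sum>j\<in>{1..H}. G (int i) (int j) * (c q * ?d q i j))" by (rule sum.swap)
    also have "\<dots> = (\<Sum>i\<in>{1..H}. \<Sum>j\<in>{1..H}. \<Sum>q\<in>A. G (int i) (int j) * (c q * ?d q i j))"
      by (intro sum.cong refl sum.swap)
    finally show ?thesis by (simp only: sum_distrib_left)
  qed
  have "SF F - 2 * (\<Sum>q\<in>?A. chi q * CF q F) =
     (\<Sum>i\<in>{1..H}. \<Sum>j\<in>{1..H}. F (int i) (int j) * (rn i j - 2 * (\<Sum>q\<in>?A. chi q * ?d q i j)))"
    unfolding swap SF_def right_diff_distrib sum_subtractf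
    by (simp only: sum_distrib_left mult.left_commute[of 2])
  hence "\<bar>SF F - 2 * (\<Sum>q\<in>?A. chi q * CF q F)\<bar> \<le>
     (\<Sum>i\<in>{1..H}. \<Sum>j\<in>{1..H}. \<bar>F (int i) (int j) * (rn i j - 2 * (\<Sum>q\<in>?A. chi q * ?d q i j))\<bar>)"
    by (simp only:) (rule order_trans[OF sum_abs sum_mono[OF sum_abs]])
  also have "\<dots> \<le> (\<Sum>i\<in>{1..H}. \<Sum>j\<in>{1..H}. 1 * (2 * (\<Sum>q\<in>?B. ?d q i j)))"
    unfolding abs_mult by (intro sum_mono mult_mono F pt) auto
  also have "\<dots> = 2 * (\<Sum>q\<in>?B. 1 * CF q box1)"
    unfolding swap sum_distrib_left mult_1_left ..
  finally show ?thesis by (simp only: Tsum_def mult_1_left)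
qed

lemma CF_1_bound:
  assumes q: "odd q" "q \<le> X"
  shows "CF q box1 \<le> (real H)\<^sup>2 * zdens (int m) q + theta m L (2 * real H) q"
proof -
  have q0: "q \<ge> 1" using q by (cases q) auto
  have "CF q box1 = (\<Sum>x<H. \<Sum>y<H. of_bool (int q dvd int m - (int (al + 2) + 2 * int x)\<^sup>2 - (int (be + 2) + 2 * int y)\<^sup>2))"
  proof -
    have "CF q box1 = (\<Sum>i\<in>{1..H}. \<Sum>j\<in>{1..H}. of_bool (int q dvd nn (int i) (int j)))" by (simp add: CF_def)
    also have "\<dots> = (\<Sum>x<H. \<Sum>y<H. of_bool (int q dvd nn (int (x + 1)) (int (y + 1))))"
    proof -
      have *: "(\<Sum>i\<in>{1..H}. g i) = (\<Sum>x<H. g (x + 1))" for g :: "nat \<Rightarrow> real"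
        by (rule sum.reindex_bij_witness[of _ "\<lambda>x. x + 1" "\<lambda>i. i - 1"]) auto
      show ?thesis unfolding * ..
    qed
    finally show ?thesis by (simp add: nn_def algebra_simps)
  qed
  also have "\<dots> = real (zcount q (int m) (int (al + 2)) (int (be + 2)) 2 H H)"
    unfolding zcount_of_bool ..
  finally have eq: "CF q box1 = real (zcount q (int m) (int (al + 2)) (int (be + 2)) 2 H H)" .
  have "\<bar>real (zcount q (int m) (int (al + 2)) (int (be + 2)) 2 H H) - real H * real H * zdens (int m) q\<bar> \<le>
     (\<Sum>c | c dvd q. kb m c * (real (H + H) * L + real c * L ^ 2)) / real q"
  proof (rule zcount_bound)
    show "coprime 2 (int q)" using q by simp
    show "norm (kl c (int m) n) \<le> kb m c" if "c dvd q" for c n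
      using that q by (intro norm_kl_le_kb) (auto elim!: dvdE)
    have "(\<Sum>h\<in>{1..<q}. 1 / real h) \<le> hsum X"
      unfolding hsum_def using q by (intro sum_mono2) auto
    thus "(\<Sum>h\<in>{1..<q}. 1 / real h) \<le> L" using hX by simp
  qed fact
  also have "\<dots> = theta m L (2 * real H) q" by (simp add: theta_def)
  finally show ?thesis unfolding eq by (simp add: power2_eq_square)
qed

lemma Tsum_bound:
  "Tsum \<le> (real H)\<^sup>2 * (\<Sum>q\<in>{q\<in>{Q<..X}. odd q}. zdens (int m) q) +
     sqrt (gsig m) * L ^ 5 * (2 * real H + real X) * real X powr (3/4)"
proof -
  have "Tsum \<le> (\<Sum>q\<in>{q\<in>{Q<..X}. odd q}. (real H)\<^sup>2 * zdens (int m) q + theta m L (2 * real H) q)"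
    unfolding Tsum_def by (intro sum_mono CF_1_bound) auto
  also have "\<dots> = (real H)\<^sup>2 * (\<Sum>q\<in>{q\<in>{Q<..X}. odd q}. zdens (int m) q) + (\<Sum>q\<in>{q\<in>{Q<..X}. odd q}. theta m L (2 * real H) q)"
    by (simp add: sum.distrib sum_distrib_left)
  also have "(\<Sum>q\<in>{q\<in>{Q<..X}. odd q}. theta m L (2 * real H) q) \<le> (\<Sum>q\<in>{1..X}. theta m L (2 * real H) q)"
    using L1 Q1 by (intro sum_mono2 theta_nonneg) auto
  also have "\<dots> \<le> sqrt (gsig m) * L ^ 5 * (2 * real H + real X) * real X powr (3/4)"
    using hX L1 m0 by (intro sum_theta_le) auto
  finally show ?thesis by simp
qed

lemma nn_cong:
  assumes "[i = i'] (mod int N)" "[j = j'] (mod int N)"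
  shows "[nn i j = nn i' j'] (mod int N)"
  unfolding nn_def by (intro cong_diff cong_pow cong_add cong_mult cong_refl assms)

lemma per2_dvd_nn: "per2 q (\<lambda>i j. dn q i j)"
  unfolding per2_def
proof (intro allI impI)
  fix i j i' j' assume "[i = i'] (mod int q)" "[j = j'] (mod int q)"
  hence "int q dvd nn i j \<longleftrightarrow> int q dvd nn i' j'" by (intro cong_dvd_iff nn_cong)
  thus "dn q i j = (of_bool (int q dvd nn i' j') :: real)" by (rule arg_cong)
qed

text \<open>For odd \<open>q\<close> the maps \<open>i -> 2 * i + al\<close> and
  \<open>j -> 2 * j + be\<close> permute the residues modulo \<open>q\<close>, so the parities do
  not affect the density.\<close>

lemma mean2_dvd_nn:
  assumes q: "odd q"
  shows "mean2 q (\<lambda>i j. dn q i j) = zdens (int m) q"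
proof -
  have q0: "q > 0" using q by (cases q) auto
  have two: "coprime 2 (int q)" using q by simp
  let ?g = "\<lambda>x y. of_bool (int q dvd int m - x\<^sup>2 - y\<^sup>2) :: real"
  have gc: "?g x y = ?g x' y'" if "[x = x'] (mod int q)" "[y = y'] (mod int q)" for x y x' y'
  proof -
    have "[int m - x\<^sup>2 - y\<^sup>2 = int m - x'\<^sup>2 - y'\<^sup>2] (mod int q)"
      by (intro cong_diff cong_pow cong_refl that)
    hence "int q dvd int m - x\<^sup>2 - y\<^sup>2 \<longleftrightarrow> int q dvd int m - x'\<^sup>2 - y'\<^sup>2" by (rule cong_dvd_iff)
    thus ?thesis by simp
  qed
  have "(\<Sum>a<q. \<Sum>b<q. of_bool (int q dvd nn (int a) (int b)) :: real) = (\<Sum>a<q. \<Sum>b<q. ?g (int al + 2 * int a) (int be + 2 * int b))"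
    by (simp add: nn_def add.commute)
  also have "\<dots> = (\<Sum>a<q. \<Sum>b<q. ?g (int al + 2 * int a) (int b))"
    by (intro sum.cong refl sum_residues_affine gc two q0) auto
  also have "\<dots> = (\<Sum>a<q. \<Sum>b<q. ?g (int a) (int b))"
  proof (rule sum_residues_affine[of q "\<lambda>x. \<Sum>b<q. ?g x (int b)" 2 "int al"])
    fix x y assume "[x = y] (mod int q)"
    thus "(\<Sum>b<q. ?g x (int b)) = (\<Sum>b<q. ?g y (int b))" by (intro sum.cong refl gc) auto
  qed (fact two q0)+
  also have "\<dots> = real (zcount q (int m) 0 0 1 q q)" by (simp add: zcount_of_bool)
  finally show ?thesis by (simp add: mean2_def zdens_def)
qed

end

text \<open>Below \<open>2^J\<close> no prime occurs with exponent \<open>J\<close> or more, so the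
  gcd with \<open>P^J\<close> takes out the full part of \<open>q\<close> composed of primes of
  \<open>P\<close>.\<close>

lemma coprime_div_gcd_power:
  fixes q P :: nat
  assumes q: "q > 0" "q < 2 ^ J"
  shows "coprime (q div gcd q (P ^ J)) P"
proof (rule ccontr)
  define q2 where "q2 = gcd q (P ^ J)"
  define q1 where "q1 = q div q2"
  have qq: "q = q1 * q2" by (simp add: q1_def q2_def)
  assume "\<not> coprime (q div gcd q (P ^ J)) P"
  hence "gcd q1 P \<noteq> 1" unfolding q1_def q2_def coprime_iff_gcd_eq_1 .
  then obtain p where p: "prime p" "p dvd gcd q1 P" using prime_factor_nat by blast
  hence pd: "p dvd q1" "p dvd P" by auto
  define k where "k = multiplicity p q"
  have pk: "p ^ k dvd q" unfolding k_def by (rule multiplicity_dvd)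
  have "(2 :: nat) ^ k \<le> p ^ k" using p prime_ge_2_nat by (intro power_mono) auto
  also have "\<dots> \<le> q" using pk q dvd_imp_le by blast
  finally have "(2 :: nat) ^ k < 2 ^ J" using q(2) by (rule le_less_trans)
  hence kJ: "k < J" by simp
  have "p ^ k dvd P ^ k" using pd(2) by (rule dvd_power_same)
  also have "P ^ k dvd P ^ J" using kJ by (intro le_imp_power_dvd) simp
  finally have "p ^ k dvd q2" using pk by (simp add: q2_def)
  hence "p * p ^ k dvd q" unfolding qq using pd by (intro mult_dvd_mono)
  hence "Suc k \<le> multiplicity p q"
    using q p by (intro multiplicity_geI) (auto dest: not_prime_unit)
  thus False by (simp add: k_def)
qed

text \<open>Unique factorisation into a part prime to \<open>P\<close> and a part \<open>q2\<close>
  dividing \<open>P^J\<close>. Completion with step \<open>2 * D\<close> requires moduli prime to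
  \<open>D\<close>; the part \<open>q2\<close> is moved into the periodic function instead.\<close>

lemma sum_split_smooth_part:
  fixes f :: "nat \<Rightarrow> real"
  assumes P: "odd P" and J: "Q < 2 ^ J"
  shows "(\<Sum>q\<in>{q\<in>{1..Q}. odd q}. f q) =
    (\<Sum>q2\<in>{q\<in>{1..Q}. q dvd P ^ J}. \<Sum>q1\<in>{q\<in>{1..Q div q2}. odd q \<and> coprime q P}. f (q1 * q2))"
proof -
  let ?E = "{q\<in>{1..Q}. q dvd P ^ J}"
  let ?R = "\<lambda>q2. {q\<in>{1..Q div q2}. odd q \<and> coprime q P}"
  have "(\<Sum>q\<in>{q\<in>{1..Q}. odd q}. f q) =
    (\<Sum>z\<in>(SIGMA q2:?E. ?R q2). f (snd z * fst z))"
  proof (rule sum.reindex_bij_witness[of _ "\<lambda>z. snd z * fst z" "\<lambda>q. (gcd q (P ^ J), q div gcd q (P ^ J))"])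
    fix q assume q: "q \<in> {q\<in>{1..Q}. odd q}"
    define q2 where "q2 = gcd q (P ^ J)"
    define q1 where "q1 = q div q2"
    have qq: "q = q1 * q2" by (simp add: q1_def q2_def)
    have pos: "q1 > 0" "q2 > 0" using q qq by (auto intro: Nat.gr0I)
    have cop: "coprime q1 P" unfolding q1_def q2_def using q J by (intro coprime_div_gcd_power) auto
    have "q2 \<le> q1 * q2" using pos by simp
    also have "\<dots> \<le> Q" using q qq by simp
    finally have "q2 \<le> Q" .
    moreover have "q1 \<le> Q div q2" using q qq pos by (simp add: less_eq_div_iff_mult_less_eq)
    moreover have "q2 dvd P ^ J" by (simp add: q2_def)
    ultimately show "(gcd q (P ^ J), q div gcd q (P ^ J)) \<in> (SIGMA q2:?E. ?R q2)"
      unfolding q2_def[symmetric] q1_def[symmetric] using pos cop q qq by auto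
    show "snd (gcd q (P ^ J), q div gcd q (P ^ J)) * fst (gcd q (P ^ J), q div gcd q (P ^ J)) = q" by simp
    show "f (snd (gcd q (P ^ J), q div gcd q (P ^ J)) * fst (gcd q (P ^ J), q div gcd q (P ^ J))) = f q" by simp
  next
    fix z assume "z \<in> (SIGMA q2:?E. ?R q2)"
    then obtain q2 q1 where z: "z = (q2, q1)" "q2 \<in> {1..Q}" "q2 dvd P ^ J" "q1 \<in> {1..Q div q2}" "odd q1" "coprime q1 P"
      by auto
    have "q1 * q2 \<le> Q" using z by (simp add: less_eq_div_iff_mult_less_eq)
    moreover have "odd q2" using z P by (meson dvd_trans even_power)
    moreover have "q1 * q2 \<ge> 1" using z by (simp add: Suc_le_eq)
    ultimately show "snd z * fst z \<in> {q\<in>{1..Q}. odd q}" using z by simp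
    have "coprime q1 (P ^ J)" using z by simp
    hence "coprime (P ^ J) q1" by (simp only: coprime_commute)
    hence "gcd (q1 * q2) (P ^ J) = gcd q2 (P ^ J)" by (rule gcd_mult_left_left_cancel)
    also have "\<dots> = q2" using z by (simp add: gcd_nat.absorb1)
    finally show "(gcd (snd z * fst z) (P ^ J), snd z * fst z div gcd (snd z * fst z) (P ^ J)) = z"
      using z by simp
  qed
  also have "\<dots> = (\<Sum>q2\<in>?E. \<Sum>q1\<in>?R q2. f (q1 * q2))"
    by (subst sum.Sigma) (auto simp: case_prod_beta)
  finally show ?thesis .
qed

lemma sum_1_to_eq_sum_below:
  fixes f :: "int \<Rightarrow> real"
  assumes per: "\<And>x y. [x = y] (mod int N) \<Longrightarrow> f x = f y" and N: "N > 0"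
  shows "(\<Sum>a\<in>{1..N}. f (int a)) = (\<Sum>a<N. f (int a))"
proof -
  have "(\<Sum>a\<in>{1..N}. f (int a)) = (\<Sum>a<N. f (1 + int a))"
    by (rule sum.reindex_bij_witness[of _ "\<lambda>x. x + 1" "\<lambda>i. i - 1"]) auto
  also have "\<dots> = (\<Sum>a<N. f (int a))" by (rule sum_residues_shift) (fact per N)+
  finally show ?thesis .
qed

lemma mean2_eq_sum_1_to:
  assumes per: "per2 N F" and N: "N > 0"
  shows "(real N)\<^sup>2 * mean2 N F = (\<Sum>a\<in>{1..N}. \<Sum>b\<in>{1..N}. F (int a) (int b))"
proof -
  have "(\<Sum>a\<in>{1..N}. \<Sum>b\<in>{1..N}. F (int a) (int b)) = (\<Sum>a\<in>{1..N}. \<Sum>b<N. F (int a) (int b))"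
    by (intro sum.cong refl sum_1_to_eq_sum_below N per2D[OF per]) auto
  also have "\<dots> = (\<Sum>a<N. \<Sum>b<N. F (int a) (int b))"
    by (rule sum_1_to_eq_sum_below[where f = "\<lambda>x. \<Sum>b<N. F x (int b)"])
       (auto intro!: sum.cong per2D[OF per] simp: N)
  finally show ?thesis using N by (simp add: mean2_def)
qed

context four_sq_box begin

text \<open>Each pair of classes modulo \<open>D\<close> is a box of side about \<open>H / D\<close>
  with step \<open>2 * D\<close>, a unit modulo \<open>q\<close>, so \<open>zcount_bound\<close>
  applies. The second error term comes from rounding the side lengths.\<close>

lemma CF_class_bound:
  assumes G: "per2 D G" and D: "D > 0" and q: "odd q" "q \<le> X" "coprime q D"
  shows "\<bar>CF q G - (real H)\<^sup>2 * mean2 D G * zdens (int m) q\<bar> \<le>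
    (real D)\<^sup>2 * mean2 D (\<lambda>i j. \<bar>G i j\<bar>) *
      (theta m L (2 * real H / real D + 2) q + (2 * real H / real D + 1) * zdens (int m) q)"
proof -
  have q0: "q > 0" using q by (cases q) auto
  define A where "A = (\<lambda>a. (H + D - a) div D)"
  define h where "h = real H / real D"
  define B where "B = theta m L (2 * h + 2) q + (2 * h + 1) * zdens (int m) q"
  have h0: "h \<ge> 0" by (simp add: h_def)
  let ?z = "\<lambda>a b. real (zcount q (int m) (2 * int a + int al) (2 * int b + int be) (2 * int D) (A a) (A b))"
  have "CF q G = (\<Sum>a\<in>{1..D}. \<Sum>x<A a. \<Sum>b\<in>{1..D}. \<Sum>y<A b.
      G (int (a + D * x)) (int (b + D * y)) * of_bool (int q dvd nn (int (a + D * x)) (int (b + D * y))))"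
    unfolding CF_def A_def by (simp only: sum_classes[OF D, of _ H])
  also have "\<dots> = (\<Sum>a\<in>{1..D}. \<Sum>x<A a. \<Sum>b\<in>{1..D}. \<Sum>y<A b.
      G (int a) (int b) * of_bool (int q dvd int m - (2 * int a + int al + 2 * int D * int x)\<^sup>2 - (2 * int b + int be + 2 * int D * int y)\<^sup>2))"
  proof (intro sum.cong refl)
    fix a x b y
    have "G (int (a + D * x)) (int (b + D * y)) = G (int a) (int b)"
      by (intro per2D[OF G]) (simp_all add: cong_iff_dvd_diff)
    moreover have "nn (int (a + D * x)) (int (b + D * y)) =
       int m - (2 * int a + int al + 2 * int D * int x)\<^sup>2 - (2 * int b + int be + 2 * int D * int y)\<^sup>2"
      unfolding nn_def by (simp add: algebra_simps)
    ultimately show "G (int (a + D * x)) (int (b + D * y)) * of_bool (int q dvd nn (int (a + D * x)) (int (b + D * y))) =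
      G (int a) (int b) * of_bool (int q dvd int m - (2 * int a + int al + 2 * int D * int x)\<^sup>2 - (2 * int b + int be + 2 * int D * int y)\<^sup>2)"
      by (simp only:)
  qed
  also have "\<dots> = (\<Sum>a\<in>{1..D}. \<Sum>b\<in>{1..D}. \<Sum>x<A a. \<Sum>y<A b.
      G (int a) (int b) * of_bool (int q dvd int m - (2 * int a + int al + 2 * int D * int x)\<^sup>2 - (2 * int b + int be + 2 * int D * int y)\<^sup>2))"
    by (intro sum.cong refl sum.swap)
  also have "\<dots> = (\<Sum>a\<in>{1..D}. \<Sum>b\<in>{1..D}. G (int a) (int b) * ?z a b)"
    unfolding zcount_of_bool by (simp only: sum_distrib_left)
  finally have CF: "CF q G = (\<Sum>a\<in>{1..D}. \<Sum>b\<in>{1..D}. G (int a) (int b) * ?z a b)" .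
  have z: "\<bar>?z a b - h\<^sup>2 * zdens (int m) q\<bar> \<le> B" if ab: "a \<in> {1..D}" "b \<in> {1..D}" for a b
  proof -
    have A1: "\<bar>real (A a) - h\<bar> \<le> 1" "\<bar>real (A b) - h\<bar> \<le> 1"
      unfolding A_def h_def using ab by (intro class_size; simp)+
    have "\<bar>?z a b - real (A a) * real (A b) * zdens (int m) q\<bar> \<le>
       (\<Sum>c | c dvd q. kb m c * (real (A a + A b) * L + real c * L ^ 2)) / real q"
    proof (rule zcount_bound)
      show "coprime (2 * int D) (int q)" using q by (simp add: coprime_commute)
      show "norm (kl c (int m) n) \<le> kb m c" if "c dvd q" for c n
        using that q by (intro norm_kl_le_kb) (auto elim!: dvdE)
      have "(\<Sum>h\<in>{1..<q}. 1 / real h) \<le> hsum X"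
        unfolding hsum_def using q by (intro sum_mono2) auto
      thus "(\<Sum>h\<in>{1..<q}. 1 / real h) \<le> L" using hX by simp
    qed fact
    also have "\<dots> = theta m L (real (A a + A b)) q" by (simp add: theta_def)
    also have "\<dots> \<le> theta m L (2 * h + 2) q" using A1 L1 by (intro theta_mono) auto
    finally have 1: "\<bar>?z a b - real (A a) * real (A b) * zdens (int m) q\<bar> \<le> theta m L (2 * h + 2) q" .
    have "\<bar>real (A a) * real (A b) - h\<^sup>2\<bar> \<le> 2 * h + 1"
    proof -
      define u v where "u = real (A a) - h" and "v = real (A b) - h"
      have uv: "\<bar>u\<bar> \<le> 1" "\<bar>v\<bar> \<le> 1" using A1 by (auto simp: u_def v_def)
      have "real (A a) * real (A b) - h\<^sup>2 = h * u + h * v + u * v"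
        by (simp add: u_def v_def algebra_simps power2_eq_square)
      also have "\<bar>\<dots>\<bar> \<le> \<bar>h * u\<bar> + \<bar>h * v\<bar> + \<bar>u * v\<bar>" by linarith
      also have "\<dots> \<le> h * 1 + h * 1 + 1 * 1"
        unfolding abs_mult using uv h0 by (intro add_mono mult_mono) auto
      finally show ?thesis by simp
    qed
    hence "\<bar>real (A a) * real (A b) - h\<^sup>2\<bar> * zdens (int m) q \<le> (2 * h + 1) * zdens (int m) q"
      by (rule mult_right_mono) (rule zdens_nonneg)
    hence 2: "\<bar>real (A a) * real (A b) * zdens (int m) q - h\<^sup>2 * zdens (int m) q\<bar> \<le> (2 * h + 1) * zdens (int m) q"
      using zdens_nonneg[of "int m" q] by (simp add: abs_mult flip: left_diff_distrib)
    show ?thesis unfolding B_def using 1 2 by linarith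
  qed
  have m1: "(real D)\<^sup>2 * mean2 D G = (\<Sum>a\<in>{1..D}. \<Sum>b\<in>{1..D}. G (int a) (int b))"
    by (rule mean2_eq_sum_1_to) fact+
  have m2: "(real D)\<^sup>2 * mean2 D (\<lambda>i j. \<bar>G i j\<bar>) = (\<Sum>a\<in>{1..D}. \<Sum>b\<in>{1..D}. \<bar>G (int a) (int b)\<bar>)"
  proof (rule mean2_eq_sum_1_to[OF _ D])
    show "per2 D (\<lambda>i j. \<bar>G i j\<bar>)"
      unfolding per2_def by (intro allI impI arg_cong[of _ _ abs] per2D[OF G])
  qed
  have "(real H)\<^sup>2 * mean2 D G = h\<^sup>2 * ((real D)\<^sup>2 * mean2 D G)"
    using D by (simp add: h_def power_divide)
  hence "CF q G - (real H)\<^sup>2 * mean2 D G * zdens (int m) q =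
    (\<Sum>a\<in>{1..D}. \<Sum>b\<in>{1..D}. G (int a) (int b) * ?z a b) - h\<^sup>2 * (\<Sum>a\<in>{1..D}. \<Sum>b\<in>{1..D}. G (int a) (int b)) * zdens (int m) q"
    unfolding CF m1 by simp
  also have "\<dots> = (\<Sum>a\<in>{1..D}. \<Sum>b\<in>{1..D}. G (int a) (int b) * (?z a b - h\<^sup>2 * zdens (int m) q))"
    by (simp only: right_diff_distrib sum_subtractf sum_distrib_left sum_distrib_right mult_ac)
  finally have "\<bar>CF q G - (real H)\<^sup>2 * mean2 D G * zdens (int m) q\<bar> \<le>
     (\<Sum>a\<in>{1..D}. \<Sum>b\<in>{1..D}. \<bar>G (int a) (int b) * (?z a b - h\<^sup>2 * zdens (int m) q)\<bar>)"
    by (simp only:) (rule order_trans[OF sum_abs sum_mono[OF sum_abs]])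
  also have "\<dots> \<le> (\<Sum>a\<in>{1..D}. \<Sum>b\<in>{1..D}. \<bar>G (int a) (int b)\<bar> * B)"
    unfolding abs_mult by (intro sum_mono mult_left_mono z) auto
  also have "\<dots> = (real D)\<^sup>2 * mean2 D (\<lambda>i j. \<bar>G i j\<bar>) * B"
    unfolding m2 by (simp only: sum_distrib_right)
  finally show ?thesis by (simp only: B_def h_def times_divide_eq_right)
qed

text \<open>The total weight of the divisors of \<open>P^J\<close> in the error terms below.\<close>

definition psi :: "nat \<Rightarrow> nat \<Rightarrow> real" where
  "psi P J = (\<Sum>q | q dvd P ^ J. real (tau3 q) * real q powr (- (3/4)))"

text \<open>The factor of the main term belonging to the primes of \<open>P\<close>: the mean of
  \<open>F\<close> against the part of the divisor sum of \<open>chi4\<close> that lives on divisors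
  of \<open>P^J\<close>. Divided by its value for \<open>box1\<close> it is the local expectation of
  \<open>F\<close>.\<close>

definition EF :: "nat \<Rightarrow> nat \<Rightarrow> box_fun \<Rightarrow> real" where
  "EF P J F = (\<Sum>q | q dvd P ^ J. chi q * mean2 (P ^ J) (\<lambda>i j. F i j * dn q i j))"

lemma per2_F_dvd:
  assumes "per2 D F"
  shows "per2 (lcm D q) (\<lambda>i j. F i j * dn q i j)"
proof (rule per2_mult)
  show "per2 (lcm D q) F" using assms by (rule per2_dvd) simp
  show "per2 (lcm D q) (\<lambda>i j. dn q i j)" by (rule per2_dvd[OF per2_dvd_nn]) simp
qed

lemma mean2_F_dvd_le:
  assumes F: "\<And>i j. \<bar>F i j\<bar> \<le> 1" and q: "odd q" "q dvd N" "N > 0"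
  shows "mean2 N (\<lambda>i j. \<bar>F i j * dn q i j\<bar>) \<le> real (tau3 q) / real q"
proof -
  have "mean2 N (\<lambda>i j. \<bar>F i j * dn q i j\<bar>) \<le> mean2 N (\<lambda>i j. dn q i j)"
    using F by (intro mean2_mono) (auto simp: of_bool_def)
  also have "\<dots> = mean2 q (\<lambda>i j. dn q i j)"
    by (rule mean2_dvd[OF per2_dvd_nn]) fact+
  also have "\<dots> = zdens (int m) q" by (rule mean2_dvd_nn) fact
  also have "\<dots> \<le> real (tau3 q) / real q" by (rule zdens_le) fact
  finally show ?thesis .
qed

lemma CF_mult_coprime:
  assumes "coprime q1 q2"
  shows "CF (q1 * q2) F = CF q1 (\<lambda>i j. F i j * dn q2 i j)"
proof -
  have "int (q1 * q2) dvd x \<longleftrightarrow> int q1 dvd x \<and> int q2 dvd x" for x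
    using assms by (metis coprime_int_iff dvd_mult_left dvd_mult_right divides_mult of_nat_mult)
  hence "of_bool (int (q1 * q2) dvd x) = (of_bool (int q2 dvd x) * of_bool (int q1 dvd x) :: real)" for x
    by (simp add: of_bool_def)
  thus ?thesis unfolding CF_def by (simp only: mult.assoc)
qed

text \<open>For fixed \<open>q2\<close> the function \<open>F\<close> times the indicator of
  \<open>q2 dvd nn i j\<close> has period \<open>lcm D q2\<close>, which is at most
  \<open>D * q2\<close>, and the sum over \<open>q1\<close> is estimated by
  \<open>CF_class_bound\<close>. All lengths are at most \<open>y = X / q2\<close>. The error
  carries \<open>(D * q2)^2\<close> from the classes, \<open>tau3 q2 / q2\<close> from the density
  and \<open>y^(7/4)\<close>; altogether \<open>q2\<close> appears with exponent
  \<open>2 - 1 - 7/4 = -3/4\<close>.\<close>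

lemma smooth_part_error:
  assumes F: "per2 D F" "\<And>i j. \<bar>F i j\<bar> \<le> 1" and D: "D > 0" "D dvd P ^ J" and P: "odd P"
    and q2: "q2 \<in> {1..Q}" "q2 dvd P ^ J"
  shows "\<bar>(\<Sum>q1\<in>{q\<in>{1..Q div q2}. odd q \<and> coprime q P}. chi q1 * CF (q1 * q2) F)
     - (real H)\<^sup>2 * mean2 (P ^ J) (\<lambda>i j. F i j * dn q2 i j) * zs m P (Q div q2)\<bar> \<le>
     8 * (real D)\<^sup>2 * sqrt (gsig m) * L ^ 5 * real X powr (7/4) * (real (tau3 q2) * real q2 powr (- (3/4)))"
proof -
  define D' where "D' = lcm D q2"
  define G where "G = (\<lambda>i j. F i j * dn q2 i j)"
  define x where "x = Q div q2"
  define y where "y = real X / real q2"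
  let ?s = "2 * real H / real D' + 2"
  let ?v = "2 * real H / real D' + 1"
  let ?W = "{q\<in>{1..x}. odd q \<and> coprime q P}"
  have P0: "P ^ J > 0" using P by (auto intro!: Nat.gr0I)
  have D'0: "D' > 0" using D q2 by (simp add: D'_def lcm_pos_nat)
  have D'P: "D' dvd P ^ J" using D q2 by (simp add: D'_def)
  have D'D: "D' \<le> D * q2" unfolding D'_def
    using D q2 by (intro dvd_imp_le lcm_least) auto
  have D'q: "q2 \<le> D'" unfolding D'_def using D q2 by (intro dvd_imp_le) (auto simp: lcm_pos_nat)
  have q20: "real q2 > 0" using q2 by simp
  have odd2: "odd q2" using P q2 by (meson dvd_trans even_power)
  have G: "per2 D' G" unfolding G_def D'_def by (rule per2_F_dvd) fact
  have xX: "x \<le> X" unfolding x_def by (rule order_trans[OF div_le_dividend QX])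
  have y1: "y \<ge> 1" using q2 QX q20 by (simp add: y_def)
  have xy: "real x \<le> y"
  proof -
    have "real x \<le> real Q / real q2" unfolding x_def by (rule of_nat_div_le_of_nat)
    also have "\<dots> \<le> y" unfolding y_def using QX by (intro divide_right_mono) auto
    finally show ?thesis .
  qed
  have Hy: "real H / real D' \<le> y"
  proof -
    have "real H / real D' \<le> real X / real D'" using HX by (intro divide_right_mono) auto
    also have "\<dots> \<le> y" unfolding y_def using D'q q20 D'0 by (intro divide_left_mono) auto
    finally show ?thesis .
  qed
  have gs1: "sqrt (gsig m) \<ge> 1" using gsig_ge_1[OF m0] by simp
  have meanG: "mean2 D' (\<lambda>i j. \<bar>G i j\<bar>) \<le> real (tau3 q2) / real q2"
    unfolding G_def using D'0 odd2 by (intro mean2_F_dvd_le F) (auto simp: D'_def)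
  have meanG0: "mean2 D' (\<lambda>i j. \<bar>G i j\<bar>) \<ge> 0" unfolding mean2_def by (intro divide_nonneg_nonneg sum_nonneg) auto
  have mean_eq: "mean2 (P ^ J) G = mean2 D' G" by (rule mean2_dvd[OF G D'P P0])
  have each: "\<bar>CF (q1 * q2) F - (real H)\<^sup>2 * mean2 D' G * zdens (int m) q1\<bar> \<le>
     (real D * real q2)\<^sup>2 * (real (tau3 q2) / real q2) * (theta m L ?s q1 + ?v * zdens (int m) q1)"
    if q1: "q1 \<in> ?W" for q1
  proof -
    have copJ: "coprime q1 (P ^ J)" using q1 by simp
    have cop2: "coprime q1 q2" using copJ q2 by (meson coprime_divisors dvd_refl)
    have copD: "coprime q1 D'" using copJ D'P by (meson coprime_divisors dvd_refl)
    have th: "theta m L ?s q1 + ?v * zdens (int m) q1 \<ge> 0"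
      using L1 by (intro add_nonneg_nonneg theta_nonneg mult_nonneg_nonneg zdens_nonneg) auto
    have "\<bar>CF q1 G - (real H)\<^sup>2 * mean2 D' G * zdens (int m) q1\<bar> \<le>
      (real D')\<^sup>2 * mean2 D' (\<lambda>i j. \<bar>G i j\<bar>) * (theta m L ?s q1 + ?v * zdens (int m) q1)"
      using q1 xX copD by (intro CF_class_bound G D'0) auto
    also have "\<dots> \<le> (real D * real q2)\<^sup>2 * (real (tau3 q2) / real q2) * (theta m L ?s q1 + ?v * zdens (int m) q1)"
    proof (intro mult_right_mono mult_mono)
      show "(real D')\<^sup>2 \<le> (real D * real q2)\<^sup>2"
        using D'D by (intro power_mono) (simp_all flip: of_nat_mult)
    qed (use meanG meanG0 th in auto)
    finally show ?thesis unfolding CF_mult_coprime[OF cop2] G_def .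
  qed
  have "zs m P x = (\<Sum>q1\<in>?W. chi q1 * zdens (int m) q1)"
    unfolding zs_def by (rule sum.inter_filter[symmetric]) simp
  hence "(real H)\<^sup>2 * mean2 (P ^ J) G * zs m P x = (\<Sum>q1\<in>?W. chi q1 * ((real H)\<^sup>2 * mean2 D' G * zdens (int m) q1))"
    unfolding mean_eq by (simp only: sum_distrib_left mult_ac)
  hence "\<bar>(\<Sum>q1\<in>?W. chi q1 * CF (q1 * q2) F) - (real H)\<^sup>2 * mean2 (P ^ J) G * zs m P x\<bar> \<le>
      (\<Sum>q1\<in>?W. (real D * real q2)\<^sup>2 * (real (tau3 q2) / real q2) * (theta m L ?s q1 + ?v * zdens (int m) q1))"
    using each by (simp only:) (intro abs_sum_mult_diff_le abs_chi_le)
  also have "\<dots> = (real D * real q2)\<^sup>2 * (real (tau3 q2) / real q2) *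
      ((\<Sum>q1\<in>?W. theta m L ?s q1) + ?v * (\<Sum>q1\<in>?W. zdens (int m) q1))"
    by (simp only: sum_distrib_left[symmetric] sum.distrib)
  also have "\<dots> \<le> (real D * real q2)\<^sup>2 * (real (tau3 q2) / real q2) * (8 * sqrt (gsig m) * L ^ 5 * y powr (7/4))"
  proof (rule mult_left_mono)
    have "(\<Sum>q1\<in>?W. theta m L ?s q1) \<le> (\<Sum>q1\<in>{1..x}. theta m L ?s q1)"
      using L1 by (intro sum_mono2 theta_nonneg) auto
    also have "\<dots> \<le> sqrt (gsig m) * L ^ 5 * (?s + real x) * real x powr (3/4)"
      using hsum_mono[OF xX] hX L1 m0 by (intro sum_theta_le) auto
    \<comment> \<open>The side lengths give \<open>2 * y + 2\<close>, at most \<open>4 * y\<close>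
      since \<open>y \<ge> 1\<close>, and the moduli give another \<open>y\<close>. Together with
      the 3 below this makes the constant 8.\<close>
    also have "\<dots> \<le> sqrt (gsig m) * L ^ 5 * (5 * y) * y powr (3/4)"
      using gs1 L1 Hy xy y1 by (intro mult_mono powr_mono2) auto
    also have "\<dots> = 5 * sqrt (gsig m) * L ^ 5 * (y powr 1 * y powr (3/4))" using y1 by simp
    also have "y powr 1 * y powr (3/4) = y powr (7/4)" unfolding powr_add[symmetric] by simp
    finally have 1: "(\<Sum>q1\<in>?W. theta m L ?s q1) \<le> 5 * sqrt (gsig m) * L ^ 5 * y powr (7/4)" .
    have "(\<Sum>q1\<in>?W. zdens (int m) q1) \<le> (\<Sum>q1\<in>?W. real (tau3 q1) / real q1)" by (intro sum_mono zdens_le) auto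
    also have "\<dots> \<le> (\<Sum>q1\<in>{1..x}. real (tau3 q1) / real q1)" by (intro sum_mono2) auto
    also have "\<dots> \<le> hsum x ^ 3" by (rule sum_tau3_le)
    also have "\<dots> \<le> L ^ 3" using hsum_mono[OF xX] hX by (intro power_mono hsum_nonneg) auto
    finally have z: "(\<Sum>q1\<in>?W. zdens (int m) q1) \<le> L ^ 3" .
    have "?v * (\<Sum>q1\<in>?W. zdens (int m) q1) \<le> (3 * y) * L ^ 3"
      using Hy y1 z by (intro mult_mono sum_nonneg zdens_nonneg) auto
    also have "\<dots> \<le> (3 * y powr (7/4)) * L ^ 5"
    proof (rule mult_mono)
      have "y powr 1 \<le> y powr (7/4)" using y1 by (intro powr_mono) auto
      thus "3 * y \<le> 3 * y powr (7/4)" using y1 by simp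
      show "L ^ 3 \<le> L ^ 5" using L1 by (intro power_increasing) auto
    qed (use L1 in auto)
    also have "\<dots> \<le> (3 * y powr (7/4)) * (sqrt (gsig m) * L ^ 5)"
      using gs1 L1 by (intro mult_left_mono) auto
    finally have 2: "?v * (\<Sum>q1\<in>?W. zdens (int m) q1) \<le> 3 * sqrt (gsig m) * L ^ 5 * y powr (7/4)"
      by (simp add: mult_ac)
    show "(\<Sum>q1\<in>?W. theta m L ?s q1) + ?v * (\<Sum>q1\<in>?W. zdens (int m) q1) \<le> 8 * sqrt (gsig m) * L ^ 5 * y powr (7/4)"
      using add_mono[OF 1 2] by (simp add: algebra_simps)
  qed auto
  also have "\<dots> = 8 * (real D)\<^sup>2 * sqrt (gsig m) * L ^ 5 * real X powr (7/4) * (real (tau3 q2) * real q2 powr (- (3/4)))"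
  proof -
    have "y powr (7/4) = real X powr (7/4) * real q2 powr (- (7/4))"
      unfolding y_def by (simp add: powr_divide powr_minus_divide)
    moreover have "real q2 * real q2 powr (- (7/4)) = real q2 powr (- (3/4))"
    proof -
      have "real q2 * real q2 powr (- (7/4)) = real q2 powr 1 * real q2 powr (- (7/4))" using q20 by simp
      also have "\<dots> = real q2 powr (- (3/4))" unfolding powr_add[symmetric] by simp
      finally show ?thesis .
    qed
    moreover have "(real D * real q2)\<^sup>2 * (real (tau3 q2) / real q2) = (real D)\<^sup>2 * real (tau3 q2) * real q2"
      using q20 by (simp add: power2_eq_square)
    ultimately show ?thesis by (simp add: mult_ac)
  qed
  finally show ?thesis by (simp only: G_def x_def)
qed

end

section \<open>Equidistribution\<close>

lemma sum_divisors_coprime_mult: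
  fixes f :: "nat \<Rightarrow> 'a :: comm_monoid_add"
  assumes cop: "coprime a b" and pos: "a > 0" "b > 0"
  shows "(\<Sum>q | q dvd a * b. f q) = (\<Sum>x | x dvd a. \<Sum>y | y dvd b. f (x * y))"
proof -
  have "(\<Sum>q | q dvd a * b. f q) = (\<Sum>z\<in>{x. x dvd a} \<times> {y. y dvd b}. f (fst z * snd z))"
  proof (rule sum.reindex_bij_witness[of _ "\<lambda>z. fst z * snd z" "\<lambda>q. (gcd q a, gcd q b)"])
    fix q assume q: "q \<in> {q. q dvd a * b}"
    have q0: "q > 0" using q pos by (auto intro: Nat.gr0I)
    have "q div gcd a q dvd b" using q q0 by (intro dvd_mult_imp_div_gcd_dvd) auto
    moreover have "q div gcd a q dvd q" by (metis dvd_div_mult_self dvd_triv_left gcd_dvd2)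
    ultimately have "gcd a q * (q div gcd a q) dvd gcd q a * gcd q b"
      by (intro mult_dvd_mono) (auto simp: gcd.commute)
    hence "q dvd gcd q a * gcd q b" by simp
    moreover have "coprime (gcd q a) (gcd q b)" using cop by (meson coprime_divisors gcd_dvd2)
    hence "gcd q a * gcd q b dvd q" by (intro divides_mult) auto
    ultimately show "fst (gcd q a, gcd q b) * snd (gcd q a, gcd q b) = q" by (simp add: dvd_antisym)
    thus "f (fst (gcd q a, gcd q b) * snd (gcd q a, gcd q b)) = f q" by simp
  next
    fix z assume "z \<in> {x. x dvd a} \<times> {y. y dvd b}"
    then obtain x y where z: "z = (x, y)" "x dvd a" "y dvd b" by auto
    show "fst z * snd z \<in> {q. q dvd a * b}" using z by (simp add: mult_dvd_mono)
    have "coprime a y" "coprime b x" using cop z by (meson coprime_divisors dvd_refl coprime_commute)+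
    hence "gcd (x * y) a = gcd x a" "gcd (x * y) b = gcd y b"
      by (simp_all add: gcd_mult_left_right_cancel gcd_mult_left_left_cancel)
    thus "(gcd (fst z * snd z) a, gcd (fst z * snd z) b) = z"
      using z by (simp add: gcd_nat.absorb1)
  qed auto
  also have "\<dots> = (\<Sum>x | x dvd a. \<Sum>y | y dvd b. f (x * y))"
    by (simp add: sum.cartesian_product')
  finally show ?thesis .
qed


lemma rr_mult_coprime:
  assumes "coprime a b" "a > 0" "b > 0"
  shows "rr (a * b) = rr a * rr b"
  unfolding rr_def by (simp add: sum_divisors_coprime_mult[OF assms] chi4_mult sum_product)

lemma chi4_power: "chi4 (n ^ k) = chi4 n ^ k"
  by (induction k) (simp_all add: chi4_mult)

lemma rr_prime_power:
  assumes "prime p"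
  shows "rr (p ^ k) = (\<Sum>j\<le>k. chi4 p ^ j)"
proof -
  have p1: "p > 1" using assms prime_gt_1_nat by blast
  have "{q. q dvd p ^ k} = (\<lambda>j. p ^ j) ` {..k}"
    using assms by (auto simp: divides_primepow_nat)
  moreover have "inj_on (\<lambda>j. p ^ j) {..k}"
    using p1 by (auto simp: inj_on_def)
  ultimately show ?thesis by (simp add: rr_def sum.reindex chi4_power)
qed

lemma rr_prime_power_cases:
  assumes "prime p"
  shows "p mod 4 = 3 \<Longrightarrow> rr (p ^ k) = (if even k then 1 else 0)"
    and "p mod 4 \<noteq> 3 \<Longrightarrow> rr (p ^ k) \<ge> 1"
proof -
  assume "p mod 4 = 3"
  hence "odd p" "p mod 4 \<noteq> 1" by presburger+
  hence "chi4 p = - 1" by (simp add: chi4_def)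
  thus "rr (p ^ k) = (if even k then 1 else 0)"
    unfolding rr_prime_power[OF assms] by (induction k) auto
next
  assume "p mod 4 \<noteq> 3"
  hence "chi4 p \<ge> 0" using odd_mod4[of p] by (auto simp: chi4_def)
  hence "(\<Sum>j\<in>{0::nat}. chi4 p ^ j) \<le> (\<Sum>j\<le>k. chi4 p ^ j)" by (intro sum_mono2) auto
  thus "rr (p ^ k) \<ge> 1" unfolding rr_prime_power[OF assms] by simp
qed

lemma rr_1 [simp]: "rr 1 = 1" "rr (Suc 0) = 1"
  by (simp_all add: rr_def)

lemma prime_power_split:
  assumes "n > 1"
  obtains p k n' where "prime p" "k > 0" "n = p ^ k * n'" "coprime (p ^ k) n'" "n' > 0" "n' < (n :: nat)"
proof -
  obtain p where p: "prime p" "p dvd n" using assms prime_factor_nat[of n] by auto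
  define k where "k = multiplicity p n"
  have "n \<noteq> 0" "\<not> is_unit p" using assms p by (auto dest: not_prime_unit)
  then obtain n' where n': "n = p ^ k * n'" "\<not> p dvd n'"
    unfolding k_def by (rule multiplicity_decompose')
  have k: "k > 0" unfolding k_def using p assms by (simp add: prime_multiplicity_gt_zero_iff)
  have n0: "n' > 0" using n' assms by (intro Nat.gr0I) auto
  have "p ^ k > 1" using p(1) k prime_gt_1_nat by (intro one_less_power)
  hence "n' < n" using n' n0 by simp
  moreover have "coprime (p ^ k) n'" using n' p prime_imp_coprime by (intro coprime_power_left_iff[THEN iffD2]) auto
  ultimately show ?thesis using that p k n' n0 by blast
qed

lemma rr_nonneg: "n > 0 \<Longrightarrow> rr n \<ge> 0"
proof (induction n rule: less_induct)
  case (less n)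
  show ?case
  proof (cases "n = 1")
    case False
    hence "n > 1" using less.prems by simp
    then obtain p k n' where *: "prime p" "k > 0" "n = p ^ k * n'" "coprime (p ^ k) n'" "n' > 0" "n' < n"
      by (rule prime_power_split)
    have "p ^ k > 0" using * by (auto intro: Nat.gr0I)
    hence "rr n = rr (p ^ k) * rr n'" using * by (simp add: rr_mult_coprime)
    moreover have "rr (p ^ k) \<ge> 0"
      using rr_prime_power_cases[OF *(1), of k] by (cases "p mod 4 = 3") auto
    ultimately show ?thesis using less.IH[of n'] * by simp
  qed simp
qed

lemma sum_crt_product:
  fixes f g :: "int \<Rightarrow> real"
  assumes f: "\<And>x y. [x = y] (mod int N1) \<Longrightarrow> f x = f y" and g: "\<And>x y. [x = y] (mod int N2) \<Longrightarrow> g x = g y"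
    and cop: "coprime N1 N2" and pos: "N1 > 0" "N2 > 0"
  shows "(\<Sum>x<N1 * N2. f (int x) * g (int x)) = (\<Sum>x<N1. f (int x)) * (\<Sum>x<N2. g (int x))"
proof -
  have "(\<Sum>x<N1 * N2. f (int x) * g (int x)) =
    (\<Sum>x<N1. \<Sum>y<N2. f (int N2 * int x + int N1 * int y) * g (int N2 * int x + int N1 * int y))"
  proof (rule sum_residues_crt[OF _ cop pos])
    fix x y assume xy: "[x = y] (mod int (N1 * N2))"
    have "[x = y] (mod int N1)" "[x = y] (mod int N2)"
      by (rule cong_dvd_modulus[OF xy]; simp)+
    thus "f x * g x = f y * g y" using f g by metis
  qed
  also have "\<dots> = (\<Sum>x<N1. \<Sum>y<N2. f (int N2 * int x) * g (int N1 * int y))"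
    by (intro sum.cong refl arg_cong2[of _ _ _ _ "(*)"] f g) (simp_all add: cong_iff_dvd_diff)
  also have "\<dots> = (\<Sum>x<N1. f (int N2 * int x)) * (\<Sum>y<N2. g (int N1 * int y))"
    by (rule sum_product[symmetric])
  also have "(\<Sum>x<N1. f (int N2 * int x)) = (\<Sum>x<N1. f (int x))"
    using cop pos by (intro sum_residues_mult f) (auto simp: coprime_commute)
  also have "(\<Sum>y<N2. g (int N1 * int y)) = (\<Sum>y<N2. g (int y))"
    using cop pos by (intro sum_residues_mult g) auto
  finally show ?thesis .
qed

lemma mean2_crt:
  assumes f: "per2 N1 f" and g: "per2 N2 g" and cop: "coprime N1 N2" and pos: "N1 > 0" "N2 > 0"
  shows "mean2 (N1 * N2) (\<lambda>i j. f i j * g i j) = mean2 N1 f * mean2 N2 g"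
proof -
  have "(\<Sum>a<N1 * N2. \<Sum>b<N1 * N2. f (int a) (int b) * g (int a) (int b)) =
     (\<Sum>a<N1 * N2. (\<lambda>x. \<Sum>b<N1. f x (int b)) (int a) * (\<lambda>x. \<Sum>b<N2. g x (int b)) (int a))"
    by (intro sum.cong refl sum_crt_product cop pos per2D[OF f] per2D[OF g]) auto
  also have "\<dots> = (\<Sum>a<N1. (\<lambda>x. \<Sum>b<N1. f x (int b)) (int a)) * (\<Sum>a<N2. (\<lambda>x. \<Sum>b<N2. g x (int b)) (int a))"
    by (rule sum_crt_product[OF _ _ cop pos]) (auto intro!: sum.cong per2D[OF f] per2D[OF g])
  finally show ?thesis by (simp add: mean2_def power_mult_distrib)
qed

lemma mean2_swap: "mean2 N (\<lambda>i j. F j i) = mean2 N F"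
  unfolding mean2_def by (subst sum.swap) (rule refl)

lemma powr_quarter_eq_sqrt: "x \<ge> 0 \<Longrightarrow> sqrt (sqrt x) = x powr (1/4)" for x :: real
  by (simp add: powr_powr flip: powr_half_sqrt)

context four_sq_box begin

lemma psi_nonneg: "psi P J \<ge> 0"
  unfolding psi_def by (intro sum_nonneg) auto

abbreviation equi_error :: "nat set \<Rightarrow> nat \<Rightarrow> box_fun \<Rightarrow> real" where
  "equi_error S J F \<equiv> \<bar>SF F - 2 * (real H)\<^sup>2 * zs m (\<Prod>S) Q * EF (\<Prod>S) J F\<bar>"

text \<open>The dependence on \<open>F\<close> sits in \<open>EF\<close> alone; the singular series
  \<open>zs\<close> over the remaining primes is common to all \<open>F\<close>. This lets the sieve
  compare \<open>SF F\<close> with \<open>SF box1\<close>.\<close>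

lemma equidistribution:
  assumes S: "finite S" "\<And>p. p \<in> S \<Longrightarrow> prime p" "\<And>p. p \<in> S \<Longrightarrow> odd p"
    and F: "per2 D F" "\<And>i j. \<bar>F i j\<bar> \<le> 1" and D: "D > 0" "D dvd (\<Prod>S) ^ J"
    and J: "Q < 2 ^ J" and XQ: "X \<le> 2 * Q"
  shows "equi_error S J F \<le>
    24 * (real D)\<^sup>2 * 2 ^ card S * sqrt (gsig m) * L ^ 5 * real X powr (7/4) * psi (\<Prod>S) J + 2 * Tsum"
proof -
  define P where "P = \<Prod>S"
  have oddP: "odd P" unfolding P_def using S by (simp add: even_prod_iff)
  have P0: "P ^ J > 0" using oddP by (auto intro!: Nat.gr0I)
  have fin: "finite {q. q dvd P ^ J}" using P0 by simp
  let ?Q = "{q. q dvd P ^ J}" and ?Q1 = "{q\<in>{1..Q}. q dvd P ^ J}"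
  have sub: "?Q1 \<subseteq> ?Q" by auto
  let ?W = "\<lambda>q2. {q\<in>{1..Q div q2}. odd q \<and> coprime q P}"
  define mn where "mn = (\<lambda>q. mean2 (P ^ J) (\<lambda>i j. F i j * dn q i j))"
  define C where "C = sqrt (gsig m) * L ^ 5 * real X powr (7/4)"
  let ?w = "\<lambda>q. real (tau3 q) * real q powr (- (3/4))"
  have gs1: "sqrt (gsig m) \<ge> 1" using gsig_ge_1[OF m0] by simp
  have X0: "real X > 0" using X1 by simp
  have C0: "C \<ge> 0" unfolding C_def using gs1 L1 by simp
  have oddq: "odd q" if "q dvd P ^ J" for q using that oddP by (meson dvd_trans even_power)
  have mn: "\<bar>mn q\<bar> \<le> real (tau3 q) / real q" if "q dvd P ^ J" for q
    unfolding mn_def by (rule order_trans[OF abs_mean2_le mean2_F_dvd_le[OF F(2) oddq[OF that] that P0]])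
  have psi1: "(\<Sum>q\<in>?Q1. ?w q) \<le> psi P J"
    unfolding psi_def by (rule sum_mono2[OF fin sub]) auto
  have X4: "(real X)\<^sup>2 * real X powr (- (1/4)) = real X powr (7/4)"
  proof -
    have "(real X)\<^sup>2 = real X powr 2" using X0 by (simp add: powr_numeral)
    thus ?thesis by (simp only: powr_add[symmetric]) simp
  qed
  have H2: "(real H)\<^sup>2 \<le> (real X)\<^sup>2" using HX by (intro power_mono) auto
  \<comment> \<open>Three replacements lead to the main term: class counts by densities
    (\<open>M1\<close> to \<open>M2\<close>), the singular series cut at \<open>Q div q2\<close> by
    that cut at \<open>Q\<close> (\<open>M2\<close> to \<open>M3\<close>), and
    \<open>q2 \<le> Q\<close> by all divisors of \<open>P^J\<close> (\<open>M3\<close> to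
    \<open>M4\<close>). The last two gain a factor \<open>X^(-1/4)\<close> over \<open>X^2\<close>,
    and each error is a multiple of \<open>C * psi P J\<close>.\<close>
  define M1 where "M1 = (\<Sum>q2\<in>?Q1. chi q2 * (\<Sum>q1\<in>?W q2. chi q1 * CF (q1 * q2) F))"
  define M2 where "M2 = (\<Sum>q2\<in>?Q1. chi q2 * ((real H)\<^sup>2 * mn q2 * zs m P (Q div q2)))"
  define M3 where "M3 = (\<Sum>q2\<in>?Q1. chi q2 * ((real H)\<^sup>2 * mn q2 * zs m P Q))"
  define M4 where "M4 = (\<Sum>q2\<in>?Q. chi q2 * ((real H)\<^sup>2 * mn q2 * zs m P Q))"
  have M1: "M1 = (\<Sum>q\<in>{q\<in>{1..Q}. odd q}. chi q * CF q F)"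
    unfolding sum_split_smooth_part[OF oddP J] M1_def
    by (simp add: sum_distrib_left chi4_mult mult_ac)
  have M4: "M4 = (real H)\<^sup>2 * zs m P Q * EF P J F"
    unfolding M4_def EF_def mn_def by (simp only: sum_distrib_left mult_ac)
  have d12: "\<bar>M1 - M2\<bar> \<le> 8 * (real D)\<^sup>2 * C * psi P J"
  proof -
    have "\<bar>M1 - M2\<bar> \<le> (\<Sum>q2\<in>?Q1. 8 * (real D)\<^sup>2 * sqrt (gsig m) * L ^ 5 * real X powr (7/4) * ?w q2)"
      unfolding M1_def M2_def mn_def
      using D by (intro abs_sum_mult_diff_le abs_chi_le smooth_part_error F oddP) (auto simp: P_def)
    also have "\<dots> = (8 * (real D)\<^sup>2 * C) * (\<Sum>q2\<in>?Q1. ?w q2)"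
      by (simp add: C_def sum_distrib_left mult_ac)
    also have "\<dots> \<le> (8 * (real D)\<^sup>2 * C) * psi P J"
      using C0 by (intro mult_left_mono psi1) auto
    finally show ?thesis .
  qed
  have d23: "\<bar>M2 - M3\<bar> \<le> 2 * 2 ^ card S * C * psi P J"
  proof -
    have "\<bar>M2 - M3\<bar> \<le> (\<Sum>q2\<in>?Q1. (2 * 2 ^ card S * C) * ?w q2)"
      unfolding M2_def M3_def
    proof (rule abs_sum_mult_diff_le[OF abs_chi_le])
      fix q2 assume q2: "q2 \<in> ?Q1"
      hence q20: "real q2 > 0" by simp
      define Y where "Y = Q div q2"
      have Y1: "Y \<ge> 1" using q2 by (simp add: Y_def less_eq_div_iff_mult_less_eq)
      let ?u = "2 ^ card S * L\<^sup>2 * sqrt (gsig m) * real q2 powr (1/4) * real X powr (- (1/4))"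
      have "Q < q2 * (Y + 1)" using dividend_less_times_div[of q2 Q] q2 by (simp add: Y_def)
      also have "\<dots> \<le> q2 * (2 * Y)" using Y1 by (intro mult_left_mono) auto
      \<comment> \<open>One factor 2 comes from \<open>X \<le> 2 * Q\<close>, the other from
        rounding \<open>Q div q2\<close> down.\<close>
      finally have "X \<le> 4 * (q2 * Y)" using XQ by simp
      hence "real X \<le> real (4 * (q2 * Y))" by (rule of_nat_mono)
      hence XY: "real X / (4 * real q2) \<le> real Y" using q20 by (simp add: field_simps)
      have "\<bar>zs m P Q - zs m P Y\<bar> \<le> 2 ^ card S * L\<^sup>2 * sqrt (gsig m) / sqrt (sqrt (real Y))"
        unfolding P_def using S Y1 hsum_mono[OF QX] hX L1 m0
        by (intro zs_diff) (auto simp: Y_def)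
      also have "\<dots> \<le> 2 ^ card S * L\<^sup>2 * sqrt (gsig m) / sqrt (sqrt (real X / (4 * real q2)))"
        using XY X0 q20 gs1 by (intro divide_left_mono mult_pos_pos real_sqrt_le_mono) (use Y1 in auto)
      also have "sqrt (sqrt (real X / (4 * real q2))) = real X powr (1/4) / (4 powr (1/4) * real q2 powr (1/4))"
        using X0 q20 by (subst powr_quarter_eq_sqrt) (auto simp: powr_divide powr_mult)
      also have "2 ^ card S * L\<^sup>2 * sqrt (gsig m) / \<dots> = (4 powr (1/4)) * ?u"
        using X0 q20 by (simp add: powr_minus_divide field_simps)
      also have "\<dots> \<le> 2 * ?u"
      proof (rule mult_right_mono)
        have "(4 :: real) powr (1/4) \<le> 4 powr (1/2)" by (intro powr_mono) auto
        also have "\<dots> = 2" by (simp add: powr_half_sqrt)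
        finally show "(4 :: real) powr (1/4) \<le> 2" .
      qed (use gs1 in auto)
      finally have zd: "\<bar>zs m P Y - zs m P Q\<bar> \<le> 2 * ?u"
        by (simp only: abs_minus_commute)
      have "\<bar>(real H)\<^sup>2 * mn q2 * (zs m P Y - zs m P Q)\<bar> \<le> (real X)\<^sup>2 * (real (tau3 q2) / real q2) * (2 * ?u)"
        unfolding abs_mult using H2 mn[of q2] q2 zd by (intro mult_mono) auto
      also have "\<dots> = 2 * 2 ^ card S * (sqrt (gsig m) * L\<^sup>2 * ((real X)\<^sup>2 * real X powr (- (1/4)))) * (real (tau3 q2) * (real q2 powr (1/4) / real q2))"
        by (simp add: mult_ac)
      also have "real q2 powr (1/4) / real q2 = real q2 powr (- (3/4))"
      proof -
        have "real q2 powr (1/4) / real q2 = real q2 powr (1/4) / real q2 powr 1" using q20 by simp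
        thus ?thesis unfolding powr_diff[symmetric] by simp
      qed
      also have "(real X)\<^sup>2 * real X powr (- (1/4)) = real X powr (7/4)" by (rule X4)
      also have "2 * 2 ^ card S * (sqrt (gsig m) * L\<^sup>2 * real X powr (7/4)) * ?w q2 \<le> 2 * 2 ^ card S * C * ?w q2"
        unfolding C_def using gs1 L1 by (intro mult_right_mono mult_left_mono power_increasing) auto
      finally have "\<bar>(real H)\<^sup>2 * mn q2 * (zs m P Y - zs m P Q)\<bar> \<le> (2 * 2 ^ card S * C) * ?w q2" .
      thus "\<bar>(real H)\<^sup>2 * mn q2 * zs m P (Q div q2) - (real H)\<^sup>2 * mn q2 * zs m P Q\<bar> \<le> (2 * 2 ^ card S * C) * ?w q2"
        by (simp only: right_diff_distrib Y_def)
    qed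
    also have "\<dots> = (2 * 2 ^ card S * C) * (\<Sum>q2\<in>?Q1. ?w q2)"
      by (rule sum_distrib_left[symmetric])
    also have "\<dots> \<le> (2 * 2 ^ card S * C) * psi P J"
      using C0 by (intro mult_left_mono psi1) auto
    finally show ?thesis .
  qed
  have d34: "\<bar>M3 - M4\<bar> \<le> 2 * C * psi P J"
  proof -
    have "M4 = M3 + (\<Sum>q2\<in>?Q - ?Q1. chi q2 * ((real H)\<^sup>2 * mn q2 * zs m P Q))"
      unfolding M3_def M4_def by (rule sum.subset_diff[OF sub fin, THEN trans]) (rule add.commute)
    hence "\<bar>M3 - M4\<bar> = \<bar>\<Sum>q2\<in>?Q - ?Q1. chi q2 * ((real H)\<^sup>2 * mn q2 * zs m P Q)\<bar>" by simp
    also have "\<dots> \<le> (\<Sum>q2\<in>?Q - ?Q1. \<bar>chi q2 * ((real H)\<^sup>2 * mn q2 * zs m P Q)\<bar>)" by (rule sum_abs)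
    also have "\<dots> \<le> (\<Sum>q2\<in>?Q - ?Q1. 1 * ((2 * C) * ?w q2))"
    proof (rule sum_mono)
      fix q2 assume q2: "q2 \<in> ?Q - ?Q1"
      hence "q2 > 0" using P0 by (auto intro: Nat.gr0I)
      hence q2Q: "q2 > Q" using q2 by auto
      have q20: "real q2 > 0" using q2Q by simp
      have zb: "\<bar>zs m P Q\<bar> \<le> L ^ 3" using hsum_mono[OF QX] hX by (intro abs_zs_le) simp
      have "\<bar>(real H)\<^sup>2 * mn q2 * zs m P Q\<bar> \<le> (real X)\<^sup>2 * (real (tau3 q2) / real q2) * L ^ 3"
        unfolding abs_mult using H2 mn[of q2] q2 zb by (intro mult_mono) auto
      also have "real (tau3 q2) / real q2 = ?w q2 * real q2 powr (- (1/4))"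
      proof -
        have "real q2 powr (- (3/4)) * real q2 powr (- (1/4)) = real q2 powr (- 1)" unfolding powr_add[symmetric] by simp
        also have "\<dots> = 1 / real q2" using q20 by (simp add: powr_minus_divide)
        finally show ?thesis by (simp add: mult.assoc)
      qed
      also have "(real X)\<^sup>2 * (?w q2 * real q2 powr (- (1/4))) * L ^ 3 \<le> (real X)\<^sup>2 * (?w q2 * (2 * real X powr (- (1/4)))) * (sqrt (gsig m) * L ^ 5)"
      proof (intro mult_mono mult_left_mono)
        have "real X \<le> 2 * real q2" using XQ q2Q by linarith
        hence "real X / 2 \<le> real q2" by simp
        hence "real q2 powr (- (1/4)) \<le> (real X / 2) powr (- (1/4))" using X0 by (intro powr_mono2') auto
        also have "\<dots> = 2 powr (1/4) * real X powr (- (1/4))"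
          using X0 by (simp add: powr_divide powr_minus_divide)
        also have "\<dots> \<le> 2 * real X powr (- (1/4))"
        proof (rule mult_right_mono)
          have "(2 :: real) powr (1/4) \<le> 2 powr 1" by (intro powr_mono) auto
          thus "(2 :: real) powr (1/4) \<le> 2" by simp
        qed auto
        finally show "real q2 powr (- (1/4)) \<le> 2 * real X powr (- (1/4))" .
        have "L ^ 3 \<le> L ^ 5" using L1 by (intro power_increasing) auto
        also have "\<dots> \<le> sqrt (gsig m) * L ^ 5" using gs1 L1 by simp
        finally show "L ^ 3 \<le> sqrt (gsig m) * L ^ 5" .
      qed (use L1 in auto)
      also have "\<dots> = 2 * (sqrt (gsig m) * L ^ 5 * ((real X)\<^sup>2 * real X powr (- (1/4)))) * ?w q2"
        by (simp only: mult_ac)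
      also have "\<dots> = (2 * C) * ?w q2" unfolding X4 C_def by (simp only: mult_ac)
      finally have "\<bar>(real H)\<^sup>2 * mn q2 * zs m P Q\<bar> \<le> (2 * C) * ?w q2" .
      thus "\<bar>chi q2 * ((real H)\<^sup>2 * mn q2 * zs m P Q)\<bar> \<le> 1 * ((2 * C) * ?w q2)"
        unfolding abs_mult[of "chi q2"] using abs_chi_le by (intro mult_mono) auto
    qed
    also have "\<dots> = (2 * C) * (\<Sum>q2\<in>?Q - ?Q1. ?w q2)"
      by (simp only: sum_distrib_left mult_1_left)
    also have "\<dots> \<le> (2 * C) * psi P J"
      unfolding psi_def using C0 fin by (intro mult_left_mono sum_mono2) auto
    finally show ?thesis .
  qed
  have "\<bar>SF F - 2 * M1\<bar> \<le> 2 * Tsum" unfolding M1 using F(2) by (rule SF_approx)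
  hence "\<bar>SF F - 2 * M4\<bar> \<le> 2 * (8 * (real D)\<^sup>2 * C * psi P J + 2 * 2 ^ card S * C * psi P J + 2 * C * psi P J) + 2 * Tsum"
  proof -
    have ch: "\<bar>s - 2 * x\<bar> \<le> 2 * t \<Longrightarrow> \<bar>x - y\<bar> \<le> k \<Longrightarrow> \<bar>s - 2 * y\<bar> \<le> 2 * k + 2 * t" for s x y k t :: real
      by linarith
    have "\<bar>x - y\<bar> \<le> a \<Longrightarrow> \<bar>y - z\<bar> \<le> b \<Longrightarrow> \<bar>x - z\<bar> \<le> a + b" for x y z a b :: real
      by linarith
    from this[OF this[OF d12 d23] d34] show ?thesis
      using ch \<open>\<bar>SF F - 2 * M1\<bar> \<le> 2 * Tsum\<close> by blast
  qed
  also have "8 * (real D)\<^sup>2 * C * psi P J + 2 * 2 ^ card S * C * psi P J + 2 * C * psi P J =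
     (8 * (real D)\<^sup>2 + 2 * 2 ^ card S + 2) * (C * psi P J)" by (simp add: algebra_simps)
  also have "2 * \<dots> \<le> 2 * ((12 * ((real D)\<^sup>2 * 2 ^ card S)) * (C * psi P J))"
  proof (intro mult_left_mono mult_right_mono)
    define x y where "x = (real D)\<^sup>2" and "y = (2 :: real) ^ card S"
    have "1 \<le> real D" using D by simp
    hence xy: "x \<ge> 1" "y \<ge> 1" by (auto simp: x_def y_def one_le_power)
    have "x \<le> x * y" "y \<le> x * y" using xy by (simp_all add: mult_le_cancel_left1 mult_le_cancel_right1)
    hence "8 * x + 2 * y + 2 \<le> 12 * (x * y)" using xy by linarith
    thus "8 * (real D)\<^sup>2 + 2 * 2 ^ card S + 2 \<le> 12 * ((real D)\<^sup>2 * 2 ^ card S)" by (simp only: x_def y_def)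
  qed (use C0 psi_nonneg in auto)
  finally show ?thesis unfolding M4 P_def[symmetric] C_def by (simp add: mult_ac)
qed

end

section \<open>Local factors at the sifted primes\<close>

lemma prod_primes_pos: "(\<And>p. p \<in> S \<Longrightarrow> prime p) \<Longrightarrow> \<Prod>S > (0 :: nat)"
  by (rule prod_pos) (blast intro: prime_gt_0_nat)

lemma coprime_prod_primes:
  assumes "prime p" "p \<notin> S" "\<And>q. q \<in> S \<Longrightarrow> prime (q :: nat)"
  shows "coprime p (\<Prod>S)"
proof (rule prod_coprime_right)
  fix q assume "q \<in> S"
  thus "coprime p q" using assms by (intro primes_coprime) auto
qed

lemma mean2_linear: "mean2 N (\<lambda>i j. a * f i j + b * g i j) = a * mean2 N f + b * mean2 N g"
  unfolding mean2_def by (simp add: sum.distrib sum_distrib_left add_divide_distrib)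

lemma mean2_cmult: "mean2 N (\<lambda>i j. a * f i j) = a * mean2 N f"
  unfolding mean2_def by (simp add: sum_distrib_left)

lemma mean2_sum: "mean2 N (\<lambda>i j. \<Sum>q\<in>A. f q i j) = (\<Sum>q\<in>A. mean2 N (f q))"
proof -
  have "(\<Sum>a<N. \<Sum>b<N. \<Sum>q\<in>A. f q (int a) (int b)) = (\<Sum>a<N. \<Sum>q\<in>A. \<Sum>b<N. f q (int a) (int b))"
    by (intro sum.cong refl sum.swap)
  also have "\<dots> = (\<Sum>q\<in>A. \<Sum>a<N. \<Sum>b<N. f q (int a) (int b))" by (rule sum.swap)
  finally show ?thesis by (simp add: mean2_def sum_divide_distrib)
qed

lemma mean2_const: "N > 0 \<Longrightarrow> mean2 N (\<lambda>_ _. c) = c"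
  by (simp add: mean2_def power2_eq_square)

lemma mean2_left: "N > 0 \<Longrightarrow> mean2 N (\<lambda>i j. f i) = (\<Sum>a<N. f (int a)) / real N"
  by (simp add: mean2_def power2_eq_square sum_distrib_left[symmetric])

text \<open>If \<open>z\<close> is one root, then \<open>p^e\<close> divides
  \<open>(y - z) * (y + z)\<close> for every root \<open>y\<close>. Whatever power of
  \<open>p\<close> divides \<open>z\<close>, one of the two factors is divisible by
  \<open>p^s\<close> with \<open>s\<close> half of \<open>e\<close> rounded up, so the roots lie in
  two classes modulo \<open>p^s\<close>.\<close>

lemma card_square_residues:
  assumes p: "prime p" "odd p" and e: "e \<le> J"
  shows "(\<Sum>y<p ^ J. of_bool (int (p ^ e) dvd c - (int y)\<^sup>2)) \<le> 2 * real (p ^ J) / real p ^ ((e + 1) div 2)"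
proof -
  define s where "s = (e + 1) div 2"
  have sJ: "s \<le> J" using e by (simp add: s_def)
  have p0: "p > 0" using p prime_gt_0_nat by blast
  have one: "(\<Sum>y<p ^ J. of_bool (int (p ^ s) dvd int y - z)) = real (p ^ J) / real p ^ s" for z
  proof -
    have "(\<Sum>y<p ^ J. of_bool (int (p ^ s) dvd int y - z) :: real) = (\<Sum>y<p ^ J. of_bool (int (p ^ s) dvd (z + int y) - z))"
    proof (rule sum_residues_shift[of "p ^ J" "\<lambda>x. of_bool (int (p ^ s) dvd x - z)", symmetric])
      fix x y assume "[x = y] (mod int (p ^ J))"
      hence "[x = y] (mod int (p ^ s))"
        by (rule cong_dvd_modulus) (use sJ in \<open>simp add: le_imp_power_dvd\<close>)
      hence "[x - z = y - z] (mod int (p ^ s))" by (intro cong_diff cong_refl)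
      hence "int (p ^ s) dvd x - z \<longleftrightarrow> int (p ^ s) dvd y - z" by (rule cong_dvd_iff)
      thus "of_bool (int (p ^ s) dvd x - z) = (of_bool (int (p ^ s) dvd y - z) :: real)" by simp
    qed (use p0 in simp)
    also have "\<dots> = (\<Sum>y<p ^ J. of_bool (p ^ s dvd y))" by (simp flip: of_nat_power)
    also have "\<dots> = real (card ({..<p ^ J} \<inter> {y. p ^ s dvd y}))" by (simp add: sum_of_bool_eq)
    also have "{..<p ^ J} \<inter> {y. p ^ s dvd y} = {y \<in> {..<p ^ J}. p ^ s dvd y}" by blast
    also have "card \<dots> = p ^ J div p ^ s"
      using sJ p0 by (intro card_multiples_below) (auto simp: le_imp_power_dvd)
    also have "real (p ^ J div p ^ s) = real (p ^ J) / real (p ^ s)"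
      using sJ by (intro real_of_nat_div le_imp_power_dvd)
    finally show ?thesis by simp
  qed
  show ?thesis
  proof (cases "\<exists>z. int (p ^ e) dvd c - z\<^sup>2")
    case True
    then obtain z where z: "int (p ^ e) dvd c - z\<^sup>2" by blast
    have "(\<Sum>y<p ^ J. of_bool (int (p ^ e) dvd c - (int y)\<^sup>2) :: real) \<le>
       (\<Sum>y<p ^ J. of_bool (int (p ^ s) dvd int y - z) + of_bool (int (p ^ s) dvd int y - (- z)))"
    proof (rule sum_mono)
      fix y
      show "of_bool (int (p ^ e) dvd c - (int y)\<^sup>2) \<le>
         (of_bool (int (p ^ s) dvd int y - z) + of_bool (int (p ^ s) dvd int y - (- z)) :: real)"
      proof (cases "int (p ^ e) dvd c - (int y)\<^sup>2")
        case True
        hence "int (p ^ e) dvd (c - z\<^sup>2) - (c - (int y)\<^sup>2)" using z by (rule dvd_diff[rotated])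
        hence "int p ^ e dvd (int y - z) * (int y - (- z))"
          by (simp add: power2_eq_square algebra_simps)
        moreover have "s + (Suc e - s) = Suc e" by (simp add: s_def)
        moreover have "prime_elem (int p)" using p by simp
        ultimately have "int p ^ s dvd int y - z \<or> int p ^ (Suc e - s) dvd int y - (- z)"
          by (rule prime_elem_power_dvd_cases)
        moreover have "s \<le> Suc e - s" by (simp add: s_def)
        hence "int p ^ s dvd int p ^ (Suc e - s)" by (rule le_imp_power_dvd)
        ultimately have "int p ^ s dvd int y - z \<or> int p ^ s dvd int y - (- z)" by (meson dvd_trans)
        thus ?thesis by auto
      qed simp
    qed
    also have "\<dots> = 2 * real (p ^ J) / real p ^ s" unfolding sum.distrib one by simp
    finally show ?thesis by (simp add: s_def)
  next
    case False
    hence "(\<Sum>y<p ^ J. of_bool (int (p ^ e) dvd c - (int y)\<^sup>2)) = (0 :: real)" by simp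
    thus ?thesis by simp
  qed
qed

text \<open>Every exponent from 1 on occurs twice, so an even cut-off \<open>2 * k\<close> gives 1
  plus twice a geometric sum.\<close>

lemma sum_power_half_le:
  fixes x :: real
  assumes "0 < x" "x < 1"
  shows "(\<Sum>e\<le>n. x ^ ((e + 1) div 2)) \<le> 1 + 2 * x / (1 - x)"
proof -
  have "(\<Sum>e\<le>2 * k. x ^ ((e + 1) div 2)) = 1 + 2 * (\<Sum>i<k. x ^ Suc i)" for k
  proof (induction k)
    case (Suc k)
    have "{..2 * Suc k} = insert (2 * k + 2) (insert (2 * k + 1) {..2 * k})" by auto
    thus ?case using Suc by (simp add: algebra_simps)
  qed simp
  moreover have "(\<Sum>i<k. x ^ Suc i) \<le> x / (1 - x)" for k
  proof -
    have "(\<Sum>i<k. x ^ Suc i) = x * (\<Sum>i<k. x ^ i)" by (simp add: sum_distrib_left)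
    also have "(\<Sum>i<k. x ^ i) = (1 - x ^ k) / (1 - x)" using assms by (intro sum_gp_strict[THEN trans]) auto
    also have "x * ((1 - x ^ k) / (1 - x)) \<le> x * (1 / (1 - x))"
      using assms by (intro mult_left_mono divide_right_mono) auto
    finally show ?thesis by simp
  qed
  ultimately have *: "(\<Sum>e\<le>2 * n. x ^ ((e + 1) div 2)) \<le> 1 + 2 * x / (1 - x)"
    by (metis add_left_mono mult_left_mono times_divide_eq_right zero_le_numeral)
  have "(\<Sum>e\<le>n. x ^ ((e + 1) div 2)) \<le> (\<Sum>e\<le>2 * n. x ^ ((e + 1) div 2))"
    using assms by (intro sum_mono2) auto
  thus ?thesis using * by linarith
qed

context four_sq_box begin

lemma EF_linear:
  "EF P J (\<lambda>i j. a * f i j + b * g i j) = a * EF P J f + b * EF P J g"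
proof -
  have "EF P J (\<lambda>i j. a * f i j + b * g i j) = (\<Sum>q | q dvd P ^ J. chi q *
     mean2 (P ^ J) (\<lambda>i j. a * (f i j * dn q i j) + b * (g i j * dn q i j)))"
    unfolding EF_def by (simp only: distrib_right mult.assoc)
  thus ?thesis unfolding mean2_linear EF_def
    by (simp add: sum.distrib sum_distrib_left ring_distribs mult_ac)
qed

text \<open>\<open>EF\<close> is a mean of \<open>F\<close> against \<open>rr\<close> of the part of
  \<open>n\<close> dividing \<open>P^J\<close>. As \<open>rr\<close> is nonnegative at positive
  arguments, \<open>EF\<close> is monotone in \<open>F\<close>, although its definition contains
  signs. The absolute value is there because residues may make \<open>nn i j\<close> negative or
  0.\<close>

lemma EF_eq_mean_rr:
  assumes P: "P ^ J > 0"
  shows "EF P J F = mean2 (P ^ J) (\<lambda>i j. F i j * real_of_int (rr (gcd (P ^ J) (nat \<bar>nn i j\<bar>))))"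
proof -
  have fin: "finite {q. q dvd P ^ J}" using P by simp
  have "real_of_int (rr (gcd (P ^ J) (nat \<bar>x\<bar>))) = (\<Sum>q | q dvd P ^ J. chi q * of_bool (int q dvd x))" for x
  proof -
    have d: "int q dvd x \<longleftrightarrow> q dvd nat \<bar>x\<bar>" for q by (simp only: dvd_nat_abs_iff)
    have "(\<Sum>q | q dvd P ^ J. chi q * of_bool (int q dvd x)) = (\<Sum>q\<in>{q \<in> {q. q dvd P ^ J}. q dvd nat \<bar>x\<bar>}. chi q)"
      using fin unfolding d by (subst sum.inter_filter) (auto simp: of_bool_def simp del: dvd_nat_abs_iff intro!: sum.cong)
    also have "{q \<in> {q. q dvd P ^ J}. q dvd nat \<bar>x\<bar>} = {q. q dvd gcd (P ^ J) (nat \<bar>x\<bar>)}"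
      by (simp only: gcd_greatest_iff mem_Collect_eq)
    finally show ?thesis by (simp only: rr_def of_int_sum)
  qed
  hence key: "F i j * real_of_int (rr (gcd (P ^ J) (nat \<bar>nn i j\<bar>))) =
      (\<Sum>q | q dvd P ^ J. chi q * (F i j * dn q i j))" for i j
    by (simp only: sum_distrib_left mult.left_commute)
  show ?thesis unfolding EF_def key mean2_sum mean2_cmult ..
qed

lemma EF_mono:
  assumes P: "P ^ J > 0" and "\<And>i j. F i j \<le> G i j"
  shows "EF P J F \<le> EF P J G"
  unfolding EF_eq_mean_rr[OF P] using P
  by (intro mean2_mono mult_right_mono assms) (auto intro!: rr_nonneg)

lemma abs_EF_le:
  assumes P: "P ^ J > 0" and F: "\<And>i j. \<bar>F i j\<bar> \<le> 1"
  shows "\<bar>EF P J F\<bar> \<le> EF P J box1"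
proof -
  have "F i j \<le> 1" "- 1 \<le> F i j" for i j using F[of i j] by linarith+
  hence "EF P J F \<le> EF P J box1" "EF P J (\<lambda>i j. (- 1) * 1 + 0 * 1) \<le> EF P J F"
    using P by (intro EF_mono; simp)+
  moreover have "EF P J (\<lambda>i j. (- 1) * 1 + 0 * 1) = - EF P J box1"
    by (subst EF_linear) simp
  ultimately show ?thesis by linarith
qed

lemma EF_crt:
  assumes cop: "coprime P1 P2" and pos: "P1 > 0" "P2 > 0" and f: "per2 (P1 ^ J) f" and g: "per2 (P2 ^ J) g"
  shows "EF (P1 * P2) J (\<lambda>i j. f i j * g i j) = EF P1 J f * EF P2 J g"
proof -
  have copJ: "coprime (P1 ^ J) (P2 ^ J)" using cop by simp
  have posJ: "P1 ^ J > 0" "P2 ^ J > 0" using pos by auto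
  have "EF (P1 * P2) J (\<lambda>i j. f i j * g i j) = (\<Sum>x | x dvd P1 ^ J. \<Sum>y | y dvd P2 ^ J.
     chi (x * y) * mean2 (P1 ^ J * P2 ^ J) (\<lambda>i j. f i j * g i j * dn (x * y) i j))"
    unfolding EF_def power_mult_distrib by (rule sum_divisors_coprime_mult[OF copJ posJ])
  also have "\<dots> = (\<Sum>x | x dvd P1 ^ J. \<Sum>y | y dvd P2 ^ J.
     (chi x * mean2 (P1 ^ J) (\<lambda>i j. f i j * dn x i j)) *
     (chi y * mean2 (P2 ^ J) (\<lambda>i j. g i j * dn y i j)))"
  proof (intro sum.cong refl)
    fix x y assume "x \<in> {x. x dvd P1 ^ J}" "y \<in> {y. y dvd P2 ^ J}"
    hence xy: "x dvd P1 ^ J" "y dvd P2 ^ J" by auto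
    have "coprime x y" using copJ xy by (meson coprime_divisors)
    hence "int (x * y) dvd z \<longleftrightarrow> int x dvd z \<and> int y dvd z" for z
      by (metis coprime_int_iff dvd_mult_left dvd_mult_right divides_mult of_nat_mult)
    hence "(\<lambda>i j. f i j * g i j * dn (x * y) i j) =
       (\<lambda>i j. (f i j * dn x i j) * (g i j * dn y i j))"
      by (auto simp: fun_eq_iff of_bool_def)
    moreover have "mean2 (P1 ^ J * P2 ^ J) (\<lambda>i j. (f i j * dn x i j) * (g i j * dn y i j)) =
       mean2 (P1 ^ J) (\<lambda>i j. f i j * dn x i j) * mean2 (P2 ^ J) (\<lambda>i j. g i j * dn y i j)"
      by (intro mean2_crt copJ posJ per2_mult f g per2_dvd[OF per2_dvd_nn] xy)
    ultimately show "chi (x * y) * mean2 (P1 ^ J * P2 ^ J) (\<lambda>i j. f i j * g i j * dn (x * y) i j) =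
      (chi x * mean2 (P1 ^ J) (\<lambda>i j. f i j * dn x i j)) *
      (chi y * mean2 (P2 ^ J) (\<lambda>i j. g i j * dn y i j))"
      by (simp only: chi4_mult of_int_mult mult_ac)
  qed
  also have "\<dots> = EF P1 J f * EF P2 J g" unfolding EF_def by (rule sum_product[symmetric])
  finally show ?thesis .
qed

lemma per2_const: "per2 N (\<lambda>_ _. c)"
  by (simp add: per2_def)

lemma EF_prod:
  assumes "finite S" "\<And>p. p \<in> S \<Longrightarrow> prime p" "\<And>p. p \<in> S \<Longrightarrow> per2 (p ^ J) (f p)"
  shows "EF (\<Prod>S) J (\<lambda>i j. \<Prod>p\<in>S. f p i j) = (\<Prod>p\<in>S. EF p J (f p)) \<and> per2 ((\<Prod>S) ^ J) (\<lambda>i j. \<Prod>p\<in>S. f p i j)"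
  using assms
proof (induction S rule: finite_induct)
  case empty
  thus ?case by (simp add: EF_def mean2_def per2_def)
next
  case (insert p S)
  have IH: "EF (\<Prod>S) J (\<lambda>i j. \<Prod>p\<in>S. f p i j) = (\<Prod>p\<in>S. EF p J (f p))" "per2 ((\<Prod>S) ^ J) (\<lambda>i j. \<Prod>p\<in>S. f p i j)"
    using insert.IH insert.prems by blast+
  have p: "prime p" using insert.prems by blast
  have "coprime p (\<Prod>S)" using insert by (intro coprime_prod_primes) auto
  moreover have "p > 0" using p by (rule prime_gt_0_nat)
  moreover have "\<Prod>S > 0" using insert.prems by (intro prod_primes_pos) auto
  ultimately have "EF (p * \<Prod>S) J (\<lambda>i j. f p i j * (\<Prod>p\<in>S. f p i j)) = EF p J (f p) * EF (\<Prod>S) J (\<lambda>i j. \<Prod>p\<in>S. f p i j)"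
    using insert.prems IH(2) by (intro EF_crt) auto
  moreover have "per2 ((p * \<Prod>S) ^ J) (\<lambda>i j. f p i j * (\<Prod>p\<in>S. f p i j))"
  proof (rule per2_mult)
    have "per2 (p ^ J) (f p)" using insert.prems by blast
    thus "per2 ((p * \<Prod>S) ^ J) (f p)" by (rule per2_dvd) (simp add: power_mult_distrib)
    show "per2 ((p * \<Prod>S) ^ J) (\<lambda>i j. \<Prod>p\<in>S. f p i j)"
      by (rule per2_dvd[OF IH(2)]) (simp add: power_mult_distrib)
  qed
  ultimately show ?case using insert.hyps IH by simp
qed

text \<open>With one coordinate fixed, divisibility of \<open>n\<close> by \<open>p^e\<close>
  prescribes the square of the other modulo \<open>p^e\<close>, and
  \<open>card_square_residues\<close> bounds the number of choices. Hence the bound also holds under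
  any condition on the fixed coordinate.\<close>

lemma mean2_event_le:
  assumes p: "prime p" "odd p" and e: "e \<le> J" and A: "\<And>i. A i \<ge> 0"
  shows "mean2 (p ^ J) (\<lambda>i j. A i * dn (p ^ e) i j) \<le>
      mean2 (p ^ J) (\<lambda>i j. A i) * (2 / real p ^ ((e + 1) div 2))"
    and "mean2 (p ^ J) (\<lambda>i j. A j * dn (p ^ e) i j) \<le>
      mean2 (p ^ J) (\<lambda>i j. A j) * (2 / real p ^ ((e + 1) div 2))"
proof -
  let ?r = "2 / real p ^ ((e + 1) div 2)"
  define N where "N = p ^ J"
  have p0: "p > 0" using p prime_gt_0_nat by blast
  have N0: "real N > 0" "N > 0" using p0 by (auto simp: N_def)
  have two: "coprime 2 (int N)" using p by (simp add: N_def)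
  have inner: "(\<Sum>j<N. of_bool (int (p ^ e) dvd c - (2 * int j + b)\<^sup>2)) \<le> real N * ?r" for b c
  proof -
    have "(\<Sum>j<N. of_bool (int (p ^ e) dvd c - (2 * int j + b)\<^sup>2) :: real) = (\<Sum>j<N. of_bool (int (p ^ e) dvd c - (b + 2 * int j)\<^sup>2))"
      by (simp only: add.commute)
    also have "\<dots> = (\<Sum>y<N. of_bool (int (p ^ e) dvd c - (int y)\<^sup>2))"
    proof (rule sum_residues_affine[of N "\<lambda>x. of_bool (int (p ^ e) dvd c - x\<^sup>2)"])
      fix x y assume "[x = y] (mod int N)"
      hence "[x = y] (mod int (p ^ e))"
        by (rule cong_dvd_modulus) (use e in \<open>simp add: N_def le_imp_power_dvd\<close>)
      hence "[c - x\<^sup>2 = c - y\<^sup>2] (mod int (p ^ e))" by (intro cong_diff cong_refl cong_pow)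
      hence "int (p ^ e) dvd c - x\<^sup>2 \<longleftrightarrow> int (p ^ e) dvd c - y\<^sup>2" by (rule cong_dvd_iff)
      thus "of_bool (int (p ^ e) dvd c - x\<^sup>2) = (of_bool (int (p ^ e) dvd c - y\<^sup>2) :: real)" by simp
    qed (use two N0 in auto)
    also have "\<dots> \<le> 2 * real N / real p ^ ((e + 1) div 2)" unfolding N_def by (rule card_square_residues[OF p e])
    finally show ?thesis by (simp only: times_divide_eq_right mult.commute)
  qed
  have eq1: "nn i j = (int m - (2 * i + int al)\<^sup>2) - (2 * j + int be)\<^sup>2"
    and eq2: "nn i j = (int m - (2 * j + int be)\<^sup>2) - (2 * i + int al)\<^sup>2" for i j
    by (simp_all add: nn_def)
  have main: "mean2 N (\<lambda>i j. A i * of_bool (int (p ^ e) dvd c i - (2 * j + b)\<^sup>2)) \<le> mean2 N (\<lambda>i j. A i) * ?r" for b c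
  proof -
    have "(\<Sum>i<N. \<Sum>j<N. A (int i) * of_bool (int (p ^ e) dvd c (int i) - (2 * int j + b)\<^sup>2)) =
       (\<Sum>i<N. A (int i) * (\<Sum>j<N. of_bool (int (p ^ e) dvd c (int i) - (2 * int j + b)\<^sup>2)))"
      by (simp only: sum_distrib_left)
    also have "\<dots> \<le> (\<Sum>i<N. A (int i) * (real N * ?r))"
      by (intro sum_mono mult_left_mono inner A)
    also have "\<dots> = (\<Sum>i<N. A (int i)) * (real N * ?r)"
      by (rule sum_distrib_right[symmetric])
    finally have "mean2 N (\<lambda>i j. A i * of_bool (int (p ^ e) dvd c i - (2 * j + b)\<^sup>2)) \<le>
       (\<Sum>i<N. A (int i)) * (real N * ?r) / (real N)\<^sup>2"
      unfolding mean2_def by (rule divide_right_mono) simp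
    also have "\<dots> = (\<Sum>i<N. A (int i)) / real N * ?r"
      using N0 by (simp add: power2_eq_square)
    finally show ?thesis using N0 by (simp only: mean2_left)
  qed
  show "mean2 (p ^ J) (\<lambda>i j. A i * dn (p ^ e) i j) \<le>
      mean2 (p ^ J) (\<lambda>i j. A i) * ?r"
    unfolding eq1 N_def[symmetric] by (rule main)
  have "mean2 N (\<lambda>i j. A j * dn (p ^ e) i j) = mean2 N (\<lambda>j i. A j * dn (p ^ e) i j)"
    by (rule mean2_swap[symmetric])
  also have "\<dots> \<le> mean2 N (\<lambda>j i. A j) * ?r" unfolding eq2 by (rule main)
  also have "mean2 N (\<lambda>j i. A j) = mean2 N (\<lambda>i j. A j)" by (rule mean2_swap)
  finally show "mean2 (p ^ J) (\<lambda>i j. A j * dn (p ^ e) i j) \<le>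
      mean2 (p ^ J) (\<lambda>i j. A j) * ?r" unfolding N_def .
qed

text \<open>The local weight is 1 where \<open>p\<close> does not divide \<open>n\<close> and
  nonnegative elsewhere; \<open>p dvd n\<close> has density at most \<open>2 / p\<close>.\<close>

lemma EF_prime_1_ge:
  assumes p: "prime p" "odd p" and J: "J \<ge> 1"
  shows "EF p J box1 \<ge> 1 - 2 / real p"
proof -
  have p0: "p ^ J > 0" using p prime_gt_0_nat by auto
  have "mean2 (p ^ J) (\<lambda>i j. 1 * of_bool (int (p ^ 1) dvd nn i j)) \<le> mean2 (p ^ J) (\<lambda>i j. 1) * (2 / real p ^ ((1 + 1) div 2))"
    using mean2_event_le(1)[OF p, of 1 J "\<lambda>_. 1"] J by simp
  hence 1: "mean2 (p ^ J) (\<lambda>i j. dn p i j) \<le> 2 / real p"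
    by (simp add: mean2_const[OF p0])
  have "1 - mean2 (p ^ J) (\<lambda>i j. dn p i j) = mean2 (p ^ J) (\<lambda>i j. 1 * 1 + (- 1) * dn p i j)"
    by (subst mean2_linear) (simp add: mean2_const[OF p0])
  also have "\<dots> \<le> mean2 (p ^ J) (\<lambda>i j. 1 * real_of_int (rr (gcd (p ^ J) (nat \<bar>nn i j\<bar>))))"
  proof (rule mean2_mono)
    fix i j
    show "1 * 1 + - 1 * dn p i j \<le> 1 * real_of_int (rr (gcd (p ^ J) (nat \<bar>nn i j\<bar>)))"
    proof (cases "int p dvd nn i j")
      case True
      thus ?thesis using p0 by (auto intro!: rr_nonneg)
    next
      case False
      hence "\<not> p dvd nat \<bar>nn i j\<bar>" unfolding dvd_nat_abs_iff .
      hence "coprime p (nat \<bar>nn i j\<bar>)" by (rule prime_imp_coprime[OF p(1)])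
      hence "gcd (p ^ J) (nat \<bar>nn i j\<bar>) = 1" unfolding coprime_iff_gcd_eq_1[symmetric] by (rule coprime_power_left_iff[THEN iffD2, OF disjI1])
      moreover have "rr 1 = 1" by (simp add: rr_def)
      ultimately show ?thesis using False by (simp only: of_bool_eq of_int_1)
    qed
  qed
  also have "\<dots> = EF p J box1" by (rule EF_eq_mean_rr[OF p0, symmetric])
  finally show ?thesis using 1 by linarith
qed

text \<open>The character is replaced by 1 and the divisors \<open>p^e\<close> are summed with the
  bounds of \<open>mean2_event_le\<close>, a geometric series in which every exponent occurs
  twice.\<close>

lemma EF_prime_le:
  assumes p: "prime p" "odd p" and f: "\<And>i j. f i j \<ge> 0" and \<beta>: "\<beta> \<ge> 0"
    and b0: "mean2 (p ^ J) f \<le> \<beta>"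
    and b: "\<And>e. e \<le> J \<Longrightarrow> mean2 (p ^ J) (\<lambda>i j. f i j * dn (p ^ e) i j) \<le> \<beta> * (2 / real p ^ ((e + 1) div 2))"
  shows "EF p J f \<le> \<beta> * (1 + 4 / (real p - 1))"
proof -
  let ?f = "\<lambda>e i j. f i j * dn (p ^ e) i j"
  have p3: "p \<ge> 3" using p prime_ge_2_nat[of p] by (cases "p = 2") auto
  have p0: "p > 0" using p3 by simp
  have chi: "chi q * x \<le> x" if "x \<ge> 0" for q x
  proof -
    have "chi q \<le> 1" using abs_chi4_le[of q] by linarith
    thus ?thesis using mult_right_mono[of _ 1 x] that by simp
  qed
  have nonneg: "mean2 (p ^ J) (\<lambda>i j. f i j * dn q i j) \<ge> 0" for q
    unfolding mean2_def using f by (intro divide_nonneg_nonneg sum_nonneg mult_nonneg_nonneg) auto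
  have divs: "{q. q dvd p ^ J} = (\<lambda>e. p ^ e) ` {..J}" using p(1) by (auto simp: divides_primepow_nat)
  have inj: "inj_on (\<lambda>e. p ^ e) {..J}" using p3 by (auto simp: inj_on_def)
  have "EF p J f = (\<Sum>e\<le>J. chi (p ^ e) * mean2 (p ^ J) (?f e))"
    unfolding EF_def divs by (subst sum.reindex[OF inj]) (simp add: o_def)
  also have "\<dots> \<le> (\<Sum>e\<le>J. mean2 (p ^ J) (?f e))"
    by (intro sum_mono chi nonneg)
  also have "{..J} = insert 0 {1..J}" by auto
  also have "(\<Sum>e\<in>insert 0 {1..J}. mean2 (p ^ J) (?f e)) =
     mean2 (p ^ J) f + (\<Sum>e\<in>{1..J}. mean2 (p ^ J) (?f e))"
    by (subst sum.insert) auto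
  also have "\<dots> \<le> \<beta> + (\<Sum>e\<in>{1..J}. \<beta> * (2 / real p ^ ((e + 1) div 2)))"
    by (intro add_mono b0 sum_mono b) auto
  also have "\<dots> = \<beta> * (1 + 2 * (\<Sum>e\<in>{1..J}. (1 / real p) ^ ((e + 1) div 2)))"
    by (simp add: sum_distrib_left power_inverse ring_distribs mult_ac divide_inverse)
  also have "\<dots> \<le> \<beta> * (1 + 4 / (real p - 1))"
  proof (intro mult_left_mono \<beta> add_left_mono)
    have "(\<Sum>e\<le>J. (1 / real p) ^ ((e + 1) div 2)) \<le> 1 + 2 * (1 / real p) / (1 - 1 / real p)"
      using p3 by (intro sum_power_half_le) auto
    moreover have "{..J} = insert 0 {1..J}" by auto
    moreover have "2 * (1 / real p) / (1 - 1 / real p) = 2 / (real p - 1)" using p3 by (simp add: field_simps)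
    ultimately show "2 * (\<Sum>e\<in>{1..J}. (1 / real p) ^ ((e + 1) div 2)) \<le> 4 / (real p - 1)" by simp
  qed
  finally show ?thesis .
qed

lemma mean_divisible:
  assumes p: "prime p" "odd p" and k: "k \<le> J"
  shows "mean2 (p ^ J) (\<lambda>i j. of_bool (int (p ^ k) dvd 2 * i + b)) = 1 / real p ^ k"
proof -
  define N where "N = p ^ J"
  have p0: "p > 0" using p prime_gt_0_nat by blast
  have N0: "real N > 0" "N > 0" using p0 by (auto simp: N_def)
  have "(\<Sum>i<N. of_bool (int (p ^ k) dvd 2 * int i + b) :: real) = (\<Sum>i<N. of_bool (int (p ^ k) dvd b + 2 * int i))"
    by (simp only: add.commute)
  also have "\<dots> = (\<Sum>i<N. of_bool (int (p ^ k) dvd int i))"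
  proof (rule sum_residues_affine[of N "\<lambda>x. of_bool (int (p ^ k) dvd x)"])
    fix x y assume "[x = y] (mod int N)"
    hence "[x = y] (mod int (p ^ k))"
      by (rule cong_dvd_modulus) (use k in \<open>simp add: N_def le_imp_power_dvd\<close>)
    hence "int (p ^ k) dvd x \<longleftrightarrow> int (p ^ k) dvd y" by (rule cong_dvd_iff)
    thus "of_bool (int (p ^ k) dvd x) = (of_bool (int (p ^ k) dvd y) :: real)" by simp
  qed (use p N0 in \<open>auto simp: N_def\<close>)
  also have "\<dots> = real (card ({..<N} \<inter> {i. p ^ k dvd i}))" by (simp add: sum_of_bool_eq flip: of_nat_power)
  also have "{..<N} \<inter> {i. p ^ k dvd i} = {i \<in> {..<N}. p ^ k dvd i}" by blast
  also have "card \<dots> = N div p ^ k"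
    using k N0 by (intro card_multiples_below) (auto simp: N_def le_imp_power_dvd)
  also have "real (N div p ^ k) = real N / real (p ^ k)"
    using k unfolding N_def by (intro real_of_nat_div le_imp_power_dvd)
  finally have "(\<Sum>i<N. of_bool (int (p ^ k) dvd 2 * int i + b)) = real N / real p ^ k" by simp
  thus ?thesis using N0 by (simp add: mean2_left N_def)
qed

lemma EF_prime_event_le:
  assumes p: "prime p" "odd p" and k: "k \<le> J"
  shows "EF p J (\<lambda>i j. of_bool (int (p ^ k) dvd 2 * i + int al)) \<le> (1 + 4 / (real p - 1)) / real p ^ k"
    and "EF p J (\<lambda>i j. of_bool (int (p ^ k) dvd 2 * j + int be)) \<le> (1 + 4 / (real p - 1)) / real p ^ k"
proof -
  let ?A = "\<lambda>i j :: int. of_bool (int (p ^ k) dvd 2 * i + int al) :: real" and ?B = "\<lambda>i j :: int. of_bool (int (p ^ k) dvd 2 * j + int be) :: real"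
  have m1: "mean2 (p ^ J) ?A = 1 / real p ^ k"
    by (rule mean_divisible[OF p k])
  have m2: "mean2 (p ^ J) ?B = 1 / real p ^ k"
    using mean_divisible[OF p k, of "int be"] mean2_swap[of "p ^ J" "\<lambda>i j. of_bool (int (p ^ k) dvd 2 * i + int be)"] by simp
  have *: "EF p J F \<le> (1 + 4 / (real p - 1)) / real p ^ k"
    if "mean2 (p ^ J) F = 1 / real p ^ k" "\<And>i j. F i j \<ge> 0"
      "\<And>e. e \<le> J \<Longrightarrow> mean2 (p ^ J) (\<lambda>i j. F i j * dn (p ^ e) i j) \<le> mean2 (p ^ J) F * (2 / real p ^ ((e + 1) div 2))" for F
  proof -
    have "EF p J F \<le> 1 / real p ^ k * (1 + 4 / (real p - 1))"
      using that by (intro EF_prime_le[OF p]) auto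
    thus ?thesis by simp
  qed
  show "EF p J ?A \<le> (1 + 4 / (real p - 1)) / real p ^ k"
    by (rule *[OF m1 _ mean2_event_le(1)[OF p]]) auto
  show "EF p J ?B \<le> (1 + 4 / (real p - 1)) / real p ^ k"
    by (rule *[OF m2 _ mean2_event_le(2)[OF p]]) auto
qed

end

section \<open>Euler product bounds for the error weight \<open>psi\<close>\<close>

lemma sum_divisors_conv_le:
  fixes g h :: "nat \<Rightarrow> real"
  assumes N: "N > 0" and g: "\<And>d. g d \<ge> 0" and h: "\<And>d. h d \<ge> 0"
  shows "(\<Sum>q | q dvd N. \<Sum>d | d dvd q. g d * h (q div d)) \<le> (\<Sum>d | d dvd N. g d) * (\<Sum>e | e dvd N. h e)"
proof -
  let ?D = "{q. q dvd N}" and ?f = "\<lambda>x :: nat \<times> nat. (snd x, fst x div snd x)"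
  let ?T = "Sigma ?D (\<lambda>q. {d. d dvd q})"
  have fin: "finite ?D" using N by simp
  have fd: "finite {d. d dvd q}" if "q dvd N" for q
    using dvd_pos_nat[OF N that] by (rule finite_divisors_nat)
  have inj: "inj_on ?f ?T"
    by (auto simp: inj_on_def elim!: dvdE)
  have sub: "?f ` ?T \<subseteq> ?D \<times> ?D"
  proof
    fix y assume "y \<in> ?f ` ?T"
    then obtain q d where qd: "q dvd N" "d dvd q" "y = (d, q div d)" by auto
    hence "q div d dvd q" by (metis dvd_triv_right dvd_div_mult_self dvd_triv_left)
    thus "y \<in> ?D \<times> ?D" using qd by (auto intro: dvd_trans)
  qed
  have "(\<Sum>q | q dvd N. \<Sum>d | d dvd q. g d * h (q div d)) = (\<Sum>(q, d)\<in>?T. g d * h (q div d))"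
    using fin fd by (intro sum.Sigma) auto
  also have "\<dots> = (\<Sum>x\<in>?T. (\<lambda>y. g (fst y) * h (snd y)) (?f x))" by (simp add: case_prod_unfold)
  also have "\<dots> = (\<Sum>y\<in>?f ` ?T. g (fst y) * h (snd y))"
    using sum.reindex[OF inj, of "\<lambda>y. g (fst y) * h (snd y)"] by (simp add: o_def)
  also have "\<dots> \<le> (\<Sum>y\<in>?D \<times> ?D. g (fst y) * h (snd y))"
    using fin g h by (intro sum_mono2 sub) auto
  also have "\<dots> = (\<Sum>d\<in>?D. \<Sum>e\<in>?D. g d * h e)"
    by (simp add: sum.cartesian_product case_prod_unfold)
  also have "\<dots> = (\<Sum>d | d dvd N. g d) * (\<Sum>e | e dvd N. h e)" by (rule sum_product[symmetric])
  finally show ?thesis .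
qed

text \<open>\<open>tau3\<close> is a threefold convolution of 1 and the power is multiplicative, so
  the sum over factorisations of divisors of \<open>N\<close> is part of a threefold product of
  divisor sums.\<close>

lemma sum_tau3_divisors_le:
  assumes N: "N > 0"
  shows "(\<Sum>q | q dvd N. real (tau3 q) * real q powr s) \<le> (\<Sum>d | d dvd N. real d powr s) ^ 3"
proof -
  let ?w = "\<lambda>d. real d powr s" and ?D = "\<lambda>N. {d :: nat. d dvd N}"
  have mult: "?w q = ?w d * ?w (q div d)" if "d dvd q" for q d
    using that by (auto simp: powr_mult elim!: dvdE)
  have tau: "(\<Sum>q\<in>?D N. real (card (?D q)) * ?w q) \<le> (\<Sum>d\<in>?D N. ?w d) ^ 2"
  proof -
    have "(\<Sum>q\<in>?D N. real (card (?D q)) * ?w q) = (\<Sum>q\<in>?D N. \<Sum>d\<in>?D q. ?w d * ?w (q div d))"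
    proof (intro sum.cong refl)
      fix q
      have "(\<Sum>d\<in>?D q. ?w d * ?w (q div d)) = (\<Sum>d\<in>?D q. ?w q)"
        by (intro sum.cong refl mult[symmetric]) simp
      thus "real (card (?D q)) * ?w q = (\<Sum>d\<in>?D q. ?w d * ?w (q div d))" by simp
    qed
    also have "\<dots> \<le> (\<Sum>d\<in>?D N. ?w d) * (\<Sum>d\<in>?D N. ?w d)" by (rule sum_divisors_conv_le[OF N]) auto
    finally show ?thesis by (simp add: power2_eq_square)
  qed
  have "(\<Sum>q\<in>?D N. real (tau3 q) * ?w q) = (\<Sum>q\<in>?D N. \<Sum>d\<in>?D q. ?w d * (real (card (?D (q div d))) * ?w (q div d)))"
  proof (intro sum.cong refl)
    fix q
    have "real (tau3 q) * ?w q = (\<Sum>d\<in>?D q. real (card (?D (q div d))) * ?w q)"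
      by (simp add: tau3_def sum_distrib_right)
    also have "\<dots> = (\<Sum>d\<in>?D q. ?w d * (real (card (?D (q div d))) * ?w (q div d)))"
    proof (intro sum.cong refl)
      fix d assume "d \<in> ?D q"
      hence "?w q = ?w d * ?w (q div d)" by (intro mult) simp
      thus "real (card (?D (q div d))) * ?w q = ?w d * (real (card (?D (q div d))) * ?w (q div d))" by simp
    qed
    finally show "real (tau3 q) * ?w q = (\<Sum>d\<in>?D q. ?w d * (real (card (?D (q div d))) * ?w (q div d)))" .
  qed
  also have "\<dots> \<le> (\<Sum>d\<in>?D N. ?w d) * (\<Sum>q\<in>?D N. real (card (?D q)) * ?w q)"
    by (rule sum_divisors_conv_le[OF N, of ?w "\<lambda>q. real (card (?D q)) * ?w q"]) auto
  also have "\<dots> \<le> (\<Sum>d\<in>?D N. ?w d) * (\<Sum>d\<in>?D N. ?w d) ^ 2"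
    by (intro mult_left_mono tau sum_nonneg) auto
  finally show ?thesis by (simp add: power3_eq_cube power2_eq_square mult.assoc)
qed

lemma sum_divisors_prime_power_le:
  assumes p: "prime p" and s: "s < 0"
  shows "(\<Sum>d | d dvd p ^ J. real d powr s) \<le> 1 / (1 - real p powr s)"
proof -
  have p2: "p \<ge> 2" using p by (rule prime_ge_2_nat)
  have x: "0 < real p powr s" "real p powr s < 1" using p2 s powr_less_one[of "real p" s] by auto
  have divs: "{q. q dvd p ^ J} = (\<lambda>e. p ^ e) ` {..J}" using p by (auto simp: divides_primepow_nat)
  have inj: "inj_on (\<lambda>e. p ^ e) {..J}" using p2 by (auto simp: inj_on_def)
  have "(\<Sum>d | d dvd p ^ J. real d powr s) = (\<Sum>e\<le>J. real (p ^ e) powr s)"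
    unfolding divs by (subst sum.reindex[OF inj]) (simp add: o_def)
  also have "\<dots> = (\<Sum>e<Suc J. (real p powr s) ^ e)"
    using p2 by (intro sum.cong) (auto simp: powr_powr mult.commute simp flip: powr_realpow)
  also have "\<dots> = (1 - (real p powr s) ^ Suc J) / (1 - real p powr s)" using x by (intro sum_gp_strict[THEN trans]) auto
  also have "\<dots> \<le> 1 / (1 - real p powr s)"
    using x by (intro divide_right_mono) (auto simp del: power_Suc)
  finally show ?thesis .
qed

lemma sum_divisors_power_le_prod:
  fixes J :: nat
  assumes "finite S" "\<And>p. p \<in> S \<Longrightarrow> prime p" and s: "s < 0"
  shows "(\<Sum>d | d dvd (\<Prod>S) ^ J. real d powr s) \<le> (\<Prod>p\<in>S. 1 / (1 - real p powr s))"
  using assms(1,2)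
proof (induction S rule: finite_induct)
  case (insert p S)
  have p: "prime p" using insert.prems by blast
  have p2: "p \<ge> 2" using p by (rule prime_ge_2_nat)
  have "coprime p (\<Prod>S)" using insert by (intro coprime_prod_primes) auto
  hence cop: "coprime (p ^ J) ((\<Prod>S) ^ J)" by simp
  have "\<Prod>S > 0" using insert.prems by (intro prod_primes_pos) auto
  hence pos: "p ^ J > 0" "(\<Prod>S) ^ J > 0" using p2 by auto
  have "\<Prod>(insert p S) = p * \<Prod>S" using insert.hyps by simp
  hence "(\<Sum>d | d dvd (\<Prod>(insert p S)) ^ J. real d powr s) = (\<Sum>x | x dvd p ^ J. \<Sum>y | y dvd (\<Prod>S) ^ J. real (x * y) powr s)"
    by (simp only: power_mult_distrib sum_divisors_coprime_mult[OF cop pos])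
  also have "\<dots> = (\<Sum>x | x dvd p ^ J. real x powr s) * (\<Sum>y | y dvd (\<Prod>S) ^ J. real y powr s)"
    by (simp add: sum_product powr_mult)
  also have "\<dots> \<le> (1 / (1 - real p powr s)) * (\<Prod>p\<in>S. 1 / (1 - real p powr s))"
  proof (intro mult_mono sum_divisors_prime_power_le p s insert.IH)
    show "0 \<le> 1 / (1 - real p powr s)" using p2 s powr_less_one[of "real p" s] by auto
  qed (use insert.prems in \<open>auto intro!: sum_nonneg\<close>)
  finally show ?case using insert.hyps by simp
qed simp

abbreviation psi_factor :: "nat \<Rightarrow> real" where
  "psi_factor p \<equiv> 2 / (1 - real p powr (- (3/4))) ^ 3"

context four_sq_box begin

lemma psi_le:
  fixes J :: nat
  assumes "finite S" "\<And>p. p \<in> S \<Longrightarrow> prime p"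
  shows "2 ^ card S * psi (\<Prod>S) J \<le> (\<Prod>p\<in>S. psi_factor p)"
proof -
  have "\<Prod>S > 0" using assms(2) by (rule prod_primes_pos)
  hence "psi (\<Prod>S) J \<le> (\<Sum>d | d dvd (\<Prod>S) ^ J. real d powr (- (3/4))) ^ 3"
    unfolding psi_def by (intro sum_tau3_divisors_le) simp
  also have "\<dots> \<le> (\<Prod>p\<in>S. 1 / (1 - real p powr (- (3/4)))) ^ 3"
    by (intro power_mono sum_divisors_power_le_prod assms sum_nonneg) auto
  finally have "2 ^ card S * psi (\<Prod>S) J \<le> 2 ^ card S * (\<Prod>p\<in>S. 1 / (1 - real p powr (- (3/4)))) ^ 3" by simp
  also have "\<dots> = (\<Prod>p\<in>S. 2) * (\<Prod>p\<in>S. (1 / (1 - real p powr (- (3/4)))) ^ 3)"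
    by (simp add: prod_power_distrib)
  also have "\<dots> = (\<Prod>p\<in>S. 2 * (1 / (1 - real p powr (- (3/4)))) ^ 3)"
    by (rule prod.distrib[symmetric])
  finally show ?thesis by (simp add: power_divide)
qed

end

text \<open>An elementary upper bound of Mertens type. Summing \<open>ln p\<close> over the primes
  dividing \<open>k\<close> gives at most \<open>ln k\<close>; summing this over
  \<open>k \<le> n\<close> in the other order counts each \<open>p\<close> exactly
  \<open>n div p\<close> times. The 2 comes from \<open>n / p \<le> 2 * (n div p)\<close> for
  \<open>p \<le> n\<close>.\<close>

lemma sum_ln_prime_div_le:
  assumes n: "n \<ge> 1"
  shows "(\<Sum>p | prime p \<and> p \<le> n. ln (real p) / real p) \<le> 2 * ln (real n)"
proof -
  let ?P = "{p. prime p \<and> p \<le> n}"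
  have fin: "finite ?P" by (rule finite_subset[of _ "{..n}"]) auto
  have lnk: "(\<Sum>p\<in>{p\<in>?P. p dvd k}. ln (real p)) \<le> ln (real n)" if k: "k \<in> {1..n}" for k
  proof -
    have eq: "{p\<in>?P. p dvd k} = prime_factors k"
      using k by (auto simp: prime_factors_dvd dest: dvd_imp_le)
    have "(\<Prod>p\<in>prime_factors k. p) \<le> (\<Prod>p\<in>prime_factors k. p ^ multiplicity p k)"
    proof (intro prod_mono conjI)
      fix p assume p: "p \<in> prime_factors k"
      have "multiplicity p k > 0" using p by (simp add: prime_factors_multiplicity)
      thus "p \<le> p ^ multiplicity p k" using p by (intro self_le_power) (auto dest!: in_prime_factors_imp_prime prime_ge_1_nat)
    qed auto
    also have "\<dots> = k" using k by (intro prime_factorization_nat[symmetric]) auto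
    finally have le: "real (\<Prod>p\<in>prime_factors k. p) \<le> real k" by (rule of_nat_mono)
    have pos: "real p > 0" if "p \<in> prime_factors k" for p
      using that by (auto dest!: in_prime_factors_imp_prime prime_gt_0_nat)
    have "(\<Sum>p\<in>prime_factors k. ln (real p)) = ln (\<Prod>p\<in>prime_factors k. real p)"
      using pos by (subst ln_prod) auto
    also have "\<dots> \<le> ln (real k)"
      using le prod_pos[of "prime_factors k" real] pos k by (subst ln_le_cancel_iff) auto
    also have "\<dots> \<le> ln (real n)" using k by simp
    finally show ?thesis unfolding eq .
  qed
  have trm: "real n * (ln (real p) / real p) \<le> 2 * (\<Sum>k\<in>{k\<in>{1..n}. p dvd k}. ln (real p))" if p: "p \<in> ?P" for p
  proof -
    have p0: "p \<ge> 1" "ln (real p) \<ge> 0" using p prime_ge_1_nat by auto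
    have "card ((\<lambda>t. p * t) ` {1..n div p}) \<le> card {k\<in>{1..n}. p dvd k}"
    proof (rule card_mono)
      show "(\<lambda>t. p * t) ` {1..n div p} \<subseteq> {k\<in>{1..n}. p dvd k}"
      proof safe
        fix t assume t: "t \<in> {1..n div p}"
        have "p * t \<le> p * (n div p)" using t by simp
        also have "\<dots> \<le> n" by simp
        finally show "p * t \<in> {1..n}" using t p0 by auto
      qed simp
    qed simp
    also have "card ((\<lambda>t. p * t) ` {1..n div p}) = n div p"
      using p0 by (subst card_image) (auto simp: inj_on_def)
    finally have c: "n div p \<le> card {k\<in>{1..n}. p dvd k}" .
    have "n div p \<ge> 1" using p p0 by (simp add: div_greater_zero_iff Suc_le_eq)
    moreover have "n = p * (n div p) + n mod p" "n mod p < p" using p0 by auto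
    moreover have "p * 1 \<le> p * (n div p)" using \<open>n div p \<ge> 1\<close> by (intro mult_left_mono) auto
    ultimately have "n \<le> 2 * (p * (n div p))" by linarith
    also have "\<dots> \<le> 2 * (p * card {k\<in>{1..n}. p dvd k})" using c by simp
    finally have "real n \<le> real (2 * (p * card {k\<in>{1..n}. p dvd k}))" by (rule of_nat_mono)
    hence "real n / real p \<le> 2 * real (card {k\<in>{1..n}. p dvd k})" using p0 by (simp add: field_simps)
    hence "real n / real p * ln (real p) \<le> 2 * real (card {k\<in>{1..n}. p dvd k}) * ln (real p)"
      by (rule mult_right_mono[OF _ p0(2)])
    thus ?thesis by simp
  qed
  have "real n * (\<Sum>p\<in>?P. ln (real p) / real p) \<le> (\<Sum>p\<in>?P. 2 * (\<Sum>k\<in>{k\<in>{1..n}. p dvd k}. ln (real p)))"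
    by (subst sum_distrib_left) (intro sum_mono trm)
  also have "\<dots> = 2 * (\<Sum>p\<in>?P. \<Sum>k\<in>{k\<in>{1..n}. p dvd k}. ln (real p))" by (simp only: sum_distrib_left)
  also have "(\<Sum>p\<in>?P. \<Sum>k\<in>{k\<in>{1..n}. p dvd k}. ln (real p)) = (\<Sum>k\<in>{1..n}. \<Sum>p\<in>{p\<in>?P. p dvd k}. ln (real p))"
    using fin by (intro sum.swap_restrict) auto
  also have "\<dots> \<le> (\<Sum>k\<in>{1..n}. ln (real n))" by (intro sum_mono lnk)
  also have "\<dots> = real n * ln (real n)" by simp
  finally have "real n * (\<Sum>p\<in>?P. ln (real p) / real p) \<le> real n * (2 * ln (real n))" by simp
  thus ?thesis using n by (simp add: mult_le_cancel_left)
qed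

section \<open>Selberg weights indexed by sets of primes\<close>

lemma finite_nat_less_real: "finite {p :: nat. real p < R}"
  by (rule finite_subset[of _ "{..nat \<lfloor>R\<rfloor>}"]) (auto intro: le_nat_floor)

text \<open>Squarefree numbers below \<open>R\<close>, encoded by their sets of prime factors; local
  factors are then plain products over the set.\<close>

definition small_sets :: "nat set \<Rightarrow> real \<Rightarrow> nat set set" where
  "small_sets PP R = {A. A \<subseteq> PP \<and> real (\<Prod>A) < R}"

text \<open>Primes below 1000 are kept out of the weights: for them the estimated local density,
  about \<open>2 / p\<close> times a constant, is not close enough to 0 for the explicit
  constants.\<close>

abbreviation sifting_sets :: "real \<Rightarrow> nat set set" where
  "sifting_sets R \<equiv> small_sets {p. prime p \<and> 1000 \<le> p \<and> real p < R} R"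

text \<open>The weight of one-dimensional Selberg type, linear in \<open>ln d\<close>; the cut at 0
  makes it vanish from \<open>R\<close> on.\<close>

definition sweight :: "real \<Rightarrow> nat set \<Rightarrow> real" where
  "sweight R A = max 0 (1 - ln (real (\<Prod>A)) / ln R)"

lemma finite_small_sets: "finite PP \<Longrightarrow> finite (small_sets PP R)"
  by (rule finite_subset[of _ "Pow PP"]) (auto simp: small_sets_def)

lemma ln_prod_primes:
  assumes "finite A" "\<And>p. p \<in> A \<Longrightarrow> prime (p :: nat)"
  shows "ln (real (\<Prod>A)) = (\<Sum>p\<in>A. ln (real p))" "real (\<Prod>A) \<ge> 1"
proof -
  have g: "real p \<ge> 1" if "p \<in> A" for p using prime_ge_1_nat[OF assms(2)[OF that]] by simp
  have "ln (\<Prod>p\<in>A. real p) = (\<Sum>p\<in>A. ln (real p))" by (rule ln_prod) (use g assms(1) in force)+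
  thus "ln (real (\<Prod>A)) = (\<Sum>p\<in>A. ln (real p))" by simp
  show "real (\<Prod>A) \<ge> 1" using g by (simp add: prod_ge_1)
qed

lemma card_small_sets_le:
  assumes PP: "finite PP" "\<And>p. p \<in> PP \<Longrightarrow> prime p" and R: "R \<ge> 0"
  shows "real (card (small_sets PP R)) \<le> R"
proof -
  have fin: "finite A" if "A \<in> small_sets PP R" for A
    using that PP(1) by (auto simp: small_sets_def intro: finite_subset)
  have "inj_on (\<lambda>A. \<Prod>A) (small_sets PP R)"
  proof (rule inj_on_inverseI[of _ prime_factors])
    fix A assume A: "A \<in> small_sets PP R"
    have pr: "prime p" if "p \<in> A" for p using A that PP(2) by (auto simp: small_sets_def)
    have "prime_factors (\<Prod>A) = (\<Union>p\<in>A. prime_factors p)"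
      using fin[OF A] pr by (subst prime_factors_prod) (auto dest: prime_gt_0_nat)
    also have "\<dots> = (\<Union>p\<in>A. {p})" using pr by (intro SUP_cong refl) (simp add: prime_prime_factors)
    finally show "prime_factors (\<Prod>A) = A" by simp
  qed
  hence "card (small_sets PP R) = card ((\<lambda>A. \<Prod>A) ` small_sets PP R)" by (rule card_image[symmetric])
  also have "\<dots> \<le> card {1..nat \<lfloor>R\<rfloor>}"
  proof (rule card_mono)
    show "(\<lambda>A. \<Prod>A) ` small_sets PP R \<subseteq> {1..nat \<lfloor>R\<rfloor>}"
    proof safe
      fix A assume A: "A \<in> small_sets PP R"
      have "real (\<Prod>A) \<ge> 1" using A PP(2) fin[OF A] by (intro ln_prod_primes) (auto simp: small_sets_def)
      moreover have "real (\<Prod>A) < R" using A by (simp add: small_sets_def)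
      hence "\<Prod>A \<le> nat \<lfloor>R\<rfloor>" by (simp add: le_nat_floor)
      ultimately show "\<Prod>A \<in> {1..nat \<lfloor>R\<rfloor>}" by (metis atLeastAtMost_iff of_nat_1 of_nat_le_iff)
    qed
  qed simp
  also have "card {1..nat \<lfloor>R\<rfloor>} = nat \<lfloor>R\<rfloor>" by simp
  finally have "real (card (small_sets PP R)) \<le> real (nat \<lfloor>R\<rfloor>)" by (rule of_nat_mono)
  also have "\<dots> \<le> R" using R by simp
  finally show ?thesis .
qed

lemma sweight_small:
  assumes PP: "finite PP" "\<And>p. p \<in> PP \<Longrightarrow> prime p" and R: "R > 1" and A: "A \<in> small_sets PP R"
  shows "ln (real (\<Prod>A)) \<ge> 0" "ln (real (\<Prod>A)) < ln R" "sweight R A = 1 - ln (real (\<Prod>A)) / ln R"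
    "0 \<le> sweight R A" "sweight R A \<le> 1"
proof -
  have fin: "finite A" using A PP(1) by (auto simp: small_sets_def intro: finite_subset)
  have "real (\<Prod>A) \<ge> 1" using A PP(2) fin by (intro ln_prod_primes) (auto simp: small_sets_def)
  thus 1: "ln (real (\<Prod>A)) \<ge> 0" by (rule ln_ge_zero)
  show 2: "ln (real (\<Prod>A)) < ln R"
    using A R \<open>real (\<Prod>A) \<ge> 1\<close> unfolding small_sets_def by (subst ln_less_cancel_iff) auto
  show "sweight R A = 1 - ln (real (\<Prod>A)) / ln R" using 2 R by (simp add: sweight_def)
  show "0 \<le> sweight R A" by (simp add: sweight_def)
  show "sweight R A \<le> 1" using 1 R by (simp add: sweight_def)
qed

text \<open>Write \<open>l\<close> for the logarithm of the product over \<open>A\<close>. Splitting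
  \<open>l\<close> over the primes of \<open>A\<close> and removing one prime, the sum of
  \<open>h * l\<close> is at most a sum over smaller sets \<open>B\<close> with an inner prime sum
  up to \<open>R\<close> divided by the product of \<open>B\<close>.
  \<open>sum_ln_prime_div_le\<close> bounds that inner sum by \<open>(101/25) * ln R\<close> times
  the weight of \<open>B\<close>. So the unweighted sum is at most
  \<open>1 + 101/25 = 126/25\<close> times the sum with weights, and Cauchy-Schwarz changes the
  weights into their squares at the cost of squaring this constant.\<close>

lemma sum_sweight_lower:
  fixes h :: "nat \<Rightarrow> real"
  assumes PP: "finite PP" "\<And>p. p \<in> PP \<Longrightarrow> prime p" and R: "R > 1"
    and h: "\<And>p. p \<in> PP \<Longrightarrow> 0 \<le> h p" "\<And>p. p \<in> PP \<Longrightarrow> h p \<le> 101 / (50 * real p)"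
  shows "(\<Sum>A\<in>small_sets PP R. \<Prod>p\<in>A. h p) \<le> (15876/625) * (\<Sum>A\<in>small_sets PP R. (sweight R A)\<^sup>2 * (\<Prod>p\<in>A. h p))"
proof -
  define LL where "LL = small_sets PP R"
  define hA where "hA A = (\<Prod>p\<in>A. h p)" for A
  define l where "l A = ln (real (\<Prod>A))" for A :: "nat set"
  define y where "y A = sweight R A" for A
  have lnR: "ln R > 0" using R by simp
  have finL: "finite LL" unfolding LL_def by (rule finite_small_sets[OF PP(1)])
  have sub: "A \<subseteq> PP" if "A \<in> LL" for A using that by (simp add: LL_def small_sets_def)
  have fin: "finite A" if "A \<in> LL" for A using sub[OF that] PP(1) by (rule finite_subset)
  have hA0: "hA A \<ge> 0" if "A \<in> LL" for A unfolding hA_def using sub[OF that] h(1) by (intro prod_nonneg) auto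
  have y: "y A = 1 - l A / ln R" "0 \<le> y A" "y A \<le> 1" "l A < ln R" if "A \<in> LL" for A
    using sweight_small[OF PP R that[unfolded LL_def]] unfolding y_def l_def by auto
  let ?N = "\<lambda>B. {p \<in> PP. real p * real (\<Prod>B) < R}"
  define T where "T = Sigma LL (\<lambda>A. A)"
  define T' where "T' = Sigma LL ?N"
  let ?f = "\<lambda>x :: nat set \<times> nat. (fst x - {snd x}, snd x)"
  have inj: "inj_on ?f T"
    by (auto simp: inj_on_def T_def)
  have im: "?f ` T \<subseteq> T'"
  proof safe
    fix A p assume x: "(A, p) \<in> T"
    hence A: "A \<in> LL" and p: "p \<in> A" by (auto simp: T_def)
    have pr: "prime p" using sub[OF A] p PP(2) by blast
    have e: "p * \<Prod>(A - {p}) = \<Prod>A" using prod.remove[OF fin[OF A] p, of "\<lambda>x. x"] by simp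
    have lt: "real (\<Prod>A) < R" using A by (simp add: LL_def small_sets_def)
    have "\<Prod>(A - {p}) \<le> p * \<Prod>(A - {p})" using prime_ge_1_nat[OF pr] by simp
    hence "real (\<Prod>(A - {p})) \<le> real (\<Prod>A)" unfolding e by (rule of_nat_mono)
    hence "A - {p} \<in> LL" using lt sub[OF A] by (auto simp: LL_def small_sets_def)
    moreover have "real p * real (\<Prod>(A - {p})) < R" using lt unfolding e[symmetric] of_nat_mult .
    ultimately show "(fst (A, p) - {snd (A, p)}, snd (A, p)) \<in> T'" using sub[OF A] p by (auto simp: T'_def)
  qed
  have "(\<Sum>A\<in>LL. hA A * l A) = (\<Sum>A\<in>LL. \<Sum>p\<in>A. hA A * ln (real p))"
  proof (intro sum.cong refl)
    fix A assume A: "A \<in> LL"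
    have "l A = (\<Sum>p\<in>A. ln (real p))" unfolding l_def
      using sub[OF A] PP(2) by (intro ln_prod_primes(1) fin[OF A]) auto
    thus "hA A * l A = (\<Sum>p\<in>A. hA A * ln (real p))" by (simp only: sum_distrib_left)
  qed
  also have "\<dots> = (\<Sum>(A, p)\<in>T. hA A * ln (real p))"
    unfolding T_def using finL fin by (intro sum.Sigma) auto
  also have "\<dots> = (\<Sum>x\<in>T. (\<lambda>z. hA (fst z) * (h (snd z) * ln (real (snd z)))) (?f x))"
  proof (intro sum.cong refl)
    fix x assume "x \<in> T"
    then obtain A p where x: "x = (A, p)" "A \<in> LL" "p \<in> A" by (auto simp: T_def)
    have "hA A = h p * hA (A - {p})" unfolding hA_def by (rule prod.remove[OF fin[OF x(2)] x(3)])
    thus "(case x of (A, p) \<Rightarrow> hA A * ln (real p)) = hA (fst (?f x)) * (h (snd (?f x)) * ln (real (snd (?f x))))"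
      using x(1) by simp
  qed
  also have "\<dots> = (\<Sum>z\<in>?f ` T. hA (fst z) * (h (snd z) * ln (real (snd z))))"
    using sum.reindex[OF inj, of "\<lambda>z. hA (fst z) * (h (snd z) * ln (real (snd z)))"] by (simp add: o_def)
  also have "\<dots> \<le> (\<Sum>z\<in>T'. hA (fst z) * (h (snd z) * ln (real (snd z))))"
  proof (rule sum_mono2[OF _ im])
    show "finite T'" unfolding T'_def using finL PP(1) by (intro finite_SigmaI) auto
    fix z assume "z \<in> T' - ?f ` T"
    hence z: "fst z \<in> LL" "snd z \<in> PP" by (auto simp: T'_def)
    thus "0 \<le> hA (fst z) * (h (snd z) * ln (real (snd z)))"
      using prime_ge_1_nat[OF PP(2)[OF z(2)]] by (intro mult_nonneg_nonneg hA0 h(1)) auto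
  qed
  also have "\<dots> = (\<Sum>B\<in>LL. \<Sum>p\<in>?N B. hA B * (h p * ln (real p)))"
    unfolding T'_def using finL PP(1) by (subst sum.Sigma) (auto simp: case_prod_unfold)
  also have "\<dots> \<le> (\<Sum>B\<in>LL. hA B * ((101/25) * (ln R - l B)))"
  proof (intro sum_mono)
    fix B assume B: "B \<in> LL"
    define n where "n = nat \<lfloor>R / real (\<Prod>B)\<rfloor>"
    have B1: "real (\<Prod>B) \<ge> 1" using sub[OF B] PP(2) by (intro ln_prod_primes(2) fin[OF B]) auto
    have BR: "real (\<Prod>B) < R" using B by (simp add: LL_def small_sets_def)
    have n1: "n \<ge> 1" unfolding n_def using B1 BR by (intro le_nat_floor) (simp add: field_simps)
    have nle: "real n \<le> R / real (\<Prod>B)" unfolding n_def using B1 R by simp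
    have "(\<Sum>p\<in>?N B. h p * ln (real p)) \<le> (\<Sum>p\<in>?N B. (101/50) * (ln (real p) / real p))"
    proof (intro sum_mono)
      fix p assume "p \<in> ?N B"
      hence p: "p \<in> PP" by simp
      have "h p * ln (real p) \<le> 101 / (50 * real p) * ln (real p)"
        using prime_ge_1_nat[OF PP(2)[OF p]] by (intro mult_right_mono h(2) p) auto
      thus "h p * ln (real p) \<le> (101/50) * (ln (real p) / real p)" by simp
    qed
    also have "\<dots> \<le> (\<Sum>p | prime p \<and> p \<le> n. (101/50) * (ln (real p) / real p))"
    proof (rule sum_mono2)
      show "finite {p. prime p \<and> p \<le> n}" by (rule finite_subset[of _ "{..n}"]) auto
      show "?N B \<subseteq> {p. prime p \<and> p \<le> n}"
      proof safe
        fix p assume p: "p \<in> PP" "real p * real (\<Prod>B) < R"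
        show "prime p" by (rule PP(2)[OF p(1)])
        have "real p \<le> R / real (\<Prod>B)" using p(2) B1 by (simp add: field_simps)
        thus "p \<le> n" unfolding n_def by (rule le_nat_floor)
      qed
      fix p assume "p \<in> {p. prime p \<and> p \<le> n} - ?N B"
      thus "0 \<le> (101/50) * (ln (real p) / real p)" using prime_ge_1_nat[of p] by auto
    qed
    also have "\<dots> = (101/50) * (\<Sum>p | prime p \<and> p \<le> n. ln (real p) / real p)" by (rule sum_distrib_left[symmetric])
    also have "\<dots> \<le> (101/50) * (2 * ln (real n))" by (intro mult_left_mono sum_ln_prime_div_le n1) simp
    also have "\<dots> \<le> (101/50) * (2 * ln (R / real (\<Prod>B)))" using n1 nle by (intro mult_left_mono ln_mono) auto
    also have "ln (R / real (\<Prod>B)) = ln R - l B" unfolding l_def using B1 R by (subst ln_div) auto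
    finally have "(\<Sum>p\<in>?N B. h p * ln (real p)) \<le> (101/25) * (ln R - l B)" by simp
    hence "hA B * (\<Sum>p\<in>?N B. h p * ln (real p)) \<le> hA B * ((101/25) * (ln R - l B))"
      by (rule mult_left_mono[OF _ hA0[OF B]])
    thus "(\<Sum>p\<in>?N B. hA B * (h p * ln (real p))) \<le> hA B * ((101/25) * (ln R - l B))"
      by (simp only: sum_distrib_left)
  qed
  finally have main: "(\<Sum>A\<in>LL. hA A * l A) \<le> (\<Sum>B\<in>LL. hA B * ((101/25) * (ln R - l B)))" .
  have e1: "(\<Sum>A\<in>LL. hA A * l A) = ln R * ((\<Sum>A\<in>LL. hA A) - (\<Sum>A\<in>LL. hA A * y A))"
    unfolding sum_subtractf[symmetric] sum_distrib_left
    using lnR by (intro sum.cong refl) (simp add: y(1) field_simps)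
  have e2: "(\<Sum>B\<in>LL. hA B * ((101/25) * (ln R - l B))) = ln R * ((101/25) * (\<Sum>A\<in>LL. hA A * y A))"
    unfolding sum_distrib_left using lnR by (intro sum.cong refl) (simp add: y(1) field_simps)
  define Hs where "Hs = (\<Sum>A\<in>LL. hA A)"
  define V where "V = (\<Sum>A\<in>LL. (y A)\<^sup>2 * hA A)"
  have "Hs - (\<Sum>A\<in>LL. hA A * y A) \<le> (101/25) * (\<Sum>A\<in>LL. hA A * y A)"
    using main lnR unfolding e1 e2 Hs_def by (simp only: mult_le_cancel_left_pos)
  hence 1: "Hs \<le> (126/25) * (\<Sum>A\<in>LL. hA A * y A)" by linarith
  have Hs0: "Hs \<ge> 0" unfolding Hs_def by (intro sum_nonneg hA0)
  have "(\<Sum>A\<in>LL. sqrt (hA A) * (sqrt (hA A) * y A))\<^sup>2 \<le> (\<Sum>A\<in>LL. (sqrt (hA A))\<^sup>2) * (\<Sum>A\<in>LL. (sqrt (hA A) * y A)\<^sup>2)"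
    by (rule Cauchy_Schwarz_ineq_sum)
  also have "(\<Sum>A\<in>LL. sqrt (hA A) * (sqrt (hA A) * y A)) = (\<Sum>A\<in>LL. hA A * y A)"
    by (intro sum.cong refl) (simp add: hA0 flip: mult.assoc)
  also have "(\<Sum>A\<in>LL. (sqrt (hA A))\<^sup>2) = Hs" unfolding Hs_def by (intro sum.cong refl) (simp add: hA0)
  also have "(\<Sum>A\<in>LL. (sqrt (hA A) * y A)\<^sup>2) = V"
    unfolding V_def by (intro sum.cong refl) (simp add: hA0 power_mult_distrib)
  finally have 2: "(\<Sum>A\<in>LL. hA A * y A)\<^sup>2 \<le> Hs * V" .
  have "Hs\<^sup>2 \<le> ((126/25) * (\<Sum>A\<in>LL. hA A * y A))\<^sup>2" by (rule power_mono[OF 1 Hs0])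
  also have "\<dots> = (15876/625) * (\<Sum>A\<in>LL. hA A * y A)\<^sup>2" by (simp add: power_mult_distrib power2_eq_square)
  also have "\<dots> \<le> (15876/625) * (Hs * V)" using 2 by simp
  finally have 3: "Hs * Hs \<le> Hs * ((15876/625) * V)" by (simp add: power2_eq_square)
  have V0: "V \<ge> 0" unfolding V_def by (intro sum_nonneg mult_nonneg_nonneg hA0) auto
  have "Hs \<le> (15876/625) * V"
  proof (cases "Hs = 0")
    case False
    thus ?thesis using 3 Hs0 by (simp add: mult_le_cancel_left_pos)
  qed (use V0 in simp)
  thus ?thesis unfolding Hs_def V_def LL_def hA_def y_def .
qed

section \<open>The sieve\<close>

lemma per2_prod:
  assumes "finite S" "\<And>p. p \<in> S \<Longrightarrow> per2 (d p) (f p)"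
  shows "per2 (\<Prod>p\<in>S. d p) (\<lambda>i j. \<Prod>p\<in>S. f p i j)"
  using assms
proof (induction S rule: finite_induct)
  case (insert p S)
  have "per2 (d p * prod d S) (\<lambda>i j. f p i j * (\<Prod>p\<in>S. f p i j))"
  proof (rule per2_mult)
    have "per2 (d p) (f p)" using insert.prems by blast
    thus "per2 (d p * prod d S) (f p)" by (rule per2_dvd) simp
    have "per2 (prod d S) (\<lambda>i j. \<Prod>p\<in>S. f p i j)" using insert by blast
    thus "per2 (d p * prod d S) (\<lambda>i j. \<Prod>p\<in>S. f p i j)" by (rule per2_dvd) simp
  qed
  thus ?case using insert.hyps by simp
qed (simp add: per2_def)

context four_sq_box begin

lemma SF_sum: "SF (\<lambda>i j. \<Sum>x\<in>T. a x * f x i j) = (\<Sum>x\<in>T. a x * SF (f x))"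
proof -
  have "SF (\<lambda>i j. \<Sum>x\<in>T. a x * f x i j) =
      (\<Sum>i\<in>{1..H}. \<Sum>j\<in>{1..H}. \<Sum>x\<in>T. a x * (f x (int i) (int j) * rn i j))"
    unfolding SF_def by (simp only: sum_distrib_right mult.assoc)
  also have "\<dots> = (\<Sum>i\<in>{1..H}. \<Sum>x\<in>T. \<Sum>j\<in>{1..H}. a x * (f x (int i) (int j) * rn i j))"
    by (intro sum.cong refl sum.swap)
  also have "\<dots> = (\<Sum>x\<in>T. \<Sum>i\<in>{1..H}. \<Sum>j\<in>{1..H}. a x * (f x (int i) (int j) * rn i j))"
    by (rule sum.swap)
  also have "\<dots> = (\<Sum>x\<in>T. a x * SF (f x))" unfolding SF_def by (simp only: sum_distrib_left)
  finally show ?thesis .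
qed

lemma SF_mono:
  assumes "\<And>i j. i \<in> {1..H} \<Longrightarrow> j \<in> {1..H} \<Longrightarrow> rr (nat (nn (int i) (int j))) > 0 \<Longrightarrow> F (int i) (int j) \<le> G (int i) (int j)"
  shows "SF F \<le> SF G"
  unfolding SF_def
proof (intro sum_mono)
  fix i j assume ij: "i \<in> {1..H}" "j \<in> {1..H}"
  show "F (int i) (int j) * rn i j \<le> G (int i) (int j) * rn i j"
  proof (cases "rr (nat (nn (int i) (int j))) > 0")
    case True
    thus ?thesis using assms[OF ij True] by (intro mult_right_mono) auto
  next
    case False
    moreover have "nat (nn (int i) (int j)) > 0" using nat_nn(2)[OF ij] by linarith
    hence "rr (nat (nn (int i) (int j))) \<ge> 0" by (rule rr_nonneg)
    ultimately have "rr (nat (nn (int i) (int j))) = 0" by linarith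
    thus ?thesis by (simp only: of_int_0 mult_zero_right)
  qed
qed

lemma EF_zero: "EF P J (\<lambda>_ _. 0) = 0"
  by (simp add: EF_def mean2_def)

lemma EF_nonneg: "P ^ J > 0 \<Longrightarrow> (\<And>i j. F i j \<ge> 0) \<Longrightarrow> EF P J F \<ge> 0"
  using EF_mono[of P J "\<lambda>_ _. 0" F] by (simp add: EF_zero)

definition uu :: "bool \<Rightarrow> int \<Rightarrow> int \<Rightarrow> int" where
  "uu b i j = (if b then 2 * i + int al else 2 * j + int be)"

definition ev :: "bool \<Rightarrow> nat \<Rightarrow> nat \<Rightarrow> box_fun" where
  "ev b p k i j = of_bool (int (p ^ k) dvd uu b i j)"

definition xi :: "nat \<Rightarrow> box_fun" where
  "xi p i j = of_bool (int p dvd uu True i j \<or> int p dvd uu False i j)"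

lemma uu_cong:
  assumes "[i = i'] (mod int N)" "[j = j'] (mod int N)"
  shows "[uu b i j = uu b i' j'] (mod int N)"
  unfolding uu_def using assms by (auto intro!: cong_add cong_mult cong_refl)

lemma per2_ev: "per2 (p ^ k) (ev b p k)"
  unfolding per2_def ev_def
proof (intro allI impI)
  fix i j i' j' assume "[i = i'] (mod int (p ^ k))" "[j = j'] (mod int (p ^ k))"
  hence "int (p ^ k) dvd uu b i j \<longleftrightarrow> int (p ^ k) dvd uu b i' j'" by (intro cong_dvd_iff uu_cong)
  thus "of_bool (int (p ^ k) dvd uu b i j) = (of_bool (int (p ^ k) dvd uu b i' j') :: real)" by simp
qed

lemma per2_xi: "per2 p (xi p)"
  unfolding per2_def xi_def
proof (intro allI impI)
  fix i j i' j' assume "[i = i'] (mod int p)" "[j = j'] (mod int p)"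
  hence "int p dvd uu b i j \<longleftrightarrow> int p dvd uu b i' j'" for b by (intro cong_dvd_iff uu_cong)
  thus "of_bool (int p dvd uu True i j \<or> int p dvd uu False i j) = (of_bool (int p dvd uu True i' j' \<or> int p dvd uu False i' j') :: real)" by simp
qed

end

text \<open>Upper bound of \<open>EF_prime_event_le\<close>, without the power of \<open>p\<close>,
  over the lower bound of \<open>EF_prime_1_ge\<close>: the factor by which the local probability of
  \<open>p^k dvd u\<close> may exceed \<open>1 / p^k\<close>.\<close>

definition av :: "nat \<Rightarrow> real" where "av p = (1 + 4 / (real p - 1)) / (1 - 2 / real p)"

lemma av_nonneg: "p \<ge> 3 \<Longrightarrow> av p \<ge> 0"
  unfolding av_def by (intro divide_nonneg_nonneg add_nonneg_nonneg) (auto simp: field_simps)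

lemma av_antimono:
  assumes "3 \<le> q" "q \<le> p"
  shows "av p \<le> av q"
proof -
  have "4 / (real p - 1) \<le> 4 / (real q - 1)" using assms by (intro divide_left_mono) auto
  moreover have "2 / real p \<le> 2 / real q" using assms by (intro divide_left_mono) auto
  moreover have "1 - 2 / real q > 0" using assms by (simp add: field_simps)
  ultimately show ?thesis unfolding av_def using assms by (intro frac_le) auto
qed

lemma av_3: "av 3 = 9" and av_5: "av 5 = 10 / 3" and av_1000: "av 1000 \<le> 1.0061"
  by (simp_all add: av_def)

text \<open>The equidistribution statement with an abstract error \<open>ERR\<close>. It covers two
  sets of sifting primes, whose product arises from squaring the weights, and a further prime
  \<open>p\<close> whose powers are counted. The bound 300 * R^2 accommodates the first power of
  \<open>p\<close> above \<open>300 * R\<close>, as \<open>p < R\<close>.\<close>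

locale sieve = four_sq_box +
  fixes R :: real and J :: nat and ERR :: real
  assumes R19: "R \<ge> 19" and J: "300 * R < 2 ^ J"
    and equid: "\<lbrakk>A \<in> sifting_sets R;
        B \<in> sifting_sets R;
        prime p; odd p; real p < R; p \<notin> A \<union> B; k \<le> J; real (p ^ k) \<le> 300 * R ^ 2;
        per2 (p ^ k * \<Prod>(A \<union> B)) F; \<And>i j. \<bar>F i j\<bar> \<le> 1\<rbrakk> \<Longrightarrow>
      equi_error (insert p (A \<union> B)) J F \<le> ERR"
begin

definition PP :: "nat set" where "PP = {p. prime p \<and> 1000 \<le> p \<and> real p < R}"

definition OP :: "nat set" where "OP = {p. prime p \<and> odd p \<and> real p < R}"

abbreviation LL :: "nat set set" where "LL \<equiv> small_sets PP R"

text \<open>The local expectation with respect to the weight \<open>rr\<close>, normalised so that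
  constants are fixed.\<close>

definition pp :: "nat \<Rightarrow> box_fun \<Rightarrow> real" where
  "pp p F = EF p J F / EF p J box1"

definition gp :: "nat \<Rightarrow> real" where "gp p = pp p (xi p)"

definition hp :: "nat \<Rightarrow> real" where "hp p = gp p / (1 - gp p)"

text \<open>Equal to \<open>hp p\<close> where \<open>p\<close> divides neither coordinate and to -1
  where it divides one. Its local mean is 0 and its second moment \<open>hp p\<close>, so the
  products over different sets of primes are orthogonal: this basis diagonalises Selberg's quadratic
  form.\<close>

definition eta :: "nat \<Rightarrow> box_fun" where
  "eta p i j = hp p + (- 1 - hp p) * xi p i j"

definition etaA :: "nat set \<Rightarrow> box_fun" where
  "etaA A i j = (\<Prod>p\<in>A. eta p i j)"

lemma J1: "J \<ge> 1"
  using J R19 by (cases J) auto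

lemma finite_PP: "finite PP" and finite_OP: "finite OP"
  unfolding PP_def OP_def
  by (rule finite_subset[OF _ finite_nat_less_real[of R]], blast)+

lemma PP_D: "p \<in> PP \<Longrightarrow> prime p" "p \<in> PP \<Longrightarrow> 1000 \<le> p" "p \<in> PP \<Longrightarrow> real p < R" "p \<in> PP \<Longrightarrow> odd p" "p \<in> PP \<Longrightarrow> p \<in> OP"
proof -
  show *: "p \<in> PP \<Longrightarrow> prime p" "p \<in> PP \<Longrightarrow> 1000 \<le> p" "p \<in> PP \<Longrightarrow> real p < R" for p by (auto simp: PP_def)
  show **: "p \<in> PP \<Longrightarrow> odd p" for p using *[of p] primes_dvd_imp_eq[of 2 p] by auto
  show "p \<in> PP \<Longrightarrow> p \<in> OP" using *[of p] **[of p] by (simp add: OP_def)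
qed

lemma OP_D: "p \<in> OP \<Longrightarrow> prime p" "p \<in> OP \<Longrightarrow> odd p" "p \<in> OP \<Longrightarrow> real p < R" "p \<in> OP \<Longrightarrow> p \<ge> 3"
proof -
  show *: "p \<in> OP \<Longrightarrow> prime p" "p \<in> OP \<Longrightarrow> odd p" "p \<in> OP \<Longrightarrow> real p < R" for p by (auto simp: OP_def)
  show "p \<in> OP \<Longrightarrow> p \<ge> 3" using *[of p] prime_ge_2_nat[of p] by (cases "p = 2") auto
qed

lemma LL_D:
  assumes "A \<in> LL"
  shows "A \<subseteq> PP" "finite A" "A \<subseteq> OP"
  using assms finite_PP PP_D(5) by (auto simp: small_sets_def intro: finite_subset)

lemma finite_LL: "finite LL"
  by (rule finite_small_sets[OF finite_PP])

lemma empty_LL: "{} \<in> LL"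
  using R19 by (simp add: small_sets_def)

lemma EF1_pos: "p \<in> OP \<Longrightarrow> EF p J box1 \<ge> 1 - 2 / real p" "p \<in> OP \<Longrightarrow> EF p J box1 > 0"
proof -
  assume p: "p \<in> OP"
  show 1: "EF p J box1 \<ge> 1 - 2 / real p" using OP_D[OF p] J1 by (intro EF_prime_1_ge) auto
  have "1 - 2 / real p > 0" using OP_D(4)[OF p] by (simp add: field_simps)
  thus "EF p J box1 > 0" using 1 by linarith
qed

lemma pp_linear:
  assumes "p \<in> OP"
  shows "pp p (\<lambda>i j. a + b * F i j) = a + b * pp p F"
proof -
  have "EF p J (\<lambda>i j. a * 1 + b * F i j) = a * EF p J box1 + b * EF p J F" by (rule EF_linear)
  thus ?thesis unfolding pp_def using EF1_pos(2)[OF assms] by (simp add: field_simps)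
qed

lemma pp_one: "p \<in> OP \<Longrightarrow> pp p (\<lambda>_ _. 1) = 1"
  unfolding pp_def using EF1_pos(2)[of p] by simp

lemma pp_mono: "p \<in> OP \<Longrightarrow> (\<And>i j. F i j \<le> G i j) \<Longrightarrow> pp p F \<le> pp p G"
  unfolding pp_def using EF1_pos(2)[of p] OP_D(4)[of p]
  by (intro divide_right_mono EF_mono) auto

lemma pp_ev:
  assumes p: "p \<in> OP" and k: "k \<le> J"
  shows "0 \<le> pp p (ev b p k)" "pp p (ev b p k) \<le> av p / real p ^ k"
proof -
  have p3: "p \<ge> 3" by (rule OP_D(4)[OF p])
  have "EF p J (ev b p k) \<ge> 0" using p3 by (intro EF_nonneg) (auto simp: ev_def)
  thus "0 \<le> pp p (ev b p k)" unfolding pp_def using EF1_pos(2)[OF p] by simp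
  have "EF p J (ev b p k) \<le> (1 + 4 / (real p - 1)) / real p ^ k"
    unfolding ev_def uu_def using EF_prime_event_le[OF OP_D(1,2)[OF p] k] by (cases b) simp_all
  hence "pp p (ev b p k) \<le> ((1 + 4 / (real p - 1)) / real p ^ k) / (1 - 2 / real p)"
    unfolding pp_def using EF1_pos[OF p] p3 by (intro frac_le) (auto simp: field_simps)
  thus "pp p (ev b p k) \<le> av p / real p ^ k" by (simp add: av_def mult.commute)
qed

lemma gp_bounds:
  assumes p: "p \<in> PP"
  shows "0 \<le> gp p" "gp p \<le> 2.0122 / real p"
proof -
  have pO: "p \<in> OP" by (rule PP_D(5)[OF p])
  have p1000: "p \<ge> 1000" by (rule PP_D(2)[OF p])
  have "pp p (\<lambda>_ _. 0) \<le> gp p" unfolding gp_def by (rule pp_mono[OF pO]) (simp add: xi_def)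
  thus "0 \<le> gp p" by (simp add: pp_def EF_zero)
  have "gp p \<le> pp p (\<lambda>i j. 1 * ev True p 1 i j + 1 * ev False p 1 i j)"
    unfolding gp_def by (rule pp_mono[OF pO]) (auto simp: xi_def ev_def)
  also have "\<dots> = pp p (ev True p 1) + pp p (ev False p 1)"
    unfolding pp_def EF_linear by (simp add: add_divide_distrib)
  also have "\<dots> \<le> av p / real p ^ 1 + av p / real p ^ 1"
    by (intro add_mono pp_ev pO J1)
  also have "av p \<le> 1.0061" using av_antimono[of 1000 p] av_1000 p1000 by linarith
  hence "av p / real p ^ 1 + av p / real p ^ 1 \<le> 1.0061 / real p ^ 1 + 1.0061 / real p ^ 1"
    by (intro add_mono divide_right_mono) auto
  finally show "gp p \<le> 2.0122 / real p" by (simp add: field_simps)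
qed

lemma hp_bounds:
  assumes p: "p \<in> PP"
  shows "gp p < 1" "0 \<le> hp p" "hp p \<le> 101 / (50 * real p)" "hp p \<le> 1"
proof -
  have p1000: "real p \<ge> 1000" using PP_D(2)[OF p] by simp
  have "2.0122 / real p \<le> 2.0122 / 1000" using p1000 by (intro divide_left_mono) auto
  hence g: "gp p \<le> 0.0020122" using gp_bounds(2)[OF p] by simp
  thus "gp p < 1" by simp
  show "0 \<le> hp p" unfolding hp_def using g gp_bounds(1)[OF p] by simp
  have "hp p \<le> (2.0122 / real p) / (1 - 0.0020122)"
    unfolding hp_def using g gp_bounds[OF p] by (intro frac_le) auto
  also have "\<dots> \<le> 101 / (50 * real p)" using p1000 by (simp add: field_simps)
  finally show 1: "hp p \<le> 101 / (50 * real p)" .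
  also have "\<dots> \<le> 1" using p1000 by (simp add: field_simps)
  finally show "hp p \<le> 1" .
qed

lemma pp_eta:
  assumes p: "p \<in> PP"
  shows "pp p (eta p) = 0" "pp p (\<lambda>i j. eta p i j * eta p i j) = hp p"
proof -
  have pO: "p \<in> OP" by (rule PP_D(5)[OF p])
  have g: "gp p < 1" by (rule hp_bounds[OF p])
  have "pp p (eta p) = hp p + (- 1 - hp p) * gp p"
    unfolding eta_def gp_def by (rule pp_linear[OF pO])
  also have "\<dots> = 0" using g by (simp add: hp_def field_simps)
  finally show "pp p (eta p) = 0" .
  have "(\<lambda>i j. eta p i j * eta p i j) = (\<lambda>i j. (hp p)\<^sup>2 + (1 - (hp p)\<^sup>2) * xi p i j)"
    by (auto simp: fun_eq_iff eta_def xi_def power2_eq_square algebra_simps)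
  hence "pp p (\<lambda>i j. eta p i j * eta p i j) = (hp p)\<^sup>2 + (1 - (hp p)\<^sup>2) * gp p"
    unfolding gp_def by (simp only: pp_linear[OF pO])
  also have "\<dots> = hp p"
  proof -
    have *: "hp p * (1 - gp p) = gp p" using g by (simp add: hp_def)
    have "(hp p)\<^sup>2 + (1 - (hp p)\<^sup>2) * gp p = hp p * (hp p * (1 - gp p)) + gp p"
      by (simp add: power2_eq_square algebra_simps)
    also have "\<dots> = hp p * gp p + gp p" by (simp only: *)
    also have "\<dots> = hp p" using * by (simp add: algebra_simps)
    finally show ?thesis .
  qed
  finally show "pp p (\<lambda>i j. eta p i j * eta p i j) = hp p" .
qed

lemma abs_eta_le: "p \<in> PP \<Longrightarrow> \<bar>eta p i j\<bar> \<le> 1"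
  using hp_bounds[of p] by (auto simp: eta_def xi_def)

lemma per2_eta: "per2 p (eta p)"
  unfolding per2_def
proof (intro allI impI)
  fix i j i' j' assume "[i = i'] (mod int p)" "[j = j'] (mod int p)"
  hence "xi p i j = xi p i' j'" by (rule per2D[OF per2_xi])
  thus "eta p i j = eta p i' j'" by (simp add: eta_def)
qed

text \<open>\<open>equid\<close> is used twice with the same primes, for the product and for the
  constant 1. The unknown singular series cancels in the ratio, and since that ratio is at most 1 in
  absolute value the errors add up to \<open>2 * ERR\<close>.\<close>

lemma SF_prod_approx:
  assumes AB: "A \<in> LL" "B \<in> LL" and p: "p \<in> OP" "p \<notin> A \<union> B" and k: "k \<le> J" "real (p ^ k) \<le> 300 * R ^ 2"
    and fp: "per2 (p ^ k) (f p)" "\<And>i j. \<bar>f p i j\<bar> \<le> 1"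
    and f: "\<And>q. q \<in> A \<union> B \<Longrightarrow> per2 q (f q)" "\<And>q i j. q \<in> A \<union> B \<Longrightarrow> \<bar>f q i j\<bar> \<le> 1"
  shows "\<bar>SF (\<lambda>i j. \<Prod>q\<in>insert p (A \<union> B). f q i j) - SF box1 * (\<Prod>q\<in>insert p (A \<union> B). pp q (f q))\<bar> \<le> 2 * ERR"
proof -
  define S where "S = insert p (A \<union> B)"
  define F where "F i j = (\<Prod>q\<in>S. f q i j)" for i j
  have finAB: "finite (A \<union> B)" using AB LL_D by blast
  have finS: "finite S" using finAB by (simp add: S_def)
  have SO: "S \<subseteq> OP" using p AB LL_D(3) by (auto simp: S_def)
  have absF: "\<bar>F i j\<bar> \<le> 1" for i j
    unfolding F_def abs_prod by (rule prod_le_1) (use fp f in \<open>auto simp: S_def\<close>)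
  have "per2 (\<Prod>q\<in>S. if q = p then p ^ k else q) (\<lambda>i j. \<Prod>q\<in>S. f q i j)"
    by (rule per2_prod[OF finS]) (use fp f in \<open>auto simp: S_def\<close>)
  moreover have "(\<Prod>q\<in>S. if q = p then p ^ k else q) = p ^ k * \<Prod>(A \<union> B)"
  proof -
    have "(\<Prod>q\<in>A \<union> B. if q = p then p ^ k else q) = \<Prod>(A \<union> B)"
      by (rule prod.cong) (use p(2) in auto)
    thus ?thesis unfolding S_def using finAB p(2) by (simp del: Un_iff)
  qed
  moreover have "F = (\<lambda>i j. \<Prod>q\<in>S. f q i j)" by (intro ext) (simp add: F_def)
  ultimately have per: "per2 (p ^ k * \<Prod>(A \<union> B)) F" by (simp only:)
  have perJ: "per2 (q ^ J) (f q)" if q: "q \<in> S" for q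
  proof (cases "q = p")
    case True
    thus ?thesis using per2_dvd[OF fp(1), of "p ^ J"] k(1) by (simp add: le_imp_power_dvd)
  next
    case False
    hence "q \<in> A \<union> B" using q by (simp add: S_def)
    thus ?thesis using per2_dvd[OF f(1), of q "q ^ J"] J1 by (simp add: dvd_power)
  qed
  let ?c = "2 * (real H)\<^sup>2 * zs m (\<Prod>S) Q"
  let ?E = "EF (\<Prod>S) J F" and ?E1 = "EF (\<Prod>S) J box1"
  have pr: "prime q" if "q \<in> S" for q using that SO OP_D(1) by blast
  have E: "?E = (\<Prod>q\<in>S. EF q J (f q))"
    using EF_prod[OF finS pr perJ] unfolding F_def by blast
  have "EF (\<Prod>S) J (\<lambda>i j. \<Prod>q\<in>S. 1) = (\<Prod>q\<in>S. EF q J box1)"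
    using EF_prod[OF finS pr, of J "\<lambda>_ _ _. 1"] per2_const by blast
  hence E1: "?E1 = (\<Prod>q\<in>S. EF q J box1)" by simp
  have E1pos: "?E1 > 0" unfolding E1 by (rule prod_pos) (use SO EF1_pos in blast)
  have "\<Prod>S > 0" using pr by (rule prod_primes_pos)
  hence absE: "\<bar>?E\<bar> \<le> ?E1" by (intro abs_EF_le absF) simp
  have ratio: "?E / ?E1 = (\<Prod>q\<in>S. pp q (f q))" unfolding E E1 pp_def prod_dividef ..
  note eq = equid[folded PP_def, OF AB OP_D(1,2,3)[OF p(1)] p(2) k]
  have 1: "\<bar>SF F - ?c * ?E\<bar> \<le> ERR" unfolding S_def by (rule eq[OF per absF])
  have 2: "\<bar>SF box1 - ?c * ?E1\<bar> \<le> ERR" unfolding S_def by (rule eq[OF per2_const]) simp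
  have "SF F - SF box1 * (?E / ?E1) = (SF F - ?c * ?E) - (SF box1 - ?c * ?E1) * (?E / ?E1)"
    using E1pos by (simp add: field_simps)
  hence 3: "\<bar>SF F - SF box1 * (?E / ?E1)\<bar> \<le> \<bar>SF F - ?c * ?E\<bar> + \<bar>(SF box1 - ?c * ?E1) * (?E / ?E1)\<bar>"
    by (simp only: abs_triangle_ineq4)
  have 4: "\<bar>(SF box1 - ?c * ?E1) * (?E / ?E1)\<bar> \<le> ERR * 1"
    unfolding abs_mult
  proof (rule mult_mono[OF 2])
    show "\<bar>?E / ?E1\<bar> \<le> 1" using absE E1pos by (simp add: abs_divide)
  qed (use 2 in auto)
  have "\<bar>SF F - SF box1 * (?E / ?E1)\<bar> \<le> 2 * ERR" using 1 3 4 by linarith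
  thus ?thesis unfolding ratio unfolding F_def S_def .
qed

lemma ERR_nonneg: "ERR \<ge> 0"
proof -
  have "(3 :: nat) \<in> OP" using R19 by (simp add: OP_def)
  moreover have "R ^ 2 \<ge> 1" using R19 by (intro one_le_power) simp
  hence "(300 :: real) * R ^ 2 \<ge> 1" by linarith
  ultimately have "\<bar>SF (\<lambda>i j. \<Prod>q\<in>insert (3 :: nat) ({} \<union> {}). 1) - SF box1 * (\<Prod>q\<in>insert 3 ({} \<union> {}). pp q (\<lambda>_ _. 1))\<bar> \<le> 2 * ERR"
    by (intro SF_prod_approx[OF empty_LL empty_LL, of 3 0 "\<lambda>_ _ _. 1"] per2_const) auto
  thus ?thesis by linarith
qed

text \<open>After expanding the square, a pair \<open>A\<close>, \<open>B\<close> of different sets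
  has a prime in exactly one of them; there the local factor is the mean of \<open>eta\<close>,
  which is 0. The diagonal gives the second moments \<open>hp\<close>.\<close>

lemma SF_quadratic:
  assumes p: "p \<in> OP" and k: "k \<le> J" "real (p ^ k) \<le> 300 * R ^ 2"
    and L0: "L0 \<subseteq> LL" "\<And>A. A \<in> L0 \<Longrightarrow> p \<notin> A" and c: "\<And>A. A \<in> L0 \<Longrightarrow> \<bar>c A\<bar> \<le> 1"
  shows "\<bar>SF (\<lambda>i j. ev b p k i j * (\<Sum>A\<in>L0. c A * etaA A i j)\<^sup>2) -
      SF box1 * pp p (ev b p k) * (\<Sum>A\<in>L0. (c A)\<^sup>2 * (\<Prod>q\<in>A. hp q))\<bar> \<le> (real (card LL))\<^sup>2 * (2 * ERR)"
proof -
  let ?V = "\<Sum>A\<in>L0. (c A)\<^sup>2 * (\<Prod>q\<in>A. hp q)"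
  have fin0: "finite L0" using L0(1) finite_LL by (rule finite_subset)
  define f where "f z i j = ev b p k i j * (etaA (fst z) i j * etaA (snd z) i j)" for z i j
  define G where "G z = (if fst z = snd z then pp p (ev b p k) * (\<Prod>q\<in>fst z. hp q) else 0)" for z :: "nat set \<times> nat set"
  let ?c = "\<lambda>z. c (fst z) * c (snd z)"
  have "ev b p k i j * (\<Sum>A\<in>L0. c A * etaA A i j)\<^sup>2 = (\<Sum>z\<in>L0 \<times> L0. ?c z * f z i j)" for i j
  proof -
    have "(\<Sum>A\<in>L0. c A * etaA A i j)\<^sup>2 = (\<Sum>A\<in>L0. \<Sum>B\<in>L0. (c A * etaA A i j) * (c B * etaA B i j))"
      unfolding power2_eq_square by (rule sum_product)
    also have "\<dots> = (\<Sum>z\<in>L0 \<times> L0. (c (fst z) * etaA (fst z) i j) * (c (snd z) * etaA (snd z) i j))"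
      by (simp add: sum.cartesian_product case_prod_unfold)
    finally show ?thesis by (simp add: sum_distrib_left f_def mult_ac)
  qed
  hence e1: "SF (\<lambda>i j. ev b p k i j * (\<Sum>A\<in>L0. c A * etaA A i j)\<^sup>2) = (\<Sum>z\<in>L0 \<times> L0. ?c z * SF (f z))"
    by (simp only: SF_sum)
  have "(\<Sum>z\<in>L0 \<times> L0. ?c z * G z) = (\<Sum>A\<in>L0. \<Sum>B\<in>L0. if A = B then c A * c B * (pp p (ev b p k) * (\<Prod>q\<in>A. hp q)) else 0)"
    unfolding sum.cartesian_product
  proof (intro sum.cong refl)
    fix z assume "z \<in> L0 \<times> L0"
    show "?c z * G z = (case z of (A, B) \<Rightarrow> if A = B then c A * c B * (pp p (ev b p k) * (\<Prod>q\<in>A. hp q)) else 0)"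
      by (cases "fst z = snd z") (simp_all add: G_def case_prod_unfold)
  qed
  also have "\<dots> = (\<Sum>A\<in>L0. (c A)\<^sup>2 * (pp p (ev b p k) * (\<Prod>q\<in>A. hp q)))"
    using fin0 by (simp add: power2_eq_square)
  also have "\<dots> = pp p (ev b p k) * ?V"
    by (simp add: sum_distrib_left mult_ac)
  finally have "SF box1 * pp p (ev b p k) * ?V = SF box1 * (\<Sum>z\<in>L0 \<times> L0. ?c z * G z)"
    by (simp only: mult.assoc)
  also have "\<dots> = (\<Sum>z\<in>L0 \<times> L0. ?c z * (SF box1 * G z))"
    by (simp only: sum_distrib_left mult.left_commute)
  finally have e2: "SF box1 * pp p (ev b p k) * ?V = (\<Sum>z\<in>L0 \<times> L0. ?c z * (SF box1 * G z))" .
  have each: "\<bar>SF (f z) - SF box1 * G z\<bar> \<le> 2 * ERR" if z: "z \<in> L0 \<times> L0" for z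
  proof -
    obtain A B where zAB: "z = (A, B)" "A \<in> L0" "B \<in> L0" using z by auto
    hence AB: "A \<in> LL" "B \<in> LL" "p \<notin> A \<union> B" using L0 by auto
    have finAB: "finite (A \<union> B)" using AB LL_D by blast
    \<comment> \<open>Local factor at each prime: the event at \<open>p\<close>, and one factor
      \<open>eta q\<close> for each of the sets \<open>A\<close>, \<open>B\<close> that contains
      \<open>q\<close>.\<close>
    define \<phi> where "\<phi> q = (if q = p then ev b p k else (\<lambda>i j. (if q \<in> A then eta q i j else 1) * (if q \<in> B then eta q i j else 1)))" for q
    have \<phi>p: "\<phi> p = ev b p k" by (simp add: \<phi>_def)
    have \<phi>q: "\<phi> q = (\<lambda>i j. (if q \<in> A then eta q i j else 1) * (if q \<in> B then eta q i j else 1))" if "q \<in> A \<union> B" for q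
      using that AB(3) by (auto simp: \<phi>_def)
    have PPq: "q \<in> PP" if "q \<in> A \<union> B" for q using that AB LL_D(1) by blast
    have prod_eq: "(\<Prod>q\<in>insert p (A \<union> B). \<phi> q i j) = f z i j" for i j
    proof -
      have "(\<Prod>q\<in>insert p (A \<union> B). \<phi> q i j) = \<phi> p i j * (\<Prod>q\<in>A \<union> B. \<phi> q i j)"
        using AB(3) finAB by (rule prod.insert[rotated])
      also have "(\<Prod>q\<in>A \<union> B. \<phi> q i j) = (\<Prod>q\<in>A \<union> B. (if q \<in> A then eta q i j else 1) * (if q \<in> B then eta q i j else 1))"
        using \<phi>q by (intro prod.cong refl) simp
      also have "\<dots> = (\<Prod>q\<in>A \<union> B. if q \<in> A then eta q i j else 1) * (\<Prod>q\<in>A \<union> B. if q \<in> B then eta q i j else 1)"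
        by (rule prod.distrib)
      also have "(\<Prod>q\<in>A \<union> B. if q \<in> A then eta q i j else 1) = etaA A i j"
        unfolding etaA_def using prod.inter_restrict[OF finAB, of "\<lambda>q. eta q i j" A] by (simp add: Int_absorb1)
      also have "(\<Prod>q\<in>A \<union> B. if q \<in> B then eta q i j else 1) = etaA B i j"
        unfolding etaA_def using prod.inter_restrict[OF finAB, of "\<lambda>q. eta q i j" B] by (simp add: Int_absorb1)
      finally show ?thesis by (simp add: \<phi>p f_def zAB(1))
    qed
    have "\<bar>SF (\<lambda>i j. \<Prod>q\<in>insert p (A \<union> B). \<phi> q i j) - SF box1 * (\<Prod>q\<in>insert p (A \<union> B). pp q (\<phi> q))\<bar> \<le> 2 * ERR"
    proof (rule SF_prod_approx[OF AB(1,2) p AB(3) k])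
      show "per2 (p ^ k) (\<phi> p)" unfolding \<phi>p by (rule per2_ev)
      show "\<bar>\<phi> p i j\<bar> \<le> 1" for i j unfolding \<phi>p by (simp add: ev_def)
      fix q assume q: "q \<in> A \<union> B"
      have "per2 q (\<lambda>i j. if q \<in> C then eta q i j else 1)" for C
        using per2_eta per2_const by (cases "q \<in> C") auto
      thus "per2 q (\<phi> q)" unfolding \<phi>q[OF q] by (intro per2_mult)
      fix i j
      have "\<bar>if q \<in> C then eta q i j else 1\<bar> \<le> 1" for C using abs_eta_le[OF PPq[OF q]] by simp
      thus "\<bar>\<phi> q i j\<bar> \<le> 1" unfolding \<phi>q[OF q] abs_mult by (intro mult_le_one) auto
    qed
    moreover have "(\<Prod>q\<in>insert p (A \<union> B). pp q (\<phi> q)) = G z"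
    proof -
      have "(\<Prod>q\<in>insert p (A \<union> B). pp q (\<phi> q)) = pp p (\<phi> p) * (\<Prod>q\<in>A \<union> B. pp q (\<phi> q))"
        using AB(3) finAB by (rule prod.insert[rotated])
      moreover have "(\<Prod>q\<in>A \<union> B. pp q (\<phi> q)) = (if A = B then (\<Prod>q\<in>A. hp q) else 0)"
      proof (cases "A = B")
        case True
        have "pp q (\<phi> q) = hp q" if "q \<in> A" for q
          using that True \<phi>q[of q] pp_eta(2)[OF PPq[of q]] by simp
        thus ?thesis using True by simp
      next
        case False
        then obtain q where q: "q \<in> A \<union> B" "q \<notin> A \<or> q \<notin> B" by blast
        have "\<phi> q = eta q" unfolding \<phi>q[OF q(1)] using q by (auto simp: fun_eq_iff)
        hence "pp q (\<phi> q) = 0" using pp_eta(1)[OF PPq[OF q(1)]] by simp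
        hence "(\<Prod>q\<in>A \<union> B. pp q (\<phi> q)) = 0" using finAB q(1) by (intro prod_zero) auto
        thus ?thesis using False by simp
      qed
      ultimately show ?thesis by (simp add: \<phi>p G_def zAB(1))
    qed
    ultimately show ?thesis unfolding prod_eq by simp
  qed
  have "(\<Sum>z\<in>L0 \<times> L0. ?c z * SF (f z)) - (\<Sum>z\<in>L0 \<times> L0. ?c z * (SF box1 * G z)) = (\<Sum>z\<in>L0 \<times> L0. ?c z * (SF (f z) - SF box1 * G z))"
    by (simp only: sum_subtractf right_diff_distrib)
  hence "\<bar>(\<Sum>z\<in>L0 \<times> L0. ?c z * SF (f z)) - (\<Sum>z\<in>L0 \<times> L0. ?c z * (SF box1 * G z))\<bar> \<le> (\<Sum>z\<in>L0 \<times> L0. \<bar>?c z * (SF (f z) - SF box1 * G z)\<bar>)"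
    by (simp only:) (rule sum_abs)
  also have "\<dots> \<le> (\<Sum>z\<in>L0 \<times> L0. 2 * ERR)"
  proof (rule sum_mono)
    fix z assume z: "z \<in> L0 \<times> L0"
    have "\<bar>?c z\<bar> \<le> 1" using z c unfolding abs_mult by (intro mult_le_one) auto
    hence "\<bar>?c z\<bar> * \<bar>SF (f z) - SF box1 * G z\<bar> \<le> 1 * (2 * ERR)" by (intro mult_mono each z) auto
    thus "\<bar>?c z * (SF (f z) - SF box1 * G z)\<bar> \<le> 2 * ERR" unfolding abs_mult[of "?c z"] by simp
  qed
  also have "\<dots> = (real (card L0))\<^sup>2 * (2 * ERR)" by (simp add: card_cartesian_product power2_eq_square)
  also have "\<dots> \<le> (real (card LL))\<^sup>2 * (2 * ERR)"
    using card_mono[OF finite_LL L0(1)] ERR_nonneg by (intro mult_right_mono power_mono) auto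
  finally show ?thesis unfolding e1 e2 .
qed

end

context four_sq_box begin

lemma SF_cmult: "SF (\<lambda>i j. a * F i j) = a * SF F"
  unfolding SF_def by (simp only: sum_distrib_left mult.assoc)

lemma SF_nonneg: "(\<And>i j. F i j \<ge> 0) \<Longrightarrow> SF F \<ge> 0"
  using SF_mono[of "\<lambda>_ _. 0" F] by (simp add: SF_def[of "\<lambda>_ _. 0"])

end

lemma inj_half_odd: "inj_on (\<lambda>p. (p - 1) div 2) {p :: nat. odd p}"
  by (auto simp: inj_on_def elim!: oddE)

context sieve begin

text \<open>Its square is the nonnegative sieve weight. The coefficients are prescribed directly in
  the orthogonal basis, so the mean square \<open>VV\<close> is immediate.\<close>

definition WW :: "box_fun" where
  "WW i j = (\<Sum>A\<in>LL. sweight R A * etaA A i j)"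

definition VV :: real where
  "VV = (\<Sum>A\<in>LL. (sweight R A)\<^sup>2 * (\<Prod>q\<in>A. hp q))"

definition NE :: real where "NE = (real (card LL))\<^sup>2 * (2 * ERR)"

definition S1 :: real where "S1 = SF box1"

text \<open>The factor by which the sieve weight changes the frequency of multiples of
  \<open>p\<close>. Primes below 1000 are not sifted; for the others it is small unless
  \<open>ln p\<close> is comparable with \<open>ln R\<close>.\<close>

definition lam :: "nat \<Rightarrow> real" where
  "lam p = (if p < 1000 then 1 else (15876/625) * (ln (real p) / ln R)\<^sup>2)"

text \<open>The exponent at which counting of \<open>p\<close>-powers stops: \<open>p^KK\<close> is
  rare enough to be excluded altogether.\<close>

definition KK :: "nat \<Rightarrow> nat" where "KK p = (LEAST k. real (p ^ k) > 300 * R)"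

lemma NE_nonneg: "NE \<ge> 0"
  unfolding NE_def using ERR_nonneg by simp

lemma S1_nonneg: "S1 \<ge> 0"
  unfolding S1_def by (rule SF_nonneg) simp

lemma hA_nonneg: "A \<in> LL \<Longrightarrow> (\<Prod>q\<in>A. hp q) \<ge> 0"
  using LL_D(1) hp_bounds(2) by (intro prod_nonneg) blast

lemma sweight_LL:
  assumes "A \<in> LL"
  shows "0 \<le> sweight R A" "sweight R A \<le> 1"
  using sweight_small[OF finite_PP PP_D(1) _ assms] R19 by simp_all

lemma VV_ge_1: "VV \<ge> 1"
proof -
  have "(\<Sum>A\<in>{{}}. (sweight R A)\<^sup>2 * (\<Prod>q\<in>A. hp q)) \<le> VV"
    unfolding VV_def using empty_LL finite_LL hA_nonneg by (intro sum_mono2 mult_nonneg_nonneg) auto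
  thus ?thesis by (simp add: sweight_def)
qed

lemma three_OP: "3 \<in> OP"
  using R19 by (simp add: OP_def)

text \<open>\<open>SF_quadratic\<close> asks for a prime outside the sets; 3 with exponent 0, an
  event that always holds, serves as a dummy.\<close>

lemma SF_W2_ge: "SF (\<lambda>i j. (WW i j)\<^sup>2) \<ge> S1 * VV - NE"
proof -
  have "R ^ 2 \<ge> 1" using R19 by (intro one_le_power) simp
  hence "(300 :: real) * R ^ 2 \<ge> 1" by linarith
  moreover have "3 \<notin> A" if "A \<in> LL" for A using LL_D(1)[OF that] PP_D(2)[of 3] by auto
  ultimately have "\<bar>SF (\<lambda>i j. ev True 3 0 i j * (\<Sum>A\<in>LL. sweight R A * etaA A i j)\<^sup>2) -
      SF box1 * pp 3 (ev True 3 0) * (\<Sum>A\<in>LL. (sweight R A)\<^sup>2 * (\<Prod>q\<in>A. hp q))\<bar> \<le> (real (card LL))\<^sup>2 * (2 * ERR)"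
    using sweight_LL by (intro SF_quadratic three_OP) auto
  moreover have ev1: "ev True 3 0 = (\<lambda>_ _. 1)" by (auto simp: fun_eq_iff ev_def)
  ultimately have "\<bar>SF (\<lambda>i j. (WW i j)\<^sup>2) - S1 * VV\<bar> \<le> NE"
    unfolding ev1 pp_one[OF three_OP] WW_def VV_def NE_def S1_def by simp
  thus ?thesis by linarith
qed

lemma sum_hA_le: "(\<Sum>A\<in>LL. \<Prod>q\<in>A. hp q) \<le> (15876/625) * VV"
  unfolding VV_def
  using R19 hp_bounds by (intro sum_sweight_lower finite_PP PP_D(1)) auto

text \<open>Where \<open>p\<close> divides a coordinate, \<open>eta p\<close> is -1, so the terms of
  \<open>A\<close> and \<open>insert p A\<close> combine and \<open>WW\<close> becomes a sum over
  sets without \<open>p\<close> with coefficients the differences of \<open>sweight\<close>. These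
  lie between 0 and \<open>ln p / ln R\<close>, and \<open>sum_hA_le\<close> compares the resulting
  sum of squares with \<open>VV\<close>. For \<open>p < 1000\<close> the sets never contain
  \<open>p\<close>.\<close>

lemma SF_event_le:
  assumes p: "p \<in> OP" and k: "1 \<le> k" "k \<le> J" "real (p ^ k) \<le> 300 * R ^ 2"
  shows "SF (\<lambda>i j. ev b p k i j * (WW i j)\<^sup>2) \<le> S1 * VV * (lam p * av p / real p ^ k) + NE"
proof -
  have p3: "p \<ge> 3" by (rule OP_D(4)[OF p])
  have *: "SF (\<lambda>i j. ev b p k i j * (WW i j)\<^sup>2) \<le> S1 * VV * (lam p * av p / real p ^ k) + NE"
    if L0: "L0 \<subseteq> LL" "\<And>A. A \<in> L0 \<Longrightarrow> p \<notin> A" and c: "\<And>A. A \<in> L0 \<Longrightarrow> \<bar>c A\<bar> \<le> 1"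
      and eq: "\<And>i j. ev b p k i j * (WW i j)\<^sup>2 = ev b p k i j * (\<Sum>A\<in>L0. c A * etaA A i j)\<^sup>2"
      and le: "(\<Sum>A\<in>L0. (c A)\<^sup>2 * (\<Prod>q\<in>A. hp q)) \<le> lam p * VV" for L0 c
  proof -
    have "\<bar>SF (\<lambda>i j. ev b p k i j * (WW i j)\<^sup>2) - S1 * pp p (ev b p k) * (\<Sum>A\<in>L0. (c A)\<^sup>2 * (\<Prod>q\<in>A. hp q))\<bar> \<le> NE"
      unfolding eq S1_def NE_def by (rule SF_quadratic[OF p k(2,3) L0 c])
    moreover have "S1 * pp p (ev b p k) * (\<Sum>A\<in>L0. (c A)\<^sup>2 * (\<Prod>q\<in>A. hp q)) \<le> S1 * (av p / real p ^ k) * (lam p * VV)"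
      using S1_nonneg pp_ev[OF p k(2), of b] L0(1) av_nonneg[OF p3] hA_nonneg
      by (intro mult_mono mult_left_mono le mult_nonneg_nonneg sum_nonneg) auto
    moreover have "S1 * (av p / real p ^ k) * (lam p * VV) = S1 * VV * (lam p * av p / real p ^ k)" by simp
    ultimately show ?thesis by linarith
  qed
  show ?thesis
  proof (cases "p < 1000")
    case True
    have "p \<notin> A" if "A \<in> LL" for A using LL_D(1)[OF that] PP_D(2)[of p] True by auto
    thus ?thesis using sweight_LL True by (intro *[of LL "sweight R"]) (auto simp: WW_def VV_def lam_def)
  next
    case False
    hence pP: "p \<in> PP" using OP_D[OF p] by (simp add: PP_def)
    have lnp: "0 \<le> ln (real p)" using p3 by simp
    have lnR: "ln R > 0" using R19 by simp
    have lnpR: "ln (real p) / ln R \<le> 1" using OP_D(3)[OF p] p3 lnR by simp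
    define L0 where "L0 = {A \<in> LL. p \<notin> A}"
    define c where "c A = sweight R A - sweight R (insert p A)" for A
    have L0: "L0 \<subseteq> LL" "finite L0" using finite_LL by (auto simp: L0_def)
    have ins: "ln (real (\<Prod>(insert p A))) = ln (real p) + ln (real (\<Prod>A))" "\<Prod>(insert p A) = p * \<Prod>A" if A: "A \<in> L0" for A
    proof -
      have A': "A \<in> LL" "p \<notin> A" using A by (auto simp: L0_def)
      show 1: "\<Prod>(insert p A) = p * \<Prod>A" using A' LL_D(2) by simp
      have "real (\<Prod>A) \<ge> 1" using LL_D[OF A'(1)] PP_D(1) by (intro ln_prod_primes) auto
      thus "ln (real (\<Prod>(insert p A))) = ln (real p) + ln (real (\<Prod>A))"
        unfolding 1 of_nat_mult using p3 by (intro ln_mult_pos) auto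
    qed
    have cb: "0 \<le> c A" "c A \<le> ln (real p) / ln R" if A: "A \<in> L0" for A
    proof -
      have "ln (real (\<Prod>(insert p A))) / ln R = ln (real p) / ln R + ln (real (\<Prod>A)) / ln R"
        unfolding ins(1)[OF A] by (rule add_divide_distrib)
      moreover have "ln (real p) / ln R \<ge> 0" using lnp lnR by simp
      ultimately show "0 \<le> c A" "c A \<le> ln (real p) / ln R" unfolding c_def sweight_def by linarith+
    qed
    show ?thesis
    proof (rule *[of L0 c])
      show "L0 \<subseteq> LL" by (rule L0)
      show "p \<notin> A" if "A \<in> L0" for A using that by (simp add: L0_def)
      show "\<bar>c A\<bar> \<le> 1" if "A \<in> L0" for A using cb[OF that] lnpR by linarith
      show "(\<Sum>A\<in>L0. (c A)\<^sup>2 * (\<Prod>q\<in>A. hp q)) \<le> lam p * VV"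
      proof -
        have "(\<Sum>A\<in>L0. (c A)\<^sup>2 * (\<Prod>q\<in>A. hp q)) \<le> (\<Sum>A\<in>L0. (ln (real p) / ln R)\<^sup>2 * (\<Prod>q\<in>A. hp q))"
          using cb L0 hA_nonneg by (intro sum_mono mult_right_mono power_mono) auto
        also have "\<dots> \<le> (\<Sum>A\<in>LL. (ln (real p) / ln R)\<^sup>2 * (\<Prod>q\<in>A. hp q))"
          using L0 hA_nonneg by (intro sum_mono2 finite_LL) auto
        also have "\<dots> = (ln (real p) / ln R)\<^sup>2 * (\<Sum>A\<in>LL. \<Prod>q\<in>A. hp q)" by (rule sum_distrib_left[symmetric])
        also have "\<dots> \<le> (ln (real p) / ln R)\<^sup>2 * ((15876/625) * VV)"
          by (intro mult_left_mono sum_hA_le) simp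
        also have "\<dots> = lam p * VV" using False by (simp add: lam_def)
        finally show ?thesis .
      qed
      fix i j
      show "ev b p k i j * (WW i j)\<^sup>2 = ev b p k i j * (\<Sum>A\<in>L0. c A * etaA A i j)\<^sup>2"
      proof (cases "int (p ^ k) dvd uu b i j")
        case True
        have "int p dvd int (p ^ k)" using k(1) by (simp add: dvd_power)
        hence "int p dvd uu b i j" using True by (rule dvd_trans)
        hence "xi p i j = 1" unfolding xi_def by (cases b) auto
        hence eta1: "eta p i j = - 1" by (simp add: eta_def)
        have etains: "etaA (insert p A) i j = - etaA A i j" if A: "A \<in> L0" for A
          using A LL_D(2)[of A] eta1 by (simp add: L0_def etaA_def)
        let ?L = "{A \<in> L0. insert p A \<in> LL}"
        define L1 where "L1 = {A \<in> LL. p \<in> A}"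
        have img: "insert p ` ?L = L1"
        proof safe
          fix A assume A: "A \<in> L1"
          have e: "insert p (A - {p}) = A" using A by (auto simp: L1_def)
          have "\<Prod>A = p * \<Prod>(A - {p})"
            using A LL_D(2)[of A] prod.remove[of A p "\<lambda>x. x"] by (simp add: L1_def)
          hence "\<Prod>(A - {p}) \<le> \<Prod>A" using p3 by simp
          hence "real (\<Prod>(A - {p})) \<le> real (\<Prod>A)" by (rule of_nat_mono)
          hence "A - {p} \<in> L0" using A by (auto simp: L0_def L1_def small_sets_def)
          moreover have "insert p (A - {p}) \<in> LL" using A unfolding e by (simp add: L1_def)
          ultimately show "A \<in> insert p ` ?L" using e by (intro image_eqI[of _ _ "A - {p}"]) auto
        qed (auto simp: L1_def)
        have inj: "inj_on (insert p) ?L"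
          by (auto simp: inj_on_def L0_def)
        have "(\<Sum>A\<in>L1. sweight R A * etaA A i j) = (\<Sum>A\<in>?L. sweight R (insert p A) * etaA (insert p A) i j)"
          unfolding img[symmetric] by (subst sum.reindex[OF inj]) simp
        \<comment> \<open>Sets \<open>insert p A\<close> that are too large to belong to
          \<open>LL\<close> have weight 0 by the cut in \<open>sweight\<close>, so they may be
          added.\<close>
        also have "\<dots> = (\<Sum>A\<in>L0. sweight R (insert p A) * etaA (insert p A) i j)"
        proof (rule sum.mono_neutral_left)
          show "\<forall>A\<in>L0 - ?L. sweight R (insert p A) * etaA (insert p A) i j = 0"
          proof
            fix A assume A: "A \<in> L0 - ?L"
            hence "A \<subseteq> PP" using L0 LL_D(1) by blast
            hence "real (\<Prod>(insert p A)) \<ge> R" using A pP by (auto simp: small_sets_def not_less)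
            hence "ln (real (\<Prod>(insert p A))) \<ge> ln R" using R19 by (intro ln_mono) auto
            hence "sweight R (insert p A) = 0" using lnR by (simp add: sweight_def)
            thus "sweight R (insert p A) * etaA (insert p A) i j = 0" by simp
          qed
        qed (use L0 in auto)
        also have "\<dots> = (\<Sum>A\<in>L0. - (sweight R (insert p A) * etaA A i j))"
          by (intro sum.cong refl) (simp add: etains)
        finally have L1: "(\<Sum>A\<in>L1. sweight R A * etaA A i j) = (\<Sum>A\<in>L0. - (sweight R (insert p A) * etaA A i j))" .
        have "LL = L0 \<union> L1" "L0 \<inter> L1 = {}" by (auto simp: L0_def L1_def)
        moreover have "finite L1" using finite_LL by (simp add: L1_def)
        ultimately have "WW i j = (\<Sum>A\<in>L0. sweight R A * etaA A i j) + (\<Sum>A\<in>L1. sweight R A * etaA A i j)"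
          unfolding WW_def using L0(2) by (simp add: sum.union_disjoint)
        also have "\<dots> = (\<Sum>A\<in>L0. c A * etaA A i j)"
          unfolding L1 sum.distrib[symmetric] by (simp add: c_def left_diff_distrib)
        finally show ?thesis by simp
      qed (simp add: ev_def)
    qed
  qed
qed

lemma KK:
  assumes p: "p \<in> OP"
  shows "real (p ^ KK p) > 300 * R" "1 \<le> KK p" "KK p \<le> J" "k \<le> KK p \<Longrightarrow> real (p ^ k) \<le> 300 * R ^ 2"
    "real (KK p) \<le> 300 * R + 1"
proof -
  have p3: "p \<ge> 3" by (rule OP_D(4)[OF p])
  obtain n where n: "300 * R < real p ^ n" using real_arch_pow[of "real p" "300 * R"] p3 by auto
  hence "300 * R < real (p ^ n)" by simp
  thus 1: "real (p ^ KK p) > 300 * R" unfolding KK_def by (rule LeastI)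
  show 2: "1 \<le> KK p"
  proof (rule ccontr)
    assume "\<not> 1 \<le> KK p"
    hence "KK p = 0" by simp
    thus False using 1 R19 by simp
  qed
  have "\<not> real (p ^ (KK p - 1)) > 300 * R"
    using 2 not_less_Least[of "KK p - 1" "\<lambda>k. real (p ^ k) > 300 * R"] unfolding KK_def[symmetric] by simp
  hence 3: "real (p ^ (KK p - 1)) \<le> 300 * R" by simp
  have "(2 :: nat) ^ (KK p - 1) \<le> p ^ (KK p - 1)" using p3 by (intro power_mono) auto
  hence 4: "real (2 ^ (KK p - 1)) \<le> 300 * R" using 3 by (meson of_nat_le_iff order_trans)
  hence "(2 :: real) ^ (KK p - 1) < 2 ^ J" using J by (simp only: of_nat_power of_nat_numeral)
  hence "KK p - 1 < J" by (rule power_less_imp_less_exp[rotated]) simp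
  thus "KK p \<le> J" by simp
  have "KK p - 1 < 2 ^ (KK p - 1)" by (rule less_exp)
  hence "real (KK p - 1) \<le> real (2 ^ (KK p - 1))" by (intro of_nat_mono) simp
  thus "real (KK p) \<le> 300 * R + 1" using 4 2 by linarith
  assume k: "k \<le> KK p"
  have "p ^ k \<le> p ^ KK p" using k p3 by (intro power_increasing) auto
  also have "p ^ KK p = p * p ^ (KK p - 1)" using 2 by (cases "KK p") auto
  finally have "real (p ^ k) \<le> real p * real (p ^ (KK p - 1))" by (metis of_nat_le_iff of_nat_mult)
  also have "\<dots> \<le> R * (300 * R)" using 3 OP_D(3)[OF p] R19 by (intro mult_mono) auto
  finally show "real (p ^ k) \<le> 300 * R ^ 2" by (simp add: power2_eq_square)
qed

text \<open>The weight 169 at the last exponent makes \<open>wt < 169\<close> exclude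
  \<open>p^KK\<close>; below that exponent the weights 1 count the multiplicity of \<open>p\<close>
  exactly. As \<open>p^KK\<close> exceeds \<open>300 * R\<close>, this penalty is cheap on
  average.\<close>

definition wk :: "nat \<Rightarrow> nat \<Rightarrow> real" where "wk p k = (if k = KK p then 169 else 1)"

definition wt :: "box_fun" where
  "wt i j = (\<Sum>p\<in>OP. \<Sum>b\<in>UNIV. \<Sum>k\<in>{1..KK p}. wk p k * ev b p k i j)"

lemma sum_wk:
  assumes p: "p \<in> OP"
  shows "(\<Sum>k\<in>{1..KK p}. wk p k) \<le> 300 * R + 169"
    "(\<Sum>k\<in>{1..KK p}. wk p k / real p ^ k) \<le> 1 / (real p - 1) + 169 / (300 * R)"
proof -
  define n where "n = KK p - 1"
  have n: "KK p = Suc n" using KK(2)[OF p] by (simp add: n_def)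
  have p3: "p \<ge> 3" by (rule OP_D(4)[OF p])
  have split: "(\<Sum>k\<in>{1..KK p}. wk p k * f k) = (\<Sum>k\<in>{1..n}. f k) + 169 * f (KK p)" for f :: "nat \<Rightarrow> real"
  proof -
    have "{1..KK p} = insert (KK p) {1..n}" unfolding n by auto
    hence "(\<Sum>k\<in>{1..KK p}. wk p k * f k) = wk p (KK p) * f (KK p) + (\<Sum>k\<in>{1..n}. wk p k * f k)"
      by (simp add: n)
    also have "(\<Sum>k\<in>{1..n}. wk p k * f k) = (\<Sum>k\<in>{1..n}. f k)"
      by (intro sum.cong refl) (simp add: wk_def n)
    finally show ?thesis by (simp add: wk_def)
  qed
  have "(\<Sum>k\<in>{1..KK p}. wk p k) = real n + 169" using split[of "\<lambda>_. 1"] by simp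
  also have "real n + 1 \<le> 300 * R + 1" using KK(5)[OF p] unfolding n by simp
  hence "real n + 169 \<le> 300 * R + 169" by simp
  finally show "(\<Sum>k\<in>{1..KK p}. wk p k) \<le> 300 * R + 169" .
  have "(\<Sum>k\<in>{1..KK p}. wk p k / real p ^ k) = (\<Sum>k\<in>{1..n}. 1 / real p ^ k) + 169 * (1 / real p ^ KK p)"
    using split[of "\<lambda>k. 1 / real p ^ k"] by simp
  also have "(\<Sum>k\<in>{1..n}. 1 / real p ^ k) \<le> 1 / (real p - 1)"
  proof -
    have "(\<Sum>k\<in>{1..n}. 1 / real p ^ k) = (\<Sum>k<n. 1 / real p ^ Suc k)"
      by (rule sum.reindex_bij_witness[of _ Suc "\<lambda>k. k - 1"]) auto
    also have "\<dots> = (1 / real p) * (\<Sum>k<n. (1 / real p) ^ k)"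
      by (simp add: sum_distrib_left power_one_over)
    also have "(\<Sum>k<n. (1 / real p) ^ k) = (1 - (1 / real p) ^ n) / (1 - 1 / real p)"
      using p3 by (intro sum_gp_strict[THEN trans]) auto
    also have "(1 / real p) * \<dots> \<le> (1 / real p) * (1 / (1 - 1 / real p))"
      using p3 by (intro mult_left_mono divide_right_mono) auto
    also have "\<dots> = 1 / (real p - 1)" using p3 by (simp add: field_simps)
    finally show ?thesis .
  qed
  also have "169 * (1 / real p ^ KK p) \<le> 169 * (1 / (300 * R))"
    using KK(1)[OF p] R19 p3 by (intro mult_left_mono divide_left_mono) auto
  finally show "(\<Sum>k\<in>{1..KK p}. wk p k / real p ^ k) \<le> 1 / (real p - 1) + 169 / (300 * R)" by simp
qed

lemma card_OP: "real (card OP) \<le> R / 2"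
proof -
  have "inj_on (\<lambda>p. (p - 1) div 2) OP" using inj_half_odd by (rule inj_on_subset) (auto simp: OP_def)
  hence "card OP = card ((\<lambda>p. (p - 1) div 2) ` OP)" by (rule card_image[symmetric])
  also have "\<dots> \<le> card {1..nat \<lfloor>R / 2\<rfloor>}"
  proof (rule card_mono)
    show "(\<lambda>p. (p - 1) div 2) ` OP \<subseteq> {1..nat \<lfloor>R / 2\<rfloor>}"
    proof safe
      fix p assume p: "p \<in> OP"
      have "2 * ((p - 1) div 2) \<le> p" by simp
      hence "2 * real ((p - 1) div 2) \<le> real p" by (metis of_nat_le_iff of_nat_mult of_nat_numeral)
      hence "real ((p - 1) div 2) \<le> R / 2" using OP_D(3)[OF p] by linarith
      hence "(p - 1) div 2 \<le> nat \<lfloor>R / 2\<rfloor>" by (rule le_nat_floor)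
      moreover have "(p - 1) div 2 \<ge> 1" using OP_D(4)[OF p] by simp
      ultimately show "(p - 1) div 2 \<in> {1..nat \<lfloor>R / 2\<rfloor>}" by simp
    qed
  qed simp
  finally have "real (card OP) \<le> real (nat \<lfloor>R / 2\<rfloor>)" by simp
  also have "\<dots> \<le> R / 2" using R19 by (intro of_nat_floor) simp
  finally show ?thesis .
qed

text \<open>The contributions are at most 9.6 from \<open>p = 3\<close>, 23 from the other primes
  below 1000 and 118 from the sifted primes. The penalty terms \<open>169 / (300 * R)\<close> sum to
  at most 169/600 in each of the last two groups, since there are at most \<open>R / 2\<close> odd
  primes below \<open>R\<close>.\<close>

lemma sum_main_constant:
  "(\<Sum>p\<in>OP. 2 * (lam p * av p * (1 / (real p - 1) + 169 / (300 * R)))) \<le> 152"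
proof -
  define \<delta> where "\<delta> = 169 / (300 * R)"
  have d0: "\<delta> \<ge> 0" using R19 by (simp add: \<delta>_def)
  have d1: "\<delta> \<le> 0.03" using R19 by (simp add: \<delta>_def field_simps)
  have dR: "R / 2 * \<delta> = 169 / 600" using R19 by (simp add: \<delta>_def)
  let ?t = "\<lambda>p. 2 * (lam p * av p * (1 / (real p - 1) + \<delta>))"
  define mid where "mid = {p \<in> OP. p \<noteq> 3 \<and> p < 1000}"
  have fin: "finite mid" "finite PP" using finite_OP finite_PP by (auto simp: mid_def)
  have un: "OP = insert 3 (mid \<union> PP)" using three_OP PP_D(5) by (auto simp: mid_def PP_def OP_def)
  have card_le: "real (card mid) \<le> R / 2" "real (card PP) \<le> R / 2"
  proof -
    have "card mid \<le> card OP" "card PP \<le> card OP"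
      using un by (intro card_mono finite_OP; blast)+
    hence "real (card mid) \<le> real (card OP)" "real (card PP) \<le> real (card OP)" by auto
    thus "real (card mid) \<le> R / 2" "real (card PP) \<le> R / 2" using card_OP by linarith+
  qed
  have "(\<Sum>p\<in>OP. ?t p) = ?t 3 + (\<Sum>p\<in>mid \<union> PP. ?t p)"
    unfolding un using fin by (subst sum.insert) (auto simp: mid_def PP_def)
  also have "(\<Sum>p\<in>mid \<union> PP. ?t p) = (\<Sum>p\<in>mid. ?t p) + (\<Sum>p\<in>PP. ?t p)"
    using fin by (intro sum.union_disjoint) (auto simp: mid_def PP_def)
  also have "?t 3 \<le> 9.6" using d1 by (simp add: lam_def av_3)
  also have "(\<Sum>p\<in>mid. ?t p) \<le> 23"
  proof -
    have mid5: "p \<ge> 5 \<and> odd p" if "p \<in> mid" for p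
    proof -
      have "odd p" "p \<ge> 3" "p \<noteq> 3" using that OP_D[of p] by (auto simp: mid_def)
      thus ?thesis by (cases "p = 4") auto
    qed
    have inj: "inj_on (\<lambda>p. (p - 1) div 2) mid" using inj_half_odd by (rule inj_on_subset) (use mid5 in auto)
    \<comment> \<open>With \<open>t = (p - 1) / 2\<close> the sum over primes is enlarged to all odd
      numbers from 5 to 999, half a harmonic sum.\<close>
    have "(\<Sum>p\<in>mid. 1 / (real p - 1)) = (\<Sum>p\<in>mid. (\<lambda>t. (1/2) * (1 / real t)) ((p - 1) div 2))"
    proof (intro sum.cong refl)
      fix p assume "p \<in> mid"
      hence "odd p" using mid5 by blast
      then obtain s where "p = 2 * s + 1" by (rule oddE)
      thus "1 / (real p - 1) = (1/2) * (1 / real ((p - 1) div 2))" by simp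
    qed
    also have "\<dots> = (\<Sum>t\<in>(\<lambda>p. (p - 1) div 2) ` mid. (1/2) * (1 / real t))"
      using sum.reindex[OF inj, of "\<lambda>t. (1/2) * (1 / real t)"] by (simp add: o_def)
    also have "\<dots> \<le> (\<Sum>t\<in>{2..499}. (1/2) * (1 / real t))"
    proof (rule sum_mono2)
      show "(\<lambda>p. (p - 1) div 2) ` mid \<subseteq> {2..499}"
      proof safe
        fix p assume p: "p \<in> mid"
        have "p < 1000" using p by (simp add: mid_def)
        thus "(p - 1) div 2 \<in> {2..499}" using mid5[OF p] by auto
      qed
    qed auto
    also have "\<dots> = (1/2) * (hsum 499 - 1)"
    proof -
      have "{1..499::nat} = insert 1 {2..499}" by auto
      hence "hsum 499 = 1 + (\<Sum>t\<in>{2..499}. 1 / real t)" unfolding hsum_def by simp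
      thus ?thesis by (simp add: sum_distrib_left)
    qed
    also have "\<dots> \<le> (1/2) * ln 499" using hsum_le_ln[of 499] by simp
    also have "ln 499 \<le> (ln (2 ^ 9) :: real)" by simp
    also have "(ln (2 ^ 9) :: real) = 9 * ln 2" by (subst ln_realpow) auto
    also have "\<dots> \<le> 9 * (25 / 36)" using ln2_le_25_over_36 by simp
    finally have h: "(\<Sum>p\<in>mid. 1 / (real p - 1)) \<le> 3.125" by simp
    have "(\<Sum>p\<in>mid. ?t p) \<le> (\<Sum>p\<in>mid. (20/3) * (1 / (real p - 1) + \<delta>))"
    proof (rule sum_mono)
      fix p assume p: "p \<in> mid"
      have a: "av p \<le> 10/3" using av_antimono[of 5 p] mid5[OF p] av_5 by simp
      have "lam p = 1" using p by (simp add: lam_def mid_def)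
      moreover have "av p * (1 / (real p - 1) + \<delta>) \<le> 10/3 * (1 / (real p - 1) + \<delta>)"
        using a d0 mid5[OF p] by (intro mult_right_mono) auto
      ultimately show "?t p \<le> (20/3) * (1 / (real p - 1) + \<delta>)" by simp
    qed
    also have "\<dots> = (20/3) * ((\<Sum>p\<in>mid. 1 / (real p - 1)) + real (card mid) * \<delta>)"
      by (simp only: sum_distrib_left[symmetric] sum.distrib sum_constant)
    also have "\<dots> \<le> (20/3) * (3.125 + R / 2 * \<delta>)"
      using h card_le d0 by (intro mult_left_mono add_mono mult_right_mono) auto
    also have "\<dots> \<le> 23" unfolding dR by simp
    finally show ?thesis .
  qed
  also have "(\<Sum>p\<in>PP. ?t p) \<le> 118"
  proof -
    have lnR: "ln R > 0" using R19 by simp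
    define n where "n = nat \<lfloor>R\<rfloor>"
    have n1: "n \<ge> 1" unfolding n_def using R19 by (intro le_nat_floor) simp
    have nR: "real n \<le> R" unfolding n_def using R19 by simp
    \<comment> \<open>Of the two factors \<open>ln p / ln R\<close> one is bounded by 1 and the
      other is kept for \<open>sum_ln_prime_div_le\<close>, so the sum stays bounded as
      \<open>R\<close> grows. The 51.2 is \<open>2 * (126/25)^2 * 1.0061\<close> rounded up, and
      1.0011 covers \<open>p / (p - 1)\<close>.\<close>
    have "(\<Sum>p\<in>PP. ?t p) \<le> (\<Sum>p\<in>PP. 51.2 * (1.0011 / ln R * (ln (real p) / real p) + \<delta>))"
    proof (rule sum_mono)
      fix p assume p: "p \<in> PP"
      have p1000: "real p \<ge> 1000" using PP_D(2)[OF p] by simp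
      define l where "l = ln (real p) / ln R"
      have "ln (real p) \<ge> 0" using p1000 by simp
      hence l0: "l \<ge> 0" unfolding l_def using lnR by simp
      have l1: "l \<le> 1" unfolding l_def using PP_D(3)[OF p] p1000 lnR by simp
      have l2: "l\<^sup>2 \<le> l" "l\<^sup>2 \<le> 1" using l0 l1 by (auto simp: power2_eq_square mult_left_le mult_le_one)
      have "l\<^sup>2 * (1 / (real p - 1)) \<le> l * (1.0011 / real p)"
        using l2 l0 p1000 by (intro mult_mono) (auto simp: field_simps)
      moreover have "l\<^sup>2 * \<delta> \<le> 1 * \<delta>" using l2 d0 by (intro mult_right_mono) auto
      ultimately have 1: "l\<^sup>2 * (1 / (real p - 1) + \<delta>) \<le> l * (1.0011 / real p) + \<delta>" by (simp only: distrib_left mult_1)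
      have a: "av p \<le> 1.0061" using av_antimono[of 1000 p] av_1000 PP_D(2)[OF p] by linarith
      have "?t p = 2 * (15876/625) * (av p * (l\<^sup>2 * (1 / (real p - 1) + \<delta>)))"
        using PP_D(2)[OF p] by (simp add: lam_def l_def)
      also have "\<dots> \<le> 2 * (15876/625) * (1.0061 * (l * (1.0011 / real p) + \<delta>))"
        using a 1 d0 p1000 by (intro mult_left_mono mult_mono) auto
      also have "\<dots> = (2 * (15876/625) * 1.0061) * (l * (1.0011 / real p) + \<delta>)" by (simp only: mult.assoc)
      also have "\<dots> \<le> 51.2 * (l * (1.0011 / real p) + \<delta>)"
        using l0 p1000 d0 by (intro mult_right_mono) auto
      also have "l * (1.0011 / real p) = 1.0011 / ln R * (ln (real p) / real p)" by (simp add: l_def)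
      finally show "?t p \<le> 51.2 * (1.0011 / ln R * (ln (real p) / real p) + \<delta>)" .
    qed
    also have "\<dots> = 51.2 * (1.0011 / ln R * (\<Sum>p\<in>PP. ln (real p) / real p) + real (card PP) * \<delta>)"
      by (simp only: sum_distrib_left[symmetric] sum.distrib sum_constant)
    also have "\<dots> \<le> 51.2 * (1.0011 / ln R * (2 * ln R) + R / 2 * \<delta>)"
    proof (intro mult_left_mono add_mono mult_right_mono card_le d0)
      have "(\<Sum>p\<in>PP. ln (real p) / real p) \<le> (\<Sum>p | prime p \<and> p \<le> n. ln (real p) / real p)"
      proof (rule sum_mono2)
        show "finite {p. prime p \<and> p \<le> n}" by (rule finite_subset[of _ "{..n}"]) auto
        show "PP \<subseteq> {p. prime p \<and> p \<le> n}" unfolding PP_def n_def by (auto intro: le_nat_floor)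
        fix p assume "p \<in> {p. prime p \<and> p \<le> n} - PP"
        thus "0 \<le> ln (real p) / real p" using prime_ge_1_nat[of p] by auto
      qed
      also have "\<dots> \<le> 2 * ln (real n)" by (rule sum_ln_prime_div_le[OF n1])
      also have "\<dots> \<le> 2 * ln R" using nR n1 by (intro mult_left_mono ln_mono) auto
      finally show "(\<Sum>p\<in>PP. ln (real p) / real p) \<le> 2 * ln R" .
      show "0 \<le> 1.0011 / ln R" using lnR by simp
    qed simp
    also have "1.0011 / ln R * (2 * ln R) = 2.0022" using lnR by simp
    also have "51.2 * (2.0022 + R / 2 * \<delta>) \<le> 118" unfolding dR by simp
    finally show ?thesis .
  qed
  finally show ?thesis unfolding \<delta>_def by simp
qed

lemma SF_wt_le:
  "SF (\<lambda>i j. wt i j * (WW i j)\<^sup>2) \<le> S1 * VV * 152 + R * (300 * R + 169) * NE"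
proof -
  define T where "T = Sigma OP (\<lambda>p. UNIV \<times> {1..KK p} :: (bool \<times> nat) set)"
  let ?w = "\<lambda>x. wk (fst x) (snd (snd x))"
  let ?e = "\<lambda>x. ev (fst (snd x)) (fst x) (snd (snd x))"
  have collect: "(\<Sum>p\<in>OP. \<Sum>b\<in>UNIV. \<Sum>k\<in>{1..KK p}. f p b k) = (\<Sum>x\<in>T. f (fst x) (fst (snd x)) (snd (snd x)))"
    for f :: "nat \<Rightarrow> bool \<Rightarrow> nat \<Rightarrow> real"
  proof -
    have "(\<Sum>p\<in>OP. \<Sum>b\<in>UNIV. \<Sum>k\<in>{1..KK p}. f p b k) = (\<Sum>p\<in>OP. \<Sum>y\<in>UNIV \<times> {1..KK p}. f p (fst y) (snd y))"
      by (simp only: sum.cartesian_product case_prod_unfold)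
    also have "\<dots> = (\<Sum>x\<in>T. f (fst x) (fst (snd x)) (snd (snd x)))"
      unfolding T_def by (subst sum.Sigma) (auto simp: finite_OP case_prod_unfold)
    finally show ?thesis .
  qed
  have "wt i j * (WW i j)\<^sup>2 = (\<Sum>x\<in>T. ?w x * (?e x i j * (WW i j)\<^sup>2))" for i j
    unfolding wt_def collect by (simp only: sum_distrib_right mult.assoc)
  hence "SF (\<lambda>i j. wt i j * (WW i j)\<^sup>2) = (\<Sum>x\<in>T. ?w x * SF (\<lambda>i j. ?e x i j * (WW i j)\<^sup>2))"
    by (simp only: SF_sum)
  also have "\<dots> \<le> (\<Sum>x\<in>T. ?w x * (S1 * VV * (lam (fst x) * av (fst x) / real (fst x) ^ snd (snd x)) + NE))"
  proof (intro sum_mono mult_left_mono)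
    fix x assume "x \<in> T"
    hence x: "fst x \<in> OP" "1 \<le> snd (snd x)" "snd (snd x) \<le> KK (fst x)" by (auto simp: T_def)
    show "SF (\<lambda>i j. ?e x i j * (WW i j)\<^sup>2) \<le> S1 * VV * (lam (fst x) * av (fst x) / real (fst x) ^ snd (snd x)) + NE"
      using x KK(3)[OF x(1)] by (intro SF_event_le KK(4)) auto
    show "0 \<le> ?w x" by (simp add: wk_def)
  qed
  also have "\<dots> = (\<Sum>p\<in>OP. \<Sum>b\<in>(UNIV :: bool set). \<Sum>k\<in>{1..KK p}. wk p k * (S1 * VV * (lam p * av p / real p ^ k) + NE))"
    by (rule collect[symmetric])
  also have "\<dots> = (\<Sum>p\<in>OP. S1 * VV * (2 * (lam p * av p * (\<Sum>k\<in>{1..KK p}. wk p k / real p ^ k))) + 2 * NE * (\<Sum>k\<in>{1..KK p}. wk p k))"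
    by (intro sum.cong refl) (simp add: UNIV_bool sum.distrib sum_distrib_left ring_distribs mult_ac)
  also have "\<dots> \<le> (\<Sum>p\<in>OP. S1 * VV * (2 * (lam p * av p * (1 / (real p - 1) + 169 / (300 * R)))) + 2 * NE * (300 * R + 169))"
  proof (intro sum_mono add_mono mult_left_mono sum_wk)
    fix p assume "p \<in> OP"
    hence "av p \<ge> 0" by (intro av_nonneg OP_D)
    moreover have "lam p \<ge> 0" by (simp add: lam_def)
    ultimately show "0 \<le> lam p * av p" by simp
    show "0 \<le> S1 * VV" using S1_nonneg VV_ge_1 by simp
  qed (use NE_nonneg in auto)
  also have "\<dots> = S1 * VV * (\<Sum>p\<in>OP. 2 * (lam p * av p * (1 / (real p - 1) + 169 / (300 * R)))) + real (card OP) * (2 * NE * (300 * R + 169))"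
    by (simp only: sum.distrib sum_constant sum_distrib_left)
  also have "\<dots> \<le> S1 * VV * 152 + R / 2 * (2 * NE * (300 * R + 169))"
    using S1_nonneg VV_ge_1 NE_nonneg R19
    by (intro add_mono mult_left_mono mult_right_mono sum_main_constant card_OP mult_nonneg_nonneg) auto
  finally show ?thesis by (simp add: mult_ac)
qed

text \<open>An averaging argument: if \<open>wt\<close> were at least 169 wherever \<open>rr\<close>
  is positive, its weighted sum would exceed the bound with average 152. The margin 169 - 152 = 17
  has to absorb the errors.\<close>

lemma exists_small_wt:
  assumes big: "(169 + R * (300 * R + 169)) * NE < 17 * S1"
  shows "\<exists>i\<in>{1..H}. \<exists>j\<in>{1..H}. rr (nat (nn (int i) (int j))) > 0 \<and> wt (int i) (int j) < 169"
proof (rule ccontr)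
  assume neg: "\<not> ?thesis"
  have "169 * (S1 * VV - NE) \<le> 169 * SF (\<lambda>i j. (WW i j)\<^sup>2)"
    by (intro mult_left_mono SF_W2_ge) simp
  also have "169 * SF (\<lambda>i j. (WW i j)\<^sup>2) = SF (\<lambda>i j. 169 * (WW i j)\<^sup>2)" by (rule SF_cmult[symmetric])
  also have "\<dots> \<le> SF (\<lambda>i j. wt i j * (WW i j)\<^sup>2)"
  proof (intro SF_mono mult_right_mono)
    fix i j assume "i \<in> {1..H}" "j \<in> {1..H}" "rr (nat (nn (int i) (int j))) > 0"
    thus "169 \<le> wt (int i) (int j)" using neg linorder_not_less by blast
  qed simp
  also have "\<dots> \<le> S1 * VV * 152 + R * (300 * R + 169) * NE" by (rule SF_wt_le)
  finally have "169 * (S1 * VV - NE) \<le> S1 * VV * 152 + R * (300 * R + 169) * NE" .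
  hence "17 * (S1 * VV) \<le> (169 + R * (300 * R + 169)) * NE"
    by (simp add: algebra_simps)
  moreover have "S1 * 1 \<le> S1 * VV" using S1_nonneg VV_ge_1 by (intro mult_left_mono)
  ultimately show False using big by simp
qed

text \<open>The penalty in \<open>wk\<close> keeps every multiplicity below \<open>KK p\<close>, so
  the truncated counts in \<open>wt\<close> are the true multiplicities, and 169 is a strict bound
  for an integer.\<close>

lemma multiplicity_le_wt:
  assumes w: "wt (int i) (int j) < 169"
    and u: "\<And>b. uu b (int i) (int j) = int (u b)" "\<And>b. u b > 0"
  shows "(\<Sum>p\<in>OP. multiplicity p (u b)) \<le> 168"
proof -
  let ?s = "\<lambda>p b. \<Sum>k\<in>{1..KK p}. wk p k * ev b p k (int i) (int j)"
  have s0: "?s p b \<ge> 0" for p b by (intro sum_nonneg mult_nonneg_nonneg) (auto simp: wk_def ev_def)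
  have wt_ge: "(\<Sum>p\<in>OP. ?s p b) \<le> wt (int i) (int j)"
    unfolding wt_def
  proof (rule sum_mono)
    fix p
    have "(\<Sum>b\<in>{b}. ?s p b) \<le> (\<Sum>b\<in>UNIV. ?s p b)" using s0 by (intro sum_mono2) auto
    thus "?s p b \<le> (\<Sum>b\<in>UNIV. ?s p b)" by simp
  qed
  have each: "real (multiplicity p (u b)) \<le> ?s p b" if p: "p \<in> OP" for p
  proof -
    have ev: "ev b p k (int i) (int j) = of_bool (k \<le> multiplicity p (u b))" for k
    proof -
      have "\<not> is_unit p" using OP_D(4)[OF p] by simp
      hence "p ^ k dvd u b \<longleftrightarrow> k \<le> multiplicity p (u b)" using u(2)[of b] by (intro power_dvd_iff_le_multiplicity) auto
      moreover have "int (p ^ k) dvd uu b (int i) (int j) \<longleftrightarrow> p ^ k dvd u b" unfolding u(1) by (rule int_dvd_int_iff)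
      ultimately show ?thesis by (simp add: ev_def)
    qed
    have "?s p b \<le> (\<Sum>p\<in>OP. ?s p b)" using s0 p by (intro member_le_sum finite_OP) auto
    hence lt: "?s p b < 169" using wt_ge w by linarith
    have "multiplicity p (u b) < KK p"
    proof (rule ccontr)
      assume "\<not> multiplicity p (u b) < KK p"
      hence "wk p (KK p) * ev b p (KK p) (int i) (int j) = 169" unfolding ev by (simp add: wk_def)
      moreover have "wk p (KK p) * ev b p (KK p) (int i) (int j) \<le> ?s p b"
        using KK(2)[OF p] by (intro member_le_sum) (auto simp: wk_def ev_def)
      ultimately show False using lt by linarith
    qed
    hence sub: "{1..multiplicity p (u b)} \<subseteq> {1..KK p}" by auto
    have "real (multiplicity p (u b)) = (\<Sum>k\<in>{1..multiplicity p (u b)}. 1)" by simp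
    also have "\<dots> \<le> (\<Sum>k\<in>{1..multiplicity p (u b)}. wk p k * ev b p k (int i) (int j))"
      by (intro sum_mono) (simp add: ev wk_def)
    also have "\<dots> \<le> ?s p b"
      by (intro sum_mono2 sub) (auto simp: wk_def ev_def)
    finally show ?thesis .
  qed
  have "real (\<Sum>p\<in>OP. multiplicity p (u b)) = (\<Sum>p\<in>OP. real (multiplicity p (u b)))" by simp
  also have "\<dots> \<le> (\<Sum>p\<in>OP. ?s p b)" by (intro sum_mono each)
  also have "\<dots> < 169" using wt_ge w by linarith
  finally have "real (\<Sum>p\<in>OP. multiplicity p (u b)) < real 169" by simp
  hence "(\<Sum>p\<in>OP. multiplicity p (u b)) < 169" by (simp only: of_nat_less_iff)
  thus ?thesis by linarith
qed

theorem sieve_exists: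
  assumes big: "(169 + R * (300 * R + 169)) * NE < 17 * S1"
  shows "\<exists>i\<in>{1..H}. \<exists>j\<in>{1..H}. rr (nat (nn (int i) (int j))) > 0 \<and>
    (\<Sum>p\<in>OP. multiplicity p (2 * i + al)) \<le> 168 \<and> (\<Sum>p\<in>OP. multiplicity p (2 * j + be)) \<le> 168"
proof -
  obtain i j where ij: "i \<in> {1..H}" "j \<in> {1..H}" "rr (nat (nn (int i) (int j))) > 0" "wt (int i) (int j) < 169"
    using exists_small_wt[OF big] by blast
  define u where "u b = (if b then 2 * i + al else 2 * j + be)" for b
  have u: "uu b (int i) (int j) = int (u b)" "u b > 0" for b
    using ij(1,2) by (auto simp: uu_def u_def)
  have "(\<Sum>p\<in>OP. multiplicity p (u b)) \<le> 168" for b by (rule multiplicity_le_wt[OF ij(4) u])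
  from this[of True] this[of False] have "(\<Sum>p\<in>OP. multiplicity p (2 * i + al)) \<le> 168"
    "(\<Sum>p\<in>OP. multiplicity p (2 * j + be)) \<le> 168" by (simp_all only: u_def if_True if_False)
  thus ?thesis using ij by blast
qed

end

section \<open>The error terms for large m\<close>

lemma card_between_multiples_le:
  assumes k: "k > 0" and QX: "Q \<le> X"
  shows "real (card {c. Q < k * c \<and> k * c \<le> X}) \<le> (real X - real Q) / real k + 1"
proof -
  have "{c. Q < k * c \<and> k * c \<le> X} = {Q div k <.. X div k}"
    using k by (auto simp: div_less_iff_less_mult less_eq_div_iff_mult_less_eq mult.commute)
  hence "card {c. Q < k * c \<and> k * c \<le> X} = X div k - Q div k" by simp
  moreover have "Q div k \<le> X div k" using QX by (rule div_le_mono)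
  ultimately have "real (card {c. Q < k * c \<and> k * c \<le> X}) = real (X div k) - real (Q div k)" by simp
  moreover have "real (X div k) \<le> real X / real k" by (rule of_nat_div_le_of_nat)
  moreover have "real Q / real k - real (Q div k) \<le> 1" by (rule real_div_minus_div_le)
  ultimately show ?thesis by (simp add: diff_divide_distrib)
qed

text \<open>In a factorisation \<open>a * b * c\<close> the largest factor can be rotated into the
  last place, at the cost of a factor 3; then \<open>(a * b)^3 \<le> X^2\<close>. For fixed
  \<open>a\<close>, \<open>b\<close> the factor \<open>c\<close> runs through an interval of length
  \<open>(X - Q) / (a * b)\<close>, and the rounding error 1 is at most
  \<open>Z / (a * b)\<close>.\<close>

lemma sum_tau3_short_interval_le:
  assumes QX: "Q \<le> X" and Z: "real X ^ 2 \<le> Z ^ 3" "Z \<ge> 0"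
  shows "(\<Sum>q\<in>{Q<..X}. real (tau3 q)) \<le> 3 * ((real X - real Q + Z) * (hsum X)\<^sup>2)"
proof -
  define T where "T = {(a, b, c). Q < a * b * c \<and> a * b * c \<le> X}"
  define T1 where "T1 = {(a, b, c). (a, b, c) \<in> T \<and> (a * b) ^ 3 \<le> X ^ 2}"
  have pos: "a \<in> {1..X}" "b \<in> {1..X}" "c \<in> {1..X}" if "(a, b, c) \<in> T" for a b c
  proof -
    have t: "Q < a * b * c" "a * b * c \<le> X" using that by (auto simp: T_def)
    hence p: "a > 0" "b > 0" "c > 0" by (auto intro!: Nat.gr0I)
    have "a \<le> a * b * c" by (rule dvd_imp_le[OF dvd_mult2[OF dvd_triv_left]]) (use p in simp)
    moreover have "b \<le> a * b * c" by (rule dvd_imp_le[OF dvd_mult2[OF dvd_triv_right]]) (use p in simp)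
    moreover have "c \<le> a * b * c" by (rule dvd_imp_le[OF dvd_triv_right]) (use p in simp)
    ultimately show "a \<in> {1..X}" "b \<in> {1..X}" "c \<in> {1..X}"
      unfolding atLeastAtMost_iff using p t(2) by linarith+
  qed
  have finT: "finite T" by (rule finite_subset[of _ "{1..X} \<times> {1..X} \<times> {1..X}"]) (use pos in auto)
  have finT1: "finite T1" by (rule finite_subset[OF _ finT]) (auto simp: T1_def)
  define U where "U = Sigma {Q<..X} (\<lambda>q. Sigma {g. g dvd q} (\<lambda>g. {e. e dvd q div g}))"
  have fd: "finite {g. g dvd q}" if "q \<in> {Q<..X}" for q using that by (intro finite_divisors_nat) simp
  have fe: "finite {e. e dvd q div g}" if "q \<in> {Q<..X}" "g dvd q" for q g
    using that by (intro finite_divisors_nat) (auto intro!: Nat.gr0I elim!: dvdE split: if_splits)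
  have "(\<Sum>q\<in>{Q<..X}. tau3 q) = (\<Sum>q\<in>{Q<..X}. card (Sigma {g. g dvd q} (\<lambda>g. {e. e dvd q div g})))"
    unfolding tau3_def using fd fe by (intro sum.cong refl card_SigmaI[symmetric]) auto
  also have "\<dots> = card U" unfolding U_def using fd fe by (intro card_SigmaI[symmetric]) auto
  also have "\<dots> \<le> card T"
  proof (rule card_inj_on_le[where f = "\<lambda>(q, g, e). (g, e, q div g div e)"])
    have q: "g * e * (q div g div e) = q" if "(q, g, e) \<in> U" for q g e
    proof -
      have "g dvd q" "e dvd q div g" using that by (simp_all add: U_def)
      thus ?thesis by (simp only: mult.assoc dvd_mult_div_cancel)
    qed
    show "inj_on (\<lambda>(q, g, e). (g, e, q div g div e)) U"
    proof (rule inj_onI)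
      fix x y assume xy: "x \<in> U" "y \<in> U" and eq: "(\<lambda>(q, g, e). (g, e, q div g div e)) x = (\<lambda>(q, g, e). (g, e, q div g div e)) y"
      obtain q1 g1 e1 where x: "x = (q1, g1, e1)" by (cases x)
      obtain q2 g2 e2 where y: "y = (q2, g2, e2)" by (cases y)
      have "g1 = g2 \<and> e1 = e2 \<and> q1 div g1 div e1 = q2 div g2 div e2" using eq unfolding x y prod.case prod.inject .
      hence e: "g1 = g2" "e1 = e2" "q1 div g1 div e1 = q2 div g2 div e2" by blast+
      have "q1 = g1 * e1 * (q1 div g1 div e1)" using q[OF xy(1)[unfolded x]] by (rule sym)
      also have "\<dots> = g2 * e2 * (q2 div g2 div e2)" unfolding e(3) unfolding e(1,2) ..
      also have "\<dots> = q2" by (rule q[OF xy(2)[unfolded y]])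
      finally have "q1 = q2" .
      thus "x = y" unfolding x y e(1,2) by (rule arg_cong)
    qed
    show "(\<lambda>(q, g, e). (g, e, q div g div e)) ` U \<subseteq> T"
    proof safe
      fix q g e assume u: "(q, g, e) \<in> U"
      hence "Q < q" "q \<le> X" by (auto simp: U_def)
      thus "(g, e, q div g div e) \<in> T" unfolding T_def using q[OF u] by simp
    qed
  qed (rule finT)
  also have "card T \<le> card (T1 \<union> (\<lambda>(a, b, c). (c, a, b)) ` T1 \<union> (\<lambda>(a, b, c). (b, c, a)) ` T1)"
  proof (rule card_mono)
    show "T \<subseteq> T1 \<union> (\<lambda>(a, b, c). (c, a, b)) ` T1 \<union> (\<lambda>(a, b, c). (b, c, a)) ` T1"
    proof safe
      fix a b c assume t: "(a, b, c) \<in> T" and n1: "(a, b, c) \<notin> (\<lambda>(a, b, c). (b, c, a)) ` T1"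
        and n2: "(a, b, c) \<notin> (\<lambda>(a, b, c). (c, a, b)) ` T1"
      \<comment> \<open>If \<open>z\<close> is the largest factor then
        \<open>x * y \<le> z^2\<close>; multiply by the square of \<open>x * y\<close>.\<close>
      have key: "(x * y) ^ 3 \<le> X ^ 2" if "x \<le> z" "y \<le> z" "x * y * z \<le> X" for x y z :: nat
      proof -
        have "x * y \<le> z ^ 2" using that by (simp add: power2_eq_square mult_mono)
        hence "(x * y) ^ 2 * (x * y) \<le> (x * y) ^ 2 * z ^ 2" by (rule mult_left_mono) simp
        also have "\<dots> = (x * y * z) ^ 2" by (simp add: power_mult_distrib)
        also have "\<dots> \<le> X ^ 2" using that(3) by (intro power_mono) auto
        finally show ?thesis by (simp add: power3_eq_cube power2_eq_square)
      qed
      have perm: "(b, c, a) \<in> T" "(c, a, b) \<in> T" using t by (auto simp: T_def mult_ac)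
      have le: "a * b * c \<le> X" "b * c * a \<le> X" "c * a * b \<le> X" using t by (auto simp: T_def mult_ac)
      have "(b, c, a) \<notin> T1" using n2 by (auto intro: image_eqI[of _ _ "(b, c, a)"])
      moreover have "(c, a, b) \<notin> T1" using n1 by (auto intro: image_eqI[of _ _ "(c, a, b)"])
      ultimately have "\<not> (b \<le> a \<and> c \<le> a)" "\<not> (c \<le> b \<and> a \<le> b)"
        using perm key[OF _ _ le(2)] key[OF _ _ le(3)] by (auto simp: T1_def)
      hence "a \<le> c" "b \<le> c" by linarith+
      thus "(a, b, c) \<in> T1" using t key[OF _ _ le(1)] by (simp add: T1_def)
    qed
  qed (use finT1 in auto)
  also have "\<dots> \<le> card T1 + card T1 + card T1"
    by (intro order.trans[OF card_Un_le] add_mono card_image_le finT1 order.refl)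
  finally have "(\<Sum>q\<in>{Q<..X}. tau3 q) \<le> 3 * card T1" by simp
  hence 1: "(\<Sum>q\<in>{Q<..X}. real (tau3 q)) \<le> 3 * real (card T1)"
    by (metis of_nat_le_iff of_nat_mult of_nat_numeral of_nat_sum)
  define Pr where "Pr = {z \<in> {1..X} \<times> {1..X}. (fst z * snd z) ^ 3 \<le> X ^ 2}"
  have finPr: "finite Pr" by (simp add: Pr_def)
  let ?B = "\<lambda>z :: nat \<times> nat. {c. Q < fst z * snd z * c \<and> fst z * snd z * c \<le> X}"
  have finc: "finite {c. Q < k * c \<and> k * c \<le> X}" if "k > 0" for k
  proof (rule finite_subset)
    show "{c. Q < k * c \<and> k * c \<le> X} \<subseteq> {..X}"
    proof safe
      fix c assume "k * c \<le> X"
      moreover have "1 * c \<le> k * c" using that by (intro mult_right_mono) auto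
      ultimately show "c \<le> X" by linarith
    qed
  qed simp
  have "card T1 \<le> card (Sigma Pr ?B)"
  proof (rule card_inj_on_le[where f = "\<lambda>(a, b, c). ((a, b), c)"])
    show "inj_on (\<lambda>(a, b, c). ((a, b), c)) T1" by (auto simp: inj_on_def)
    show "(\<lambda>(a, b, c). ((a, b), c)) ` T1 \<subseteq> Sigma Pr ?B"
    proof (rule image_subsetI)
      fix x assume x: "x \<in> T1"
      obtain a b c where abc: "x = (a, b, c)" by (cases x)
      have t: "(a, b, c) \<in> T" "(a * b) ^ 3 \<le> X ^ 2" using x unfolding abc by (simp_all add: T1_def)
      have "(a, b) \<in> Pr" using pos(1,2)[OF t(1)] t(2) by (simp add: Pr_def)
      thus "(case x of (a, b, c) \<Rightarrow> ((a, b), c)) \<in> Sigma Pr ?B"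
        using t(1) unfolding abc by (simp add: T_def)
    qed
    show "finite (Sigma Pr ?B)"
    proof (intro finite_SigmaI finPr)
      fix z assume "z \<in> Pr"
      hence "fst z * snd z > 0" by (auto simp: Pr_def)
      thus "finite (?B z)"
        by (rule finc)
    qed
  qed
  also have "\<dots> = (\<Sum>z\<in>Pr. card (?B z))"
  proof (intro card_SigmaI finPr ballI)
    fix z assume "z \<in> Pr"
    hence "fst z * snd z > 0" by (auto simp: Pr_def)
    thus "finite (?B z)"
      by (rule finc)
  qed
  finally have "real (card T1) \<le> real (\<Sum>z\<in>Pr. card (?B z))"
    by (rule of_nat_mono)
  also have "\<dots> = (\<Sum>z\<in>Pr. real (card (?B z)))"
    by (rule of_nat_sum)
  also have "\<dots> \<le> (\<Sum>z\<in>Pr. (real X - real Q + Z) * (1 / real (fst z) * (1 / real (snd z))))"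
  proof (rule sum_mono)
    fix z assume z: "z \<in> Pr"
    hence z0: "fst z > 0" "snd z > 0" by (auto simp: Pr_def)
    have "(fst z * snd z) ^ 3 \<le> X ^ 2" using z by (simp add: Pr_def)
    hence "real ((fst z * snd z) ^ 3) \<le> real (X ^ 2)" by (rule of_nat_mono)
    hence "(real (fst z * snd z)) ^ 3 \<le> real X ^ 2" by (simp only: of_nat_power)
    also have "\<dots> \<le> Z ^ 3" by (rule Z(1))
    finally have "real (fst z * snd z) \<le> Z" using Z(2) by (subst (asm) power_mono_iff) auto
    hence "1 \<le> Z / real (fst z * snd z)" using z0 by (simp add: field_simps)
    moreover have "real (card (?B z)) \<le> (real X - real Q) / real (fst z * snd z) + 1"
      using z0 by (intro card_between_multiples_le QX) simp
    ultimately have "real (card (?B z)) \<le> (real X - real Q) / real (fst z * snd z) + Z / real (fst z * snd z)"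
      by linarith
    thus "real (card (?B z)) \<le> (real X - real Q + Z) * (1 / real (fst z) * (1 / real (snd z)))"
      by (simp add: add_divide_distrib)
  qed
  also have "\<dots> \<le> (\<Sum>z\<in>{1..X} \<times> {1..X}. (real X - real Q + Z) * (1 / real (fst z) * (1 / real (snd z))))"
    using QX Z(2) by (intro sum_mono2) (auto simp: Pr_def)
  also have "\<dots> = (real X - real Q + Z) * (\<Sum>a\<in>{1..X}. \<Sum>b\<in>{1..X}. 1 / real a * (1 / real b))"
    by (simp only: sum_distrib_left sum.cartesian_product case_prod_unfold)
  also have "(\<Sum>a\<in>{1..X}. \<Sum>b\<in>{1..X}. 1 / real a * (1 / real b)) = (hsum X)\<^sup>2"
    unfolding hsum_def power2_eq_square by (rule sum_product[symmetric])
  finally show ?thesis using 1 by linarith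
qed

text \<open>The Euler product over the primes of \<open>m\<close> has factors
  \<open>1 / (1 - p^(-1/2))\<close>. From 128 on such a factor is at most \<open>p^(1/32)\<close>;
  below there are at most 8 primes under 16 with factor at most 4 and at most 56 others with factor
  at most 4/3, together less than \<open>2^40\<close>.\<close>

lemma gsig_le:
  assumes m: "m > 0"
  shows "gsig m \<le> 2 ^ 40 * real m powr (1/32)"
proof -
  define S where "S = prime_factors m"
  define w where "w p = 1 / (1 - real p powr (- (1/2)))" for p
  have fin: "finite S" by (simp add: S_def)
  have pr: "prime p" if "p \<in> S" for p using that by (simp add: S_def in_prime_factors_imp_prime)
  \<comment> \<open>Any exponent that exceeds all multiplicities will do, since the Euler product
    bound does not depend on it.\<close>
  have "m dvd (\<Prod>S) ^ m"
  proof -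
    have "m = (\<Prod>p\<in>S. p ^ multiplicity p m)" unfolding S_def by (rule prime_factorization_nat[OF m])
    also have "\<dots> dvd (\<Prod>p\<in>S. p ^ m)"
    proof (intro prod_dvd_prod le_imp_power_dvd)
      fix p assume p: "p \<in> S"
      have "multiplicity p m < 2 ^ multiplicity p m" by (rule less_exp)
      also have "(2 :: nat) ^ multiplicity p m \<le> p ^ multiplicity p m" using prime_ge_2_nat[OF pr[OF p]] by (intro power_mono) auto
      also have "\<dots> \<le> m" using m by (intro dvd_imp_le multiplicity_dvd) auto
      finally show "multiplicity p m \<le> m" by simp
    qed
    also have "(\<Prod>p\<in>S. p ^ m) = (\<Prod>S) ^ m" by (simp add: prod_power_distrib)
    finally show ?thesis .
  qed
  moreover have "\<Prod>S > 0" using pr by (rule prod_primes_pos)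
  ultimately have sub: "{g. g dvd m} \<subseteq> {g. g dvd (\<Prod>S) ^ m}" "finite {g. g dvd (\<Prod>S) ^ m}"
    by (auto intro: dvd_trans)
  have "gsig m = (\<Sum>g | g dvd m. real g powr (- (1/2)))"
    unfolding gsig_def by (intro sum.cong refl) (simp add: powr_minus_divide powr_half_sqrt)
  also have "\<dots> \<le> (\<Sum>g | g dvd (\<Prod>S) ^ m. real g powr (- (1/2)))" by (rule sum_mono2) (use sub in auto)
  also have "\<dots> \<le> (\<Prod>p\<in>S. w p)" unfolding w_def by (intro sum_divisors_power_le_prod fin pr) auto
  finally have 1: "gsig m \<le> (\<Prod>p\<in>S. w p)" .
  define A where "A = {p \<in> S. p < 16}"
  define B where "B = {p \<in> S. 16 \<le> p \<and> p < 128}"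
  define C where "C = {p \<in> S. 128 \<le> p}"
  have odd_or: "p = 2 \<or> odd p" if "p \<in> S" for p using primes_dvd_imp_eq[of 2 p] pr[OF that] by auto
  have sq: "real p powr (- (1/2)) \<le> 1 / x" if "x > 0" "x ^ 2 \<le> real p" for p x
  proof -
    have "x \<le> sqrt (real p)" using that by (intro real_le_rsqrt) auto
    moreover have "real p powr (- (1/2)) = 1 / sqrt (real p)" by (simp add: powr_minus_divide powr_half_sqrt)
    ultimately show ?thesis using that by (simp add: frac_le)
  qed
  have w: "0 \<le> w p" "w p \<le> 1 / (1 - 1 / x)" if "x > 1" "x ^ 2 \<le> real p" for p x
  proof -
    have "1 - 1 / x > 0" using that by (simp add: field_simps)
    moreover have "1 - 1 / x \<le> 1 - real p powr (- (1/2))" using sq[of x p] that by simp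
    ultimately show "0 \<le> w p" "w p \<le> 1 / (1 - 1 / x)" unfolding w_def by (auto intro!: frac_le)
  qed
  have "(\<Prod>p\<in>S. w p) = (\<Prod>p\<in>A. w p) * ((\<Prod>p\<in>B. w p) * (\<Prod>p\<in>C. w p))"
  proof -
    have "S = A \<union> (B \<union> C)" "A \<inter> (B \<union> C) = {}" "B \<inter> C = {}" by (auto simp: A_def B_def C_def)
    moreover have "finite A" "finite B" "finite C" using fin by (auto simp: A_def B_def C_def)
    ultimately show ?thesis by (simp add: prod.union_disjoint)
  qed
  also have "\<dots> \<le> 4 ^ 8 * ((4/3) ^ 56 * real m powr (1/32))"
  proof (intro mult_mono)
    have "(\<Prod>p\<in>A. w p) \<le> (\<Prod>p\<in>A. 4)"
    proof (intro prod_mono conjI)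
      fix p assume "p \<in> A"
      hence "p \<ge> 2" using pr prime_ge_2_nat by (auto simp: A_def)
      hence "(4/3 :: real) ^ 2 \<le> real p" by (simp add: power2_eq_square)
      thus "0 \<le> w p" "w p \<le> 4" using w[of "4/3" p] by auto
    qed
    also have "\<dots> = 4 ^ card A" by simp
    also have "\<dots> \<le> 4 ^ 8"
    proof (rule power_increasing)
      have "A \<subseteq> {2,3,5,7,9,11,13,15}"
      proof
        fix p assume p: "p \<in> A"
        have "p < 16" "p = 2 \<or> odd p" "p \<ge> 2" using p odd_or pr prime_ge_2_nat by (auto simp: A_def)
        thus "p \<in> {2,3,5,7,9,11,13,15}" by simp presburger
      qed
      hence "card A \<le> card {2,3,5,7,9,11,13,15::nat}" by (intro card_mono) auto
      thus "card A \<le> 8" by simp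
    qed simp
    finally show "(\<Prod>p\<in>A. w p) \<le> 4 ^ 8" .
    have "(\<Prod>p\<in>B. w p) \<le> (\<Prod>p\<in>B. 4/3)"
    proof (intro prod_mono conjI)
      fix p assume "p \<in> B"
      hence "(4 :: real) ^ 2 \<le> real p" by (simp add: B_def)
      thus "0 \<le> w p" "w p \<le> 4/3" using w[of 4 p] by auto
    qed
    also have "\<dots> = (4/3) ^ card B" by simp
    also have "\<dots> \<le> (4/3) ^ 56"
    proof (rule power_increasing)
      have inj: "inj_on (\<lambda>p. (p - 1) div 2) B"
        using inj_half_odd
      proof (rule inj_on_subset)
        show "B \<subseteq> {p. odd p}" using odd_or by (force simp: B_def)
      qed
      have "(\<lambda>p. (p - 1) div 2) ` B \<subseteq> {8..63}"
      proof safe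
        fix p assume p: "p \<in> B"
        hence "odd p" "16 \<le> p" "p < 128" using odd_or[of p] by (auto simp: B_def)
        thus "(p - 1) div 2 \<in> {8..63}" by (auto elim!: oddE)
      qed
      hence "card ((\<lambda>p. (p - 1) div 2) ` B) \<le> card {8..63::nat}" by (intro card_mono) auto
      thus "card B \<le> 56" using card_image[OF inj] by simp
    qed simp
    finally show "(\<Prod>p\<in>B. w p) \<le> (4/3) ^ 56" .
    have "(\<Prod>p\<in>C. w p) \<le> (\<Prod>p\<in>C. real p powr (1/32))"
    proof (intro prod_mono conjI)
      fix p assume p: "p \<in> C"
      hence p1: "(11 :: real) ^ 2 \<le> real p" by (simp add: C_def)
      thus "0 \<le> w p" using w(1)[of 11 p] by simp
      \<comment> \<open>For \<open>p \<ge> 128\<close> the square root is at least 11, so the factor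
        is at most 11/10, and \<open>(11/10)^32 \<le> 128\<close>.\<close>
      have "(11/10 :: real) = (11/10) powr (32 * (1/32))" by simp
      also have "\<dots> = ((11/10) powr 32) powr (1/32)" by (rule powr_powr[symmetric])
      also have "\<dots> \<le> real p powr (1/32)"
      proof (rule powr_mono2)
        have "(11/10 :: real) powr 32 \<le> 128" by (simp add: power_divide)
        also have "128 \<le> real p" using p by (simp add: C_def)
        finally show "(11/10 :: real) powr 32 \<le> real p" .
      qed auto
      finally show "w p \<le> real p powr (1/32)" using w(2)[of 11 p] p1 by simp
    qed
    also have "\<dots> = (\<Prod>p\<in>C. real p) powr (1/32)" by (rule prod_powr_distrib[symmetric])
    also have "\<dots> \<le> real m powr (1/32)"
    proof (rule powr_mono2)
      have "(\<Prod>p\<in>C. p) \<le> (\<Prod>p\<in>S. p)"         using \<open>\<Prod>S > 0\<close> fin by (intro dvd_imp_le prod_dvd_prod_subset) (auto simp: C_def)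
      also have "\<dots> \<le> (\<Prod>p\<in>S. p ^ multiplicity p m)"
      proof (intro prod_mono conjI)
        fix p assume p: "p \<in> S"
        have "multiplicity p m > 0" using p by (simp add: S_def prime_factors_multiplicity)
        thus "p \<le> p ^ multiplicity p m" using prime_ge_1_nat[OF pr[OF p]] by (intro self_le_power) auto
      qed auto
      also have "\<dots> = m" unfolding S_def by (rule prime_factorization_nat[OF m, symmetric])
      finally have "real (\<Prod>p\<in>C. p) \<le> real m" by (rule of_nat_mono)
      thus "(\<Prod>p\<in>C. real p) \<le> real m" by simp
    qed (auto intro!: prod_nonneg)
    finally show "(\<Prod>p\<in>C. w p) \<le> real m powr (1/32)" .
    have "0 \<le> w p" if "16 \<le> p" for p using w(1)[of 4 p] that by simp
    hence B0: "0 \<le> (\<Prod>p\<in>B. w p)" and C0: "0 \<le> (\<Prod>p\<in>C. w p)"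
      by (intro prod_nonneg; simp add: B_def C_def)+
    show "0 \<le> (\<Prod>p\<in>C. w p)" by (rule C0)
    show "0 \<le> (\<Prod>p\<in>B. w p) * (\<Prod>p\<in>C. w p)" using B0 C0 by simp
  qed auto
  also have "\<dots> = (4 ^ 8 * (4/3) ^ 56) * real m powr (1/32)" by (simp only: mult.assoc)
  also have "\<dots> \<le> 2 ^ 40 * real m powr (1/32)"
    by (rule mult_right_mono) (simp_all add: power_divide)
  finally show ?thesis using 1 by linarith
qed

lemma powr_three_quarters_le:
  fixes x p :: real
  assumes "x > 0" "p \<ge> 0" "x ^ 4 \<le> p ^ 3"
  shows "p powr (- (3/4)) \<le> 1 / x"
proof -
  have "x = x powr (4 * (1/4))" using assms by simp
  also have "\<dots> = (x powr 4) powr (1/4)" by (rule powr_powr[symmetric])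
  also have "x powr 4 = x ^ 4" using assms by simp
  also have "(x ^ 4) powr (1/4) \<le> (p ^ 3) powr (1/4)" using assms by (intro powr_mono2) auto
  also have "p ^ 3 = p powr 3" using assms by simp
  also have "(p powr 3) powr (1/4) = p powr (3/4)" by (simp add: powr_powr)
  finally have "x \<le> p powr (3/4)" .
  thus ?thesis using assms by (simp add: powr_minus_divide frac_le)
qed

lemma psi_factor_le_13: "p \<ge> 3 \<Longrightarrow> psi_factor p \<le> 13"
  and psi_factor_le_sqrt: "p \<ge> 1000 \<Longrightarrow> psi_factor p \<le> sqrt (real p)"
  and psi_factor_nonneg: "p \<ge> 3 \<Longrightarrow> psi_factor p \<ge> 0"
proof -
  have bd: "0 < y ^ 3 \<and> psi_factor p \<le> 2 / y ^ 3" if "real p powr (- (3/4)) \<le> 1 - y" "y > 0" for y p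
  proof -
    have "y ^ 3 \<le> (1 - real p powr (- (3/4))) ^ 3" using that by (intro power_mono) auto
    moreover have "y ^ 3 > 0" using that by simp
    ultimately show ?thesis by (intro conjI frac_le) auto
  qed
  {
    assume p: "p \<ge> 3"
    have "(3 :: real) ^ 3 \<le> real p ^ 3" using p by (intro power_mono) auto
    hence "(20/9 :: real) ^ 4 \<le> real p ^ 3" by (simp add: power_divide)
    hence 1: "real p powr (- (3/4)) \<le> 1 - 11/20" using powr_three_quarters_le[of "20/9" "real p"] by simp
    show "psi_factor p \<le> 13" using bd[OF 1] by (simp add: power_divide)
    show "psi_factor p \<ge> 0" using 1 by (intro divide_nonneg_nonneg zero_le_power) auto
  }
  assume p: "p \<ge> 1000"
  have "(1000 :: real) ^ 3 \<le> real p ^ 3" using p by (intro power_mono) auto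
  hence "(2 :: real) ^ 4 \<le> real p ^ 3" by simp
  hence 1: "real p powr (- (3/4)) \<le> 1 - 1/2" using powr_three_quarters_le[of 2 "real p"] by simp
  have "psi_factor p \<le> 16" using bd[OF 1] by (simp add: power_divide)
  also have "16 \<le> sqrt (real p)" using p by (intro real_le_rsqrt) simp
  finally show "psi_factor p \<le> sqrt (real p)" .
qed

lemma sqrt_prod_nat: "finite A \<Longrightarrow> (\<Prod>q\<in>A. sqrt (real q)) = sqrt (real (\<Prod>A))"
  by (induction A rule: finite_induct) (auto simp: real_sqrt_mult)

text \<open>\<open>T\<close> is a common unit, the 3200th root of \<open>X\<close>: all quantities
  (\<open>H\<close>, the sieve level \<open>T^16\<close>, logarithms, errors) are compared by
  integral exponents of \<open>T\<close>.\<close>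

locale large_base =
  fixes H X :: nat and L T :: real
  assumes T1: "T > 1" and TX: "T ^ 3200 = real X" and X_ge: "2 ^ 859 \<le> X"
    and H_def: "H = nat \<lfloor>T ^ 3100\<rfloor>" and L_def: "L = 1 + ln (real X)"
begin

text \<open>Numerical constants are converted into powers of \<open>T\<close> through
  \<open>X \<ge> 2^859\<close>.\<close>

lemma pow2_le_T:
  assumes "3200 * e \<le> 859 * k"
  shows "2 ^ e \<le> T ^ k"
proof -
  have "((2 :: real) ^ e) ^ 3200 = 2 ^ (3200 * e)" by (simp only: power_mult[symmetric] mult.commute)
  also have "\<dots> \<le> 2 ^ (859 * k)" using assms by (intro power_increasing) auto
  also have "\<dots> = (2 ^ 859) ^ k" by (rule power_mult)
  also have "\<dots> \<le> (T ^ 3200) ^ k"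
  proof (rule power_mono)
    have "real (2 ^ 859) \<le> real X" using X_ge by (rule of_nat_mono)
    thus "(2 :: real) ^ 859 \<le> T ^ 3200" unfolding TX by (simp only: of_nat_power of_nat_numeral)
  qed simp
  also have "\<dots> = (T ^ k) ^ 3200" by (simp only: power_mult[symmetric] mult.commute)
  finally show ?thesis using T1 by (subst (asm) power_mono_iff) auto
qed

lemma T_mono: "a \<le> b \<Longrightarrow> T ^ a \<le> T ^ b"
  using T1 by (intro power_increasing) auto

lemma T_pos: "T ^ a > 0"
  using T1 by simp

lemma R19: "T ^ 16 \<ge> 19"
proof -
  have "(19 :: real) ^ 200 \<le> 2 ^ 859" by simp
  also have "\<dots> \<le> T ^ 3200" using pow2_le_T[of 859 3200] by simp
  also have "\<dots> = (T ^ 16) ^ 200" by (simp only: power_mult[symmetric]) simp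
  finally show ?thesis using T1 by (subst (asm) power_mono_iff) auto
qed

lemma X_pos: "real X > 0" using TX T_pos[of 3200] by simp

lemma L_bounds: "L \<ge> 1" "hsum X \<le> L" "L \<le> T ^ 36"
proof -
  have X1: "real X \<ge> 1" using TX T1 one_le_power[of T 3200] by simp
  show "L \<ge> 1" unfolding L_def using X1 by simp
  show "hsum X \<le> L" unfolding L_def using X_pos by (intro hsum_le_ln) simp
  define z where "z = T ^ 36"
  have z0: "z > 0" using T1 by (simp add: z_def)
  have "ln (real X) = 3200 * ln T" unfolding TX[symmetric] using T1 by (subst ln_realpow) auto
  moreover have "ln z = 36 * ln T" unfolding z_def using T1 by (subst ln_realpow) auto
  ultimately have 1: "ln (real X) = 800 / 9 * ln z" by simp
  \<comment> \<open>The tangent of the logarithm at 1024. The resulting linear bound for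
    \<open>L\<close> is below \<open>z\<close> once \<open>z \<ge> 600\<close>, and
    \<open>X \<ge> 2^859\<close> guarantees that.\<close>
  have "ln (z / 1024) \<le> z / 1024 - 1" using z0 by (intro ln_le_minus_one) simp
  moreover have "ln (z / 1024) = ln z - ln 1024" using z0 by (subst ln_div) auto
  moreover have "ln (1024 :: real) = 10 * ln 2"
    using ln_realpow[of "2 :: real" 10] by simp
  moreover have "ln (2 :: real) \<le> 25 / 36" by (rule ln2_le_25_over_36)
  ultimately have "ln z \<le> z / 1024 + 250/36 - 1" by linarith
  hence 2: "L \<le> 1 + 800 / 9 * (z / 1024 + 250/36 - 1)" unfolding L_def 1 by simp
  have "(600 :: real) ^ 3 \<le> 2 ^ 28" by simp
  also have "\<dots> \<le> T ^ 108" by (rule pow2_le_T) simp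
  also have "\<dots> = z ^ 3" unfolding z_def by (simp only: power_mult[symmetric]) simp
  finally have "z \<ge> 600" using z0 by (subst (asm) power_mono_iff) auto
  thus "L \<le> T ^ 36" using 2 unfolding z_def[symmetric] by (simp add: field_simps)
qed

lemma H_bounds: "real H \<le> T ^ 3100" "T ^ 3100 \<le> 2 * real H" "1 \<le> H"
proof -
  show "real H \<le> T ^ 3100" unfolding H_def using T_pos[of 3100] by simp
  have "T ^ 3100 \<ge> 2 ^ 1" by (rule pow2_le_T) simp
  moreover have "T ^ 3100 \<le> real H + 1" unfolding H_def using T_pos[of 3100] by linarith
  ultimately show "T ^ 3100 \<le> 2 * real H" by simp
  thus "1 \<le> H" using T_pos[of 3100] by (cases H) auto
qed

lemma H_sq: "2 * (2 * real H + 1) ^ 2 \<le> 18 * T ^ 6200"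
proof -
  have "2 * real H + 1 \<le> 3 * T ^ 3100" using H_bounds(1,3) of_nat_mono[OF H_bounds(3), where 'a = real] by simp
  hence "(2 * real H + 1) ^ 2 \<le> (3 * T ^ 3100) ^ 2" by (intro power_mono) auto
  also have "\<dots> = 9 * T ^ 6200" by (simp add: power_mult_distrib flip: power_mult)
  finally show ?thesis by simp
qed

end

locale large_params = large_base H X L T for H X :: nat and L T :: real +
  fixes m al be Q :: nat
  assumes al1: "al \<le> 1" and be1: "be \<le> 1" and m_mod4: "m mod 4 = 1 + al + be"
    and mX2: "m \<le> X ^ 2" and mX1: "(X - 1) ^ 2 < m"
    and Qm1: "Q ^ 2 + 2 * (2 * H + 1) ^ 2 < m" and Qm2: "m \<le> (Q + 1) ^ 2 + 2 * (2 * H + 1) ^ 2"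
begin

text \<open>The difference of the squares is at most about the squared side \<open>T^6200\<close> of
  the box; dividing by the sum, which exceeds \<open>X = T^3200\<close>, leaves
  \<open>T^3000\<close>.\<close>

lemma X_minus_Q: "real X - real Q \<le> 20 * T ^ 3000"
proof -
  define x where "x = real X - 1"
  define q where "q = real Q + 1"
  have one: "T ^ 3000 \<ge> 1" using T1 by (intro one_le_power) simp
  have "real ((X - 1) ^ 2) < real ((Q + 1) ^ 2 + 2 * (2 * H + 1) ^ 2)"
    using mX1 Qm2 by (intro of_nat_less_iff[THEN iffD2]) (rule less_le_trans)
  moreover have "real (X - 1) = x" unfolding x_def using X_pos by (simp add: of_nat_diff)
  ultimately have "x ^ 2 < q ^ 2 + 2 * (2 * real H + 1) ^ 2"
    by (simp add: q_def add.commute)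
  hence 1: "x ^ 2 - q ^ 2 \<le> 18 * T ^ 6200" using H_sq by linarith
  have "x - q \<le> 18 * T ^ 3000"
  proof (cases "x \<le> q")
    case False
    have "(x - q) * T ^ 3200 \<le> (x - q) * (x + q)"
      unfolding TX using False by (intro mult_left_mono) (auto simp: x_def q_def)
    also have "\<dots> = x ^ 2 - q ^ 2" by (simp add: power2_eq_square algebra_simps)
    also have "\<dots> \<le> 18 * T ^ 6200" by (rule 1)
    also have "\<dots> = (18 * T ^ 3000) * T ^ 3200" by (simp flip: power_add)
    finally show ?thesis using T_pos[of 3200] by (simp only: mult_le_cancel_right_pos)
  next
    case True
    thus ?thesis using one by linarith
  qed
  thus ?thesis using one unfolding x_def q_def by linarith
qed

lemma X_le_2Q: "real X \<le> 2 * real Q"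
proof -
  have "(2 :: real) ^ 6 \<le> T ^ 200" by (rule pow2_le_T) simp
  hence "T ^ 3000 * 64 \<le> T ^ 3000 * T ^ 200" using T_pos[of 3000] by (intro mult_left_mono) auto
  also have "\<dots> = real X" unfolding TX[symmetric] by (simp flip: power_add)
  finally show ?thesis using X_minus_Q T_pos[of 3000] by linarith
qed

lemma Q_ge_1: "Q \<ge> 1"
  using X_le_2Q X_pos by (cases Q) auto

end

sublocale large_params \<subseteq> four_sq_box m al be H Q X L
  using al1 be1 m_mod4 Qm1 mX2 Q_ge_1 L_bounds by unfold_locales auto

context large_params begin

definition B0 :: real where "B0 = 2 ^ 20 * T ^ 5880"

text \<open>Bounds both the number of sifting sets and their products. While the sieve level is at
  most 1000 the empty set is the only sifting set, and the value 1 saves powers that the smallest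
  \<open>m\<close> could not afford.\<close>

definition MM :: real where "MM = (if T ^ 16 \<le> 1000 then 1 else T ^ 16)"

text \<open>The constants are \<open>24 * 1170000 + 2 * 3\<close> and \<open>2 * 126\<close>, from
  \<open>error_le\<close> and twice the bound \<open>Tsum_le\<close>.\<close>

definition ERRT :: real where
  "ERRT = 28080006 * (T ^ 64 * MM ^ 5 * B0) + 252 * ((real H)\<^sup>2 / T ^ 128)"

lemma X_powr: "real X powr (real k / 3200) = T ^ k"
proof -
  have "real X = T powr 3200" unfolding TX[symmetric] using T1 by simp
  hence "real X powr (real k / 3200) = T powr real k" by (simp add: powr_powr)
  thus ?thesis using T1 by (simp add: powr_realpow)
qed

lemma sqrt_gsig_le: "sqrt (gsig m) \<le> 2 ^ 20 * T ^ 100"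
proof (rule real_le_lsqrt)
  have "gsig m \<le> 2 ^ 40 * real m powr (1/32)" by (rule gsig_le[OF m0])
  also have "real m powr (1/32) \<le> (real X ^ 2) powr (1/32)"
    using of_nat_mono[OF mX2, where 'a = real] by (intro powr_mono2) auto
  also have "(real X ^ 2) powr (1/32) = real X powr (real 200 / 3200)"
  proof -
    have "real X ^ 2 = real X powr 2" using X_pos by simp
    thus ?thesis by (simp only: powr_powr) simp
  qed
  also have "\<dots> = T ^ 200" by (rule X_powr)
  finally have "gsig m \<le> 2 ^ 40 * T ^ 200" by simp
  also have "\<dots> = (2 ^ 20 * T ^ 100)\<^sup>2" by (simp add: power_mult_distrib flip: power_mult)
  finally show "gsig m \<le> (2 ^ 20 * T ^ 100)\<^sup>2" .
qed (use T1 in auto)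

lemma L5: "L ^ 5 \<le> T ^ 180"
proof -
  have "L ^ 5 \<le> (T ^ 36) ^ 5" using L_bounds by (intro power_mono) auto
  also have "\<dots> = T ^ 180" by (simp flip: power_mult)
  finally show ?thesis .
qed

lemma gsig_L_le: "sqrt (gsig m) * L ^ 5 \<le> 2 ^ 20 * T ^ 280"
proof -
  have "sqrt (gsig m) * L ^ 5 \<le> (2 ^ 20 * T ^ 100) * T ^ 180"
    using L_bounds T1 by (intro mult_mono sqrt_gsig_le L5) auto
  also have "\<dots> = 2 ^ 20 * T ^ 280" by (simp flip: power_add)
  finally show ?thesis .
qed

lemma main_error_le: "sqrt (gsig m) * L ^ 5 * real X powr (7/4) \<le> B0"
proof -
  have e: "real X powr (7/4) = T ^ 5600" using X_powr[of 5600] by simp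
  have "sqrt (gsig m) * L ^ 5 * real X powr (7/4) \<le> 2 ^ 20 * T ^ 280 * T ^ 5600"
    unfolding e using gsig_L_le T_pos[of 5600] by (intro mult_right_mono) auto
  also have "\<dots> = B0" by (simp add: B0_def flip: power_add)
  finally show ?thesis .
qed

text \<open>The divisors left over lie in the short interval above \<open>Q\<close>, where densities
  are at most \<open>tau3 q * 2 / X\<close>. Length \<open>T^3000\<close> and two logarithms
  \<open>T^72\<close> against \<open>X = T^3200\<close> give the saving \<open>T^128\<close>. The
  constant is \<open>2 * 3 * 21\<close>.\<close>

lemma Tsum_le: "Tsum \<le> 126 * ((real H)\<^sup>2 / T ^ 128) + 3 * B0"
proof -
  have XQn: "Q \<le> X" by (rule QX)
  have "(\<Sum>q\<in>{q\<in>{Q<..X}. odd q}. zdens (int m) q) \<le> (\<Sum>q\<in>{q\<in>{Q<..X}. odd q}. real (tau3 q) * (2 / real X))"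
  proof (rule sum_mono)
    fix q assume q: "q \<in> {q\<in>{Q<..X}. odd q}"
    have "zdens (int m) q \<le> real (tau3 q) / real q" using q by (intro zdens_le) auto
    also have "\<dots> = real (tau3 q) * (1 / real q)" by simp
    also have "\<dots> \<le> real (tau3 q) * (1 / real Q)" using q Q_ge_1 by (intro mult_left_mono divide_left_mono) auto
    also have "1 / real Q \<le> 2 / real X" using X_le_2Q X_pos Q_ge_1 by (simp add: field_simps)
    finally show "zdens (int m) q \<le> real (tau3 q) * (2 / real X)" by (simp add: mult_left_mono)
  qed
  also have "\<dots> \<le> (\<Sum>q\<in>{Q<..X}. real (tau3 q) * (2 / real X))" by (intro sum_mono2) auto
  also have "\<dots> = (2 / real X) * (\<Sum>q\<in>{Q<..X}. real (tau3 q))" by (simp only: sum_distrib_right[symmetric] mult.commute)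
  also have "\<dots> \<le> (2 / real X) * (3 * ((real X - real Q + T ^ 3000) * (hsum X)\<^sup>2))"
  proof (intro mult_left_mono sum_tau3_short_interval_le XQn)
    have "real X ^ 2 = T ^ 6400" unfolding TX[symmetric] by (simp flip: power_mult)
    also have "\<dots> \<le> T ^ 9000" by (rule T_mono) simp
    also have "\<dots> = (T ^ 3000) ^ 3" by (simp flip: power_mult)
    finally show "real X ^ 2 \<le> (T ^ 3000) ^ 3" .
  qed (use T1 in auto)
  also have "\<dots> \<le> (2 / real X) * (3 * ((21 * T ^ 3000) * (T ^ 36)\<^sup>2))"
    using X_minus_Q L_bounds hsum_nonneg[of X] XQn T1 by (intro mult_left_mono mult_mono power_mono) auto
  also have "\<dots> = 126 * (T ^ 3072 / T ^ 3200)" unfolding TX[symmetric] by (simp flip: power_mult power_add)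
  also have "T ^ 3072 / T ^ 3200 = 1 / T ^ 128"
  proof -
    have e: "T ^ 3200 = T ^ 3072 * T ^ 128" by (simp flip: power_add)
    have "T ^ 3072 \<noteq> 0" using T_pos[of 3072] by simp
    thus ?thesis unfolding e by (rule nonzero_divide_mult_cancel_left)
  qed
  finally have 1: "(\<Sum>q\<in>{q\<in>{Q<..X}. odd q}. zdens (int m) q) \<le> 126 * (1 / T ^ 128)" .
  have "2 * real H + real X \<le> 3 * T ^ 3200"
    using H_bounds(1) T_mono[of 3100 3200] unfolding TX[symmetric] by simp
  hence "sqrt (gsig m) * L ^ 5 * (2 * real H + real X) * real X powr (3/4) \<le> (2 ^ 20 * T ^ 280) * (3 * T ^ 3200) * T ^ 2400"
    using X_powr[of 2400] T1 L_bounds by (intro mult_mono gsig_L_le) auto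
  also have "\<dots> = 3 * B0" by (simp add: B0_def flip: power_add)
  finally have 2: "sqrt (gsig m) * L ^ 5 * (2 * real H + real X) * real X powr (3/4) \<le> 3 * B0" .
  have "(real H)\<^sup>2 * (\<Sum>q\<in>{q\<in>{Q<..X}. odd q}. zdens (int m) q) \<le> (real H)\<^sup>2 * (126 * (1 / T ^ 128))"
    by (intro mult_left_mono 1) simp
  also have "\<dots> = 126 * ((real H)\<^sup>2 / T ^ 128)" by simp
  finally show ?thesis using Tsum_bound 2 by linarith
qed

lemma MM: "MM \<ge> 1" "2 ^ 55 * MM ^ 7 \<le> T ^ 224" "2 ^ 15 * MM ^ 2 \<le> T ^ 96"
proof -
  have R: "T ^ 16 \<ge> 19" by (rule R19)
  show "MM \<ge> 1" using R by (simp add: MM_def)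
  show "2 ^ 55 * MM ^ 7 \<le> T ^ 224"
  proof (cases "T ^ 16 \<le> 1000")
    case True
    have "(2 :: real) ^ 55 \<le> T ^ 224" by (rule pow2_le_T) simp
    thus ?thesis using True by (simp add: MM_def)
  next
    case False
    have "(2 :: real) ^ 55 \<le> 1000 ^ 7" by simp
    also have "\<dots> \<le> (T ^ 16) ^ 7" using False by (intro power_mono) auto
    finally have "2 ^ 55 * (T ^ 16) ^ 7 \<le> (T ^ 16) ^ 7 * (T ^ 16) ^ 7" using T1 by (intro mult_right_mono) auto
    also have "\<dots> = T ^ 224" by (simp flip: power_mult power_add)
    finally show ?thesis using False by (simp add: MM_def)
  qed
  show "2 ^ 15 * MM ^ 2 \<le> T ^ 96"
  proof (cases "T ^ 16 \<le> 1000")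
    case True
    have "(2 :: real) ^ 15 \<le> T ^ 96" by (rule pow2_le_T) simp
    thus ?thesis using True by (simp add: MM_def)
  next
    case False
    have "(2 :: real) ^ 15 \<le> 1000 ^ 4" by simp
    also have "\<dots> \<le> (T ^ 16) ^ 4" using False by (intro power_mono) auto
    finally have "2 ^ 15 * (T ^ 16) ^ 2 \<le> (T ^ 16) ^ 4 * (T ^ 16) ^ 2" using T1 by (intro mult_right_mono) auto
    also have "\<dots> = T ^ 96" by (simp flip: power_mult power_add)
    finally show ?thesis using False by (simp add: MM_def)
  qed
qed

lemma B0_pos: "B0 > 0" using T1 by (simp add: B0_def)

lemma error_le:
  assumes "(real D)\<^sup>2 * (2 ^ n * ps) \<le> 1170000 * (T ^ 64 * MM ^ 5)" "ps \<ge> 0"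
  shows "24 * (real D)\<^sup>2 * 2 ^ n * sqrt (gsig m) * L ^ 5 * real X powr (7/4) * ps + 2 * Tsum \<le> ERRT"
proof -
  have "24 * (real D)\<^sup>2 * 2 ^ n * sqrt (gsig m) * L ^ 5 * real X powr (7/4) * ps =
      24 * ((real D)\<^sup>2 * (2 ^ n * ps)) * (sqrt (gsig m) * L ^ 5 * real X powr (7/4))" by (simp only: mult_ac)
  also have "\<dots> \<le> 24 * (1170000 * (T ^ 64 * MM ^ 5)) * B0"
  proof (rule mult_mono[OF _ main_error_le])
    show "24 * ((real D)\<^sup>2 * (2 ^ n * ps)) \<le> 24 * (1170000 * (T ^ 64 * MM ^ 5))"
      using assms(1) by (rule mult_left_mono) simp
  qed (use L_bounds gsig_ge_1[OF m0] MM(1) T1 in auto)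
  finally have 1: "24 * (real D)\<^sup>2 * 2 ^ n * sqrt (gsig m) * L ^ 5 * real X powr (7/4) * ps \<le> 28080000 * (T ^ 64 * MM ^ 5 * B0)"
    by simp
  have "1 * 1 \<le> T ^ 64 * MM ^ 5" using MM(1) T1 by (intro mult_mono one_le_power) auto
  hence "1 * B0 \<le> T ^ 64 * MM ^ 5 * B0" using B0_pos by (intro mult_right_mono) auto
  thus ?thesis using 1 Tsum_le unfolding ERRT_def by linarith
qed

lemma sifting_primes_empty:
  assumes "T ^ 16 \<le> 1000"
  shows "{p. prime p \<and> 1000 \<le> p \<and> real p < T ^ 16} = {}"
proof -
  have "\<not> real p < T ^ 16" if "1000 \<le> p" for p :: nat
    using of_nat_mono[OF that, where 'a = real] assms by simp
  thus ?thesis by blast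
qed

lemma finite_sifting_primes: "finite {p. prime p \<and> 1000 \<le> p \<and> real p < T ^ 16}"
  by (rule finite_subset[OF _ finite_nat_less_real[of "T ^ 16"]]) auto

lemma small_sets_bounds:
  assumes A: "A \<in> sifting_sets (T ^ 16)"
  shows "real (\<Prod>A) \<le> MM" "finite A" "\<And>q. q \<in> A \<Longrightarrow> prime q \<and> 1000 \<le> q"
proof -
  have sub: "A \<subseteq> {p. prime p \<and> 1000 \<le> p \<and> real p < T ^ 16}" "real (\<Prod>A) < T ^ 16"
    using A by (auto simp: small_sets_def)
  show "finite A" using sub(1) finite_sifting_primes by (rule finite_subset)
  show "prime q \<and> 1000 \<le> q" if "q \<in> A" for q using sub that by auto
  show "real (\<Prod>A) \<le> MM"
  proof (cases "T ^ 16 \<le> 1000")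
    case True
    hence "A = {}" using sub(1) sifting_primes_empty by blast
    thus ?thesis using MM(1) by simp
  next
    case False
    thus ?thesis using sub(2) by (simp add: MM_def)
  qed
qed

lemma card_small_sets_MM: "real (card (sifting_sets (T ^ 16))) \<le> MM"
proof (cases "T ^ 16 \<le> 1000")
  case True
  hence "sifting_sets (T ^ 16) \<subseteq> {{}}" unfolding sifting_primes_empty[OF True] by (auto simp: small_sets_def)
  hence "card (sifting_sets (T ^ 16)) \<le> card {{} :: nat set}" by (intro card_mono) auto
  thus ?thesis using MM(1) by simp
next
  case False
  have "real (card (sifting_sets (T ^ 16))) \<le> T ^ 16"
    using T1 finite_sifting_primes by (intro card_small_sets_le) auto
  thus ?thesis using False by (simp add: MM_def)
qed

lemma X2Q: "X \<le> 2 * Q"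
proof -
  have "real X \<le> real (2 * Q)" using X_le_2Q by simp
  thus ?thesis by (simp only: of_nat_le_iff)
qed

lemma Q_less: "Q < 2 ^ (X + 9)"
proof -
  have "Q \<le> X" by (rule QX)
  also have "X < 2 ^ X" by (rule less_exp)
  also have "(2 :: nat) ^ X \<le> 2 ^ (X + 9)" by (intro power_increasing) auto
  finally show ?thesis .
qed

text \<open>The period is at most \<open>300 * R^2 * MM^2\<close>. By \<open>psi_le\<close> each
  sifted prime \<open>q\<close> costs at most \<open>sqrt q\<close>, so all of them cost at most
  \<open>MM\<close>, and the extra prime \<open>p\<close> costs 13; hence
  \<open>300^2 * 13 = 1170000\<close>.\<close>

lemma equid_T:
  assumes A: "A \<in> sifting_sets (T ^ 16)"
    and B: "B \<in> sifting_sets (T ^ 16)"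
    and p: "prime p" "odd p" "p \<notin> A \<union> B" and k: "k \<le> X + 9" "real (p ^ k) \<le> 300 * (T ^ 16) ^ 2"
    and F: "per2 (p ^ k * \<Prod>(A \<union> B)) F" "\<And>i j. \<bar>F i j\<bar> \<le> 1"
  shows "equi_error (insert p (A \<union> B)) (X + 9) F \<le> ERRT"
proof -
  define S where "S = insert p (A \<union> B)"
  define D where "D = p ^ k * \<Prod>(A \<union> B)"
  have p3: "p \<ge> 3" using p(1,2) prime_ge_2_nat[of p] by (cases "p = 2") auto
  have fin: "finite (A \<union> B)" "finite A" "finite B" using A B small_sets_bounds(2) by auto
  have AB: "prime q \<and> 1000 \<le> q" if "q \<in> A \<union> B" for q using that A B small_sets_bounds(3) by blast
  have S: "finite S" "\<And>q. q \<in> S \<Longrightarrow> prime q" using fin p(1) AB by (auto simp: S_def)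
  have Sodd: "odd q" if "q \<in> S" for q using that p(2) AB[of q] primes_dvd_imp_eq[of 2 q] by (auto simp: S_def)
  have posAB: "\<Prod>(A \<union> B) > 0" using AB by (intro prod_primes_pos) blast
  have D0: "D > 0" using p3 posAB by (simp add: D_def)
  have prodS: "\<Prod>S = p * \<Prod>(A \<union> B)" unfolding S_def using fin(1) p(3) by (rule prod.insert)
  have Ddvd: "D dvd (\<Prod>S) ^ (X + 9)"
    unfolding D_def prodS power_mult_distrib using k(1) by (intro mult_dvd_mono le_imp_power_dvd dvd_power) auto
  have prodAB: "real (\<Prod>(A \<union> B)) \<le> MM ^ 2"
  proof -
    have "\<Prod>(A \<union> B) * \<Prod>(A \<inter> B) = \<Prod>A * \<Prod>B" using fin by (intro prod.union_inter)
    moreover have "\<Prod>(A \<inter> B) \<ge> 1"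
    proof (rule prod_ge_1)
      fix q assume "q \<in> A \<inter> B"
      thus "1 \<le> q" using AB[of q] by auto
    qed
    hence "\<Prod>(A \<union> B) * 1 \<le> \<Prod>(A \<union> B) * \<Prod>(A \<inter> B)" by (rule mult_left_mono) simp
    ultimately have "\<Prod>(A \<union> B) \<le> \<Prod>A * \<Prod>B" by simp
    hence "real (\<Prod>(A \<union> B)) \<le> real (\<Prod>A * \<Prod>B)" by (rule of_nat_mono)
    also have "\<dots> \<le> MM * MM" unfolding of_nat_mult
      by (intro mult_mono small_sets_bounds(1) A B) (use MM(1) in \<open>simp_all del: of_nat_prod\<close>)
    finally show ?thesis by (simp add: power2_eq_square)
  qed
  have "real D \<le> (300 * (T ^ 16) ^ 2) * MM ^ 2"
    unfolding D_def of_nat_mult[of "p ^ k"]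
    by (intro mult_mono k(2) prodAB) (use T1 in \<open>simp_all del: of_nat_prod\<close>)
  hence "(real D)\<^sup>2 \<le> ((300 * (T ^ 16) ^ 2) * MM ^ 2)\<^sup>2" by (intro power_mono) auto
  also have "\<dots> = 90000 * (T ^ 64 * MM ^ 4)" by (simp add: power_mult_distrib flip: power_mult)
  finally have D2: "(real D)\<^sup>2 \<le> 90000 * (T ^ 64 * MM ^ 4)" .
  have "2 ^ card S * psi (\<Prod>S) (X + 9) \<le> (\<Prod>q\<in>S. psi_factor q)" by (rule psi_le[OF S])
  also have "\<dots> = psi_factor p * (\<Prod>q\<in>A \<union> B. psi_factor q)" unfolding S_def using fin(1) p(3) by (rule prod.insert)
  also have "\<dots> \<le> 13 * (\<Prod>q\<in>A \<union> B. sqrt (real q))"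
  proof (intro mult_mono psi_factor_le_13 p3 prod_mono conjI)
    fix q assume "q \<in> A \<union> B"
    hence q: "q \<ge> 1000" using AB by blast
    show "0 \<le> psi_factor q" using q by (intro psi_factor_nonneg) simp
    show "psi_factor q \<le> sqrt (real q)" by (rule psi_factor_le_sqrt[OF q])
  next
    show "0 \<le> (\<Prod>q\<in>A \<union> B. psi_factor q)"
    proof (rule prod_nonneg)
      fix q assume "q \<in> A \<union> B"
      hence "q \<ge> 1000" using AB by blast
      thus "0 \<le> psi_factor q" by (intro psi_factor_nonneg) simp
    qed
  qed simp
  also have "(\<Prod>q\<in>A \<union> B. sqrt (real q)) = sqrt (real (\<Prod>(A \<union> B)))" by (rule sqrt_prod_nat[OF fin(1)])
  also have "\<dots> \<le> MM" using prodAB MM(1) by (intro real_le_lsqrt) auto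
  finally have ps: "2 ^ card S * psi (\<Prod>S) (X + 9) \<le> 13 * MM" by simp
  have "(real D)\<^sup>2 * (2 ^ card S * psi (\<Prod>S) (X + 9)) \<le> (90000 * (T ^ 64 * MM ^ 4)) * (13 * MM)"
    using psi_nonneg[of "\<Prod>S" "X + 9"] MM(1) T1 by (intro mult_mono D2 ps) auto
  also have "\<dots> = 1170000 * (T ^ 64 * MM ^ 5)" by (simp add: eval_nat_numeral)
  finally have key: "(real D)\<^sup>2 * (2 ^ card S * psi (\<Prod>S) (X + 9)) \<le> 1170000 * (T ^ 64 * MM ^ 5)" .
  have "equi_error S (X + 9) F \<le>
    24 * (real D)\<^sup>2 * 2 ^ card S * sqrt (gsig m) * L ^ 5 * real X powr (7/4) * psi (\<Prod>S) (X + 9) + 2 * Tsum"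
    by (rule equidistribution[OF S Sodd F(1)[folded D_def] F(2) D0 Ddvd Q_less X2Q])
  also have "\<dots> \<le> ERRT" by (rule error_le[OF key psi_nonneg])
  finally show ?thesis unfolding S_def .
qed

text \<open>With the empty set of primes \<open>EF\<close> is 1, so the total weight is
  \<open>2 * H^2\<close> times the full singular series, which is at least 5/12.\<close>

lemma SF_1_ge: "SF box1 \<ge> 5 / 6 * (real H)\<^sup>2 - ERRT"
proof -
  have psi1: "psi 1 J = 1" for J by (simp add: psi_def tau3_def)
  have EF1: "EF 1 J box1 = 1" for J by (simp add: EF_def mean2_def chi4_def)
  have "equi_error {} (X + 9) (\<lambda>_ _. 1) \<le>
    24 * (real 1)\<^sup>2 * 2 ^ card ({} :: nat set) * sqrt (gsig m) * L ^ 5 * real X powr (7/4) * psi (\<Prod>{}) (X + 9) + 2 * Tsum"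
    by (rule equidistribution[OF _ _ _ per2_const _ _ _ Q_less X2Q]) auto
  also have "\<dots> \<le> ERRT"
  proof (rule error_le)
    have "1 * 1 \<le> T ^ 64 * MM ^ 5" using MM(1) T1 by (intro mult_mono one_le_power) auto
    thus "(real 1)\<^sup>2 * (2 ^ card ({} :: nat set) * psi (\<Prod>{}) (X + 9)) \<le> 1170000 * (T ^ 64 * MM ^ 5)" using psi1[of "X + 9"] by simp
  qed (rule psi_nonneg)
  finally have "\<bar>SF box1 - 2 * (real H)\<^sup>2 * zs m 1 Q\<bar> \<le> ERRT" using EF1[of "X + 9"] by simp
  moreover have "2 * (real H)\<^sup>2 * (5/12) \<le> 2 * (real H)\<^sup>2 * zs m 1 Q"
    using Q_ge_1 by (intro mult_left_mono zs_1_lower) auto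
  ultimately show ?thesis by linarith
qed

text \<open>The form needed in \<open>sieve_condition\<close>: \<open>637 = 620 + 17\<close>, and 14
  is below \<open>17 * 5/6\<close>.\<close>

lemma ERRT_small: "637 * (T ^ 32 * MM ^ 2) * ERRT < 14 * (real H)\<^sup>2"
proof -
  have H2: "T ^ 6200 \<le> 4 * (real H)\<^sup>2"
  proof -
    have "(T ^ 3100)\<^sup>2 \<le> (2 * real H)\<^sup>2" using H_bounds(2) T1 by (intro power_mono) auto
    thus ?thesis by (simp add: power_mult_distrib flip: power_mult)
  qed
  have Hpos: "(real H)\<^sup>2 > 0" using H_bounds(3) by simp
  have "637 * (T ^ 32 * MM ^ 2) * (28080006 * (T ^ 64 * MM ^ 5 * B0)) = (637 * 28080006) * (2 ^ 20 * MM ^ 7 * T ^ 5976)"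
  proof -
    have e: "MM ^ 2 * MM ^ 5 = MM ^ 7" "T ^ 32 * (T ^ 64 * T ^ 5880) = T ^ 5976" by (simp_all flip: power_add)
    have "637 * (T ^ 32 * MM ^ 2) * (28080006 * (T ^ 64 * MM ^ 5 * B0)) =
        (637 * 28080006) * (2 ^ 20 * (MM ^ 2 * MM ^ 5) * (T ^ 32 * (T ^ 64 * T ^ 5880)))"
      unfolding B0_def by (simp only: mult_ac)
    thus ?thesis unfolding e .
  qed
  \<comment> \<open>With the \<open>2^20\<close> already present the constants amount to
    \<open>2^55\<close>. The exponent 5976 falls short of that of \<open>H^2\<close> by 224, exactly
    what \<open>MM(2)\<close> allows for them together with \<open>MM^7\<close>.\<close>
  also have "\<dots> \<le> 2 ^ 35 * (2 ^ 20 * MM ^ 7 * T ^ 5976)"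
    using MM(1) T1 by (intro mult_right_mono) auto
  also have "\<dots> = (2 ^ 55 * MM ^ 7) * T ^ 5976" by simp
  also have "\<dots> \<le> T ^ 224 * T ^ 5976" using T1 by (intro mult_right_mono MM(2)) auto
  also have "\<dots> = T ^ 6200" by (simp flip: power_add)
  also have "\<dots> \<le> 4 * (real H)\<^sup>2" by (rule H2)
  finally have 1: "637 * (T ^ 32 * MM ^ 2) * (28080006 * (T ^ 64 * MM ^ 5 * B0)) \<le> 4 * (real H)\<^sup>2" .
  have "(2 ^ 15 * MM ^ 2) * T ^ 32 \<le> T ^ 96 * T ^ 32" using T1 by (intro mult_right_mono MM(3)) auto
  hence "MM ^ 2 * T ^ 32 \<le> T ^ 128 / 2 ^ 15" by (simp flip: power_add)
  hence "(MM ^ 2 * T ^ 32) / T ^ 128 \<le> (T ^ 128 / 2 ^ 15) / T ^ 128" using T_pos[of 128] by (intro divide_right_mono) auto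
  hence "(MM ^ 2 * T ^ 32) / T ^ 128 \<le> 1 / 2 ^ 15" using T_pos[of 128] by simp
  hence "(637 * 252) * (real H)\<^sup>2 * ((MM ^ 2 * T ^ 32) / T ^ 128) \<le> (637 * 252) * (real H)\<^sup>2 * (1 / 2 ^ 15)"
    by (intro mult_left_mono) auto
  also have "\<dots> \<le> 5 * (real H)\<^sup>2" by simp
  finally have 2: "637 * (T ^ 32 * MM ^ 2) * (252 * ((real H)\<^sup>2 / T ^ 128)) \<le> 5 * (real H)\<^sup>2"
    by (simp add: mult_ac)
  have "637 * (T ^ 32 * MM ^ 2) * ERRT \<le> 4 * (real H)\<^sup>2 + 5 * (real H)\<^sup>2"
    unfolding ERRT_def distrib_left by (rule add_mono[OF 1 2])
  thus ?thesis using Hpos by linarith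
qed

end

text \<open>The exponent \<open>J = X + 9\<close> is far larger than any multiplicity in question;
  it enters no error bound. The 9 is there because \<open>300 \<le> 2^9\<close>.\<close>

sublocale large_params \<subseteq> sieve m al be H Q X L "T ^ 16" "X + 9" ERRT
proof unfold_locales
  show "19 \<le> T ^ 16" by (rule R19)
  have "T ^ 16 \<le> T ^ 3200" by (rule T_mono) simp
  hence "300 * T ^ 16 \<le> 512 * real X" using T_pos[of 3200] unfolding TX[symmetric] by linarith
  also have "real X < 2 ^ X" using of_nat_less_two_power[of X] by simp
  also have "512 * (2 :: real) ^ X = 2 ^ (X + 9)" by (simp add: power_add)
  finally show "300 * T ^ 16 < 2 ^ (X + 9)" by simp
  fix A B p k F
  assume "A \<in> sifting_sets (T ^ 16)"
    "B \<in> sifting_sets (T ^ 16)"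
    "prime p" "odd p" "real p < T ^ 16" "p \<notin> A \<union> B" "k \<le> X + 9" "real (p ^ k) \<le> 300 * (T ^ 16) ^ 2"
    "per2 (p ^ k * \<Prod>(A \<union> B)) F" and F: "\<And>i j. \<bar>F i j\<bar> \<le> 1"
  thus "equi_error (insert p (A \<union> B)) (X + 9) F \<le> ERRT"
    by (intro equid_T)
qed

section \<open>Conclusion\<close>

lemma ex_nat_sqrt: "\<exists>s :: nat. s ^ 2 \<le> n \<and> n < (s + 1) ^ 2"
proof (induction n)
  case (Suc n)
  then obtain s where s: "s ^ 2 \<le> n" "n < (s + 1) ^ 2" by blast
  show ?case
  proof (cases "Suc n = (s + 1) ^ 2")
    case True
    have "(s + 1) ^ 2 < (s + 1 + 1) ^ 2" by (intro power_strict_mono) auto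
    thus ?thesis using True by (intro exI[of _ "s + 1"]) simp
  next
    case False
    thus ?thesis using s by (intro exI[of _ s]) linarith
  qed
qed (auto intro: exI[of _ 0])

text \<open>Thue's argument: there are more than \<open>p\<close> pairs with entries up to the
  integer square root \<open>s\<close> of \<open>p\<close>, so two of them agree in
  \<open>x - z * y\<close> modulo \<open>p\<close>, where \<open>z\<close> is a square root of -1.
  The difference has \<open>x^2 + y^2\<close> divisible by \<open>p\<close>, positive and below
  \<open>2 * p\<close>, hence equal to \<open>p\<close>.\<close>

lemma prime_sum_two_squares:
  fixes p :: nat
  assumes p: "prime p" "p mod 4 \<noteq> 3"
  shows "\<exists>x y :: int. int p = x\<^sup>2 + y\<^sup>2"
proof (cases "p = 2")
  case True
  thus ?thesis by (intro exI[of _ 1]) simp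
next
  case False
  have odd: "odd p" using primes_dvd_imp_eq[of 2 p] p False by auto
  hence "p mod 4 = 1" using p(2) by presburger
  hence "QuadRes (int p) (- 1)" using QuadRes_minus_1_iff[OF p(1) odd] by simp
  then obtain z where z: "[z\<^sup>2 = - 1] (mod int p)" by (auto simp: QuadRes_def)
  have p0: "p > 0" using p(1) prime_gt_0_nat by blast
  obtain s where s: "s ^ 2 \<le> p" "p < (s + 1) ^ 2" using ex_nat_sqrt[of p] by blast
  have "s ^ 2 \<noteq> p" using p(1) prime_power_iff[of s 2] by auto
  hence sp: "s ^ 2 < p" using s by simp
  define f where "f x = (int (fst x) - z * int (snd x)) mod int p" for x :: "nat \<times> nat"
  have "\<not> inj_on f ({..s} \<times> {..s})"
  proof (rule pigeonhole)
    have "card (f ` ({..s} \<times> {..s})) \<le> card {0..<int p}"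
      using p0 by (intro card_mono) (auto simp: f_def)
    also have "\<dots> = p" by simp
    also have "p < card ({..s} \<times> {..s})" using s by (simp add: power2_eq_square)
    finally show "card (f ` ({..s} \<times> {..s})) < card ({..s} \<times> {..s})" .
  qed
  then obtain a1 b1 a2 b2 where ab: "a1 \<le> s" "b1 \<le> s" "a2 \<le> s" "b2 \<le> s" "(a1, b1) \<noteq> (a2, b2)" "f (a1, b1) = f (a2, b2)"
    by (auto simp: inj_on_def)
  define x where "x = int a1 - int a2"
  define y where "y = int b1 - int b2"
  have "[int a1 - z * int b1 = int a2 - z * int b2] (mod int p)" using ab(6) by (simp add: f_def cong_def)
  hence "int p dvd (int a1 - z * int b1) - (int a2 - z * int b2)" by (simp add: cong_iff_dvd_diff)
  hence "int p dvd x - z * y" by (simp add: x_def y_def algebra_simps)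
  hence d1: "int p dvd (x - z * y) * (x + z * y)" by (rule dvd_mult2)
  have "int p dvd z\<^sup>2 - (- 1)" using z by (simp add: cong_iff_dvd_diff)
  hence "int p dvd (z\<^sup>2 - (- 1)) * y\<^sup>2" by (rule dvd_mult2)
  hence "int p dvd (x - z * y) * (x + z * y) + (z\<^sup>2 - (- 1)) * y\<^sup>2" using d1 by (intro dvd_add)
  also have "(x - z * y) * (x + z * y) + (z\<^sup>2 - (- 1)) * y\<^sup>2 = x\<^sup>2 + y\<^sup>2"
    by (simp add: power2_eq_square algebra_simps)
  finally obtain k where k: "x\<^sup>2 + y\<^sup>2 = int p * k" by (auto elim: dvdE)
  have "x \<noteq> 0 \<or> y \<noteq> 0" using ab(5) by (auto simp: x_def y_def)
  hence "0 < x\<^sup>2 + y\<^sup>2" by (auto simp: sum_power2_gt_zero_iff)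
  moreover have "\<bar>x\<bar> \<le> int s" "\<bar>y\<bar> \<le> int s" using ab by (auto simp: x_def y_def)
  hence "x\<^sup>2 \<le> (int s)\<^sup>2" "y\<^sup>2 \<le> (int s)\<^sup>2" by (simp_all add: abs_le_square_iff[symmetric])
  moreover have "(int s)\<^sup>2 < int p" using sp by (metis of_nat_less_iff of_nat_power)
  ultimately have "0 < int p * k" "int p * k < int p * 2" unfolding k[symmetric] by linarith+
  hence "k = 1" using p0 by (simp add: zero_less_mult_iff)
  thus ?thesis using k by (intro exI[of _ x] exI[of _ y]) simp
qed

lemma two_squares_mult:
  fixes a b c d :: int
  shows "(a\<^sup>2 + b\<^sup>2) * (c\<^sup>2 + d\<^sup>2) = (a * c - b * d)\<^sup>2 + (a * d + b * c)\<^sup>2"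
  by (simp add: power2_eq_square algebra_simps)

text \<open>\<open>rr\<close> is multiplicative, and positivity forces even exponents at primes 3
  modulo 4. The other prime powers are sums of two squares, and such sums are closed under
  products.\<close>

lemma rr_pos_imp_two_squares:
  "n > 0 \<Longrightarrow> rr n > 0 \<Longrightarrow> \<exists>x y :: int. int n = x\<^sup>2 + y\<^sup>2"
proof (induction n rule: less_induct)
  case (less n)
  show ?case
  proof (cases "n = 1")
    case True
    thus ?thesis by (intro exI[of _ 1] exI[of _ 0]) simp
  next
    case False
    hence "n > 1" using less.prems by simp
    then obtain p k n' where n: "prime p" "k > 0" "n = p ^ k * n'" "coprime (p ^ k) n'" "n' > 0" "n' < n"
      by (rule prime_power_split)
    have pk: "p ^ k > 0" using prime_gt_0_nat[OF n(1)] by simp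
    have "rr n = rr (p ^ k) * rr n'" unfolding n(3) by (rule rr_mult_coprime[OF n(4) pk n(5)])
    moreover have "rr (p ^ k) \<ge> 0" "rr n' \<ge> 0" by (intro rr_nonneg pk n)+
    ultimately have pos: "rr (p ^ k) > 0" "rr n' > 0" using less.prems(2) by (auto simp: zero_less_mult_iff)
    obtain c d where cd: "int n' = c\<^sup>2 + d\<^sup>2" using less.IH[OF n(6,5) pos(2)] by blast
    have "\<exists>a b :: int. int (p ^ k) = a\<^sup>2 + b\<^sup>2"
    proof (cases "p mod 4 = 3")
      case True
      hence "even k" using rr_prime_power_cases(1)[OF n(1) True, of k] pos(1) by (auto split: if_splits)
      then obtain l where "k = 2 * l" by (auto elim: evenE)
      hence "int (p ^ k) = (int p ^ l)\<^sup>2 + 0\<^sup>2" by (simp add: power_mult mult.commute flip: power_mult)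
      thus ?thesis by blast
    next
      case False
      obtain u v where uv: "int p = u\<^sup>2 + v\<^sup>2" using prime_sum_two_squares[OF n(1) False] by blast
      show ?thesis
      proof (induction k)
        case 0
        show ?case by (intro exI[of _ 1] exI[of _ 0]) simp
      next
        case (Suc k)
        then obtain a b where "int (p ^ k) = a\<^sup>2 + b\<^sup>2" by blast
        hence "int (p ^ Suc k) = (u\<^sup>2 + v\<^sup>2) * (a\<^sup>2 + b\<^sup>2)" using uv by simp
        thus ?case unfolding two_squares_mult by blast
      qed
    qed
    then obtain a b where "int (p ^ k) = a\<^sup>2 + b\<^sup>2" by blast
    hence "int n = (a\<^sup>2 + b\<^sup>2) * (c\<^sup>2 + d\<^sup>2)" unfolding n(3) using cd by simp
    thus ?thesis unfolding two_squares_mult by blast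
  qed
qed

section \<open>Lagrange's four-square theorem\<close>

definition four_sq :: "int \<Rightarrow> bool" where
  "four_sq n \<longleftrightarrow> (\<exists>a b c d. n = a\<^sup>2 + b\<^sup>2 + c\<^sup>2 + d\<^sup>2)"

lemma four_sq_intro: "n = a\<^sup>2 + b\<^sup>2 + c\<^sup>2 + d\<^sup>2 \<Longrightarrow> four_sq n"
  unfolding four_sq_def by blast

lemma euler_four_squares:
  fixes a b c d A B C D :: int
  shows "(a\<^sup>2 + b\<^sup>2 + c\<^sup>2 + d\<^sup>2) * (A\<^sup>2 + B\<^sup>2 + C\<^sup>2 + D\<^sup>2) =
    (a * A + b * B + c * C + d * D)\<^sup>2 + (a * B - b * A + c * D - d * C)\<^sup>2 +
    (a * C - b * D - c * A + d * B)\<^sup>2 + (a * D + b * C - c * B - d * A)\<^sup>2"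
  by (simp add: power2_eq_square algebra_simps)

lemma four_sq_mult: "four_sq m \<Longrightarrow> four_sq n \<Longrightarrow> four_sq (m * n)"
  unfolding four_sq_def[of m] four_sq_def[of n] using four_sq_intro[OF euler_four_squares] by blast

text \<open>The four numbers can be grouped into two pairs of equal parity; half the sum and half
  the difference of each pair are the new coordinates.\<close>

lemma four_sq_half:
  fixes n :: int
  assumes "four_sq (2 * n)"
  shows "four_sq n"
proof -
  have pair: "four_sq n" if e: "2 * n = a\<^sup>2 + b\<^sup>2 + c\<^sup>2 + d\<^sup>2" "even (a + b)" "even (c + d)" for a b c d
  proof -
    obtain s where s1: "a + b = 2 * s" using e(2) by (rule evenE)
    obtain t where s2: "c + d = 2 * t" using e(3) by (rule evenE)
    note s = s1 s2
    have ab: "b = 2 * s - a" "d = 2 * t - c" using s by auto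
    have "n = s\<^sup>2 + (s - a)\<^sup>2 + t\<^sup>2 + (t - c)\<^sup>2"
      using e(1) unfolding ab by (simp add: power2_eq_square algebra_simps)
    thus ?thesis by (rule four_sq_intro)
  qed
  obtain a b c d where e: "2 * n = a\<^sup>2 + b\<^sup>2 + c\<^sup>2 + d\<^sup>2" using assms by (auto simp: four_sq_def)
  have "even (a\<^sup>2 + b\<^sup>2 + c\<^sup>2 + d\<^sup>2)" using e by (metis dvd_triv_left)
  hence ev: "even (a + b + c + d)" by simp
  consider "even (a + b)" | "even (a + c)" | "even (a + d)" using ev by auto
  thus ?thesis
  proof cases
    case 1
    thus ?thesis using ev e by (intro pair[of a b c d]) auto
  next
    case 2
    thus ?thesis using ev e by (intro pair[of a c b d]) auto
  next
    case 3
    thus ?thesis using ev e by (intro pair[of a d b c]) auto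
  qed
qed

lemma ex_small_residue:
  fixes a k :: int
  assumes "k > 0" "odd k"
  shows "\<exists>r. k dvd a - r \<and> 4 * r\<^sup>2 < k\<^sup>2"
proof -
  obtain h where h: "k = 2 * h + 1" using assms by (auto elim: oddE)
  define r where "r = (a + h) mod k - h"
  have "0 \<le> (a + h) mod k" "(a + h) mod k < k" using assms by auto
  hence "- k < 2 * r" "2 * r < k" unfolding r_def right_diff_distrib using h by linarith+
  hence "\<bar>2 * r\<bar> < k" by linarith
  hence "\<bar>2 * r\<bar>\<^sup>2 < k\<^sup>2" by (intro power_strict_mono) auto
  hence "(2 * r)\<^sup>2 < k\<^sup>2" by simp
  moreover have "k dvd (a + h) - (a + h) mod k" by (simp add: minus_mod_eq_mult_div)
  hence "k dvd a - r" by (simp add: r_def algebra_simps)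
  ultimately show ?thesis by (intro exI[of _ r]) (simp add: power_mult_distrib)
qed

text \<open>Euler's and Lagrange's descent on the multiplier \<open>k\<close>. An even multiplier is
  halved. For odd \<open>k\<close> the coordinates are reduced to residues of absolute value less
  than \<open>k / 2\<close>, which represent \<open>k * w\<close> with \<open>w < k\<close>; Euler's
  identity represents the product of both, all four terms are divisible by \<open>k\<close>, and
  \<open>w * p\<close> remains.\<close>

lemma four_sq_descent:
  fixes p :: int
  assumes p: "prime p"
  shows "0 < k \<Longrightarrow> int k < p \<Longrightarrow> four_sq (int k * p) \<Longrightarrow> four_sq p"
proof (induction k rule: less_induct)
  case (less k)
  consider "k = 1" | "even k" | "odd k" "k > 1" using less.prems(1) by fastforce
  thus ?case
  proof cases
    case 1
    thus ?thesis using less.prems by simp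
  next
    case 2
    then obtain l where l: "k = 2 * l" by (auto elim: evenE)
    have "four_sq (2 * (int l * p))" using less.prems(3) unfolding l by (simp add: mult.assoc)
    hence "four_sq (int l * p)" by (rule four_sq_half)
    moreover have "0 < l" "l < k" "int l < p" using less.prems(1,2) l by auto
    ultimately show ?thesis using less.IH by blast
  next
    case 3
    define K where "K = int k"
    have K: "K > 1" "odd K" "K < p" using 3 less.prems by (auto simp: K_def)
    obtain a b c d where e: "K * p = a\<^sup>2 + b\<^sup>2 + c\<^sup>2 + d\<^sup>2" using less.prems(3) by (auto simp: four_sq_def K_def)
    have "\<forall>x. \<exists>r. K dvd x - r \<and> 4 * r\<^sup>2 < K\<^sup>2" using K by (auto intro!: ex_small_residue)
    then obtain f where f: "\<And>x. K dvd x - f x" "\<And>x. 4 * (f x)\<^sup>2 < K\<^sup>2" by metis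
    define A where "A = f a"
    define B where "B = f b"
    define C where "C = f c"
    define D where "D = f d"
    obtain a' b' c' d' where r: "a = A + K * a'" "b = B + K * b'" "c = C + K * c'" "d = D + K * d'"
      using f(1)[of a] f(1)[of b] f(1)[of c] f(1)[of d] unfolding A_def B_def C_def D_def
      by (auto elim!: dvdE simp: algebra_simps)
    have sm: "4 * A\<^sup>2 < K\<^sup>2" "4 * B\<^sup>2 < K\<^sup>2" "4 * C\<^sup>2 < K\<^sup>2" "4 * D\<^sup>2 < K\<^sup>2"
      using f(2) by (simp_all add: A_def B_def C_def D_def)
    define w where "w = p - (2 * (A * a' + B * b' + C * c' + D * d') + K * (a'\<^sup>2 + b'\<^sup>2 + c'\<^sup>2 + d'\<^sup>2))"
    have w: "A\<^sup>2 + B\<^sup>2 + C\<^sup>2 + D\<^sup>2 = K * w"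
      using e unfolding r w_def by (simp add: power2_eq_square algebra_simps)
    have "K * w < K * K" using sm unfolding w[symmetric] by (simp add: power2_eq_square)
    hence wK: "w < K" using K by simp
    have "0 \<le> K * w" unfolding w[symmetric] by simp
    hence w0: "w \<ge> 0" using K by (simp add: zero_le_mult_iff)
    have "w \<noteq> 0"
    proof
      assume "w = 0"
      hence "A\<^sup>2 + B\<^sup>2 + C\<^sup>2 + D\<^sup>2 = 0" using w by simp
      hence z: "A\<^sup>2 = 0" "B\<^sup>2 = 0" "C\<^sup>2 = 0" "D\<^sup>2 = 0"
        using zero_le_power2[of A] zero_le_power2[of B] zero_le_power2[of C] zero_le_power2[of D] by linarith+
      hence "A = 0" "B = 0" "C = 0" "D = 0" by auto
      hence "K * p = K * (K * (a'\<^sup>2 + b'\<^sup>2 + c'\<^sup>2 + d'\<^sup>2))"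
        using e unfolding r by (simp add: power2_eq_square algebra_simps)
      hence "p = K * (a'\<^sup>2 + b'\<^sup>2 + c'\<^sup>2 + d'\<^sup>2)" using K by simp
      hence "K dvd p" by (metis dvd_triv_left)
      moreover have "K \<ge> 0" using K by simp
      ultimately have "K = 1 \<or> K = p" using p unfolding prime_int_iff by blast
      thus False using K by simp
    qed
    hence wpos: "w > 0" using w0 by simp
    have "K * K * (w * p) = (K * w) * (K * p)" by simp
    also have "\<dots> = (a\<^sup>2 + b\<^sup>2 + c\<^sup>2 + d\<^sup>2) * (A\<^sup>2 + B\<^sup>2 + C\<^sup>2 + D\<^sup>2)" by (simp only: w e mult.commute)
    also have "\<dots> = (a * A + b * B + c * C + d * D)\<^sup>2 + (a * B - b * A + c * D - d * C)\<^sup>2 +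
      (a * C - b * D - c * A + d * B)\<^sup>2 + (a * D + b * C - c * B - d * A)\<^sup>2" by (rule euler_four_squares)
    also have "a * A + b * B + c * C + d * D = K * (w + a' * A + b' * B + c' * C + d' * D)"
    proof -
      have "a * A + b * B + c * C + d * D = (A\<^sup>2 + B\<^sup>2 + C\<^sup>2 + D\<^sup>2) + K * (a' * A + b' * B + c' * C + d' * D)"
        unfolding r by (simp add: power2_eq_square algebra_simps)
      thus ?thesis unfolding w by (simp add: algebra_simps)
    qed
    also have "a * B - b * A + c * D - d * C = K * (a' * B - b' * A + c' * D - d' * C)"
      unfolding r by (simp add: algebra_simps)
    also have "a * C - b * D - c * A + d * B = K * (a' * C - b' * D - c' * A + d' * B)"
      unfolding r by (simp add: algebra_simps)
    also have "a * D + b * C - c * B - d * A = K * (a' * D + b' * C - c' * B - d' * A)"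
      unfolding r by (simp add: algebra_simps)
    finally have "K * K * (w * p) = K * K * ((w + a' * A + b' * B + c' * C + d' * D)\<^sup>2 + (a' * B - b' * A + c' * D - d' * C)\<^sup>2 +
      (a' * C - b' * D - c' * A + d' * B)\<^sup>2 + (a' * D + b' * C - c' * B - d' * A)\<^sup>2)"
      by (simp only: power_mult_distrib power2_eq_square[of K] distrib_left[of "K * K"])
    hence "w * p = (w + a' * A + b' * B + c' * C + d' * D)\<^sup>2 + (a' * B - b' * A + c' * D - d' * C)\<^sup>2 +
      (a' * C - b' * D - c' * A + d' * B)\<^sup>2 + (a' * D + b' * C - c' * B - d' * A)\<^sup>2"
      using K by simp
    hence "four_sq (w * p)" by (rule four_sq_intro)
    hence "four_sq (int (nat w) * p)" using wpos by simp
    moreover have "nat w < k" "0 < nat w" "int (nat w) < p" using wK wpos K by (auto simp: K_def)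
    ultimately show ?thesis using less.IH by blast
  qed
qed

text \<open>There are \<open>h + 1 = (p + 1) / 2\<close> squares and as many values
  \<open>- 1 - b^2\<close> modulo \<open>p\<close>, so the two sets meet. The representatives are
  below \<open>p / 2\<close>, so the multiplier is below \<open>p\<close>.\<close>

lemma ex_two_squares_plus_1:
  fixes p :: nat
  assumes p: "prime p" "odd p"
  shows "\<exists>k. 0 < k \<and> k < p \<and> four_sq (int k * int p)"
proof -
  have p3: "p \<ge> 3" using p prime_ge_2_nat[of p] by (cases "p = 2") auto
  obtain h where h: "p = 2 * h + 1" using p(2) by (auto elim: oddE)
  define f where "f a = (int a ^ 2) mod int p" for a :: nat
  define g where "g b = (- 1 - int b ^ 2) mod int p" for b :: nat
  have key: "a = b" if "a \<le> h" "b \<le> h" "int p dvd int a ^ 2 - int b ^ 2" for a b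
  proof -
    have "int p dvd (int a - int b) * (int a + int b)"
      using that(3) by (simp add: power2_eq_square algebra_simps)
    hence "int p dvd int a - int b \<or> int p dvd int a + int b"
      using p(1) by (simp add: prime_dvd_mult_iff)
    moreover have "\<bar>int a - int b\<bar> < int p" "\<bar>int a + int b\<bar> < int p" using that h by auto
    ultimately have "int a - int b = 0 \<or> int a + int b = 0"
      using zdvd_not_zless[of "\<bar>int a - int b\<bar>" "int p"] zdvd_not_zless[of "\<bar>int a + int b\<bar>" "int p"] by auto
    thus ?thesis by auto
  qed
  have "inj_on f {..h}"
  proof (rule inj_onI)
    fix a b assume "a \<in> {..h}" "b \<in> {..h}" "f a = f b"
    thus "a = b" by (intro key) (auto simp: f_def mod_eq_dvd_iff)
  qed
  hence cf: "card (f ` {..h}) = h + 1" by (simp add: card_image)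
  have "inj_on g {..h}"
  proof (rule inj_onI)
    fix a b assume ab: "a \<in> {..h}" "b \<in> {..h}" "g a = g b"
    hence "int p dvd (- 1 - int b ^ 2) - (- 1 - int a ^ 2)" unfolding g_def by (metis mod_eq_dvd_iff)
    thus "a = b" using ab by (intro key) auto
  qed
  hence cg: "card (g ` {..h}) = h + 1" by (simp add: card_image)
  have "f ` {..h} \<inter> g ` {..h} \<noteq> {}"
  proof
    assume "f ` {..h} \<inter> g ` {..h} = {}"
    hence "card (f ` {..h} \<union> g ` {..h}) = p + 1" using cf cg h by (subst card_Un_disjoint) auto
    moreover have "card (f ` {..h} \<union> g ` {..h}) \<le> card {0..<int p}"
      using p3 by (intro card_mono) (auto simp: f_def g_def)
    ultimately show False by simp
  qed
  then obtain a b where ab: "a \<le> h" "b \<le> h" "f a = g b" by auto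
  hence "int p dvd int a ^ 2 - (- 1 - int b ^ 2)" by (auto simp: f_def g_def mod_eq_dvd_iff)
  then obtain k where "int a ^ 2 - (- 1 - int b ^ 2) = int p * k" by (rule dvdE)
  hence k: "int a ^ 2 + int b ^ 2 + 1 = int p * k" by simp
  have "int a ^ 2 + int b ^ 2 + 1 > 0" by (simp add: add_nonneg_pos)
  hence k0: "k > 0" unfolding k using p3 by (simp add: zero_less_mult_iff)
  have "int a ^ 2 \<le> int h ^ 2" "int b ^ 2 \<le> int h ^ 2" using ab by (auto intro!: power_mono)
  moreover have "int h \<ge> 1" using p3 h by simp
  hence "2 * int h ^ 2 + 1 < int p * int p"
    unfolding h by (simp add: power2_eq_square algebra_simps add_pos_nonneg)
  ultimately have "int p * k < int p * int p" unfolding k[symmetric] by linarith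
  hence kp: "k < int p" using p3 by simp
  have "int (nat k) * int p = int a ^ 2 + int b ^ 2 + 1 ^ 2 + 0 ^ 2" using k k0 by (simp add: mult.commute)
  hence "four_sq (int (nat k) * int p)" by (rule four_sq_intro)
  thus ?thesis using k0 kp by (intro exI[of _ "nat k"]) auto
qed

theorem four_sq_nat: "four_sq (int n)"
proof (induction n rule: less_induct)
  case (less n)
  consider "n = 0" | "n = 1" | "n > 1" by linarith
  thus ?case
  proof cases
    case 1
    thus ?thesis by (intro four_sq_intro[of _ 0 0 0 0]) simp
  next
    case 2
    thus ?thesis by (intro four_sq_intro[of _ 1 0 0 0]) simp
  next
    case 3
    then obtain p where p: "prime p" "p dvd n" using prime_factor_nat[of n] by auto
    then obtain l where l: "n = p * l" by (auto elim: dvdE)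
    have "l > 0" using l 3 by (cases l) auto
    hence "l < n" using l prime_gt_1_nat[OF p(1)] by simp
    hence "four_sq (int l)" by (rule less.IH)
    moreover have "four_sq (int p)"
    proof (cases "p = 2")
      case True
      thus ?thesis by (intro four_sq_intro[of _ 1 1 0 0]) simp
    next
      case False
      hence "odd p" using primes_dvd_imp_eq[of 2 p] p by auto
      then obtain k where "0 < k" "k < p" "four_sq (int k * int p)" using ex_two_squares_plus_1[OF p(1)] by blast
      thus ?thesis using p(1) by (intro four_sq_descent[of "int p" k]) auto
    qed
    ultimately show ?thesis unfolding l by (simp add: four_sq_mult)
  qed
qed

text \<open>If 3 divides all four coordinates then \<open>n = 9 * l\<close>, and \<open>l\<close>
  has by induction a representation with \<open>v\<close> prime to 3. The matrix with rows
  \<open>(2, 1, -2)\<close>, \<open>(2, -2, 1)\<close>, \<open>(1, 2, 2)\<close> multiplies the norm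
  of \<open>(v, y, u)\<close> by 9. Its last coordinate is \<open>v + 2 * y + 2 * u\<close>;
  changing the signs of \<open>y\<close> and \<open>u\<close> makes it prime to 3 if it was
  not.\<close>

lemma four_squares_not_dvd_3:
  assumes "n > 0"
  shows "\<exists>x y u v :: int. int n = x\<^sup>2 + y\<^sup>2 + u\<^sup>2 + v\<^sup>2 \<and> \<not> 3 dvd v"
  using assms
proof (induction n rule: less_induct)
  case (less n)
  obtain a b c d where e: "int n = a\<^sup>2 + b\<^sup>2 + c\<^sup>2 + d\<^sup>2" using four_sq_nat[of n] by (auto simp: four_sq_def)
  show ?case
  proof (cases "3 dvd a \<and> 3 dvd b \<and> 3 dvd c \<and> 3 dvd d")
    case False
    have "int n = a\<^sup>2 + b\<^sup>2 + d\<^sup>2 + c\<^sup>2" "int n = a\<^sup>2 + c\<^sup>2 + d\<^sup>2 + b\<^sup>2" "int n = b\<^sup>2 + c\<^sup>2 + d\<^sup>2 + a\<^sup>2"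
      using e by simp_all
    thus ?thesis using False e by blast
  next
    case True
    then obtain a' b' c' d' where "a = 3 * a'" "b = 3 * b'" "c = 3 * c'" "d = 3 * d'" by (auto elim!: dvdE)
    hence "int n = 9 * (a'\<^sup>2 + b'\<^sup>2 + c'\<^sup>2 + d'\<^sup>2)" using e by (simp add: power_mult_distrib)
    hence "int 9 dvd int n" by simp
    hence "9 dvd n" by (simp only: int_dvd_int_iff)
    then obtain l where l: "n = 9 * l" by (rule dvdE)
    have "l > 0" "l < n" using l less.prems by auto
    then obtain x y u v where xy: "int l = x\<^sup>2 + y\<^sup>2 + u\<^sup>2 + v\<^sup>2" "\<not> 3 dvd v" using less.IH by blast
    have n1: "int n = (3 * x)\<^sup>2 + (2 * v + y' - 2 * u')\<^sup>2 + (2 * v - 2 * y' + u')\<^sup>2 + (v + 2 * y' + 2 * u')\<^sup>2"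
      if "y'\<^sup>2 + u'\<^sup>2 = y\<^sup>2 + u\<^sup>2" for y' u'
    proof -
      have "int n = 9 * (x\<^sup>2 + (y'\<^sup>2 + u'\<^sup>2) + v\<^sup>2)" unfolding that using l xy(1) by simp
      thus ?thesis by (simp add: power2_eq_square algebra_simps)
    qed
    show ?thesis
    proof (cases "3 dvd v + 2 * y + 2 * u")
      case False
      thus ?thesis using n1[of y u] by blast
    next
      case True
      have "\<not> 3 dvd v + 2 * (- y) + 2 * (- u)"
      proof
        assume "3 dvd v + 2 * (- y) + 2 * (- u)"
        hence "3 dvd (v + 2 * y + 2 * u) + (v + 2 * (- y) + 2 * (- u))" using True by (rule dvd_add[rotated])
        hence "3 dvd 2 * v" by (simp add: algebra_simps)
        thus False using xy(2) by presburger
      qed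
      moreover have "(- y)\<^sup>2 + (- u)\<^sup>2 = y\<^sup>2 + u\<^sup>2" by simp
      ultimately show ?thesis using n1[of "- y" "- u"] by blast
    qed
  qed
qed

section \<open>Counting prime factors and assembling the representations\<close>

lemma at_most_prime_factors_of_nat:
  assumes "z > 0" "size (prime_factorization z) \<le> n"
  shows "at_most_prime_factors n (int z)"
proof -
  have prod: "\<bar>int (\<Prod>\<^sub># M)\<bar> = \<Prod>\<^sub># (image_mset int M)" for M
    by (induction M) auto
  have "z = \<Prod>\<^sub># (prime_factorization z)" using assms(1) by (simp add: prod_mset_prime_factorization_nat)
  hence "\<bar>int z\<bar> = \<Prod>\<^sub># (image_mset int (prime_factorization z))" using prod[of "prime_factorization z"] by simp
  thus ?thesis unfolding at_most_prime_factors_def using assms(2)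
    by (intro exI[of _ "image_mset int (prime_factorization z)"]) (auto simp: in_prime_factors_imp_prime)
qed

lemma size_prime_factorization_eq:
  "size (prime_factorization z) = (\<Sum>p\<in>prime_factors z. multiplicity p z)" for z :: nat
  unfolding size_multiset_overloaded_eq
  by (intro sum.cong refl) (simp add: count_prime_factorization_prime in_prime_factors_imp_prime)

lemma size_prime_factorization_le_367:
  fixes z :: nat and R :: real
  assumes z: "z > 0" "odd z" and R: "R > 1" "real z < R ^ 200"
    and sm: "(\<Sum>p | prime p \<and> odd p \<and> real p < R. multiplicity p z) \<le> 168"
  shows "size (prime_factorization z) \<le> 367"
proof -
  define S where "S = prime_factors z"
  define S1 where "S1 = {p \<in> S. real p < R}"
  define S2 where "S2 = {p \<in> S. R \<le> real p}"
  have fin: "finite S" by (simp add: S_def)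
  have pr: "prime p" "p dvd z" if "p \<in> S" for p using that by (auto simp: S_def dest: in_prime_factors_imp_prime)
  have odd: "odd p" if "p \<in> S" for p using pr(2)[OF that] z(2) by (meson dvd_trans)
  have "(\<Sum>p\<in>S1. multiplicity p z) \<le> (\<Sum>p | prime p \<and> odd p \<and> real p < R. multiplicity p z)"
  proof (rule sum_mono2)
    show "finite {p. prime p \<and> odd p \<and> real p < R}"
      by (rule finite_subset[OF _ finite_nat_less_real[of R]]) auto
  qed (use pr odd in \<open>auto simp: S1_def\<close>)
  hence 1: "(\<Sum>p\<in>S1. multiplicity p z) \<le> 168" using sm by linarith
  have "R ^ (\<Sum>p\<in>S2. multiplicity p z) = (\<Prod>p\<in>S2. R ^ multiplicity p z)" by (rule power_sum)
  also have "\<dots> \<le> (\<Prod>p\<in>S2. real p ^ multiplicity p z)"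
    using R by (intro prod_mono conjI power_mono) (auto simp: S2_def)
  also have "\<dots> = real (\<Prod>p\<in>S2. p ^ multiplicity p z)" by simp
  also have "\<dots> \<le> real z"
  proof (intro of_nat_mono dvd_imp_le z)
    have "(\<Prod>p\<in>S2. p ^ multiplicity p z) dvd (\<Prod>p\<in>S. p ^ multiplicity p z)"
      using fin by (intro prod_dvd_prod_subset) (auto simp: S2_def)
    thus "(\<Prod>p\<in>S2. p ^ multiplicity p z) dvd z" unfolding S_def prime_factorization_nat[OF z(1), symmetric] .
  qed
  also have "\<dots> < R ^ 200" by (rule R(2))
  finally have 2: "(\<Sum>p\<in>S2. multiplicity p z) < 200" using R(1) by (simp add: power_strict_increasing_iff)
  have un: "S = S1 \<union> S2" by (auto simp: S1_def S2_def)
  have "(\<Sum>p\<in>S. multiplicity p z) = (\<Sum>p\<in>S1. multiplicity p z) + (\<Sum>p\<in>S2. multiplicity p z)"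
    unfolding un by (rule sum.union_disjoint) (use fin in \<open>auto simp: S1_def S2_def\<close>)
  thus ?thesis unfolding size_prime_factorization_eq S_def[symmetric] using 1 2 by linarith
qed

lemma odd_part_few_prime_factors:
  fixes u :: nat and R :: real
  assumes u: "u > 0" and R: "R > 1" "real u < R ^ 200"
    and sm: "(\<Sum>p | prime p \<and> odd p \<and> real p < R. multiplicity p u) \<le> 168"
  shows "\<exists>a z. u = 2 ^ a * z \<and> z > 0 \<and> size (prime_factorization z) \<le> 367"
proof -
  have "u \<noteq> 0" "\<not> is_unit (2 :: nat)" using u by auto
  then obtain z where z: "u = 2 ^ multiplicity 2 u * z" "\<not> 2 dvd z"
    by (rule multiplicity_decompose')
  define a where "a = multiplicity 2 u"
  have ua: "u = 2 ^ a * z" using z(1) by (simp add: a_def)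
  have z0: "z > 0" using z(2) by (cases z) auto
  have mult: "multiplicity p u = multiplicity p z" if p: "prime p" "odd p" for p
  proof -
    have "\<not> p dvd 2 ^ a"
    proof
      assume "p dvd 2 ^ a"
      hence "p dvd 2" using p(1) by (rule prime_dvd_power[rotated])
      hence "p = 2" using p(1) by (simp add: primes_dvd_imp_eq)
      thus False using p(2) by simp
    qed
    hence "multiplicity p (2 ^ a) = 0" by (rule not_dvd_imp_multiplicity_0)
    moreover have "multiplicity p (2 ^ a * z) = multiplicity p (2 ^ a) + multiplicity p z"
      using p(1) z0 by (intro prime_elem_multiplicity_mult_distrib) auto
    ultimately show ?thesis unfolding ua by simp
  qed
  have "z \<le> u" unfolding ua using z0 by simp
  hence "real z < R ^ 200" using R(2) by (meson of_nat_le_iff le_less_trans)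
  moreover have "(\<Sum>p | prime p \<and> odd p \<and> real p < R. multiplicity p z) \<le> 168"
  proof -
    have "(\<Sum>p | prime p \<and> odd p \<and> real p < R. multiplicity p z) = (\<Sum>p | prime p \<and> odd p \<and> real p < R. multiplicity p u)"
      by (intro sum.cong refl mult[symmetric]) auto
    thus ?thesis using sm by linarith
  qed
  ultimately have "size (prime_factorization z) \<le> 367"
    using z(2) z0 R(1) by (intro size_prime_factorization_le_367) auto
  thus ?thesis using ua z0 by blast
qed

context large_params begin

lemma sieve_condition: "(169 + T ^ 16 * (300 * T ^ 16 + 169)) * NE < 17 * S1"
proof -
  define R where "R = T ^ 16"
  have R: "R \<ge> 19" unfolding R_def by (rule R19)
  have "R * R \<ge> 19 * R" "R * R \<ge> 19 * 19" using R by (intro mult_right_mono mult_mono; simp)+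
  \<comment> \<open>The lower order terms are absorbed using \<open>R \<ge> 19\<close>.\<close>
  hence c: "169 + R * (300 * R + 169) \<le> 310 * R ^ 2" by (simp add: power2_eq_square algebra_simps)
  have M1: "MM \<ge> 1" by (rule MM)
  have "NE \<le> MM ^ 2 * (2 * ERRT)"
    unfolding NE_def PP_def using card_small_sets_MM ERR_nonneg by (intro mult_right_mono power_mono) auto
  hence "(169 + R * (300 * R + 169)) * NE \<le> (310 * R ^ 2) * (MM ^ 2 * (2 * ERRT))"
    using NE_nonneg R ERR_nonneg by (intro mult_mono c) auto
  also have "\<dots> = 620 * ((R ^ 2 * MM ^ 2) * ERRT)" by simp
  finally have 1: "(169 + R * (300 * R + 169)) * NE \<le> 620 * ((R ^ 2 * MM ^ 2) * ERRT)" .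
  have "1 * 1 \<le> R ^ 2 * MM ^ 2" using R M1 by (intro mult_mono one_le_power) auto
  hence "1 * ERRT \<le> (R ^ 2 * MM ^ 2) * ERRT" using ERR_nonneg by (intro mult_right_mono) auto
  moreover have "R ^ 2 = T ^ 32" by (simp add: R_def flip: power_mult)
  hence "637 * ((R ^ 2 * MM ^ 2) * ERRT) < 14 * (real H)\<^sup>2" using ERRT_small by simp
  moreover have "S1 \<ge> 5 / 6 * (real H)\<^sup>2 - ERRT" unfolding S1_def by (rule SF_1_ge)
  moreover have "(real H)\<^sup>2 \<ge> 0" by simp
  ultimately have "620 * ((R ^ 2 * MM ^ 2) * ERRT) < 17 * S1" by linarith
  thus ?thesis using 1 unfolding R_def by linarith
qed

theorem exists_representation:
  "\<exists>(x :: int) (y :: int) a c z1 z2. int m = x\<^sup>2 + y\<^sup>2 + (int (2 ^ a * z1))\<^sup>2 + (int (2 ^ c * z2))\<^sup>2 \<and>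
     z1 > 0 \<and> z2 > 0 \<and> size (prime_factorization z1) \<le> 367 \<and> size (prime_factorization z2) \<le> 367"
proof -
  obtain i j where ij: "i \<in> {1..H}" "j \<in> {1..H}" "rr (nat (nn (int i) (int j))) > 0"
    "(\<Sum>p\<in>OP. multiplicity p (2 * i + al)) \<le> 168" "(\<Sum>p\<in>OP. multiplicity p (2 * j + be)) \<le> 168"
    using sieve_exists[OF sieve_condition] by blast
  have nn0: "nn (int i) (int j) > 0" using nn_bounds(1)[OF ij(1,2)] by (meson le_less_trans of_nat_0_le_iff)
  then obtain x y where xy: "int (nat (nn (int i) (int j))) = x\<^sup>2 + y\<^sup>2"
    using rr_pos_imp_two_squares[OF _ ij(3)] by auto
  have R: "T ^ 16 > 1" using R19 by simp
  have small: "real u < (T ^ 16) ^ 200" if "u \<le> 2 * H + 1" for u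
  proof -
    have "real u \<le> real (2 * H + 1)" using that by (rule of_nat_mono)
    also have "\<dots> \<le> 3 * T ^ 3100" using H_bounds(1,3) of_nat_mono[OF H_bounds(3), where 'a = real] by simp
    also have "\<dots> < 4 * T ^ 3100" using T_pos[of 3100] by simp
    also have "(2 :: real) ^ 2 \<le> T ^ 100" by (rule pow2_le_T) simp
    hence "4 * T ^ 3100 \<le> T ^ 100 * T ^ 3100" using T_pos[of 3100] by (intro mult_right_mono) auto
    also have "\<dots> = (T ^ 16) ^ 200" by (simp flip: power_mult power_add)
    finally show ?thesis .
  qed
  have "\<exists>a z. 2 * i + al = 2 ^ a * z \<and> z > 0 \<and> size (prime_factorization z) \<le> 367"
    using ij al1 by (intro odd_part_few_prime_factors[OF _ R] small) (auto simp: OP_def)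
  then obtain a z1 where z1: "2 * i + al = 2 ^ a * z1" "z1 > 0" "size (prime_factorization z1) \<le> 367" by blast
  have "\<exists>a z. 2 * j + be = 2 ^ a * z \<and> z > 0 \<and> size (prime_factorization z) \<le> 367"
    using ij be1 by (intro odd_part_few_prime_factors[OF _ R] small) (auto simp: OP_def)
  then obtain c z2 where z2: "2 * j + be = 2 ^ c * z2" "z2 > 0" "size (prime_factorization z2) \<le> 367" by blast
  have "int m = nn (int i) (int j) + (int (2 * i + al))\<^sup>2 + (int (2 * j + be))\<^sup>2" by (simp add: nn_def)
  also have "nn (int i) (int j) = x\<^sup>2 + y\<^sup>2" using xy nn0 by simp
  finally have "int m = x\<^sup>2 + y\<^sup>2 + (int (2 ^ a * z1))\<^sup>2 + (int (2 ^ c * z2))\<^sup>2" unfolding z1(1) z2(1) .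
  thus ?thesis using z1 z2 by blast
qed

end

lemma representation_large:
  assumes m4: "m mod 4 \<noteq> 0" and m: "4 ^ 859 \<le> m"
  shows "\<exists>(x :: int) (y :: int) a c z1 z2. int m = x\<^sup>2 + y\<^sup>2 + (int (2 ^ a * z1))\<^sup>2 + (int (2 ^ c * z2))\<^sup>2 \<and>
     z1 > 0 \<and> z2 > 0 \<and> size (prime_factorization z1) \<le> 367 \<and> size (prime_factorization z2) \<le> 367"
proof -
  have m0: "m > 0" using m4 by (cases m) auto
  obtain s where s: "s ^ 2 \<le> m - 1" "m - 1 < (s + 1) ^ 2" using ex_nat_sqrt by blast
  define X where "X = s + 1"
  have X: "m \<le> X ^ 2" "(X - 1) ^ 2 < m" using s m0 unfolding X_def by simp_all
  have "((2 :: nat) ^ 859) ^ 2 = 4 ^ 859" by simp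
  hence "((2 :: nat) ^ 859) ^ 2 \<le> X ^ 2" using le_trans[OF m X(1)] by (simp only:)
  hence X859: "2 ^ 859 \<le> X" by (rule power2_le_imp_le) simp
  have X2: "2 \<le> X"
  proof -
    have "(2 :: nat) ^ 1 \<le> 2 ^ 859" by (rule power_increasing) auto
    thus ?thesis using le_trans[OF _ X859, of "2 ^ 1"] by simp
  qed
  define T where "T = root 3200 (real X)"
  have TX: "T ^ 3200 = real X" unfolding T_def by (intro real_root_pow_pos2) auto
  have T1: "T > 1" unfolding T_def using X2 by (subst real_root_gt_1_iff) auto
  define H where "H = nat \<lfloor>T ^ 3100\<rfloor>"
  interpret large_base H X "1 + ln (real X)" T
    by unfold_locales (use T1 TX X859 in \<open>auto simp: H_def\<close>)
  \<comment> \<open>18 is the constant of \<open>H_sq\<close>, and the further factor 4 makes up for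
    replacing \<open>X - 1\<close> by \<open>X / 2\<close>.\<close>
  have T200: "72 \<le> T ^ 200" using pow2_le_T[of 7 200] by simp
  have "18 * T ^ 6200 * 4 \<le> T ^ 200 * T ^ 6200" using mult_right_mono[OF T200, of "T ^ 6200"] T1 by simp
  also have "\<dots> = (real X) ^ 2" unfolding TX[symmetric] by (simp flip: power_mult power_add)
  also have "\<dots> \<le> (2 * real (X - 1)) ^ 2" using X2 by (intro power_mono) (auto simp: of_nat_diff)
  also have "\<dots> = 4 * real ((X - 1) ^ 2)" by (simp only: power_mult_distrib of_nat_power) simp
  also have "\<dots> < 4 * real m" using X(2) by (intro mult_strict_left_mono of_nat_less_iff[THEN iffD2]) auto
  finally have "2 * (2 * real H + 1) ^ 2 < real m" using H_sq by linarith
  hence "real (2 * (2 * H + 1) ^ 2) < real m" by (simp add: add.commute)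
  hence Hm: "2 * (2 * H + 1) ^ 2 < m" by (simp only: of_nat_less_iff)
  \<comment> \<open>\<open>Q + 1\<close> is the least \<open>k\<close> for which the lower bound on
    \<open>n\<close> fails; it is positive because the two sieved squares leave room in
    \<open>m\<close>.\<close>
  define P where "P k \<longleftrightarrow> m \<le> k ^ 2 + 2 * (2 * H + 1) ^ 2" for k
  have "\<not> P 0" using Hm by (simp add: P_def)
  moreover have "m * 1 \<le> m * m" using m0 by (intro mult_left_mono) auto
  hence "P m" unfolding P_def power2_eq_square by linarith
  ultimately obtain k where k: "\<forall>i<k. \<not> P i" "P k" using ex_least_nat_le[of P m] by blast
  have "k \<noteq> 0" using k(2) \<open>\<not> P 0\<close> by (cases k) auto
  then obtain Q where Q: "k = Q + 1" by (cases k) auto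
  have "\<not> P Q" using k(1) Q by simp
  hence Q1: "Q ^ 2 + 2 * (2 * H + 1) ^ 2 < m" unfolding P_def not_le .
  have Q2: "m \<le> (Q + 1) ^ 2 + 2 * (2 * H + 1) ^ 2" using k(2) Q by (simp add: P_def)
  \<comment> \<open>Among the residues 1, 2 and 3 of \<open>m\<close> modulo 4, the number of odd
    coordinates is one less than the residue.\<close>
  define al :: nat where "al = (if m mod 4 = 1 then 0 else 1)"
  define be :: nat where "be = (if m mod 4 = 3 then 1 else 0)"
  have "m mod 4 < 4" by simp
  hence "m mod 4 = 1 \<or> m mod 4 = 2 \<or> m mod 4 = 3" using m4 by linarith
  hence "m mod 4 = 1 + al + be" "al \<le> 1" "be \<le> 1" by (auto simp: al_def be_def)
  then interpret large_params H X "1 + ln (real X)" T m al be Q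
    using X Q1 Q2 by unfold_locales auto
  show ?thesis by (rule exists_representation)
qed

lemma prime_factors_ge_5_size_le:
  assumes z: "z > 0" "odd z" "\<not> 3 dvd z" "z < 2 ^ 859"
  shows "size (prime_factorization (z :: nat)) \<le> 369"
proof (rule ccontr)
  assume "\<not> ?thesis"
  hence "370 \<le> size (prime_factorization z)" by simp
  hence "(5 :: nat) ^ 370 \<le> 5 ^ size (prime_factorization z)" by (intro power_increasing) auto
  also have "\<dots> \<le> \<Prod>\<^sub># (prime_factorization z)"
  proof -
    have "(5 :: nat) ^ size M \<le> \<Prod>\<^sub># M" if "\<forall>p\<in>#M. 5 \<le> p" for M
      using that by (induction M) (auto intro: mult_le_mono)
    moreover have "5 \<le> p" if "p \<in># prime_factorization z" for p
    proof -
      have p: "prime p" "p dvd z" using that by (auto dest: in_prime_factors_imp_prime)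
      have "p \<noteq> 2" "p \<noteq> 3" "p \<noteq> 4" "p \<ge> 2" using p z prime_ge_2_nat[of p] by auto
      thus ?thesis by linarith
    qed
    ultimately show ?thesis by blast
  qed
  also have "\<dots> = z" using z(1) by (simp add: prod_mset_prime_factorization_nat)
  also have "z < 2 ^ 859" by (rule z(4))
  finally have "(5 :: nat) ^ 370 < 2 ^ 859" .
  thus False by simp
qed

lemma strip_2_3:
  fixes n :: nat
  assumes "n > 0"
  shows "\<exists>a b z. n = 2 ^ a * 3 ^ b * z \<and> z > 0 \<and> odd z \<and> \<not> 3 dvd z"
proof -
  have "n \<noteq> 0" "\<not> is_unit (2 :: nat)" using assms by auto
  then obtain y where y: "n = 2 ^ multiplicity 2 n * y" "\<not> 2 dvd y" by (rule multiplicity_decompose')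
  have "y \<noteq> 0" "\<not> is_unit (3 :: nat)" using y(2) by (auto intro: Nat.gr0I)
  then obtain z where z: "y = 3 ^ multiplicity 3 y * z" "\<not> 3 dvd z" by (rule multiplicity_decompose')
  have "n = 2 ^ multiplicity 2 n * 3 ^ multiplicity 3 y * z" using y(1) z(1) by (metis mult.assoc)
  moreover have "odd z" using y(2) z(1) by (metis dvd_mult)
  moreover have "z > 0" using z(2) by (cases z) auto
  ultimately show ?thesis using z(2) by blast
qed

text \<open>Factors 3 of \<open>u\<close> are taken up by the power of 3, but the other coefficient
  admits only 2 and 5, so \<open>v\<close> is chosen prime to 3. Factors 5 stay in both cofactors,
  whose primes are then at least 5; as they are at most \<open>sqrt m < 2^859\<close>,
  \<open>prime_factors_ge_5_size_le\<close> applies.\<close>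

lemma representation_small:
  assumes m: "m > 0" "m < 4 ^ 859"
  shows "\<exists>(x :: int) (y :: int) a b c (z1 :: nat) z2. int m = x\<^sup>2 + y\<^sup>2 + (2 ^ a * 3 ^ b * int z1)\<^sup>2 + (2 ^ c * int z2)\<^sup>2 \<and>
     (z1 = 0 \<or> size (prime_factorization z1) \<le> 369) \<and> z2 > 0 \<and> size (prime_factorization z2) \<le> 369"
proof -
  obtain x y u v where xy: "int m = x\<^sup>2 + y\<^sup>2 + u\<^sup>2 + v\<^sup>2" "\<not> 3 dvd v"
    using four_squares_not_dvd_3[OF m(1)] by blast
  have lt: "nat \<bar>w\<bar> < 2 ^ 859" if "w\<^sup>2 \<le> int m" for w
  proof -
    have "int (nat \<bar>w\<bar> ^ 2) \<le> int m" using that by simp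
    hence "nat \<bar>w\<bar> ^ 2 \<le> m" by (simp only: of_nat_le_iff)
    also have "m < 4 ^ 859" by (rule m(2))
    also have "(4 :: nat) ^ 859 = (2 ^ 859) ^ 2" by simp
    finally show ?thesis by (rule power2_less_imp_less) simp
  qed
  have sq: "u\<^sup>2 \<le> int m" "v\<^sup>2 \<le> int m" using xy(1) by simp_all
  have "\<exists>a b z1. u\<^sup>2 = (2 ^ a * 3 ^ b * int z1)\<^sup>2 \<and> (z1 = 0 \<or> size (prime_factorization z1) \<le> 369)"
  proof (cases "u = 0")
    case True
    thus ?thesis by (intro exI[of _ 0]) auto
  next
    case False
    then obtain a b z where z: "nat \<bar>u\<bar> = 2 ^ a * 3 ^ b * z" "z > 0" "odd z" "\<not> 3 dvd z"
      using strip_2_3[of "nat \<bar>u\<bar>"] by auto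
    have "z \<le> nat \<bar>u\<bar>" unfolding z(1) by simp
    hence "z < 2 ^ 859" using lt[OF sq(1)] by (rule le_less_trans)
    hence "size (prime_factorization z) \<le> 369" by (rule prime_factors_ge_5_size_le[OF z(2,3,4)])
    moreover have "\<bar>u\<bar> = 2 ^ a * 3 ^ b * int z" using arg_cong[OF z(1), of int] by simp
    hence "u\<^sup>2 = (2 ^ a * 3 ^ b * int z)\<^sup>2" by (metis power2_abs)
    ultimately show ?thesis by blast
  qed
  then obtain a b z1 where z1: "u\<^sup>2 = (2 ^ a * 3 ^ b * int z1)\<^sup>2" "z1 = 0 \<or> size (prime_factorization z1) \<le> 369" by blast
  have "v \<noteq> 0" using xy(2) by auto
  then obtain c d z2 where z2: "nat \<bar>v\<bar> = 2 ^ c * 3 ^ d * z2" "z2 > 0" "odd z2" "\<not> 3 dvd z2"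
    using strip_2_3[of "nat \<bar>v\<bar>"] by auto
  have v: "\<bar>v\<bar> = 2 ^ c * 3 ^ d * int z2" using arg_cong[OF z2(1), of int] by simp
  have "d = 0"
  proof (rule ccontr)
    assume "d \<noteq> 0"
    hence "3 dvd \<bar>v\<bar>" unfolding v by (intro dvd_mult2 dvd_mult dvd_power) auto
    thus False using xy(2) by simp
  qed
  hence "\<bar>v\<bar> = 2 ^ c * int z2" using v by simp
  hence v2: "v\<^sup>2 = (2 ^ c * int z2)\<^sup>2" by (metis power2_abs)
  have "z2 \<le> nat \<bar>v\<bar>" unfolding z2(1) by simp
  hence "z2 < 2 ^ 859" using lt[OF sq(2)] by (rule le_less_trans)
  hence "size (prime_factorization z2) \<le> 369" by (rule prime_factors_ge_5_size_le[OF z2(2,3,4)])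
  thus ?thesis using xy(1) z1 z2(2) unfolding z1(1) v2 by blast
qed

theorem theorem1p4:
  fixes m :: nat
  shows "\<exists>(x::nat) (y::nat) (a::nat) (b::nat) (c::nat) (d::nat) (z1::int) (z2::int).
           (z1 = 0 \<or> at_most_prime_factors 369 z1) \<and>
           (z2 = 0 \<or> at_most_prime_factors 369 z2) \<and>
           int m = (int x)^2 + (int y)^2 + (2^a * 3^b * z1)^2 + (2^c * 5^d * z2)^2"
proof (induction m rule: less_induct)
  case (less m)
  have wrap: ?case if e: "int m = x\<^sup>2 + y\<^sup>2 + (2 ^ a * 3 ^ b * int z1)\<^sup>2 + (2 ^ c * 5 ^ d * int z2)\<^sup>2"
    and z1: "z1 = 0 \<or> size (prime_factorization z1) \<le> 369" and z2: "z2 = 0 \<or> size (prime_factorization z2) \<le> 369"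
  for x y :: int and a b c d z1 z2 :: nat
  proof -
    have "int z = 0 \<or> at_most_prime_factors 369 (int z)" if "z = 0 \<or> size (prime_factorization z) \<le> 369" for z :: nat
      using that at_most_prime_factors_of_nat[of z 369] by (cases "z = 0") auto
    moreover have "int m = (int (nat \<bar>x\<bar>))\<^sup>2 + (int (nat \<bar>y\<bar>))\<^sup>2 + (2 ^ a * 3 ^ b * int z1)\<^sup>2 + (2 ^ c * 5 ^ d * int z2)\<^sup>2"
      using e by simp
    ultimately show ?case using z1 z2 by blast
  qed
  consider "m = 0" | "m > 0" "m mod 4 = 0" | "m > 0" "m < 4 ^ 859" | "m mod 4 \<noteq> 0" "4 ^ 859 \<le> m"
    using not_less gr0I by blast
  thus ?case
  proof cases
    case 1
    thus ?thesis by (intro wrap[of 0 0 0 0 0 0 0 0]) auto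
  next
    case 2
    then obtain l where l: "m = 4 * l" by auto
    have "l < m" using l 2 by simp
    from less.IH[OF this] obtain x y a b c d z1 z2 where
      IH: "z1 = 0 \<or> at_most_prime_factors 369 z1" "z2 = 0 \<or> at_most_prime_factors 369 z2"
        "int l = (int x)^2 + (int y)^2 + (2^a * 3^b * z1)^2 + (2^c * 5^d * z2)^2" by blast
    have "int m = (int (2 * x))^2 + (int (2 * y))^2 + (2^(a + 1) * 3^b * z1)^2 + (2^(c + 1) * 5^d * z2)^2"
      unfolding l of_nat_mult IH(3) by (simp add: power_mult_distrib algebra_simps)
    thus ?thesis using IH(1,2) by blast
  next
    case 3
    obtain x y a b c z1 z2 where r: "int m = x\<^sup>2 + y\<^sup>2 + (2 ^ a * 3 ^ b * int z1)\<^sup>2 + (2 ^ c * int z2)\<^sup>2"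
      "z1 = 0 \<or> size (prime_factorization z1) \<le> 369" "size (prime_factorization z2) \<le> 369"
      using representation_small[OF 3] by blast
    thus ?thesis by (intro wrap[of x y a b z1 c 0 z2]) auto
  next
    case 4
    obtain x y a c z1 z2 where r: "int m = x\<^sup>2 + y\<^sup>2 + (int (2 ^ a * z1))\<^sup>2 + (int (2 ^ c * z2))\<^sup>2"
      "size (prime_factorization z1) \<le> 367" "size (prime_factorization z2) \<le> 367"
      using representation_large[OF 4] by blast
    thus ?thesis by (intro wrap[of x y a 0 z1 c 0 z2]) auto
  qed
qed

end
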